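(* Let $R$ be an associative ring with identity and let $\mathcal{E}$ be an exact structure on $\operatorname{Mod} R$ with enough $\mathcal{E}$-projectives and enough $\mathcal{E}$-injectives such that $\mathcal{E}$ contains all pure short exact sequences. Let $\mathcal{X}\subseteq\mathcal{PP}$ and $\mathcal{Y}\subseteq\mathcal{PI}$ be two subcategories of $\operatorname{Mod} R$. Then the following hold. (1) $\mathcal{X}^{\bot_{\ast}}$ is preenveloping. If moreover each $X\in\mathcal{X}$ admits an $\mathcal{E}$-presentation $$C_2\to C_1\to C_0\to X\to 0,$$ where the $C_i$ are $\mathcal{E}$-projective in $\operatorname{Mod} R$ and finitely presented, then $\mathcal{X}^{\bot_{\ast}}$ is also covering. (2) ${}^{\bot_{\ast}}\mathcal{Y}$ is covering and closed under pure quotients. (3) If $\mathcal{Y}$ is closed under taking $\mathcal{E}$-cosyzygies, then: (i) $({}^{\bot_{\ast}}\mathcal{Y},({}^{\bot_{\ast}}\mathcal{Y})^{\bot_{\ast}})$ is a complete hereditary $\mathcal{E}$-cotorsion pair. (ii) If, for every $Y\in\mathcal{Y}$, $\operatorname{Ext}^1_R(-,Y)$ vanishes on the $\mathcal{E}$-projective objects of $\operatorname{Mod} R$, then $({}^{\bot_1}\mathcal{Y},({}^{\bot_1}\mathcal{Y})^{\bot_{\ast}})$ is a complete hereditary $\mathcal{E}$-cotorsion pair.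
   Context: $\operatorname{Mod} R$ is the category of right $R$-modules. A subcategory means a full and additive subcategory closed under isomorphisms and direct summands. A short exact sequence $0\to A\to B\to C\to 0$ in $\operatorname{Mod} R$ is pure exact if it stays exact under $\operatorname{Hom}_R(F,-)$ for every finitely presented right $R$-module $F$; then $A$ is a pure submodule of $B$ and $C$ is a pure quotient of $B$. Modules projective (resp. injective) relative to pure exact sequences are pure projective (resp. pure injective); $\mathcal{PP}$ (resp. $\mathcal{PI}$) is the subcategory of pure projective (resp. pure injective) modules. Exact structure: a kernel-cokernel pair $(i,p)$ is a composable pair $L\xrightarrow{i}M\xrightarrow{p}N$ with $i$ a kernel of $p$ and $p$ a cokernel of $i$. For a class $\mathcal{E}$ of such pairs, $i$ (resp. $p$) is an admissible monic (resp. admissible epic) if it is the first (resp. second) morphism of a pair in $\mathcal{E}$. $\mathcal{E}$ is an exact structure if it is closed under isomorphisms and: identities are both admissible monics and admissible epics; admissible monics (resp. epics) are closed under composition; push-outs of admissible monics along arbitrary morphisms exist and are admissible monics; pull-backs of admissible epics along arbitrary morphisms exist and are admissible epics. Elements of $\mathcal{E}$ are called conflations. $P$ is $\mathcal{E}$-projective if every morphism $P\to N$ lifts along every admissible epic $M\to N$; $I$ is $\mathcal{E}$-injective if every morphism $L\to I$ extends along every admissible monic $L\to M$. Enough $\mathcal{E}$-projectives (resp. $\mathcal{E}$-injectives): every object $M$ admits an admissible epic $P\to M$ with $P$ $\mathcal{E}$-projective (resp. an admissible monic $M\to I$ with $I$ $\mathcal{E}$-injective). Write $\mathcal{A}=\operatorname{Mod}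 R$. $\mathcal{E}\mathrm{xt}^{i}_{\mathcal{A}}(M,N)$, $i\ge 1$, is the $i$-th cohomology group obtained by applying $\operatorname{Hom}_R(-,N)$ to an $\mathcal{E}$-projective resolution of $M$ (built from conflations), or equivalently $\operatorname{Hom}_R(M,-)$ to an $\mathcal{E}$-injective coresolution of $N$. For a class $\mathcal{Z}$ of modules, $\mathcal{Z}^{\bot_{\ast}}=\{N\mid \mathcal{E}\mathrm{xt}^1_{\mathcal{A}}(M,N)=0\ \forall M\in\mathcal{Z}\}$, ${}^{\bot_{\ast}}\mathcal{Z}=\{M\mid \mathcal{E}\mathrm{xt}^1_{\mathcal{A}}(M,N)=0\ \forall N\in\mathcal{Z}\}$, and ${}^{\bot_1}\mathcal{Z}=\{M\mid \operatorname{Ext}^1_R(M,N)=0\ \forall N\in\mathcal{Z}\}$. An $\mathcal{E}$-presentation $C_2\to C_1\to C_0\to X\to 0$ with the $C_i$ $\mathcal{E}$-projective is the beginning of an $\mathcal{E}$-projective resolution of $X$: an exact sequence obtained by splicing conflations (equivalently, one that remains exact under $\operatorname{Hom}_R(P,-)$ for all $\mathcal{E}$-projective $P$). $\mathcal{Y}$ is closed under taking $\mathcal{E}$-cosyzygies if for every conflation $0\to Y\to I\to L\to 0$ with $Y\in\mathcal{Y}$ and $I$ $\mathcal{E}$-injective one has $L\in\mathcal{Y}$. A subcategory $\mathcal{C}$ is covering if every module $M$ has a $\mathcal{C}$-cover, i.e. a morphism $f:C\to M$ with $C\in\mathcal{C}$ through which every morphism $C'\to M$ with $C'\in\mathcal{C}$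 factors, and such that every endomorphism $h$ of $C$ with $f=fh$ is an automorphism. $\mathcal{C}$ is preenveloping if every module $M$ has a $\mathcal{C}$-preenvelope, i.e. a morphism $M\to C$ with $C\in\mathcal{C}$ through which every morphism $M\to C'$ with $C'\in\mathcal{C}$ factors. A pair $(\mathcal{U},\mathcal{V})$ of full subcategories is an $\mathcal{E}$-cotorsion pair if $\mathcal{U}={}^{\bot_{\ast}}\mathcal{V}$ and $\mathcal{V}=\mathcal{U}^{\bot_{\ast}}$. It is complete if for every module $M$ there are conflations $0\to V\to U\to M\to 0$ and $0\to M\to V'\to U'\to 0$ with $U,U'\in\mathcal{U}$, $V,V'\in\mathcal{V}$. It is hereditary if $\mathcal{U}$ is $\mathcal{E}$-resolving, i.e. contains all $\mathcal{E}$-projectives, is closed under $\mathcal{E}$-extensions (the middle term of a conflation lies in $\mathcal{U}$ if both end terms do), and for every conflation $0\to X\to Y\to Z\to 0$ with $Y,Z\in\mathcal{U}$ one has $X\in\mathcal{U}$. *)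

theory Defs
  imports "HOL-Algebra.Module" "HOL-Algebra.Elementary_Groups" "HOL-Library.FuncSet"
begin

unbundle cardinal_syntax

section \<open>Right modules and the category of right modules\<close>

text \<open>
  The scalar multiplication \<open>r \<odot>\<^bsub>M\<^esub> x\<close> of the library record is read as \<open>x r\<close>, whence the
  order of the factors in \<open>smult_assoc\<close>.  The library locale \<open>module\<close> cannot be used, since it
  is restricted to commutative rings.  The fields \<open>mult\<close> and \<open>one\<close> of the record are irrelevant.
\<close>

locale right_module = R?: ring R + M?: abelian_group M
  for R :: "('r, 'x) ring_scheme" (structure) and M :: "('r, 'm) module" (structure) +
  assumes smult_closed:
      "\<lbrakk>r \<in> carrier R; x \<in> carrier M\<rbrakk> \<Longrightarrow> r \<odot>\<^bsub>M\<^esub> x \<in> carrier M"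
    and smult_add_scalar:
      "\<lbrakk>r \<in> carrier R; s \<in> carrier R; x \<in> carrier M\<rbrakk> \<Longrightarrow>
       (r \<oplus>\<^bsub>R\<^esub> s) \<odot>\<^bsub>M\<^esub> x = r \<odot>\<^bsub>M\<^esub> x \<oplus>\<^bsub>M\<^esub> s \<odot>\<^bsub>M\<^esub> x"
    and smult_add:
      "\<lbrakk>r \<in> carrier R; x \<in> carrier M; y \<in> carrier M\<rbrakk> \<Longrightarrow>
       r \<odot>\<^bsub>M\<^esub> (x \<oplus>\<^bsub>M\<^esub> y) = r \<odot>\<^bsub>M\<^esub> x \<oplus>\<^bsub>M\<^esub> r \<odot>\<^bsub>M\<^esub> y"
    and smult_assoc:
      "\<lbrakk>r \<in> carrier R; s \<in> carrier R; x \<in> carrier M\<rbrakk> \<Longrightarrow>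
       (r \<otimes>\<^bsub>R\<^esub> s) \<odot>\<^bsub>M\<^esub> x = s \<odot>\<^bsub>M\<^esub> (r \<odot>\<^bsub>M\<^esub> x)"
    and smult_one:
      "x \<in> carrier M \<Longrightarrow> \<one>\<^bsub>R\<^esub> \<odot>\<^bsub>M\<^esub> x = x"

text \<open>
  The type \<open>'m\<close> plays the role of the class of all sets: a set is small if its cardinality is
  less than that of \<open>'m\<close>.  The condition \<open>set_universe\<close> says that the cardinality of \<open>'m\<close> is
  strongly inaccessible (uncountable, regular, strong limit), so that small sets are closed under
  the usual constructions of set theory.  The category of right modules consists of the modules
  with small underlying set.
\<close>

definition set_universe :: "'m itself \<Rightarrow> bool" where
  "set_universe _ \<longleftrightarrow>
     |UNIV :: nat set| <o |UNIV :: 'm set| \<and>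
     regularCard |UNIV :: 'm set| \<and>
     (\<forall>A :: 'm set. |A| <o |UNIV :: 'm set| \<longrightarrow> |Pow A| <o |UNIV :: 'm set| )"

definition small :: "'m itself \<Rightarrow> 'a set \<Rightarrow> bool" where
  "small _ A \<longleftrightarrow> |A| <o |UNIV :: 'm set|"

definition ModR :: "('r, 'x) ring_scheme \<Rightarrow> ('r, 'm) module set" where
  "ModR R = {M. right_module R M \<and> small TYPE('m) (carrier M)}"

text \<open>
  Morphisms are extensional functions, so that equality of morphisms is equality of functions;
  the composite of \<open>f : L \<rightarrow> M\<close> and \<open>g : M \<rightarrow> N\<close> is \<open>compose (carrier L) g f\<close>.
\<close>

definition Hom ::
  "('r, 'x) ring_scheme \<Rightarrow> ('r, 'a) module \<Rightarrow> ('r, 'b) module \<Rightarrow> ('a \<Rightarrow> 'b) set" where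
  "Hom R M N = {f \<in> carrier M \<rightarrow>\<^sub>E carrier N.
     (\<forall>x\<in>carrier M. \<forall>y\<in>carrier M. f (x \<oplus>\<^bsub>M\<^esub> y) = f x \<oplus>\<^bsub>N\<^esub> f y) \<and>
     (\<forall>r\<in>carrier R. \<forall>x\<in>carrier M. f (r \<odot>\<^bsub>M\<^esub> x) = r \<odot>\<^bsub>N\<^esub> f x)}"

definition zero_hom :: "('r, 'a) module \<Rightarrow> ('r, 'b) module \<Rightarrow> 'a \<Rightarrow> 'b" where
  "zero_hom M N = (\<lambda>x\<in>carrier M. \<zero>\<^bsub>N\<^esub>)"

definition id_hom :: "('r, 'a) module \<Rightarrow> 'a \<Rightarrow> 'a" where
  "id_hom M = (\<lambda>x\<in>carrier M. x)"

definition Iso ::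
  "('r, 'x) ring_scheme \<Rightarrow> ('r, 'a) module \<Rightarrow> ('r, 'b) module \<Rightarrow> ('a \<Rightarrow> 'b) set" where
  "Iso R M N = {f \<in> Hom R M N. bij_betw f (carrier M) (carrier N)}"

definition is_biproduct ::
  "('r, 'x) ring_scheme \<Rightarrow> ('r, 'm) module \<Rightarrow> ('r, 'm) module \<Rightarrow> ('r, 'm) module \<Rightarrow> bool" where
  "is_biproduct R A B M \<longleftrightarrow>
     (\<exists>i \<in> Hom R A M. \<exists>j \<in> Hom R B M. \<exists>p \<in> Hom R M A. \<exists>q \<in> Hom R M B.
        compose (carrier A) p i = id_hom A \<and> compose (carrier B) q j = id_hom B \<and>
        compose (carrier B) p j = zero_hom B A \<and> compose (carrier A) q i = zero_hom A B \<and>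
        (\<forall>x\<in>carrier M. i (p x) \<oplus>\<^bsub>M\<^esub> j (q x) = x))"

text \<open>Full additive subcategories closed under isomorphisms and direct summands.\<close>

definition subcategory ::
  "('r, 'x) ring_scheme \<Rightarrow> ('r, 'm) module set \<Rightarrow> bool" where
  "subcategory R U \<longleftrightarrow>
     U \<subseteq> ModR R \<and>
     (\<forall>M\<in>U. \<forall>N\<in>ModR R. Iso R M N \<noteq> {} \<longrightarrow> N \<in> U) \<and>
     (\<forall>Z\<in>ModR R. carrier Z = {\<zero>\<^bsub>Z\<^esub>} \<longrightarrow> Z \<in> U) \<and>
     (\<forall>A\<in>U. \<forall>B\<in>U. \<forall>M\<in>ModR R. is_biproduct R A B M \<longrightarrow> M \<in> U) \<and>
     (\<forall>M\<in>U. \<forall>A\<in>ModR R. \<forall>B\<in>ModR R. is_biproduct R A B M \<longrightarrow> A \<in> U)"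


section \<open>Exact structures\<close>

text \<open>A composable pair \<open>L \<rightarrow> M \<rightarrow> N\<close>, given as \<open>(L, i, M, p, N)\<close>.\<close>

type_synonym ('r, 'm) mod_pair =
  "('r, 'm) module \<times> ('m \<Rightarrow> 'm) \<times> ('r, 'm) module \<times> ('m \<Rightarrow> 'm) \<times> ('r, 'm) module"

definition is_kernel ::
  "('r, 'x) ring_scheme \<Rightarrow> ('r, 'm) module \<Rightarrow> ('m \<Rightarrow> 'm) \<Rightarrow> ('r, 'm) module
    \<Rightarrow> ('m \<Rightarrow> 'm) \<Rightarrow> ('r, 'm) module \<Rightarrow> bool" where
  "is_kernel R L i M p N \<longleftrightarrow>
     compose (carrier L) p i = zero_hom L N \<and>
     (\<forall>K\<in>(ModR R :: ('r, 'm) module set). \<forall>f\<in>Hom R K M. compose (carrier K) p f = zero_hom K N \<longrightarrow>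
        (\<exists>!g. g \<in> Hom R K L \<and> compose (carrier K) i g = f))"

definition is_cokernel ::
  "('r, 'x) ring_scheme \<Rightarrow> ('r, 'm) module \<Rightarrow> ('m \<Rightarrow> 'm) \<Rightarrow> ('r, 'm) module
    \<Rightarrow> ('m \<Rightarrow> 'm) \<Rightarrow> ('r, 'm) module \<Rightarrow> bool" where
  "is_cokernel R L i M p N \<longleftrightarrow>
     compose (carrier L) p i = zero_hom L N \<and>
     (\<forall>K\<in>(ModR R :: ('r, 'm) module set). \<forall>f\<in>Hom R M K. compose (carrier L) f i = zero_hom L K \<longrightarrow>
        (\<exists>!g. g \<in> Hom R N K \<and> compose (carrier M) g p = f))"

definition kernel_cokernel_pairs :: "('r, 'x) ring_scheme \<Rightarrow> ('r, 'm) mod_pair set" where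
  "kernel_cokernel_pairs R = {(L, i, M, p, N).
     L \<in> ModR R \<and> M \<in> ModR R \<and> N \<in> ModR R \<and> i \<in> Hom R L M \<and> p \<in> Hom R M N \<and>
     is_kernel R L i M p N \<and> is_cokernel R L i M p N}"

definition admissible_monic ::
  "('r, 'm) mod_pair set \<Rightarrow> ('r, 'm) module \<Rightarrow> ('m \<Rightarrow> 'm) \<Rightarrow> ('r, 'm) module \<Rightarrow> bool" where
  "admissible_monic E L i M \<longleftrightarrow> (\<exists>p N. (L, i, M, p, N) \<in> E)"

definition admissible_epic ::
  "('r, 'm) mod_pair set \<Rightarrow> ('r, 'm) module \<Rightarrow> ('m \<Rightarrow> 'm) \<Rightarrow> ('r, 'm) module \<Rightarrow> bool" where
  "admissible_epic E M p N \<longleftrightarrow> (\<exists>L i. (L, i, M, p, N) \<in> E)"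

definition iso_closed :: "('r, 'x) ring_scheme \<Rightarrow> ('r, 'm) mod_pair set \<Rightarrow> bool" where
  "iso_closed R E \<longleftrightarrow>
     (\<forall>L i M p N L' i' M' p' N'.
        (L, i, M, p, N) \<in> E \<and> (L', i', M', p', N') \<in> kernel_cokernel_pairs R \<and>
        (\<exists>a\<in>Iso R L L'. \<exists>b\<in>Iso R M M'. \<exists>c\<in>Iso R N N'.
           compose (carrier L) b i = compose (carrier L) i' a \<and>
           compose (carrier M) c p = compose (carrier M) p' b) \<longrightarrow>
        (L', i', M', p', N') \<in> E)"

text \<open>\<open>i' : L' \<rightarrow> M'\<close> is the push-out of \<open>i : L \<rightarrow> M\<close> along \<open>f : L \<rightarrow> L'\<close>, with \<open>f' : M \<rightarrow> M'\<close>.\<close>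

definition is_pushout ::
  "('r, 'x) ring_scheme \<Rightarrow> ('r, 'm) module \<Rightarrow> ('m \<Rightarrow> 'm) \<Rightarrow> ('r, 'm) module \<Rightarrow> ('m \<Rightarrow> 'm)
    \<Rightarrow> ('r, 'm) module \<Rightarrow> ('m \<Rightarrow> 'm) \<Rightarrow> ('r, 'm) module \<Rightarrow> ('m \<Rightarrow> 'm) \<Rightarrow> bool" where
  "is_pushout R L i M f L' i' M' f' \<longleftrightarrow>
     M' \<in> ModR R \<and> i' \<in> Hom R L' M' \<and> f' \<in> Hom R M M' \<and>
     compose (carrier L) f' i = compose (carrier L) i' f \<and>
     (\<forall>T\<in>(ModR R :: ('r, 'm) module set). \<forall>u\<in>Hom R M T. \<forall>v\<in>Hom R L' T.
        compose (carrier L) u i = compose (carrier L) v f \<longrightarrow>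
        (\<exists>!w. w \<in> Hom R M' T \<and> compose (carrier M) w f' = u \<and> compose (carrier L') w i' = v))"

text \<open>\<open>p' : M' \<rightarrow> N'\<close> is the pull-back of \<open>p : M \<rightarrow> N\<close> along \<open>f : N' \<rightarrow> N\<close>, with \<open>f' : M' \<rightarrow> M\<close>.\<close>

definition is_pullback ::
  "('r, 'x) ring_scheme \<Rightarrow> ('r, 'm) module \<Rightarrow> ('m \<Rightarrow> 'm) \<Rightarrow> ('r, 'm) module \<Rightarrow> ('m \<Rightarrow> 'm)
    \<Rightarrow> ('r, 'm) module \<Rightarrow> ('m \<Rightarrow> 'm) \<Rightarrow> ('r, 'm) module \<Rightarrow> ('m \<Rightarrow> 'm) \<Rightarrow> bool" where
  "is_pullback R M p N f N' p' M' f' \<longleftrightarrow>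
     M' \<in> ModR R \<and> p' \<in> Hom R M' N' \<and> f' \<in> Hom R M' M \<and>
     compose (carrier M') p f' = compose (carrier M') f p' \<and>
     (\<forall>T\<in>(ModR R :: ('r, 'm) module set). \<forall>u\<in>Hom R T M. \<forall>v\<in>Hom R T N'.
        compose (carrier T) p u = compose (carrier T) f v \<longrightarrow>
        (\<exists>!w. w \<in> Hom R T M' \<and> compose (carrier T) f' w = u \<and> compose (carrier T) p' w = v))"

definition exact_structure :: "('r, 'x) ring_scheme \<Rightarrow> ('r, 'm) mod_pair set \<Rightarrow> bool" where
  "exact_structure R E \<longleftrightarrow>
     E \<subseteq> kernel_cokernel_pairs R \<and>
     iso_closed R E \<and>
     (\<forall>M\<in>ModR R. admissible_monic E M (id_hom M) M \<and> admissible_epic E M (id_hom M) M) \<and>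
     (\<forall>L i M j N. admissible_monic E L i M \<and> admissible_monic E M j N \<longrightarrow>
        admissible_monic E L (compose (carrier L) j i) N) \<and>
     (\<forall>L p M q N. admissible_epic E L p M \<and> admissible_epic E M q N \<longrightarrow>
        admissible_epic E L (compose (carrier L) q p) N) \<and>
     (\<forall>L i M. \<forall>L'\<in>ModR R. \<forall>f\<in>Hom R L L'. admissible_monic E L i M \<longrightarrow>
        (\<exists>i' M' f'. is_pushout R L i M f L' i' M' f') \<and>
        (\<forall>i' M' f'. is_pushout R L i M f L' i' M' f' \<longrightarrow> admissible_monic E L' i' M')) \<and>
     (\<forall>M p N. \<forall>N'\<in>ModR R. \<forall>f\<in>Hom R N' N. admissible_epic E M p N \<longrightarrow>
        (\<exists>p' M' f'. is_pullback R M p N f N' p' M' f') \<and>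
        (\<forall>p' M' f'. is_pullback R M p N f N' p' M' f' \<longrightarrow> admissible_epic E M' p' N'))"

definition E_projective ::
  "('r, 'x) ring_scheme \<Rightarrow> ('r, 'm) mod_pair set \<Rightarrow> ('r, 'm) module \<Rightarrow> bool" where
  "E_projective R E P \<longleftrightarrow> P \<in> ModR R \<and>
     (\<forall>M p N. admissible_epic E M p N \<longrightarrow>
        (\<forall>f\<in>Hom R P N. \<exists>g\<in>Hom R P M. compose (carrier P) p g = f))"

definition E_injective ::
  "('r, 'x) ring_scheme \<Rightarrow> ('r, 'm) mod_pair set \<Rightarrow> ('r, 'm) module \<Rightarrow> bool" where
  "E_injective R E I \<longleftrightarrow> I \<in> ModR R \<and>
     (\<forall>L i M. admissible_monic E L i M \<longrightarrow>
        (\<forall>f\<in>Hom R L I. \<exists>g\<in>Hom R M I. compose (carrier L) g i = f))"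

definition enough_projectives ::
  "('r, 'x) ring_scheme \<Rightarrow> ('r, 'm) mod_pair set \<Rightarrow> bool" where
  "enough_projectives R E \<longleftrightarrow>
     (\<forall>M\<in>ModR R. \<exists>P p. E_projective R E P \<and> admissible_epic E P p M)"

definition enough_injectives ::
  "('r, 'x) ring_scheme \<Rightarrow> ('r, 'm) mod_pair set \<Rightarrow> bool" where
  "enough_injectives R E \<longleftrightarrow>
     (\<forall>M\<in>ModR R. \<exists>I i. E_injective R E I \<and> admissible_monic E M i I)"


section \<open>Purity\<close>

definition free_module :: "('r, 'x) ring_scheme \<Rightarrow> nat \<Rightarrow> ('r, nat \<Rightarrow> 'r) module" where
  "free_module R n =
     \<lparr>carrier = {..<n} \<rightarrow>\<^sub>E carrier R,
      mult = undefined, one = undefined,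
      zero = (\<lambda>k\<in>{..<n}. \<zero>\<^bsub>R\<^esub>),
      add = (\<lambda>v w. \<lambda>k\<in>{..<n}. v k \<oplus>\<^bsub>R\<^esub> w k),
      smult = (\<lambda>r v. \<lambda>k\<in>{..<n}. v k \<otimes>\<^bsub>R\<^esub> r)\<rparr>"

text \<open>Exactness of \<open>R\<^sup>m \<rightarrow> R\<^sup>n \<rightarrow> F \<rightarrow> 0\<close> for some \<open>m\<close> and \<open>n\<close>.\<close>

definition finitely_presented ::
  "('r, 'x) ring_scheme \<Rightarrow> ('r, 'm) module \<Rightarrow> bool" where
  "finitely_presented R F \<longleftrightarrow>
     (\<exists>m n. \<exists>g \<in> Hom R (free_module R m) (free_module R n). \<exists>f \<in> Hom R (free_module R n) F.
        f ` carrier (free_module R n) = carrier F \<and>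
        g ` carrier (free_module R m) = {v \<in> carrier (free_module R n). f v = \<zero>\<^bsub>F\<^esub>})"

definition short_exact ::
  "('r, 'x) ring_scheme \<Rightarrow> ('r, 'm) module \<Rightarrow> ('m \<Rightarrow> 'm) \<Rightarrow> ('r, 'm) module
    \<Rightarrow> ('m \<Rightarrow> 'm) \<Rightarrow> ('r, 'm) module \<Rightarrow> bool" where
  "short_exact R A i B p C \<longleftrightarrow>
     A \<in> ModR R \<and> B \<in> ModR R \<and> C \<in> ModR R \<and> i \<in> Hom R A B \<and> p \<in> Hom R B C \<and>
     inj_on i (carrier A) \<and>
     i ` carrier A = {x \<in> carrier B. p x = \<zero>\<^bsub>C\<^esub>} \<and>
     p ` carrier B = carrier C"

text \<open>Exactness of \<open>0 \<rightarrow> Hom(F, A) \<rightarrow> Hom(F, B) \<rightarrow> Hom(F, C) \<rightarrow> 0\<close>.\<close>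

definition Hom_exact ::
  "('r, 'x) ring_scheme \<Rightarrow> ('r, 'm) module \<Rightarrow> ('r, 'm) module \<Rightarrow> ('m \<Rightarrow> 'm) \<Rightarrow> ('r, 'm) module
    \<Rightarrow> ('m \<Rightarrow> 'm) \<Rightarrow> ('r, 'm) module \<Rightarrow> bool" where
  "Hom_exact R F A i B p C \<longleftrightarrow>
     inj_on (compose (carrier F) i) (Hom R F A) \<and>
     compose (carrier F) i ` Hom R F A =
       {g \<in> Hom R F B. compose (carrier F) p g = zero_hom F C} \<and>
     compose (carrier F) p ` Hom R F B = Hom R F C"

definition pure_exact :: "('r, 'x) ring_scheme \<Rightarrow> ('r, 'm) mod_pair set" where
  "pure_exact R = {(A, i, B, p, C). short_exact R A i B p C \<and>
     (\<forall>F\<in>ModR R. finitely_presented R F \<longrightarrow> Hom_exact R F A i B p C)}"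

definition pure_projectives :: "('r, 'x) ring_scheme \<Rightarrow> ('r, 'm) module set" where
  "pure_projectives R = {P. E_projective R (pure_exact R) P}"

definition pure_injectives :: "('r, 'x) ring_scheme \<Rightarrow> ('r, 'm) module set" where
  "pure_injectives R = {I. E_injective R (pure_exact R) I}"

definition closed_under_pure_quotients ::
  "('r, 'x) ring_scheme \<Rightarrow> ('r, 'm) module set \<Rightarrow> bool" where
  "closed_under_pure_quotients R U \<longleftrightarrow>
     (\<forall>A i B p C. (A, i, B, p, C) \<in> pure_exact R \<and> B \<in> U \<longrightarrow> C \<in> U)"


section \<open>Relative Ext groups\<close>

text \<open>
  \<open>P\<close>, with augmentation \<open>e : P 0 \<rightarrow> M\<close> and differentials \<open>d n : P (n + 1) \<rightarrow> P n\<close>, is spliced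
  from the conflations \<open>K (n + 1) \<rightarrow> P n \<rightarrow> K n\<close> with \<open>K 0 = M\<close>.
\<close>

definition E_projective_resolution ::
  "('r, 'x) ring_scheme \<Rightarrow> ('r, 'm) mod_pair set \<Rightarrow> ('r, 'm) module \<Rightarrow> ('m \<Rightarrow> 'm)
    \<Rightarrow> (nat \<Rightarrow> ('r, 'm) module) \<Rightarrow> (nat \<Rightarrow> 'm \<Rightarrow> 'm) \<Rightarrow> bool" where
  "E_projective_resolution R E M e P d \<longleftrightarrow>
     (\<exists>K i p. K 0 = M \<and> p 0 = e \<and>
        (\<forall>n. E_projective R E (P n) \<and>
             (K (Suc n), i n, P n, p n, K n) \<in> E \<and>
             d n = compose (carrier (P (Suc n))) (i n) (p (Suc n))))"

definition Hom_group ::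
  "('r, 'x) ring_scheme \<Rightarrow> ('r, 'm) module \<Rightarrow> ('r, 'm) module \<Rightarrow> ('m \<Rightarrow> 'm) monoid" where
  "Hom_group R M N =
     \<lparr>carrier = Hom R M N,
      mult = (\<lambda>f g. \<lambda>x\<in>carrier M. f x \<oplus>\<^bsub>N\<^esub> g x),
      one = zero_hom M N\<rparr>"

definition cocycles ::
  "('r, 'x) ring_scheme \<Rightarrow> (nat \<Rightarrow> ('r, 'm) module) \<Rightarrow> (nat \<Rightarrow> 'm \<Rightarrow> 'm) \<Rightarrow> ('r, 'm) module
    \<Rightarrow> nat \<Rightarrow> ('m \<Rightarrow> 'm) set" where
  "cocycles R P d N n =
     {f \<in> Hom R (P n) N. compose (carrier (P (Suc n))) f (d n) = zero_hom (P (Suc n)) N}"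

fun coboundaries ::
  "('r, 'x) ring_scheme \<Rightarrow> (nat \<Rightarrow> ('r, 'm) module) \<Rightarrow> (nat \<Rightarrow> 'm \<Rightarrow> 'm) \<Rightarrow> ('r, 'm) module
    \<Rightarrow> nat \<Rightarrow> ('m \<Rightarrow> 'm) set" where
  "coboundaries R P d N 0 = {zero_hom (P 0) N}"
| "coboundaries R P d N (Suc n) =
     (\<lambda>f. compose (carrier (P (Suc n))) f (d n)) ` Hom R (P n) N"

definition cohomology ::
  "('r, 'x) ring_scheme \<Rightarrow> (nat \<Rightarrow> ('r, 'm) module) \<Rightarrow> (nat \<Rightarrow> 'm \<Rightarrow> 'm) \<Rightarrow> ('r, 'm) module
    \<Rightarrow> nat \<Rightarrow> ('m \<Rightarrow> 'm) set monoid" where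
  "cohomology R P d N n =
     ((Hom_group R (P n) N)\<lparr>carrier := cocycles R P d N n\<rparr>) Mod (coboundaries R P d N n)"

text \<open>
  The groups are well defined up to isomorphism when there are enough projectives; a resolution
  is chosen.
\<close>

definition E_Ext ::
  "('r, 'x) ring_scheme \<Rightarrow> ('r, 'm) mod_pair set \<Rightarrow> nat \<Rightarrow> ('r, 'm) module \<Rightarrow> ('r, 'm) module
    \<Rightarrow> ('m \<Rightarrow> 'm) set monoid" where
  "E_Ext R E n M N =
     (case (SOME (P, d). \<exists>e. E_projective_resolution R E M e P d) of
        (P, d) \<Rightarrow> cohomology R P d N n)"

text \<open>The ordinary Ext groups are those of the exact structure of all kernel-cokernel pairs.\<close>

definition Ext_R ::
  "('r, 'x) ring_scheme \<Rightarrow> nat \<Rightarrow> ('r, 'm) module \<Rightarrow> ('r, 'm) module \<Rightarrow> ('m \<Rightarrow> 'm) set monoid"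
  where "Ext_R R n M N = E_Ext R (kernel_cokernel_pairs R) n M N"

definition right_perp ::
  "('r, 'x) ring_scheme \<Rightarrow> ('r, 'm) mod_pair set \<Rightarrow> ('r, 'm) module set \<Rightarrow> ('r, 'm) module set"
  where "right_perp R E Z = {N \<in> ModR R. \<forall>M\<in>Z. trivial_group (E_Ext R E 1 M N)}"

definition left_perp ::
  "('r, 'x) ring_scheme \<Rightarrow> ('r, 'm) mod_pair set \<Rightarrow> ('r, 'm) module set \<Rightarrow> ('r, 'm) module set"
  where "left_perp R E Z = {M \<in> ModR R. \<forall>N\<in>Z. trivial_group (E_Ext R E 1 M N)}"

definition left_perp_1 ::
  "('r, 'x) ring_scheme \<Rightarrow> ('r, 'm) module set \<Rightarrow> ('r, 'm) module set" where
  "left_perp_1 R Z = {M \<in> ModR R. \<forall>N\<in>Z. trivial_group (Ext_R R 1 M N)}"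

text \<open>
  Only \<open>P 0\<close>, \<open>P 1\<close> and \<open>P 2\<close>, the terms of the presentation, are required to be finitely
  presented.
\<close>

definition has_fp_E_presentation ::
  "('r, 'x) ring_scheme \<Rightarrow> ('r, 'm) mod_pair set \<Rightarrow> ('r, 'm) module \<Rightarrow> bool" where
  "has_fp_E_presentation R E M \<longleftrightarrow>
     (\<exists>e P d. E_projective_resolution R E M e P d \<and>
        finitely_presented R (P 0) \<and> finitely_presented R (P 1) \<and> finitely_presented R (P 2))"

definition closed_under_E_cosyzygies ::
  "('r, 'x) ring_scheme \<Rightarrow> ('r, 'm) mod_pair set \<Rightarrow> ('r, 'm) module set \<Rightarrow> bool" where
  "closed_under_E_cosyzygies R E Y \<longleftrightarrow>
     (\<forall>A i I p L. (A, i, I, p, L) \<in> E \<and> A \<in> Y \<and> E_injective R E I \<longrightarrow> L \<in> Y)"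


section \<open>Approximations and cotorsion pairs\<close>

definition is_cover ::
  "('r, 'x) ring_scheme \<Rightarrow> ('r, 'm) module set \<Rightarrow> ('r, 'm) module \<Rightarrow> ('m \<Rightarrow> 'm)
    \<Rightarrow> ('r, 'm) module \<Rightarrow> bool" where
  "is_cover R U C f M \<longleftrightarrow>
     C \<in> U \<and> f \<in> Hom R C M \<and>
     (\<forall>C'\<in>U. \<forall>g\<in>Hom R C' M. \<exists>h\<in>Hom R C' C. compose (carrier C') f h = g) \<and>
     (\<forall>h\<in>Hom R C C. compose (carrier C) f h = f \<longrightarrow> h \<in> Iso R C C)"

definition is_preenvelope ::
  "('r, 'x) ring_scheme \<Rightarrow> ('r, 'm) module set \<Rightarrow> ('r, 'm) module \<Rightarrow> ('m \<Rightarrow> 'm)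
    \<Rightarrow> ('r, 'm) module \<Rightarrow> bool" where
  "is_preenvelope R U M f C \<longleftrightarrow>
     C \<in> U \<and> f \<in> Hom R M C \<and>
     (\<forall>C'\<in>U. \<forall>g\<in>Hom R M C'. \<exists>h\<in>Hom R C C'. compose (carrier M) h f = g)"

definition covering :: "('r, 'x) ring_scheme \<Rightarrow> ('r, 'm) module set \<Rightarrow> bool" where
  "covering R U \<longleftrightarrow> (\<forall>M\<in>ModR R. \<exists>C f. is_cover R U C f M)"

definition preenveloping :: "('r, 'x) ring_scheme \<Rightarrow> ('r, 'm) module set \<Rightarrow> bool" where
  "preenveloping R U \<longleftrightarrow> (\<forall>M\<in>ModR R. \<exists>C f. is_preenvelope R U M f C)"

definition E_cotorsion_pair ::
  "('r, 'x) ring_scheme \<Rightarrow> ('r, 'm) mod_pair set \<Rightarrow> ('r, 'm) module set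
    \<Rightarrow> ('r, 'm) module set \<Rightarrow> bool" where
  "E_cotorsion_pair R E U V \<longleftrightarrow> U = left_perp R E V \<and> V = right_perp R E U"

definition complete_pair ::
  "('r, 'x) ring_scheme \<Rightarrow> ('r, 'm) mod_pair set \<Rightarrow> ('r, 'm) module set
    \<Rightarrow> ('r, 'm) module set \<Rightarrow> bool" where
  "complete_pair R E U V \<longleftrightarrow>
     (\<forall>M\<in>ModR R.
        (\<exists>A\<in>V. \<exists>B\<in>U. \<exists>i p. (A, i, B, p, M) \<in> E) \<and>
        (\<exists>A\<in>V. \<exists>B\<in>U. \<exists>i p. (M, i, A, p, B) \<in> E))"

definition E_resolving ::
  "('r, 'x) ring_scheme \<Rightarrow> ('r, 'm) mod_pair set \<Rightarrow> ('r, 'm) module set \<Rightarrow> bool" where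
  "E_resolving R E U \<longleftrightarrow>
     (\<forall>P. E_projective R E P \<longrightarrow> P \<in> U) \<and>
     (\<forall>A i B p C. (A, i, B, p, C) \<in> E \<and> A \<in> U \<and> C \<in> U \<longrightarrow> B \<in> U) \<and>
     (\<forall>A i B p C. (A, i, B, p, C) \<in> E \<and> B \<in> U \<and> C \<in> U \<longrightarrow> A \<in> U)"

definition complete_hereditary_cotorsion_pair ::
  "('r, 'x) ring_scheme \<Rightarrow> ('r, 'm) mod_pair set \<Rightarrow> ('r, 'm) module set
    \<Rightarrow> ('r, 'm) module set \<Rightarrow> bool" where
  "complete_hereditary_cotorsion_pair R E U V \<longleftrightarrow>
     E_cotorsion_pair R E U V \<and> complete_pair R E U V \<and> E_resolving R E U"

end

theory Submission imports Defs begin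

text \<open>
  A class closed under coproducts and pure quotients is covering.  By the theorem of Bican,
  El Bashir and Enochs, a map \<open>C \<rightarrow> M\<close> from a large module has a nonzero pure submodule of \<open>C\<close> in
  its kernel, so that the maps to \<open>M\<close> that admit only injective maps over \<open>M\<close> out of their domain
  have bounded cardinality; a maximal one among them is a cover.  Dually, a class closed under
  products and pure submodules is preenveloping, since every map \<open>M \<rightarrow> N\<close> factors through a
  pure submodule of \<open>N\<close> of bounded cardinality.

  The group \<open>Ext\<^sup>1(M, N)\<close> vanishes if and only if maps to \<open>N\<close> from the first syzygy of \<open>M\<close>
  extend to the projective, or equivalently maps from \<open>M\<close> to the cosyzygy of \<open>N\<close> lift to the
  injective.  With these criteria, pure projectivity of \<open>M\<close> (respectively pure injectivity
  of \<open>N\<close>) gives the closure properties of the orthogonal classes.  If the first syzygy of \<open>M\<close> is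
  finitely presented, then maps from it commute with direct sums and lift along pure quotients.
  The covers are admissible epics with orthogonal kernel by Wakamatsu's lemma, and pulling them
  back along injective coresolutions gives the special preenvelopes.
\<close>

section \<open>Small sets\<close>

text \<open>Direct limits of modules have no canonical carrier, while Zorn's lemma wants a set
  ordered by inclusion. Both needs are met inside one free module \<open>G\<close> on the basis
  \<open>'m \<times> 'm\<close>: an object over \<open>M\<close> is a pair of submodules of
  \<open>G\<close>, and a directed family has its componentwise union as limit. The basis of
  \<open>G\<close> is not small, so after any small part of it has been used there are fresh basis
  elements above every element of \<open>M\<close>. Unions stay in the class because a direct limit
  is a pure quotient of a coproduct, but coproducts exist for small families only. Each use of
  Zorn's lemma therefore has to bound the chain first, either by traces on a fixed small set or by a
  small cofinal subset; the latter is what the bound on cardinalities is for. Relative Ext groups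
  are defined through an arbitrarily chosen resolution. They are replaced at once by the splitting
  of conflations, which mentions no resolution and serves \<open>E\<close> and the ordinary exact
  structure alike.\<close>

lemma small_subset: "\<lbrakk>small TYPE('m) B; A \<subseteq> B\<rbrakk> \<Longrightarrow> small TYPE('m) A"
  unfolding small_def by (rule ordLeq_ordLess_trans[OF card_of_mono1])

lemma small_ordLeq: "\<lbrakk>|A| \<le>o |B|; small TYPE('m) B\<rbrakk> \<Longrightarrow> small TYPE('m) A"
  unfolding small_def by (rule ordLeq_ordLess_trans)

lemma finite_ordLess_infinite: "\<lbrakk>finite A; infinite B\<rbrakk> \<Longrightarrow> |A| <o |B|"
  using card_of_ordLeq_finite[of B A] not_ordLess_iff_ordLeq[OF card_of_Well_order card_of_Well_order]
  by blast

lemma small_image: "small TYPE('m) A \<Longrightarrow> small TYPE('m) (f ` A)"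
  by (rule small_ordLeq[OF card_of_image])

lemma small_inj_on: "\<lbrakk>inj_on f A; f ` A \<subseteq> B; small TYPE('m) B\<rbrakk> \<Longrightarrow> small TYPE('m) A"
  by (rule small_ordLeq) (use card_of_ordLeq in blast)+

lemma not_small_ordLeq: "\<lbrakk>\<not> small TYPE('m) A; small TYPE('m) B\<rbrakk> \<Longrightarrow> |B| \<le>o |A|"
  unfolding small_def not_ordLess_iff_ordLeq[OF card_of_Well_order card_of_Well_order]
  by (rule ordLess_imp_ordLeq[OF ordLess_ordLeq_trans])

lemma small_imp_inj: "small TYPE('m) A \<Longrightarrow> \<exists>f::'a \<Rightarrow> 'm. inj_on f A"
  unfolding small_def using card_of_ordLeq[of A "UNIV :: 'm set"] ordLess_imp_ordLeq by blast

locale inaccessible_universe =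
  fixes ty :: "'m itself"
  assumes set_universe: "set_universe TYPE('m)"
begin

lemma infinite_universe: "infinite (UNIV :: 'm set)"
  using set_universe unfolding set_universe_def
  by (meson infinite_iff_card_of_nat ordLess_imp_ordLeq)

lemma small_nat: "small TYPE('m) (A :: nat set)"
  using set_universe small_subset[of UNIV A] unfolding set_universe_def small_def by blast

lemma small_finite: "finite A \<Longrightarrow> small TYPE('m) A"
  unfolding small_def using finite_ordLess_infinite[OF _ infinite_universe] by blast

lemma small_Pow: assumes "small TYPE('m) A" shows "small TYPE('m) (Pow A)"
proof -
  obtain f :: "'a \<Rightarrow> 'm" where f: "inj_on f A" using small_imp_inj assms by blast
  have "small TYPE('m) (Pow (f ` A))"
    using set_universe small_image[OF assms, of f] unfolding set_universe_def small_def by blast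
  moreover have "inj_on (image f) (Pow A)" using f by (simp add: inj_on_image_Pow)
  ultimately show ?thesis by (rule small_inj_on[rotated 2]) auto
qed

text \<open>This is the regularity of the universe, used through the library notion
  \<open>stable\<close>.\<close>

lemma small_UN:
  assumes "small TYPE('m) I" "\<And>i. i \<in> I \<Longrightarrow> small TYPE('m) (A i)"
  shows "small TYPE('m) (\<Union>i\<in>I. A i)"
proof -
  have "stable |UNIV :: 'm set|"
    using set_universe infinite_universe card_of_Card_order unfolding set_universe_def
    by (intro regularCard_stable) (auto simp: Field_card_of)
  then show ?thesis using assms stable_UNION unfolding small_def by blast
qed

lemma small_Union: "\<lbrakk>small TYPE('m) F; \<And>A. A \<in> F \<Longrightarrow> small TYPE('m) A\<rbrakk> \<Longrightarrow> small TYPE('m) (\<Union>F)"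
  using small_UN[of F "\<lambda>A. A"] by simp

lemma small_Sigma:
  assumes "small TYPE('m) I" "\<And>i. i \<in> I \<Longrightarrow> small TYPE('m) (A i)"
  shows "small TYPE('m) (Sigma I A)"
proof -
  have "small TYPE('m) (\<Union>i\<in>I. Pair i ` A i)"
    by (rule small_UN) (auto intro: assms small_image)
  then show ?thesis by (rule small_subset) auto
qed

lemma small_Times: "\<lbrakk>small TYPE('m) A; small TYPE('m) B\<rbrakk> \<Longrightarrow> small TYPE('m) (A \<times> B)"
  by (rule small_Sigma)

lemma small_Un: "\<lbrakk>small TYPE('m) A; small TYPE('m) B\<rbrakk> \<Longrightarrow> small TYPE('m) (A \<union> B)"
  using small_Union[of "{A, B}"] small_finite[of "{A, B}"] by auto

text \<open>A function in the product is determined by its graph, a subset of the small set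
  \<open>Sigma I A\<close>, so the strong limit property applies through
  \<open>small_Pow\<close>.\<close>

lemma small_PiE:
  assumes "small TYPE('m) I" "\<And>i. i \<in> I \<Longrightarrow> small TYPE('m) (A i)"
  shows "small TYPE('m) (PiE I A)"
proof -
  let ?g = "\<lambda>f. (\<lambda>i. (i, f i)) ` I"
  have "inj_on ?g (PiE I A)"
  proof (rule inj_onI)
    fix f h assume *: "f \<in> PiE I A" "h \<in> PiE I A" "?g f = ?g h"
    have "f i = h i" if "i \<in> I" for i
    proof -
      have "(i, f i) \<in> ?g h" using *(3) that by blast
      then show ?thesis by auto
    qed
    then show "f = h" by (rule PiE_ext[OF *(1,2)])
  qed
  moreover have "?g ` PiE I A \<subseteq> Pow (Sigma I A)" by (auto simp: PiE_iff)
  moreover have "small TYPE('m) (Pow (Sigma I A))" by (intro small_Pow small_Sigma assms)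
  ultimately show ?thesis by (rule small_inj_on)
qed

lemma not_small_UNIV: "\<not> small TYPE('m) (UNIV :: 'm set)"
  unfolding small_def by (rule ordLess_irreflexive)

text \<open>Supplies fresh names: the complement of a small set is not small, since two small sets
  cannot cover \<open>'m\<close>.\<close>

lemma small_avoid:
  assumes "small TYPE('m) A" "small TYPE('m) (S :: 'm set)"
  shows "\<exists>f::'a \<Rightarrow> 'm. inj_on f A \<and> f ` A \<inter> S = {}"
proof -
  have "\<not> small TYPE('m) (UNIV - S)"
    using small_Un[of "UNIV - S" S] assms(2) not_small_UNIV by auto
  then have "|A| \<le>o |UNIV - S|" using not_small_ordLeq assms(1) by blast
  then obtain f where "inj_on f A" "f ` A \<subseteq> UNIV - S" using card_of_ordLeq by metis
  then show ?thesis by blast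
qed

end

subsection \<open>Cardinals of the form \<open>2\<^sup>Y\<close>\<close>

text \<open>
  Bounds on cardinalities are taken of the form \<open>|Pow Y|\<close> with \<open>Y\<close> infinite, since these are
  preserved by taking families indexed by \<open>Y\<close>.
\<close>

lemma Func_Pow_ordLeq:
  assumes "infinite Y" "|I| \<le>o |Y|" "|B| \<le>o |Pow Y|"
  shows "|PiE I (\<lambda>_. B)| \<le>o |Pow Y|"
proof -
  obtain e where e: "inj_on e (I \<times> Y)" "e ` (I \<times> Y) \<subseteq> Y"
  proof -
    have "|I \<times> Y| \<le>o |Y|"
      using assms by (intro card_of_Sigma_ordLeq_infinite) (auto intro: card_of_mono1)
    then show ?thesis using that card_of_ordLeq[of "I \<times> Y" Y] by blast
  qed
  obtain c where c: "inj_on c B" "c ` B \<subseteq> Pow Y" using assms(3) card_of_ordLeq by metis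
  \<comment> \<open>\<open>c\<close> codes each value as a subset of \<open>Y\<close> and
    \<open>e\<close> codes \<open>I \<times> Y\<close> in \<open>Y\<close>, so a whole family
    becomes one subset of \<open>Y\<close>. This is the computation (2^Y)^Y = 2^(Y \<times> Y) =
    2^Y.\<close>
  define g where "g f = e ` (SIGMA i:I. c (f i))" for f
  have "inj_on g (PiE I (\<lambda>_. B))"
  proof (rule inj_onI)
    fix f h assume *: "f \<in> PiE I (\<lambda>_. B)" "h \<in> PiE I (\<lambda>_. B)" "g f = g h"
    have sub: "(SIGMA i:I. c (k i)) \<subseteq> I \<times> Y" if "k \<in> PiE I (\<lambda>_. B)" for k
      using that c(2) by (auto simp: PiE_iff)
    have eq: "(SIGMA i:I. c (f i)) = (SIGMA i:I. c (h i))"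
      using *(3) e(1) sub[OF *(1)] sub[OF *(2)] unfolding g_def
      by (simp add: inj_on_image_eq_iff)
    have "f i = h i" if "i \<in> I" for i
    proof -
      have "c (f i) = c (h i)" using that eq by (auto simp: set_eq_iff)
      then show ?thesis using c(1) * that by (auto simp: inj_on_def PiE_iff)
    qed
    then show "f = h" by (rule PiE_ext[OF *(1,2)])
  qed
  moreover have "g ` PiE I (\<lambda>_. B) \<subseteq> Pow Y"
    unfolding g_def using c(2) e(2) by (auto simp: PiE_iff) blast
  ultimately show ?thesis using card_of_ordLeq by blast
qed

lemma infinite_Pow_ordLeq: "infinite Y \<Longrightarrow> infinite (Pow Y)"
  by simp

lemma UN_Pow_ordLeq:
  assumes "infinite Y" "|I| \<le>o |Pow Y|" "\<And>i. i \<in> I \<Longrightarrow> |A i| \<le>o |Pow Y|"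
  shows "|\<Union>i\<in>I. A i| \<le>o |Pow Y|"
  using assms by (intro card_of_UNION_ordLeq_infinite) auto

lemma Un_Pow_ordLeq:
  assumes "infinite Y" "|A| \<le>o |Pow Y|" "|B| \<le>o |Pow Y|"
  shows "|A \<union> B| \<le>o |Pow Y|"
  using UN_Pow_ordLeq[of Y "{A, B}" "\<lambda>S. S"] assms
    ordLess_imp_ordLeq[OF finite_ordLess_infinite[of "{A, B}" "Pow Y"]] by auto

lemma ordLeq_Pow: "|A| \<le>o |Y| \<Longrightarrow> |A| \<le>o |Pow Y|"
  by (rule ordLeq_transitive[OF _ ordLess_imp_ordLeq[OF card_of_Pow]])

lemma nat_ordLeq: "infinite Y \<Longrightarrow> |UNIV :: nat set| \<le>o |Y|"
  by (simp add: infinite_iff_card_of_nat)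

text \<open>
  A set closed under an operator whose value depends on subsets of cardinality at most \<open>|Y|\<close>
  is built by iterating the operator along the successor cardinal of \<open>|Y|\<close>.
\<close>

lemma bounded_closure:
  fixes c :: "'n set \<Rightarrow> 'n set"
  assumes Y: "infinite (Y :: 'y set)"
    and mono: "\<And>S T. S \<subseteq> T \<Longrightarrow> c S \<subseteq> c T"
    and local: "\<And>S x. x \<in> c S \<Longrightarrow> \<exists>T\<subseteq>S. |T| \<le>o |Y| \<and> x \<in> c T"
    and bound: "\<And>S. |S| \<le>o |Pow Y| \<Longrightarrow> |c S| \<le>o |Pow Y|"
  shows "\<exists>A. c A \<subseteq> A \<and> |A| \<le>o |Pow Y|"
proof -
  \<comment> \<open>The successor cardinal is regular, so a subset of the union with at most
    \<open>|Y|\<close> elements already lies in one stage. Being at most 2^Y, it also keeps the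
    number of stages within the bound.\<close>
  let ?r = "cardSuc |Y|"
  have co: "Card_order |Y|" by (rule card_of_Card_order)
  have cor: "Card_order ?r" using cardSuc_Card_order[OF co] .
  then have wo: "wo_rel ?r" unfolding wo_rel_def card_order_on_def by auto
  define H where "H f i = c (\<Union>j\<in>underS ?r i. f j)" for f :: "'y set \<Rightarrow> 'n set" and i
  have adm: "wo_rel.adm_wo ?r H" unfolding wo_rel.adm_wo_def[OF wo] H_def by auto
  define As where "As = wo_rel.worec ?r H"
  have As: "As i = c (\<Union>j\<in>underS ?r i. As j)" for i
    using fun_cong[OF wo_rel.worec_fixpoint[OF wo adm], of i] unfolding As_def H_def by simp
  have le: "?r \<le>o |Pow Y|"
    using cardSuc_least[OF co card_of_Card_order card_of_Pow] .
  have under: "|underS ?r i| \<le>o |Pow Y|" for i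
  proof (cases "i \<in> Field ?r")
    case True
    then show ?thesis by (intro ordLess_imp_ordLeq[OF ordLess_ordLeq_trans[OF card_of_underS[OF cor] le]])
  next
    case False
    then have "underS ?r i = {}" unfolding underS_def Field_def by auto
    then show ?thesis by (simp add: card_of_empty)
  qed
  have bnd: "|As i| \<le>o |Pow Y|" for i
  proof (induction i rule: wo_rel.well_order_induct[OF wo])
    case (1 i)
    then have "\<And>j. j \<in> underS ?r i \<Longrightarrow> |As j| \<le>o |Pow Y|" unfolding underS_def by auto
    then show ?case by (subst As) (intro bound UN_Pow_ordLeq[OF Y under])
  qed
  have mon: "As i \<subseteq> As j" if "(i, j) \<in> ?r" for i j
  proof -
    have "underS ?r i \<subseteq> underS ?r j"
      using that by (intro underS_incr wo_rel.TRANS[OF wo] wo_rel.ANTISYM[OF wo])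
    then have "c (\<Union>k\<in>underS ?r i. As k) \<subseteq> c (\<Union>k\<in>underS ?r j. As k)" by (intro mono UN_mono) auto
    then show ?thesis using As[of i] As[of j] by simp
  qed
  define A where "A = (\<Union>i\<in>Field ?r. As i)"
  have "|Field ?r| \<le>o |Pow Y|"
    by (rule ordIso_ordLeq_trans[OF card_of_Field_ordIso[OF cor] le])
  then have "|A| \<le>o |Pow Y|" unfolding A_def using UN_Pow_ordLeq[OF Y] bnd by blast
  moreover have "c A \<subseteq> A"
  proof
    fix x assume "x \<in> c A"
    then obtain T where T: "T \<subseteq> A" "|T| \<le>o |Y|" "x \<in> c T" using local by blast
    have "\<exists>i\<in>Field ?r. T \<subseteq> As i"
      using T Y mon by (intro cardSuc_UNION[OF co]) (auto simp: A_def relChain_def Field_card_of)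
    then obtain i where i: "i \<in> Field ?r" "T \<subseteq> As i" by blast
    \<comment> \<open>Stage \<open>j\<close> is built from strictly earlier stages, so a
      \<open>j\<close> beyond the stage that contains \<open>T\<close> is needed; an infinite
      cardinal has no last element.\<close>
    have "infinite (Field ?r)" using Y cardSuc_finite[OF co] by (simp add: Field_card_of)
    then obtain j where j: "j \<in> Field ?r" "i \<noteq> j" "(i, j) \<in> ?r"
      using infinite_Card_order_limit[OF cor _ i(1)] by auto
    have "T \<subseteq> (\<Union>k\<in>underS ?r j. As k)" using i j unfolding underS_def by auto
    then have "x \<in> As j" using T(3) mono[of T] by (subst As) blast
    then show "x \<in> A" unfolding A_def using j by blast
  qed
  ultimately show ?thesis by blast
qed

section \<open>Right modules and linear maps\<close>

text \<open>Linear maps that need not be extensional; \<open>Hom\<close> consists of their restrictions.\<close>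

definition lin :: "('r, 'x) ring_scheme \<Rightarrow> ('r, 'a) module \<Rightarrow> ('r, 'b) module \<Rightarrow> ('a \<Rightarrow> 'b) \<Rightarrow> bool" where
  "lin R M N f \<longleftrightarrow> f \<in> carrier M \<rightarrow> carrier N \<and>
     (\<forall>x\<in>carrier M. \<forall>y\<in>carrier M. f (x \<oplus>\<^bsub>M\<^esub> y) = f x \<oplus>\<^bsub>N\<^esub> f y) \<and>
     (\<forall>r\<in>carrier R. \<forall>x\<in>carrier M. f (r \<odot>\<^bsub>M\<^esub> x) = r \<odot>\<^bsub>N\<^esub> f x)"

text \<open>Closure under negatives comes from multiplication by the scalar -1, see
  \<open>submod_minus\<close>.\<close>

definition submod :: "('r, 'x) ring_scheme \<Rightarrow> ('r, 'a) module \<Rightarrow> 'a set \<Rightarrow> bool" where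
  "submod R N P \<longleftrightarrow> P \<subseteq> carrier N \<and> \<zero>\<^bsub>N\<^esub> \<in> P \<and>
     (\<forall>x\<in>P. \<forall>y\<in>P. x \<oplus>\<^bsub>N\<^esub> y \<in> P) \<and> (\<forall>r\<in>carrier R. \<forall>x\<in>P. r \<odot>\<^bsub>N\<^esub> x \<in> P)"

abbreviation sub :: "('r, 'a) module \<Rightarrow> 'a set \<Rightarrow> ('r, 'a) module" where
  "sub N P \<equiv> N\<lparr>carrier := P\<rparr>"

lemma right_module_abelian_group: "right_module R M \<Longrightarrow> abelian_group M"
  by (rule right_module.axioms(2))

section \<open>Arithmetic in right modules\<close>

context right_module
begin

lemma smult_zero: "r \<in> carrier R \<Longrightarrow> r \<odot>\<^bsub>M\<^esub> \<zero>\<^bsub>M\<^esub> = \<zero>\<^bsub>M\<^esub>"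
  using smult_add[of r "\<zero>\<^bsub>M\<^esub>" "\<zero>\<^bsub>M\<^esub>"] smult_closed[of r "\<zero>\<^bsub>M\<^esub>"] M.add.l_cancel_one by fastforce

lemma zero_smult: "x \<in> carrier M \<Longrightarrow> \<zero>\<^bsub>R\<^esub> \<odot>\<^bsub>M\<^esub> x = \<zero>\<^bsub>M\<^esub>"
  using smult_add_scalar[of "\<zero>\<^bsub>R\<^esub>" "\<zero>\<^bsub>R\<^esub>" x] smult_closed[of "\<zero>\<^bsub>R\<^esub>" x] M.add.l_cancel_one by fastforce

text \<open>Negatives become scalar multiples, so that closure of submodules under negation and
  \<open>lin_minus\<close> follow from compatibility with scalars.\<close>

lemma minus_one_smult: assumes "x \<in> carrier M" shows "(\<ominus>\<^bsub>R\<^esub> \<one>\<^bsub>R\<^esub>) \<odot>\<^bsub>M\<^esub> x = \<ominus>\<^bsub>M\<^esub> x"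
proof -
  have "(\<ominus>\<^bsub>R\<^esub> \<one>\<^bsub>R\<^esub>) \<odot>\<^bsub>M\<^esub> x \<oplus>\<^bsub>M\<^esub> x = (\<ominus>\<^bsub>R\<^esub> \<one>\<^bsub>R\<^esub> \<oplus>\<^bsub>R\<^esub> \<one>\<^bsub>R\<^esub>) \<odot>\<^bsub>M\<^esub> x"
    using smult_add_scalar[of "\<ominus>\<^bsub>R\<^esub> \<one>\<^bsub>R\<^esub>" "\<one>\<^bsub>R\<^esub>" x] smult_one assms by simp
  also have "\<dots> = \<zero>\<^bsub>M\<^esub>" using zero_smult assms by (simp add: R.l_neg)
  finally show ?thesis
    using M.minus_equality smult_closed assms by (metis R.a_inv_closed R.one_closed)
qed

lemma submod_minus: assumes "submod R M P" "x \<in> P" shows "\<ominus>\<^bsub>M\<^esub> x \<in> P"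
  using assms minus_one_smult[of x] unfolding submod_def by (metis R.a_inv_closed R.one_closed subsetD)

lemma submod_diff: "\<lbrakk>submod R M P; x \<in> P; y \<in> P\<rbrakk> \<Longrightarrow> x \<ominus>\<^bsub>M\<^esub> y \<in> P"
  using submod_minus[of P y] unfolding submod_def a_minus_def by blast

lemma submod_diff_add:
  assumes "submod R M P" "x \<in> carrier M" "y \<in> P" "x \<ominus>\<^bsub>M\<^esub> y \<in> P" shows "x \<in> P"
proof -
  have "y \<in> carrier M" using assms unfolding submod_def by auto
  then have "x = (x \<ominus>\<^bsub>M\<^esub> y) \<oplus>\<^bsub>M\<^esub> y" using assms(2)
    by (simp add: M.minus_eq M.a_assoc M.l_neg)
  then show ?thesis using assms unfolding submod_def by metis
qed

lemma smult_minus: "\<lbrakk>r \<in> carrier R; x \<in> carrier M\<rbrakk> \<Longrightarrow> r \<odot>\<^bsub>M\<^esub> (\<ominus>\<^bsub>M\<^esub> x) = \<ominus>\<^bsub>M\<^esub> (r \<odot>\<^bsub>M\<^esub> x)"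
  using smult_add[of r "\<ominus>\<^bsub>M\<^esub> x" x] smult_zero
  by (metis M.a_inv_closed M.l_neg M.minus_equality smult_closed)

lemma smult_diff:
  "\<lbrakk>r \<in> carrier R; x \<in> carrier M; y \<in> carrier M\<rbrakk>
   \<Longrightarrow> r \<odot>\<^bsub>M\<^esub> (x \<ominus>\<^bsub>M\<^esub> y) = r \<odot>\<^bsub>M\<^esub> x \<ominus>\<^bsub>M\<^esub> r \<odot>\<^bsub>M\<^esub> y"
  using smult_add smult_minus by (simp add: M.minus_eq)

lemma diff_zero_iff: "\<lbrakk>x \<in> carrier M; y \<in> carrier M\<rbrakk> \<Longrightarrow> x \<ominus>\<^bsub>M\<^esub> y = \<zero>\<^bsub>M\<^esub> \<longleftrightarrow> x = y"
  by (metis M.minus_eq M.r_neg M.minus_minus M.minus_equality M.a_inv_closed)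

lemma diff_diff_eq:
  "\<lbrakk>x \<in> carrier M; y \<in> carrier M; z \<in> carrier M; w \<in> carrier M\<rbrakk>
   \<Longrightarrow> (x \<oplus>\<^bsub>M\<^esub> y) \<ominus>\<^bsub>M\<^esub> (z \<oplus>\<^bsub>M\<^esub> w) = (x \<ominus>\<^bsub>M\<^esub> z) \<oplus>\<^bsub>M\<^esub> (y \<ominus>\<^bsub>M\<^esub> w)"
  by (simp add: M.minus_eq M.minus_add M.a_ac)

lemma add_diff_cancel: "\<lbrakk>x \<in> carrier M; y \<in> carrier M\<rbrakk> \<Longrightarrow> (x \<oplus>\<^bsub>M\<^esub> y) \<ominus>\<^bsub>M\<^esub> y = x"
  by (simp add: M.minus_eq M.a_assoc M.r_neg)

lemma diff_zero: "x \<in> carrier M \<Longrightarrow> x \<ominus>\<^bsub>M\<^esub> \<zero>\<^bsub>M\<^esub> = x"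
  using add_diff_cancel[of x "\<zero>\<^bsub>M\<^esub>"] by simp

lemma diff_diff_cancel:
  assumes "x \<in> carrier M" "y \<in> carrier M" "z \<in> carrier M"
  shows "(z \<ominus>\<^bsub>M\<^esub> y) \<ominus>\<^bsub>M\<^esub> (z \<ominus>\<^bsub>M\<^esub> x) = x \<ominus>\<^bsub>M\<^esub> y"
proof -
  have "(z \<ominus>\<^bsub>M\<^esub> y) \<ominus>\<^bsub>M\<^esub> (z \<ominus>\<^bsub>M\<^esub> x) = (z \<ominus>\<^bsub>M\<^esub> z) \<oplus>\<^bsub>M\<^esub> (\<ominus>\<^bsub>M\<^esub> y \<ominus>\<^bsub>M\<^esub> \<ominus>\<^bsub>M\<^esub> x)"
    using diff_diff_eq[of z "\<ominus>\<^bsub>M\<^esub> y" z "\<ominus>\<^bsub>M\<^esub> x"] assms by (simp add: a_minus_def)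
  also have "\<dots> = \<ominus>\<^bsub>M\<^esub> y \<oplus>\<^bsub>M\<^esub> x"
    using assms by (simp add: M.minus_eq M.r_neg)
  also have "\<dots> = x \<ominus>\<^bsub>M\<^esub> y" using assms M.a_comm by (simp add: M.minus_eq)
  finally show ?thesis .
qed

lemma diff_add_cancel: "\<lbrakk>x \<in> carrier M; y \<in> carrier M\<rbrakk> \<Longrightarrow> (x \<ominus>\<^bsub>M\<^esub> y) \<oplus>\<^bsub>M\<^esub> y = x"
  by (simp add: M.minus_eq M.a_assoc M.l_neg)

lemma add_diff: "\<lbrakk>x \<in> carrier M; y \<in> carrier M\<rbrakk> \<Longrightarrow> y \<oplus>\<^bsub>M\<^esub> (x \<ominus>\<^bsub>M\<^esub> y) = x"
  using diff_add_cancel M.a_comm by simp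

end

section \<open>Elementary properties of linear maps\<close>

lemma lin_closed: "lin R M N f \<Longrightarrow> x \<in> carrier M \<Longrightarrow> f x \<in> carrier N"
  unfolding lin_def by auto

lemma lin_add: "lin R M N f \<Longrightarrow> x \<in> carrier M \<Longrightarrow> y \<in> carrier M \<Longrightarrow> f (x \<oplus>\<^bsub>M\<^esub> y) = f x \<oplus>\<^bsub>N\<^esub> f y"
  unfolding lin_def by auto

lemma lin_smult: "lin R M N f \<Longrightarrow> r \<in> carrier R \<Longrightarrow> x \<in> carrier M \<Longrightarrow> f (r \<odot>\<^bsub>M\<^esub> x) = r \<odot>\<^bsub>N\<^esub> f x"
  unfolding lin_def by auto

lemma linI:
  "\<lbrakk>\<And>x. x \<in> carrier M \<Longrightarrow> f x \<in> carrier N;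
    \<And>x y. \<lbrakk>x \<in> carrier M; y \<in> carrier M\<rbrakk> \<Longrightarrow> f (x \<oplus>\<^bsub>M\<^esub> y) = f x \<oplus>\<^bsub>N\<^esub> f y;
    \<And>r x. \<lbrakk>r \<in> carrier R; x \<in> carrier M\<rbrakk> \<Longrightarrow> f (r \<odot>\<^bsub>M\<^esub> x) = r \<odot>\<^bsub>N\<^esub> f x\<rbrakk> \<Longrightarrow> lin R M N f"
  unfolding lin_def by auto

lemma submodD:
  assumes "submod R N P"
  shows "P \<subseteq> carrier N" "\<zero>\<^bsub>N\<^esub> \<in> P" "\<And>x y. x \<in> P \<Longrightarrow> y \<in> P \<Longrightarrow> x \<oplus>\<^bsub>N\<^esub> y \<in> P"
    "\<And>r x. r \<in> carrier R \<Longrightarrow> x \<in> P \<Longrightarrow> r \<odot>\<^bsub>N\<^esub> x \<in> P"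
  using assms unfolding submod_def by auto

lemma submodI:
  "\<lbrakk>P \<subseteq> carrier N; \<zero>\<^bsub>N\<^esub> \<in> P; \<And>x y. \<lbrakk>x \<in> P; y \<in> P\<rbrakk> \<Longrightarrow> x \<oplus>\<^bsub>N\<^esub> y \<in> P;
    \<And>r x. \<lbrakk>r \<in> carrier R; x \<in> P\<rbrakk> \<Longrightarrow> r \<odot>\<^bsub>N\<^esub> x \<in> P\<rbrakk> \<Longrightarrow> submod R N P"
  unfolding submod_def by auto

lemma lin_cong: "(\<And>x. x \<in> carrier M \<Longrightarrow> f x = g x) \<Longrightarrow> right_module R M \<Longrightarrow> lin R M N f \<Longrightarrow> lin R M N g"
proof -
  assume a: "\<And>x. x \<in> carrier M \<Longrightarrow> f x = g x" "right_module R M" "lin R M N f"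
  interpret M: right_module R M by fact
  show ?thesis
    by (rule linI) (simp_all add: a(1)[symmetric] M.smult_closed lin_closed[OF a(3)] lin_add[OF a(3)]
        lin_smult[OF a(3)])
qed

lemma Hom_iff: "right_module R M \<Longrightarrow> f \<in> Hom R M N \<longleftrightarrow> lin R M N f \<and> f \<in> extensional (carrier M)"
  unfolding Hom_def lin_def PiE_def by auto

lemma Hom_lin: "f \<in> Hom R M N \<Longrightarrow> lin R M N f"
  unfolding Hom_def lin_def PiE_def by auto

lemma Hom_restrict: "f \<in> Hom R M N \<Longrightarrow> restrict f (carrier M) = f"
  unfolding Hom_def by (auto simp: PiE_def extensional_restrict)

lemma lin_restrict: "right_module R M \<Longrightarrow> lin R M N f \<Longrightarrow> restrict f (carrier M) \<in> Hom R M N"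
  using lin_cong[of M f "restrict f (carrier M)" R N] Hom_iff by force

lemma lin_comp: "\<lbrakk>lin R M N f; lin R N P g\<rbrakk> \<Longrightarrow> lin R M P (\<lambda>x. g (f x))"
  by (rule linI) (simp_all add: lin_closed lin_add lin_smult)

lemma lin_id: "lin R M M (\<lambda>x. x)"
  unfolding lin_def by auto

lemma lin_zero_map: "right_module R N \<Longrightarrow> lin R M N (\<lambda>x. \<zero>\<^bsub>N\<^esub>)"
proof -
  assume "right_module R N"
  then interpret N: right_module R N .
  show ?thesis by (rule linI) (auto simp: N.smult_zero)
qed

lemma lin_zero:
  assumes "right_module R M" "right_module R N" "lin R M N f" shows "f \<zero>\<^bsub>M\<^esub> = \<zero>\<^bsub>N\<^esub>"
proof -
  interpret M: right_module R M by fact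
  interpret N: right_module R N by fact
  have "f \<zero>\<^bsub>M\<^esub> \<oplus>\<^bsub>N\<^esub> f \<zero>\<^bsub>M\<^esub> = f \<zero>\<^bsub>M\<^esub>"
    using lin_add[OF assms(3), of "\<zero>\<^bsub>M\<^esub>" "\<zero>\<^bsub>M\<^esub>"] by simp
  then show ?thesis using lin_closed[OF assms(3), of "\<zero>\<^bsub>M\<^esub>"] N.M.add.l_cancel_one by simp
qed

lemma lin_minus:
  assumes "right_module R M" "right_module R N" "lin R M N f" "x \<in> carrier M"
  shows "f (\<ominus>\<^bsub>M\<^esub> x) = \<ominus>\<^bsub>N\<^esub> f x"
proof -
  interpret M: right_module R M by fact
  interpret N: right_module R N by fact
  show ?thesis
    using lin_smult[OF assms(3), of "\<ominus>\<^bsub>R\<^esub> \<one>\<^bsub>R\<^esub>" x] assms(4) lin_closed[OF assms(3,4)]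
      M.minus_one_smult N.minus_one_smult by simp
qed

lemma lin_diff:
  assumes "right_module R M" "right_module R N" "lin R M N f" "x \<in> carrier M" "y \<in> carrier M"
  shows "f (x \<ominus>\<^bsub>M\<^esub> y) = f x \<ominus>\<^bsub>N\<^esub> f y"
proof -
  interpret M: right_module R M by fact
  show ?thesis using assms lin_add[OF assms(3), of x "\<ominus>\<^bsub>M\<^esub> y"] lin_minus[OF assms(1,2,3)]
    by (simp add: a_minus_def)
qed

lemma lin_sum:
  assumes "right_module R M" "right_module R N" "lin R M N f" "lin R M N g"
  shows "lin R M N (\<lambda>x. f x \<oplus>\<^bsub>N\<^esub> g x)"
proof -
  interpret N: right_module R N by fact
  show ?thesis
    by (rule linI) (simp_all add: lin_closed[OF assms(3)] lin_closed[OF assms(4)] lin_add[OF assms(3)]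
        lin_add[OF assms(4)] lin_smult[OF assms(3)] lin_smult[OF assms(4)] N.M.a_ac N.smult_add)
qed

lemma lin_difference:
  assumes "right_module R M" "right_module R N" "lin R M N f" "lin R M N g"
  shows "lin R M N (\<lambda>x. f x \<ominus>\<^bsub>N\<^esub> g x)"
proof -
  interpret N: right_module R N by fact
  show ?thesis
    by (rule linI) (simp_all add: lin_closed[OF assms(3)] lin_closed[OF assms(4)] lin_add[OF assms(3)]
        lin_add[OF assms(4)] lin_smult[OF assms(3)] lin_smult[OF assms(4)] N.diff_diff_eq N.smult_diff)
qed

lemma lin_inj_on_iff:
  assumes "right_module R M" "right_module R N" "lin R M N f"
  shows "inj_on f (carrier M) \<longleftrightarrow> (\<forall>x\<in>carrier M. f x = \<zero>\<^bsub>N\<^esub> \<longrightarrow> x = \<zero>\<^bsub>M\<^esub>)"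
proof -
  interpret M: right_module R M by fact
  interpret N: right_module R N by fact
  have *: "f x = f y \<longleftrightarrow> f (x \<ominus>\<^bsub>M\<^esub> y) = \<zero>\<^bsub>N\<^esub>" if "x \<in> carrier M" "y \<in> carrier M" for x y
    using that lin_diff[OF assms] N.diff_zero_iff lin_closed[OF assms(3)] by simp
  show ?thesis
  proof
    assume "inj_on f (carrier M)"
    then show "\<forall>x\<in>carrier M. f x = \<zero>\<^bsub>N\<^esub> \<longrightarrow> x = \<zero>\<^bsub>M\<^esub>"
      using lin_zero[OF assms] by (simp add: inj_on_def)
  next
    assume k: "\<forall>x\<in>carrier M. f x = \<zero>\<^bsub>N\<^esub> \<longrightarrow> x = \<zero>\<^bsub>M\<^esub>"
    show "inj_on f (carrier M)"
      by (rule inj_onI) (use k * M.diff_zero_iff in auto)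
  qed
qed

subsection \<open>Submodules, images and quotients\<close>

lemma right_module_sub:
  assumes "right_module R N" "submod R N P" shows "right_module R (sub N P)"
proof -
  interpret N: right_module R N by fact
  note P = submodD[OF assms(2)]
  have "abelian_group (sub N P)"
  proof (rule abelian_groupI)
    fix x assume "x \<in> carrier (sub N P)"
    then show "\<exists>y\<in>carrier (sub N P). y \<oplus>\<^bsub>sub N P\<^esub> x = \<zero>\<^bsub>sub N P\<^esub>"
      using N.submod_minus[OF assms(2), of x] P(1) by (auto intro!: bexI[of _ "\<ominus>\<^bsub>N\<^esub> x"] simp: N.M.l_neg)
  qed (use P in \<open>auto simp: N.M.a_ac subsetD\<close>)
  then show ?thesis
    unfolding right_module_def right_module_axioms_def
    using P N.R.ring_axioms by (auto simp: subsetD N.smult_add_scalar N.smult_add N.smult_assoc N.smult_one)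
qed

lemma lin_sub: "P \<subseteq> carrier N \<Longrightarrow> lin R N T f \<Longrightarrow> lin R (sub N P) T f"
  unfolding lin_def by (auto simp: subset_iff Pi_iff)

lemma lin_into_sub: "lin R M N f \<Longrightarrow> (\<And>x. x \<in> carrier M \<Longrightarrow> f x \<in> P) \<Longrightarrow> lin R M (sub N P) f"
  unfolding lin_def by auto

lemma lin_from_into_sub: "lin R M (sub N P) f \<Longrightarrow> P \<subseteq> carrier N \<Longrightarrow> lin R M N f"
  unfolding lin_def by auto

lemma submod_carrier: "right_module R N \<Longrightarrow> submod R N (carrier N)"
proof -
  assume "right_module R N"
  then interpret N: right_module R N .
  show ?thesis by (rule submodI) (auto intro: N.smult_closed)
qed

lemma submod_zero: "right_module R N \<Longrightarrow> submod R N {\<zero>\<^bsub>N\<^esub>}"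
proof -
  assume "right_module R N"
  then interpret N: right_module R N .
  show ?thesis by (rule submodI) (auto simp: N.smult_zero)
qed

lemma submod_vimage:
  assumes "right_module R M" "right_module R N" "lin R M N f" "submod R N P"
  shows "submod R M {x \<in> carrier M. f x \<in> P}"
proof -
  interpret M: right_module R M by fact
  show ?thesis
    by (rule submodI) (auto simp: lin_zero[OF assms(1-3)] lin_add[OF assms(3)] lin_smult[OF assms(3)]
        submodD[OF assms(4)] M.smult_closed)
qed

lemma submod_kernel:
  assumes "right_module R M" "right_module R N" "lin R M N f"
  shows "submod R M {x \<in> carrier M. f x = \<zero>\<^bsub>N\<^esub>}"
  using submod_vimage[OF assms submod_zero[OF assms(2)]] by simp

lemma submod_image:
  assumes "right_module R M" "right_module R N" "lin R M N f" "submod R M P"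
  shows "submod R N (f ` P)"
proof (rule submodI)
  note P = submodD[OF assms(4)]
  show "f ` P \<subseteq> carrier N" using P(1) lin_closed[OF assms(3)] by auto
  show "\<zero>\<^bsub>N\<^esub> \<in> f ` P" using P(2) lin_zero[OF assms(1-3)] by force
  show "x \<oplus>\<^bsub>N\<^esub> y \<in> f ` P" if "x \<in> f ` P" "y \<in> f ` P" for x y
    using that P(1,3) lin_add[OF assms(3)] by (auto simp: subset_iff image_iff) metis
  show "r \<odot>\<^bsub>N\<^esub> x \<in> f ` P" if "r \<in> carrier R" "x \<in> f ` P" for r x
    using that P(1,4) lin_smult[OF assms(3)] by (auto simp: subset_iff image_iff) metis
qed

text \<open>The target of \<open>\<pi>\<close> is a bare type. The operations are transported
  through chosen preimages \<open>s\<close>, and the hypotheses say that the fibres of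
  \<open>\<pi>\<close> form a congruence, so that the choice does not matter.\<close>

lemma image_module:
  fixes N :: "('r, 'a) module" and \<pi> :: "'a \<Rightarrow> 'b"
  assumes N: "right_module R N"
    and add: "\<And>x x' y y'. \<lbrakk>x \<in> carrier N; x' \<in> carrier N; y \<in> carrier N; y' \<in> carrier N;
        \<pi> x = \<pi> x'; \<pi> y = \<pi> y'\<rbrakk> \<Longrightarrow> \<pi> (x \<oplus>\<^bsub>N\<^esub> y) = \<pi> (x' \<oplus>\<^bsub>N\<^esub> y')"
    and smult: "\<And>r x x'. \<lbrakk>r \<in> carrier R; x \<in> carrier N; x' \<in> carrier N; \<pi> x = \<pi> x'\<rbrakk>
        \<Longrightarrow> \<pi> (r \<odot>\<^bsub>N\<^esub> x) = \<pi> (r \<odot>\<^bsub>N\<^esub> x')"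
  shows "\<exists>Q. right_module R Q \<and> carrier Q = \<pi> ` carrier N \<and> lin R N Q \<pi>"
proof -
  interpret N: right_module R N by fact
  define s where "s = inv_into (carrier N) \<pi>"
  have s: "s (\<pi> x) \<in> carrier N" "\<pi> (s (\<pi> x)) = \<pi> x" if "x \<in> carrier N" for x
    unfolding s_def using that by (auto intro: inv_into_into f_inv_into_f)
  define Q :: "('r, 'b) module" where
    "Q = \<lparr>carrier = \<pi> ` carrier N, mult = undefined, one = undefined, zero = \<pi> \<zero>\<^bsub>N\<^esub>,
          add = (\<lambda>u v. \<pi> (s u \<oplus>\<^bsub>N\<^esub> s v)), smult = (\<lambda>r u. \<pi> (r \<odot>\<^bsub>N\<^esub> s u))\<rparr>"
  have add_Q: "\<pi> x \<oplus>\<^bsub>Q\<^esub> \<pi> y = \<pi> (x \<oplus>\<^bsub>N\<^esub> y)" if "x \<in> carrier N" "y \<in> carrier N" for x y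
    unfolding Q_def using add[of "s (\<pi> x)" x "s (\<pi> y)" y] s that by simp
  have smult_Q: "r \<odot>\<^bsub>Q\<^esub> \<pi> x = \<pi> (r \<odot>\<^bsub>N\<^esub> x)" if "r \<in> carrier R" "x \<in> carrier N" for r x
    unfolding Q_def using smult[of r "s (\<pi> x)" x] s that by simp
  have cQ: "carrier Q = \<pi> ` carrier N" and zQ: "\<zero>\<^bsub>Q\<^esub> = \<pi> \<zero>\<^bsub>N\<^esub>" unfolding Q_def by auto
  have "abelian_group Q"
  proof (rule abelian_groupI)
    fix x assume "x \<in> carrier Q"
    then obtain a where a: "a \<in> carrier N" "x = \<pi> a" unfolding cQ by blast
    then show "\<exists>y\<in>carrier Q. y \<oplus>\<^bsub>Q\<^esub> x = \<zero>\<^bsub>Q\<^esub>"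
      by (intro bexI[of _ "\<pi> (\<ominus>\<^bsub>N\<^esub> a)"]) (auto simp: add_Q N.M.l_neg zQ cQ)
  qed (auto simp: cQ zQ add_Q N.M.a_ac)
  then have "right_module R Q"
    unfolding right_module_def right_module_axioms_def
    using N.R.ring_axioms
    by (auto simp: cQ smult_Q add_Q N.smult_closed N.smult_add_scalar N.smult_add N.smult_assoc N.smult_one)
  moreover have "lin R N Q \<pi>" by (rule linI) (auto simp: cQ add_Q smult_Q)
  ultimately show ?thesis using cQ by blast
qed

lemma ModR_iff: "M \<in> ModR R \<longleftrightarrow> right_module R M \<and> small TYPE('m) (carrier M)"
  for M :: "('r, 'm) module"
  unfolding ModR_def by auto

lemma ModR_module: "M \<in> ModR R \<Longrightarrow> right_module R M"
  unfolding ModR_def by auto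

lemma ModR_small: "M \<in> ModR R \<Longrightarrow> small TYPE('m) (carrier M)"
  for M :: "('r, 'm) module"
  unfolding ModR_def by auto

lemma ModR_sub: "M \<in> ModR R \<Longrightarrow> submod R M P \<Longrightarrow> sub M P \<in> ModR R"
  for M :: "('r, 'm) module"
  unfolding ModR_iff using right_module_sub submodD(1) small_subset by force

text \<open>\<open>N\<close> may have any carrier type, but the quotient has to live on
  \<open>'m\<close>: a coset is named by the image under \<open>\<iota>\<close> of a chosen
  representative, and \<open>image_module\<close> supplies the structure.\<close>

lemma quotient_exists:
  fixes N :: "('r, 'a) module"
  assumes N: "right_module R N" and P: "submod R N P" and small: "small TYPE('m) (carrier N)"
  shows "\<exists>Q \<in> (ModR R :: ('r, 'm) module set). \<exists>\<pi>. lin R N Q \<pi> \<and> \<pi> ` carrier N = carrier Q \<and>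
     (\<forall>x\<in>carrier N. \<pi> x = \<zero>\<^bsub>Q\<^esub> \<longleftrightarrow> x \<in> P)"
proof -
  interpret N: right_module R N by fact
  note SP = submodD[OF P]
  obtain \<iota> :: "'a \<Rightarrow> 'm" where \<iota>: "inj_on \<iota> (carrier N)" using small_imp_inj small by blast
  \<comment> \<open>\<open>SOME\<close> depends only on its predicate, and elements of one coset
    define the same predicate; hence they share a representative.\<close>
  define rep where "rep x = (SOME y. y \<in> carrier N \<and> y \<ominus>\<^bsub>N\<^esub> x \<in> P)" for x
  have rep: "rep x \<in> carrier N" "rep x \<ominus>\<^bsub>N\<^esub> x \<in> P" if "x \<in> carrier N" for x
    using someI[of "\<lambda>y. y \<in> carrier N \<and> y \<ominus>\<^bsub>N\<^esub> x \<in> P" x] that SP(2)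
    unfolding rep_def by (auto simp: N.diff_zero_iff N.M.minus_eq N.M.r_neg)
  have cong: "rep x = rep y \<longleftrightarrow> x \<ominus>\<^bsub>N\<^esub> y \<in> P" if xy: "x \<in> carrier N" "y \<in> carrier N" for x y
  proof
    assume eq: "rep x = rep y"
    have "x \<ominus>\<^bsub>N\<^esub> y = (rep y \<ominus>\<^bsub>N\<^esub> y) \<ominus>\<^bsub>N\<^esub> (rep x \<ominus>\<^bsub>N\<^esub> x)"
      using N.diff_diff_cancel[OF xy rep(1)[OF xy(2)]] eq by simp
    then show "x \<ominus>\<^bsub>N\<^esub> y \<in> P" using N.submod_diff[OF P] rep xy by metis
  next
    assume d: "x \<ominus>\<^bsub>N\<^esub> y \<in> P"
    have "z \<ominus>\<^bsub>N\<^esub> x \<in> P \<longleftrightarrow> z \<ominus>\<^bsub>N\<^esub> y \<in> P" if z: "z \<in> carrier N" for z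
    proof -
      have 1: "z \<ominus>\<^bsub>N\<^esub> y = (z \<ominus>\<^bsub>N\<^esub> x) \<oplus>\<^bsub>N\<^esub> (x \<ominus>\<^bsub>N\<^esub> y)"
        using xy z by (simp add: N.M.minus_eq N.M.a_assoc N.M.r_neg1)
      have 2: "z \<ominus>\<^bsub>N\<^esub> x = (z \<ominus>\<^bsub>N\<^esub> y) \<ominus>\<^bsub>N\<^esub> (x \<ominus>\<^bsub>N\<^esub> y)"
        unfolding 1 using xy z by (simp add: N.add_diff_cancel)
      show ?thesis using 1 2 d SP(3) N.submod_diff[OF P] by metis
    qed
    then show "rep x = rep y" unfolding rep_def by (metis (no_types, lifting))
  qed
  define \<pi> where "\<pi> x = \<iota> (rep x)" for x
  have \<pi>: "\<pi> x = \<pi> y \<longleftrightarrow> x \<ominus>\<^bsub>N\<^esub> y \<in> P" if "x \<in> carrier N" "y \<in> carrier N" for x y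
    unfolding \<pi>_def using cong[OF that] inj_on_eq_iff[OF \<iota> rep(1)[OF that(1)] rep(1)[OF that(2)]] by simp
  have "\<exists>Q. right_module R Q \<and> carrier Q = \<pi> ` carrier N \<and> lin R N Q \<pi>"
  proof (rule image_module[OF N])
    fix x x' y y' assume *: "x \<in> carrier N" "x' \<in> carrier N" "y \<in> carrier N" "y' \<in> carrier N"
      "\<pi> x = \<pi> x'" "\<pi> y = \<pi> y'"
    then have "(x \<oplus>\<^bsub>N\<^esub> y) \<ominus>\<^bsub>N\<^esub> (x' \<oplus>\<^bsub>N\<^esub> y') \<in> P" using \<pi> SP(3) by (simp add: N.diff_diff_eq)
    then show "\<pi> (x \<oplus>\<^bsub>N\<^esub> y) = \<pi> (x' \<oplus>\<^bsub>N\<^esub> y')" using * \<pi> by simp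
  next
    fix r x x' assume *: "r \<in> carrier R" "x \<in> carrier N" "x' \<in> carrier N" "\<pi> x = \<pi> x'"
    then have "r \<odot>\<^bsub>N\<^esub> x \<ominus>\<^bsub>N\<^esub> r \<odot>\<^bsub>N\<^esub> x' \<in> P" using \<pi> SP(4) by (simp add: N.smult_diff[symmetric])
    then show "\<pi> (r \<odot>\<^bsub>N\<^esub> x) = \<pi> (r \<odot>\<^bsub>N\<^esub> x')" using * \<pi> N.smult_closed by simp
  qed
  then obtain Q where Q: "right_module R Q" "carrier Q = \<pi> ` carrier N" "lin R N Q \<pi>" by blast
  have "small TYPE('m) (carrier Q)" unfolding Q(2) using small by (rule small_image)
  moreover have "\<pi> x = \<zero>\<^bsub>Q\<^esub> \<longleftrightarrow> x \<in> P" if "x \<in> carrier N" for x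
    using \<pi>[OF that, of "\<zero>\<^bsub>N\<^esub>"] lin_zero[OF N Q(1,3)] that by (simp add: N.diff_zero)
  ultimately show ?thesis using Q by (intro bexI[of _ Q] exI[of _ \<pi>]) (auto simp: ModR_iff)
qed

text \<open>The quotient by the zero submodule is a copy of \<open>N\<close> on \<open>'m\<close>.
  Modules built on other carrier types, such as free modules and products, enter \<open>ModR\<close>
  this way.\<close>

lemma realize:
  fixes N :: "('r, 'a) module"
  assumes "right_module R N" "small TYPE('m) (carrier N)"
  shows "\<exists>Q \<in> (ModR R :: ('r, 'm) module set). \<exists>\<pi>. lin R N Q \<pi> \<and> bij_betw \<pi> (carrier N) (carrier Q)"
  using quotient_exists[OF assms(1) submod_zero[OF assms(1)] assms(2)] lin_inj_on_iff[OF assms(1)]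
  unfolding bij_betw_def by (meson ModR_module singletonD)

lemma lin_inv:
  assumes "right_module R M" "right_module R N" "lin R M N f" "bij_betw f (carrier M) (carrier N)"
  shows "lin R N M (inv_into (carrier M) f)"
proof -
  interpret M: right_module R M by fact
  have b: "f ` carrier M = carrier N" "inj_on f (carrier M)" using assms(4) by (auto simp: bij_betw_def)
  let ?g = "inv_into (carrier M) f"
  have g: "?g (f x) = x" if "x \<in> carrier M" for x using that b by simp
  show ?thesis
  proof (rule linI)
    show "?g x \<in> carrier M" if "x \<in> carrier N" for x using that b by (metis inv_into_into)
  next
    fix x y assume "x \<in> carrier N" "y \<in> carrier N"
    then obtain a c where ac: "x = f a" "y = f c" "a \<in> carrier M" "c \<in> carrier M" using b by blast
    have "x \<oplus>\<^bsub>N\<^esub> y = f (a \<oplus>\<^bsub>M\<^esub> c)" using lin_add[OF assms(3)] ac by simp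
    then show "?g (x \<oplus>\<^bsub>N\<^esub> y) = ?g x \<oplus>\<^bsub>M\<^esub> ?g y" using g ac by simp
  next
    fix r x assume r: "r \<in> carrier R" "x \<in> carrier N"
    then obtain a where a: "x = f a" "a \<in> carrier M" using b by blast
    have "r \<odot>\<^bsub>N\<^esub> x = f (r \<odot>\<^bsub>M\<^esub> a)" using lin_smult[OF assms(3)] a r by simp
    then show "?g (r \<odot>\<^bsub>N\<^esub> x) = r \<odot>\<^bsub>M\<^esub> ?g x" using g a r M.smult_closed by simp
  qed
qed

definition mutually_inverse :: "('r, 'x) ring_scheme \<Rightarrow> ('r, 'a) module \<Rightarrow> ('r, 'b) module \<Rightarrow> ('a \<Rightarrow> 'b) \<Rightarrow> ('b \<Rightarrow> 'a) \<Rightarrow> bool" where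
  "mutually_inverse R M N \<phi> \<psi> \<longleftrightarrow> lin R M N \<phi> \<and> lin R N M \<psi> \<and>
     (\<forall>x\<in>carrier M. \<psi> (\<phi> x) = x) \<and> (\<forall>y\<in>carrier N. \<phi> (\<psi> y) = y)"

lemma mutually_inverseD:
  assumes "mutually_inverse R M N \<phi> \<psi>"
  shows "lin R M N \<phi>" "lin R N M \<psi>" "\<And>x. x \<in> carrier M \<Longrightarrow> \<psi> (\<phi> x) = x" "\<And>y. y \<in> carrier N \<Longrightarrow> \<phi> (\<psi> y) = y"
  using assms unfolding mutually_inverse_def by auto

lemma realize_inverse:
  fixes N :: "('r, 'a) module"
  assumes m: "right_module R N" and small: "small TYPE('m) (carrier N)"
  shows "\<exists>D\<in>(ModR R :: ('r, 'm) module set). \<exists>\<phi> \<psi>. mutually_inverse R N D \<phi> \<psi>"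
proof -
  obtain D :: "('r, 'm) module" and \<phi> where D: "D \<in> ModR R" "lin R N D \<phi>" "bij_betw \<phi> (carrier N) (carrier D)"
    using realize[OF m small] by blast
  have "mutually_inverse R N D \<phi> (inv_into (carrier N) \<phi>)"
    unfolding mutually_inverse_def
    using D(2) lin_inv[OF m ModR_module[OF D(1)] D(2,3)] D(3) by (simp add: bij_betw_def f_inv_into_f)
  then show ?thesis using D(1) by blast
qed

lemma lin_factor_surj:
  assumes M: "right_module R M" and N: "right_module R N" and T: "right_module R T"
    and p: "lin R M N p" "p ` carrier M = carrier N" and u: "lin R M T u"
    and ker: "\<And>x. \<lbrakk>x \<in> carrier M; p x = \<zero>\<^bsub>N\<^esub>\<rbrakk> \<Longrightarrow> u x = \<zero>\<^bsub>T\<^esub>"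
  shows "\<exists>w. lin R N T w \<and> (\<forall>x\<in>carrier M. w (p x) = u x)"
proof -
  interpret M: right_module R M by fact
  interpret N: right_module R N by fact
  interpret T: right_module R T by fact
  have wd: "u x = u y" if "x \<in> carrier M" "y \<in> carrier M" "p x = p y" for x y
  proof -
    have "p (x \<ominus>\<^bsub>M\<^esub> y) = \<zero>\<^bsub>N\<^esub>"
      using that lin_diff[OF M N p(1)] lin_closed[OF p(1)] by (simp add: N.diff_zero_iff)
    then have "u x \<ominus>\<^bsub>T\<^esub> u y = \<zero>\<^bsub>T\<^esub>" using ker lin_diff[OF M T u] that by (metis M.M.minus_closed)
    then show ?thesis using lin_closed[OF u] that T.diff_zero_iff by metis
  qed
  define w where "w y = u (inv_into (carrier M) p y)" for y
  have w: "w (p x) = u x" if "x \<in> carrier M" for x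
    unfolding w_def using that by (intro wd) (auto intro: inv_into_into f_inv_into_f)
  have "lin R N T w"
  proof (rule linI)
    show "w x \<in> carrier T" if "x \<in> carrier N" for x
      using that lin_closed[OF u] inv_into_into[of x p "carrier M"] unfolding w_def p(2) by blast
  next
    fix x y assume "x \<in> carrier N" "y \<in> carrier N"
    then obtain a c where ac: "x = p a" "y = p c" "a \<in> carrier M" "c \<in> carrier M" using p(2) by blast
    then show "w (x \<oplus>\<^bsub>N\<^esub> y) = w x \<oplus>\<^bsub>T\<^esub> w y"
      using w[of "a \<oplus>\<^bsub>M\<^esub> c"] by (simp add: lin_add[OF p(1)] w lin_add[OF u])
  next
    fix r x assume r: "r \<in> carrier R" "x \<in> carrier N"
    then obtain a where a: "x = p a" "a \<in> carrier M" using p(2) by blast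
    then show "w (r \<odot>\<^bsub>N\<^esub> x) = r \<odot>\<^bsub>T\<^esub> w x"
      using r w[of "r \<odot>\<^bsub>M\<^esub> a"] by (simp add: lin_smult[OF p(1)] w lin_smult[OF u] M.smult_closed)
  qed
  then show ?thesis using w by blast
qed

lemma lin_factor_inj:
  assumes A: "right_module R A" and B: "right_module R B" and M: "right_module R M"
    and i: "lin R A B i" "inj_on i (carrier A)" and u: "lin R M B u"
    and im: "\<And>x. x \<in> carrier M \<Longrightarrow> u x \<in> i ` carrier A"
  shows "\<exists>w. lin R M A w \<and> (\<forall>x\<in>carrier M. i (w x) = u x)"
proof -
  interpret A: right_module R A by fact
  define w where "w x = inv_into (carrier A) i (u x)" for x
  have w: "w x \<in> carrier A" "i (w x) = u x" if "x \<in> carrier M" for x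
    unfolding w_def using im[OF that] by (auto intro: inv_into_into f_inv_into_f)
  have weq: "w x = a" if "x \<in> carrier M" "a \<in> carrier A" "u x = i a" for x a
    unfolding w_def using that i(2) by simp
  have "lin R M A w"
  proof (rule linI)
    interpret M: right_module R M by fact
    show "w x \<in> carrier A" if "x \<in> carrier M" for x using w that by simp
    show "w (x \<oplus>\<^bsub>M\<^esub> y) = w x \<oplus>\<^bsub>A\<^esub> w y" if "x \<in> carrier M" "y \<in> carrier M" for x y
      by (rule weq) (use that w in \<open>auto simp: lin_add[OF u] lin_add[OF i(1)]\<close>)
    show "w (r \<odot>\<^bsub>M\<^esub> x) = r \<odot>\<^bsub>A\<^esub> w x" if "r \<in> carrier R" "x \<in> carrier M" for r x
      by (rule weq) (use that w in \<open>auto simp: lin_smult[OF u] lin_smult[OF i(1)] A.smult_closed M.smult_closed\<close>)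
  qed
  then show ?thesis using w by blast
qed

section \<open>Products, direct sums and free modules\<close>

definition prodm :: "'i set \<Rightarrow> ('i \<Rightarrow> ('r, 'a) module) \<Rightarrow> ('r, 'i \<Rightarrow> 'a) module" where
  "prodm I N =
     \<lparr>carrier = PiE I (\<lambda>i. carrier (N i)),
      mult = undefined, one = undefined,
      zero = (\<lambda>i\<in>I. \<zero>\<^bsub>N i\<^esub>),
      add = (\<lambda>v w. \<lambda>i\<in>I. v i \<oplus>\<^bsub>N i\<^esub> w i),
      smult = (\<lambda>r v. \<lambda>i\<in>I. r \<odot>\<^bsub>N i\<^esub> v i)\<rparr>"

definition supp :: "'i set \<Rightarrow> ('i \<Rightarrow> ('r, 'a) module) \<Rightarrow> ('i \<Rightarrow> 'a) \<Rightarrow> 'i set" where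
  "supp I N x = {i \<in> I. x i \<noteq> \<zero>\<^bsub>N i\<^esub>}"

definition dsum :: "'i set \<Rightarrow> ('i \<Rightarrow> ('r, 'a) module) \<Rightarrow> ('r, 'i \<Rightarrow> 'a) module" where
  "dsum I N = sub (prodm I N) {x \<in> carrier (prodm I N). finite (supp I N x)}"

definition dsum_in :: "'i set \<Rightarrow> ('i \<Rightarrow> ('r, 'a) module) \<Rightarrow> 'i \<Rightarrow> 'a \<Rightarrow> 'i \<Rightarrow> 'a" where
  "dsum_in I N i a = (\<lambda>j\<in>I. if j = i then a else \<zero>\<^bsub>N j\<^esub>)"

definition dsum_lift :: "'i set \<Rightarrow> ('i \<Rightarrow> ('r, 'a) module) \<Rightarrow> ('r, 'b) module \<Rightarrow> ('i \<Rightarrow> 'a \<Rightarrow> 'b) \<Rightarrow> ('i \<Rightarrow> 'a) \<Rightarrow> 'b" where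
  "dsum_lift I N T u x = finsum T (\<lambda>i. u i (x i)) (supp I N x)"

lemma prodm_simps:
  "carrier (prodm I N) = PiE I (\<lambda>i. carrier (N i))"
  "\<zero>\<^bsub>prodm I N\<^esub> = (\<lambda>i\<in>I. \<zero>\<^bsub>N i\<^esub>)"
  "v \<oplus>\<^bsub>prodm I N\<^esub> w = (\<lambda>i\<in>I. v i \<oplus>\<^bsub>N i\<^esub> w i)"
  "r \<odot>\<^bsub>prodm I N\<^esub> v = (\<lambda>i\<in>I. r \<odot>\<^bsub>N i\<^esub> v i)"
  unfolding prodm_def by auto

lemma right_module_prodm:
  assumes R: "ring R" and N: "\<And>i. i \<in> I \<Longrightarrow> right_module R (N i)"
  shows "right_module R (prodm I N)"
proof -
  have ab: "abelian_group (N i)" if "i \<in> I" for i using N[OF that] by (rule right_module_abelian_group)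
  note am = abelian_group.axioms(1)[OF ab]
  have "abelian_group (prodm I N)"
  proof (rule abelian_groupI)
    fix x assume x: "x \<in> carrier (prodm I N)"
    have "(\<lambda>i\<in>I. \<ominus>\<^bsub>N i\<^esub> x i) \<in> carrier (prodm I N)"
      using x abelian_group.a_inv_closed[OF ab] by (auto simp: prodm_simps PiE_iff)
    moreover have "(\<lambda>i\<in>I. \<ominus>\<^bsub>N i\<^esub> x i) \<oplus>\<^bsub>prodm I N\<^esub> x = \<zero>\<^bsub>prodm I N\<^esub>"
      using x abelian_group.l_neg[OF ab] by (auto simp: prodm_simps PiE_iff fun_eq_iff restrict_def)
    ultimately show "\<exists>y\<in>carrier (prodm I N). y \<oplus>\<^bsub>prodm I N\<^esub> x = \<zero>\<^bsub>prodm I N\<^esub>" by blast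
  qed (auto simp: prodm_simps PiE_iff fun_eq_iff extensional_def abelian_monoid.a_closed[OF am]
      abelian_monoid.zero_closed[OF am] abelian_monoid.a_assoc[OF am] abelian_monoid.a_comm[OF am]
      abelian_monoid.l_zero[OF am] abelian_monoid.r_zero[OF am] abelian_monoid.a_lcomm[OF am] restrict_def)
  then show ?thesis
    using R
    by (auto intro!: right_module.intro right_module_axioms.intro
        simp: prodm_simps PiE_iff fun_eq_iff extensional_def restrict_def
        right_module.smult_closed[OF N] right_module.smult_add_scalar[OF N] right_module.smult_add[OF N]
        right_module.smult_assoc[OF N] right_module.smult_one[OF N])
qed

lemma prodm_proj: "i \<in> I \<Longrightarrow> lin R (prodm I N) (N i) (\<lambda>x. x i)"
  by (rule linI) (auto simp: prodm_simps PiE_iff)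

lemma prodm_lift:
  assumes "\<And>i. i \<in> I \<Longrightarrow> lin R M (N i) (u i)" "right_module R M"
  shows "lin R M (prodm I N) (\<lambda>x. \<lambda>i\<in>I. u i x)"
  by (rule linI) (auto simp: prodm_simps PiE_iff fun_eq_iff restrict_def extensional_def
      lin_closed[OF assms(1)] lin_add[OF assms(1)] lin_smult[OF assms(1)])

lemma dsum_simps:
  "carrier (dsum I N) = {x \<in> PiE I (\<lambda>i. carrier (N i)). finite (supp I N x)}"
  "\<zero>\<^bsub>dsum I N\<^esub> = (\<lambda>i\<in>I. \<zero>\<^bsub>N i\<^esub>)"
  "v \<oplus>\<^bsub>dsum I N\<^esub> w = (\<lambda>i\<in>I. v i \<oplus>\<^bsub>N i\<^esub> w i)"
  "r \<odot>\<^bsub>dsum I N\<^esub> v = (\<lambda>i\<in>I. r \<odot>\<^bsub>N i\<^esub> v i)"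
  unfolding dsum_def by (auto simp: prodm_simps)

lemma submod_dsum:
  assumes R: "ring R" and N: "\<And>i. i \<in> I \<Longrightarrow> right_module R (N i)"
  shows "submod R (prodm I N) {x \<in> carrier (prodm I N). finite (supp I N x)}"
proof -
  interpret P: right_module R "prodm I N" by (rule right_module_prodm) fact+
  note am = abelian_group.axioms(1)[OF right_module_abelian_group[OF N]]
  show ?thesis
  proof (rule submodI)
    show "\<zero>\<^bsub>prodm I N\<^esub> \<in> {x \<in> carrier (prodm I N). finite (supp I N x)}"
      using P.M.zero_closed by (auto simp: supp_def prodm_simps)
  next
    fix x y assume "x \<in> {x \<in> carrier (prodm I N). finite (supp I N x)}"
      "y \<in> {x \<in> carrier (prodm I N). finite (supp I N x)}"
    moreover have "supp I N (x \<oplus>\<^bsub>prodm I N\<^esub> y) \<subseteq> supp I N x \<union> supp I N y"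
      using abelian_monoid.l_zero[OF am] abelian_monoid.zero_closed[OF am] by (auto simp: supp_def prodm_simps)
    ultimately show "x \<oplus>\<^bsub>prodm I N\<^esub> y \<in> {x \<in> carrier (prodm I N). finite (supp I N x)}"
      by (auto dest: finite_subset)
  next
    fix r x assume "r \<in> carrier R" "x \<in> {x \<in> carrier (prodm I N). finite (supp I N x)}"
    moreover from this have "supp I N (r \<odot>\<^bsub>prodm I N\<^esub> x) \<subseteq> supp I N x"
      using right_module.smult_zero[OF N] by (auto simp: supp_def prodm_simps)
    ultimately show "r \<odot>\<^bsub>prodm I N\<^esub> x \<in> {x \<in> carrier (prodm I N). finite (supp I N x)}"
      using P.smult_closed by (auto dest: finite_subset)
  qed auto
qed

lemma right_module_dsum:
  assumes "ring R" "\<And>i. i \<in> I \<Longrightarrow> right_module R (N i)"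
  shows "right_module R (dsum I N)"
  unfolding dsum_def by (intro right_module_sub right_module_prodm submod_dsum assms)

lemma dsum_proj: "i \<in> I \<Longrightarrow> lin R (dsum I N) (N i) (\<lambda>x. x i)"
  by (rule linI) (auto simp: dsum_simps PiE_iff)

lemma dsum_in_lin:
  assumes N: "\<And>i. i \<in> I \<Longrightarrow> right_module R (N i)" and i: "i \<in> I"
  shows "lin R (N i) (dsum I N) (dsum_in I N i)"
proof -
  note am = abelian_group.axioms(1)[OF right_module_abelian_group[OF N]]
  have "finite (supp I N (dsum_in I N i a))" for a
    by (rule finite_subset[of _ "{i}"]) (auto simp: supp_def dsum_in_def)
  then show ?thesis
    by (intro linI) (auto simp: dsum_simps dsum_in_def PiE_iff fun_eq_iff restrict_def extensional_def i
        abelian_monoid.zero_closed[OF am] abelian_monoid.l_zero[OF am] right_module.smult_zero[OF N])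
qed

text \<open>Stated for additive maps, so that it covers multiplication by a scalar.\<close>

lemma additive_finsum:
  assumes G: "abelian_monoid G" and H: "abelian_monoid H" and F: "finite F"
    and c: "\<And>x. x \<in> carrier G \<Longrightarrow> h x \<in> carrier H" and z: "h \<zero>\<^bsub>G\<^esub> = \<zero>\<^bsub>H\<^esub>"
    and add: "\<And>x y. \<lbrakk>x \<in> carrier G; y \<in> carrier G\<rbrakk> \<Longrightarrow> h (x \<oplus>\<^bsub>G\<^esub> y) = h x \<oplus>\<^bsub>H\<^esub> h y"
    and f: "f \<in> F \<rightarrow> carrier G"
  shows "h (finsum G f F) = finsum H (\<lambda>i. h (f i)) F"
proof -
  interpret G: abelian_monoid G by fact
  interpret H: abelian_monoid H by fact
  show ?thesis using F f
  proof (induction rule: finite_induct)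
    case empty
    show ?case by (simp add: z)
  next
    case (insert i F)
    then have "f \<in> F \<rightarrow> carrier G" "f i \<in> carrier G" by auto
    then show ?case using insert by (simp add: add c Pi_iff)
  qed
qed

text \<open>Sums over different supports become comparable after padding with zero terms to a common
  finite set; the linearity of \<open>dsum_lift\<close> rests on this.\<close>

lemma dsum_lift_superset:
  assumes T: "right_module R T" and N: "\<And>i. i \<in> I \<Longrightarrow> right_module R (N i)"
    and u: "\<And>i. i \<in> I \<Longrightarrow> lin R (N i) T (u i)"
    and x: "x \<in> carrier (dsum I N)" and F: "finite F" "supp I N x \<subseteq> F" "F \<subseteq> I"
  shows "dsum_lift I N T u x = finsum T (\<lambda>i. u i (x i)) F"
proof -
  interpret T: right_module R T by fact
  show ?thesis unfolding dsum_lift_def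
  proof (rule T.M.add.finprod_mono_neutral_cong_left[OF F(1,2)])
    show "u i (x i) = \<zero>\<^bsub>T\<^esub>" if "i \<in> F - supp I N x" for i
      using that F lin_zero[OF N T u] by (auto simp: supp_def)
    show "(\<lambda>i. u i (x i)) \<in> F \<rightarrow> carrier T"
      using F x lin_closed[OF u] by (auto simp: dsum_simps PiE_iff subset_iff)
  qed auto
qed

lemma dsum_lift_lin:
  assumes R: "ring R" and T: "right_module R T" and N: "\<And>i. i \<in> I \<Longrightarrow> right_module R (N i)"
    and u: "\<And>i. i \<in> I \<Longrightarrow> lin R (N i) T (u i)"
  shows "lin R (dsum I N) T (dsum_lift I N T u)"
proof -
  interpret T: right_module R T by fact
  interpret D: right_module R "dsum I N" by (rule right_module_dsum) fact+
  note sup = dsum_lift_superset[OF T N u]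
  have cl: "u i (x i) \<in> carrier T" if "x \<in> carrier (dsum I N)" "i \<in> I" for x i
    using that lin_closed[OF u] by (auto simp: dsum_simps PiE_iff)
  have fin: "finite (supp I N x)" if "x \<in> carrier (dsum I N)" for x using that by (simp add: dsum_simps)
  have sI: "supp I N x \<subseteq> I" for x by (auto simp: supp_def)
  show ?thesis
  proof (rule linI)
    fix x assume x: "x \<in> carrier (dsum I N)"
    show "dsum_lift I N T u x \<in> carrier T"
      unfolding dsum_lift_def using cl[OF x] sI by (intro T.M.finsum_closed) auto
  next
    fix x y assume x: "x \<in> carrier (dsum I N)" and y: "y \<in> carrier (dsum I N)"
    let ?F = "supp I N x \<union> supp I N y \<union> supp I N (x \<oplus>\<^bsub>dsum I N\<^esub> y)"
    have F: "finite ?F" "?F \<subseteq> I" using fin x y D.M.a_closed sI by auto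
    have "dsum_lift I N T u (x \<oplus>\<^bsub>dsum I N\<^esub> y) = finsum T (\<lambda>i. u i ((x \<oplus>\<^bsub>dsum I N\<^esub> y) i)) ?F"
      using F x y D.M.a_closed by (intro sup) auto
    also have "\<dots> = finsum T (\<lambda>i. u i (x i) \<oplus>\<^bsub>T\<^esub> u i (y i)) ?F"
    proof (rule T.M.finsum_cong'[OF refl])
      show "(\<lambda>i. u i (x i) \<oplus>\<^bsub>T\<^esub> u i (y i)) \<in> ?F \<rightarrow> carrier T"
        using F(2) cl[OF x] cl[OF y] by auto
      fix i assume "i \<in> ?F"
      then have "i \<in> I" using F(2) by auto
      then show "u i ((x \<oplus>\<^bsub>dsum I N\<^esub> y) i) = u i (x i) \<oplus>\<^bsub>T\<^esub> u i (y i)"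
        using x y lin_add[OF u] by (auto simp: dsum_simps PiE_iff)
    qed
    also have "\<dots> = finsum T (\<lambda>i. u i (x i)) ?F \<oplus>\<^bsub>T\<^esub> finsum T (\<lambda>i. u i (y i)) ?F"
      using F(2) cl[OF x] cl[OF y] by (intro T.M.finsum_addf) auto
    also have "finsum T (\<lambda>i. u i (x i)) ?F = dsum_lift I N T u x"
      using F x by (intro sup[symmetric]) auto
    also have "finsum T (\<lambda>i. u i (y i)) ?F = dsum_lift I N T u y"
      using F y by (intro sup[symmetric]) auto
    finally show "dsum_lift I N T u (x \<oplus>\<^bsub>dsum I N\<^esub> y) = dsum_lift I N T u x \<oplus>\<^bsub>T\<^esub> dsum_lift I N T u y" .
  next
    fix r x assume r: "r \<in> carrier R" and x: "x \<in> carrier (dsum I N)"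
    let ?F = "supp I N x \<union> supp I N (r \<odot>\<^bsub>dsum I N\<^esub> x)"
    have F: "finite ?F" "?F \<subseteq> I" using fin x r D.smult_closed sI by auto
    have "dsum_lift I N T u (r \<odot>\<^bsub>dsum I N\<^esub> x) = finsum T (\<lambda>i. u i ((r \<odot>\<^bsub>dsum I N\<^esub> x) i)) ?F"
      using F x r D.smult_closed by (intro sup) auto
    also have "\<dots> = finsum T (\<lambda>i. r \<odot>\<^bsub>T\<^esub> u i (x i)) ?F"
    proof (rule T.M.finsum_cong'[OF refl])
      show "(\<lambda>i. r \<odot>\<^bsub>T\<^esub> u i (x i)) \<in> ?F \<rightarrow> carrier T"
        using F(2) cl[OF x] r T.smult_closed by auto
      fix i assume "i \<in> ?F"
      then have "i \<in> I" using F(2) by auto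
      then show "u i ((r \<odot>\<^bsub>dsum I N\<^esub> x) i) = r \<odot>\<^bsub>T\<^esub> u i (x i)"
        using x r lin_smult[OF u] by (auto simp: dsum_simps PiE_iff)
    qed
    also have "\<dots> = r \<odot>\<^bsub>T\<^esub> finsum T (\<lambda>i. u i (x i)) ?F"
      using F cl[OF x] r
      by (intro additive_finsum[symmetric] T.M.abelian_monoid_axioms T.smult_closed T.smult_zero T.smult_add) auto
    also have "finsum T (\<lambda>i. u i (x i)) ?F = dsum_lift I N T u x"
      using F x by (intro sup[symmetric]) auto
    finally show "dsum_lift I N T u (r \<odot>\<^bsub>dsum I N\<^esub> x) = r \<odot>\<^bsub>T\<^esub> dsum_lift I N T u x" .
  qed
qed

lemma dsum_lift_in:
  assumes T: "right_module R T" and N: "\<And>i. i \<in> I \<Longrightarrow> right_module R (N i)"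
    and u: "\<And>i. i \<in> I \<Longrightarrow> lin R (N i) T (u i)" and i: "i \<in> I" and a: "a \<in> carrier (N i)"
  shows "dsum_lift I N T u (dsum_in I N i a) = u i a"
proof -
  interpret T: right_module R T by fact
  have "dsum_lift I N T u (dsum_in I N i a) = finsum T (\<lambda>j. u j (dsum_in I N i a j)) {i}"
    using lin_closed[OF dsum_in_lin[where N = N and I = I, OF N i] a] i
    by (intro dsum_lift_superset[OF T N u]) (auto simp: supp_def dsum_in_def)
  then show ?thesis using lin_closed[OF u[OF i] a] i by (simp add: dsum_in_def)
qed

lemma dsum_unique:
  assumes R: "ring R" and T: "right_module R T" and N: "\<And>i. i \<in> I \<Longrightarrow> right_module R (N i)"
    and f: "lin R (dsum I N) T f" and g: "lin R (dsum I N) T g"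
    and eq: "\<And>i a. i \<in> I \<Longrightarrow> a \<in> carrier (N i) \<Longrightarrow> f (dsum_in I N i a) = g (dsum_in I N i a)"
    and x: "x \<in> carrier (dsum I N)"
  shows "f x = g x"
proof -
  interpret D: right_module R "dsum I N" by (rule right_module_dsum) fact+
  note am = abelian_group.axioms(1)[OF right_module_abelian_group[OF N]]
  have "\<forall>x\<in>carrier (dsum I N). supp I N x \<subseteq> F \<longrightarrow> f x = g x" if "finite F" for F
    using that
  proof (induction rule: finite_induct)
    case empty
    have "x = \<zero>\<^bsub>dsum I N\<^esub>" if "x \<in> carrier (dsum I N)" "supp I N x \<subseteq> {}" for x
      using that by (auto simp: dsum_simps supp_def PiE_iff extensional_def fun_eq_iff restrict_def)
    then show ?case using lin_zero[OF D.right_module_axioms T f] lin_zero[OF D.right_module_axioms T g] by metis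
  next
    case (insert i F)
    show ?case
    proof (intro ballI impI)
      fix x assume x: "x \<in> carrier (dsum I N)" "supp I N x \<subseteq> insert i F"
      show "f x = g x"
      proof (cases "i \<in> I")
        case False
        then have "supp I N x \<subseteq> F" using x(2) by (auto simp: supp_def)
        then show ?thesis using insert x by blast
      next
        case True
        \<comment> \<open>\<open>y\<close> is \<open>x\<close> with the coordinate at
          \<open>i\<close> erased: its support lies in \<open>F\<close>, and \<open>x\<close> is
          \<open>y\<close> plus an element of a single summand.\<close>
        define y where "y = (\<lambda>j\<in>I. if j = i then \<zero>\<^bsub>N j\<^esub> else x j)"
        have "supp I N y \<subseteq> supp I N x" by (auto simp: supp_def y_def)
        then have y: "y \<in> carrier (dsum I N)"
          using x finite_subset abelian_monoid.zero_closed[OF am]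
          by (auto simp: dsum_simps y_def PiE_iff)
        have "supp I N y \<subseteq> F" using x(2) by (auto simp: supp_def y_def)
        then have fy: "f y = g y" using insert y by blast
        have xi: "x i \<in> carrier (N i)" using x True by (auto simp: dsum_simps)
        have ix: "dsum_in I N i (x i) \<in> carrier (dsum I N)"
          using lin_closed[OF dsum_in_lin[where N = N and I = I, OF N True] xi] .
        have "x = y \<oplus>\<^bsub>dsum I N\<^esub> dsum_in I N i (x i)"
          using x xi abelian_monoid.l_zero[OF am] abelian_monoid.r_zero[OF am]
          by (auto simp: dsum_simps y_def dsum_in_def PiE_iff extensional_def fun_eq_iff restrict_def)
        then show ?thesis
          using lin_add[OF f y ix] lin_add[OF g y ix] fy eq[OF True xi] by simp
      qed
    qed
  qed
  moreover have "finite (supp I N x)" using x by (simp add: dsum_simps)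
  ultimately show ?thesis using x by blast
qed

subsection \<open>Free modules\<close>

text \<open>The ring as a right module over itself, hence the scalar \<open>r\<close> as the
  right-hand factor.\<close>

definition regm :: "('r, 'x) ring_scheme \<Rightarrow> ('r, 'r) module" where
  "regm R = \<lparr>carrier = carrier R, mult = undefined, one = undefined, zero = \<zero>\<^bsub>R\<^esub>,
     add = (\<lambda>x y. x \<oplus>\<^bsub>R\<^esub> y), smult = (\<lambda>r x. x \<otimes>\<^bsub>R\<^esub> r)\<rparr>"

definition free :: "('r, 'x) ring_scheme \<Rightarrow> 'i set \<Rightarrow> ('r, 'i \<Rightarrow> 'r) module" where
  "free R I = dsum I (\<lambda>_. regm R)"

definition basis :: "('r, 'x) ring_scheme \<Rightarrow> 'i set \<Rightarrow> 'i \<Rightarrow> 'i \<Rightarrow> 'r" where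
  "basis R I i = dsum_in I (\<lambda>_. regm R) i \<one>\<^bsub>R\<^esub>"

lemma right_module_regm: assumes "ring R" shows "right_module R (regm R)"
proof -
  interpret R: ring R by fact
  have "abelian_group (regm R)"
  proof (rule abelian_groupI)
    fix x assume "x \<in> carrier (regm R)"
    then show "\<exists>y\<in>carrier (regm R). y \<oplus>\<^bsub>regm R\<^esub> x = \<zero>\<^bsub>regm R\<^esub>"
      by (intro bexI[of _ "\<ominus>\<^bsub>R\<^esub> x"]) (auto simp: regm_def R.l_neg)
  qed (auto simp: regm_def R.a_ac)
  then show ?thesis
    unfolding right_module_def right_module_axioms_def using assms
    by (auto simp: regm_def R.l_distr R.r_distr R.m_assoc)
qed

lemma right_module_free: "ring R \<Longrightarrow> right_module R (free R I)"
  unfolding free_def by (intro right_module_dsum right_module_regm)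

text \<open>Over a finite index set every function has finite support, so the free modules in the
  definition of \<open>finitely_presented\<close> are instances of \<open>free\<close>.\<close>

lemma free_module_eq: "free_module R n = free R {..<n}"
  unfolding free_module_def free_def dsum_def prodm_def regm_def supp_def by (auto simp: restrict_def)

lemma basis_closed: assumes "ring R" "i \<in> I" shows "basis R I i \<in> carrier (free R I)"
proof -
  interpret R: ring R by fact
  show ?thesis unfolding basis_def free_def
    by (rule lin_closed[OF dsum_in_lin[where N = "\<lambda>_. regm R", OF right_module_regm[OF assms(1)] assms(2)]])
      (simp add: regm_def)
qed

text \<open>Turns agreement on the basis into agreement on each summand, which is what
  \<open>dsum_unique\<close> asks for.\<close>

lemma dsum_in_eq_smult_basis:
  assumes "ring R" "i \<in> I" "r \<in> carrier R"
  shows "dsum_in I (\<lambda>_. regm R) i r = r \<odot>\<^bsub>free R I\<^esub> basis R I i"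
proof -
  interpret R: ring R by fact
  show ?thesis
    unfolding free_def basis_def dsum_simps dsum_in_def using assms(2,3) by (auto simp: regm_def fun_eq_iff restrict_def)
qed

lemma free_lift:
  assumes R: "ring R" and T: "right_module R T" and c: "\<And>i. i \<in> I \<Longrightarrow> c i \<in> carrier T"
  shows "\<exists>w. lin R (free R I) T w \<and> (\<forall>i\<in>I. w (basis R I i) = c i)"
proof -
  interpret T: right_module R T by fact
  interpret R: ring R by fact
  define u where "u i r = r \<odot>\<^bsub>T\<^esub> c i" for i r
  have u: "lin R (regm R) T (u i)" if "i \<in> I" for i
    using c[OF that] by (intro linI) (auto simp: regm_def u_def T.smult_closed T.smult_add_scalar T.smult_assoc)
  have "lin R (free R I) T (dsum_lift I (\<lambda>_. regm R) T u)"
    unfolding free_def by (rule dsum_lift_lin[OF R T right_module_regm[OF R] u])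
  moreover have "dsum_lift I (\<lambda>_. regm R) T u (basis R I i) = c i" if "i \<in> I" for i
    using dsum_lift_in[where N = "\<lambda>_. regm R" and u = u and I = I, OF T right_module_regm[OF R] u that, of "\<one>\<^bsub>R\<^esub>"]
      c[OF that] by (simp add: basis_def u_def T.smult_one regm_def[of R])
  ultimately show ?thesis by blast
qed

lemma free_unique:
  assumes R: "ring R" and T: "right_module R T" and f: "lin R (free R I) T f" and g: "lin R (free R I) T g"
    and eq: "\<And>i. i \<in> I \<Longrightarrow> f (basis R I i) = g (basis R I i)" and x: "x \<in> carrier (free R I)"
  shows "f x = g x"
proof -
  have "f (dsum_in I (\<lambda>_. regm R) i r) = g (dsum_in I (\<lambda>_. regm R) i r)"
    if "i \<in> I" "r \<in> carrier (regm R)" for i r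
    using that eq dsum_in_eq_smult_basis[OF R that(1), of r]
      lin_smult[OF f _ basis_closed[OF R that(1)], of r] lin_smult[OF g _ basis_closed[OF R that(1)], of r]
    by (simp add: regm_def)
  then show ?thesis
    using dsum_unique[OF R T right_module_regm[OF R] f[unfolded free_def] g[unfolded free_def]] x
    unfolding free_def by blast
qed

lemma free_projective:
  assumes R: "ring R" and M: "right_module R M" and N: "right_module R N" and p: "lin R M N p" "p ` carrier M = carrier N"
    and h: "lin R (free R I) N h"
  shows "\<exists>g. lin R (free R I) M g \<and> (\<forall>x\<in>carrier (free R I). p (g x) = h x)"
proof -
  define c where "c i = inv_into (carrier M) p (h (basis R I i))" for i
  have c: "c i \<in> carrier M" "p (c i) = h (basis R I i)" if "i \<in> I" for i
    using lin_closed[OF h basis_closed[OF R that]] inv_into_into[of _ p "carrier M"]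
      f_inv_into_f[of _ p "carrier M"]
    unfolding c_def p(2) by auto
  obtain g where g: "lin R (free R I) M g" "\<forall>i\<in>I. g (basis R I i) = c i"
    using free_lift[OF R M, of I c] c(1) by blast
  have e: "p (g (basis R I i)) = h (basis R I i)" if "i \<in> I" for i using that g(2) c(2) by auto
  have "p (g x) = h x" if "x \<in> carrier (free R I)" for x
    by (rule free_unique[OF R N lin_comp[OF g(1) p(1)] h, OF e that])
  then show ?thesis using g by blast
qed

text \<open>A map into \<open>sub T P\<close> with the same values on the basis exists, and
  uniqueness identifies it with \<open>f\<close>; no linear combinations have to be written
  out.\<close>

lemma free_image_subset:
  assumes R: "ring R" and T: "right_module R T" and f: "lin R (free R I) T f" and P: "submod R T P"
    and b: "\<And>i. i \<in> I \<Longrightarrow> f (basis R I i) \<in> P" and x: "x \<in> carrier (free R I)"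
  shows "f x \<in> P"
proof -
  obtain g where g: "lin R (free R I) (sub T P) g" "\<forall>i\<in>I. g (basis R I i) = f (basis R I i)"
    using free_lift[OF R right_module_sub[OF T P], of I "\<lambda>i. f (basis R I i)"] b by auto
  have "f x = g x"
    using free_unique[OF R T f lin_from_into_sub[OF g(1) submodD(1)[OF P]] _ x] g(2) by simp
  then show ?thesis using lin_closed[OF g(1) x] by simp
qed

section \<open>Short exact sequences and purity\<close>

text \<open>Morphisms are extensional functions; this reduces equations between composites to
  pointwise equations on the carrier.\<close>

lemma compose_eq_iff: "f \<in> extensional A \<Longrightarrow> compose A g h = f \<longleftrightarrow> (\<forall>x\<in>A. g (h x) = f x)"
  by (auto simp: compose_def fun_eq_iff extensional_def restrict_def)

lemma compose_zero_iff: "compose (carrier A) g h = zero_hom A C \<longleftrightarrow> (\<forall>x\<in>carrier A. g (h x) = \<zero>\<^bsub>C\<^esub>)"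
  by (subst compose_eq_iff) (auto simp: zero_hom_def)

lemma Hom_extensional: "f \<in> Hom R M N \<Longrightarrow> f \<in> extensional (carrier M)"
  unfolding Hom_def by (auto simp: PiE_def)

lemma compose_Hom_iff:
  "f \<in> Hom R A C \<Longrightarrow> compose (carrier A) g h = f \<longleftrightarrow> (\<forall>x\<in>carrier A. g (h x) = f x)"
  by (rule compose_eq_iff) (rule Hom_extensional)

lemma Hom_eqI: "\<lbrakk>f \<in> Hom R A C; g \<in> Hom R A C; \<And>x. x \<in> carrier A \<Longrightarrow> f x = g x\<rbrakk> \<Longrightarrow> f = g"
  using Hom_extensional by (metis extensionalityI)

lemma lin_Hom_exists:
  assumes "right_module R A" "lin R A C f"
  shows "\<exists>g\<in>Hom R A C. \<forall>x\<in>carrier A. g x = f x"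
  using lin_restrict[OF assms] by (intro bexI[of _ "restrict f (carrier A)"]) auto

text \<open>Like \<open>short_exact\<close>, but the maps need not be extensional.\<close>

definition sx ::
  "('r, 'x) ring_scheme \<Rightarrow> ('r, 'm) module \<Rightarrow> ('m \<Rightarrow> 'm) \<Rightarrow> ('r, 'm) module
    \<Rightarrow> ('m \<Rightarrow> 'm) \<Rightarrow> ('r, 'm) module \<Rightarrow> bool" where
  "sx R A i B p C \<longleftrightarrow>
     A \<in> ModR R \<and> B \<in> ModR R \<and> C \<in> ModR R \<and> lin R A B i \<and> lin R B C p \<and>
     inj_on i (carrier A) \<and> i ` carrier A = {x \<in> carrier B. p x = \<zero>\<^bsub>C\<^esub>} \<and>
     p ` carrier B = carrier C"

lemma sxD:
  assumes "sx R A i B p C"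
  shows "A \<in> ModR R" "B \<in> ModR R" "C \<in> ModR R" "right_module R A" "right_module R B" "right_module R C"
    "lin R A B i" "lin R B C p"
    "inj_on i (carrier A)" "i ` carrier A = {x \<in> carrier B. p x = \<zero>\<^bsub>C\<^esub>}" "p ` carrier B = carrier C"
    "\<And>x. x \<in> carrier A \<Longrightarrow> p (i x) = \<zero>\<^bsub>C\<^esub>"
    "\<And>y. \<lbrakk>y \<in> carrier B; p y = \<zero>\<^bsub>C\<^esub>\<rbrakk> \<Longrightarrow> \<exists>x\<in>carrier A. i x = y"
    "\<And>z. z \<in> carrier C \<Longrightarrow> \<exists>y\<in>carrier B. p y = z"
proof -
  have *: "i ` carrier A = {x \<in> carrier B. p x = \<zero>\<^bsub>C\<^esub>}" "p ` carrier B = carrier C"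
    using assms unfolding sx_def by auto
  then show "\<And>x. x \<in> carrier A \<Longrightarrow> p (i x) = \<zero>\<^bsub>C\<^esub>"
    "\<And>y. \<lbrakk>y \<in> carrier B; p y = \<zero>\<^bsub>C\<^esub>\<rbrakk> \<Longrightarrow> \<exists>x\<in>carrier A. i x = y"
    "\<And>z. z \<in> carrier C \<Longrightarrow> \<exists>y\<in>carrier B. p y = z"
    by (metis (mono_tags, lifting) image_eqI image_iff mem_Collect_eq)+
qed (use assms in \<open>auto simp: sx_def ModR_module\<close>)

lemma sxI:
  assumes "A \<in> ModR R" "B \<in> ModR R" "C \<in> ModR R" "lin R A B i" "lin R B C p"
    "inj_on i (carrier A)"
    "\<And>x. x \<in> carrier A \<Longrightarrow> p (i x) = \<zero>\<^bsub>C\<^esub>"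
    "\<And>y. \<lbrakk>y \<in> carrier B; p y = \<zero>\<^bsub>C\<^esub>\<rbrakk> \<Longrightarrow> \<exists>x\<in>carrier A. i x = y"
    "\<And>z. z \<in> carrier C \<Longrightarrow> \<exists>y\<in>carrier B. p y = z"
  shows "sx R A i B p C"
  unfolding sx_def
proof (intro conjI)
  show "i ` carrier A = {x \<in> carrier B. p x = \<zero>\<^bsub>C\<^esub>}"
    using assms(7,8) lin_closed[OF assms(4)] by (fastforce simp: image_iff)
  show "p ` carrier B = carrier C"
    using assms(9) lin_closed[OF assms(5)] by (fastforce simp: image_iff)
qed fact+

lemma short_exact_imp_sx: "short_exact R A i B p C \<Longrightarrow> sx R A i B p C"
  unfolding short_exact_def sx_def by (auto intro: Hom_lin)

lemma sx_imp_short_exact: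
  assumes "sx R A i B p C"
  shows "short_exact R A (restrict i (carrier A)) B (restrict p (carrier B)) C"
proof -
  note s = sxD[OF assms]
  show ?thesis
    unfolding short_exact_def
    using s(1-3,9-11) lin_restrict[OF s(4,7)] lin_restrict[OF s(5,8)]
    by (auto simp: inj_on_restrict_eq cong: conj_cong)
qed

lemma sx_factor_mono:
  assumes s: "sx R A i B p C" and T: "right_module R T" and u: "lin R T B u"
    and z: "\<And>x. x \<in> carrier T \<Longrightarrow> p (u x) = \<zero>\<^bsub>C\<^esub>"
  shows "\<exists>w. lin R T A w \<and> (\<forall>x\<in>carrier T. i (w x) = u x)"
  using sxD[OF s] lin_closed[OF u] z
  by (intro lin_factor_inj[OF _ _ T _ _ u]) auto

lemma sx_factor_epi:
  assumes s: "sx R A i B p C" and T: "right_module R T" and u: "lin R B T u"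
    and z: "\<And>x. x \<in> carrier A \<Longrightarrow> u (i x) = \<zero>\<^bsub>T\<^esub>"
  shows "\<exists>w. lin R C T w \<and> (\<forall>x\<in>carrier B. w (p x) = u x)"
proof (rule lin_factor_surj[OF sxD(5,6)[OF s] T sxD(8,11)[OF s] u])
  fix x assume "x \<in> carrier B" "p x = \<zero>\<^bsub>C\<^esub>"
  then show "u x = \<zero>\<^bsub>T\<^esub>" using sxD(13)[OF s] z by blast
qed

lemma sx_sub:
  assumes N: "N \<in> ModR R" and Q: "Q \<in> ModR R" and \<pi>: "lin R N Q \<pi>" "\<pi> ` carrier N = carrier Q"
    and P: "submod R N P" and ker: "\<And>x. x \<in> carrier N \<Longrightarrow> \<pi> x = \<zero>\<^bsub>Q\<^esub> \<longleftrightarrow> x \<in> P"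
  shows "sx R (sub N P) (\<lambda>x. x) N \<pi> Q"
proof (rule sxI)
  show "sub N P \<in> ModR R" by (rule ModR_sub[OF N P])
  show "lin R (sub N P) N (\<lambda>x. x)" by (rule lin_sub[OF submodD(1)[OF P] lin_id])
  show "\<exists>y\<in>carrier N. \<pi> y = z" if "z \<in> carrier Q" for z using that \<pi>(2) by (metis imageE)
qed (use assms submodD(1)[OF P] in auto)

subsection \<open>Kernel-cokernel pairs\<close>

lemma is_kernelD:
  fixes K L :: "('r, 'm) module"
  assumes "is_kernel R L i M p N" "K \<in> ModR R" "f \<in> Hom R K M" "compose (carrier K) p f = zero_hom K N"
  shows "\<exists>g. g \<in> Hom R K L \<and> compose (carrier K) i g = f"
    "\<lbrakk>g \<in> Hom R K L; compose (carrier K) i g = f; g' \<in> Hom R K L; compose (carrier K) i g' = f\<rbrakk> \<Longrightarrow> g = g'"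
proof -
  have "\<exists>!g. g \<in> Hom R K L \<and> compose (carrier K) i g = f"
    by (rule conjunct2[OF assms(1)[unfolded is_kernel_def], rule_format, OF assms(2-4)])
  then show "\<exists>g. g \<in> Hom R K L \<and> compose (carrier K) i g = f"
    "\<lbrakk>g \<in> Hom R K L; compose (carrier K) i g = f; g' \<in> Hom R K L; compose (carrier K) i g' = f\<rbrakk> \<Longrightarrow> g = g'"
    by (auto elim!: ex1E)
qed

lemma is_cokernelD:
  fixes K L :: "('r, 'm) module"
  assumes "is_cokernel R L i M p N" "K \<in> ModR R" "f \<in> Hom R M K" "compose (carrier L) f i = zero_hom L K"
  shows "\<exists>g. g \<in> Hom R N K \<and> compose (carrier M) g p = f"
    "\<lbrakk>g \<in> Hom R N K; compose (carrier M) g p = f; g' \<in> Hom R N K; compose (carrier M) g' p = f\<rbrakk> \<Longrightarrow> g = g'"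
proof -
  have "\<exists>!g. g \<in> Hom R N K \<and> compose (carrier M) g p = f"
    by (rule conjunct2[OF assms(1)[unfolded is_cokernel_def], rule_format, OF assms(2-4)])
  then show "\<exists>g. g \<in> Hom R N K \<and> compose (carrier M) g p = f"
    "\<lbrakk>g \<in> Hom R N K; compose (carrier M) g p = f; g' \<in> Hom R N K; compose (carrier M) g' p = f\<rbrakk> \<Longrightarrow> g = g'"
    by (auto elim!: ex1E)
qed

text \<open>The universal property is tested on two submodules: the inclusion of the set-theoretic
  kernel of \<open>p\<close> must factor through \<open>i\<close>, and on the kernel of
  \<open>i\<close> the inclusion and the zero map agree after \<open>i\<close>, hence are
  equal.\<close>

lemma is_kernel_imp:
  fixes L :: "('r, 'm) module"
  assumes M: "L \<in> ModR R" "M \<in> ModR R" "N \<in> ModR R" and h: "i \<in> Hom R L M" "p \<in> Hom R M N"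
    and k: "is_kernel R L i M p N"
  shows "inj_on i (carrier L)" "i ` carrier L = {x \<in> carrier M. p x = \<zero>\<^bsub>N\<^esub>}"
proof -
  note m = ModR_module[OF M(1)] ModR_module[OF M(2)] ModR_module[OF M(3)]
  note i = Hom_lin[OF h(1)] and p = Hom_lin[OF h(2)]
  have z: "p (i x) = \<zero>\<^bsub>N\<^esub>" if "x \<in> carrier L" for x
    using k that unfolding is_kernel_def compose_zero_iff by blast
  let ?K = "sub M {x \<in> carrier M. p x = \<zero>\<^bsub>N\<^esub>}"
  have sK: "submod R M {x \<in> carrier M. p x = \<zero>\<^bsub>N\<^esub>}" by (rule submod_kernel[OF m(2,3) p])
  have K: "?K \<in> ModR R" by (rule ModR_sub[OF M(2) sK])
  have "lin R ?K M (\<lambda>x. x)" by (rule lin_sub[OF submodD(1)[OF sK] lin_id])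
  from lin_Hom_exists[OF ModR_module[OF K] this]
  obtain j where j: "j \<in> Hom R ?K M" "\<And>x. x \<in> carrier ?K \<Longrightarrow> j x = x" by blast
  then have "compose (carrier ?K) p j = zero_hom ?K N" unfolding compose_zero_iff by simp
  then obtain g where g: "g \<in> Hom R ?K L" "compose (carrier ?K) i g = j"
    using is_kernelD(1)[OF k K j(1)] by blast
  have "x \<in> i ` carrier L" if "x \<in> carrier ?K" for x
  proof -
    have "i (g x) = x" using g(2) that j(2)[OF that] unfolding compose_Hom_iff[OF j(1)] by simp
    moreover have "g x \<in> carrier L" using lin_closed[OF Hom_lin[OF g(1)] that] .
    ultimately show ?thesis by force
  qed
  then show "i ` carrier L = {x \<in> carrier M. p x = \<zero>\<^bsub>N\<^esub>}"
    using z lin_closed[OF i] by auto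
  let ?Z = "sub L {x \<in> carrier L. i x = \<zero>\<^bsub>M\<^esub>}"
  have sZ: "submod R L {x \<in> carrier L. i x = \<zero>\<^bsub>M\<^esub>}" by (rule submod_kernel[OF m(1,2) i])
  have Z: "?Z \<in> ModR R" by (rule ModR_sub[OF M(1) sZ])
  have "lin R ?Z L (\<lambda>x. x)" by (rule lin_sub[OF submodD(1)[OF sZ] lin_id])
  from lin_Hom_exists[OF ModR_module[OF Z] this]
  obtain a where a: "a \<in> Hom R ?Z L" "\<And>x. x \<in> carrier ?Z \<Longrightarrow> a x = x" by blast
  obtain b where b: "b \<in> Hom R ?Z L" "\<And>x. x \<in> carrier ?Z \<Longrightarrow> b x = \<zero>\<^bsub>L\<^esub>"
    using lin_Hom_exists[OF ModR_module[OF Z] lin_zero_map[OF m(1)]] by blast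
  obtain c where c: "c \<in> Hom R ?Z M" "\<And>x. x \<in> carrier ?Z \<Longrightarrow> c x = \<zero>\<^bsub>M\<^esub>"
    using lin_Hom_exists[OF ModR_module[OF Z] lin_zero_map[OF m(2)]] by blast
  have "compose (carrier ?Z) i a = c" "compose (carrier ?Z) i b = c" "compose (carrier ?Z) p c = zero_hom ?Z N"
    unfolding compose_Hom_iff[OF c(1)] compose_zero_iff
    using a b c lin_zero[OF m(1,2) i] lin_zero[OF m(2,3) p] by auto
  then have "a = b" using is_kernelD(2)[OF k Z c(1) _ a(1) _ b(1)] by simp
  then have "\<forall>x\<in>carrier L. i x = \<zero>\<^bsub>M\<^esub> \<longrightarrow> x = \<zero>\<^bsub>L\<^esub>" using a(2) b(2) by auto
  then show "inj_on i (carrier L)" using lin_inj_on_iff[OF m(1,2) i] by blast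
qed

text \<open>Tested on the quotient of \<open>N\<close> by the image of \<open>p\<close>: the
  projection and the zero map agree after \<open>p\<close>, so the quotient is zero.\<close>

lemma is_cokernel_imp:
  fixes L :: "('r, 'm) module"
  assumes M: "L \<in> ModR R" "M \<in> ModR R" "N \<in> ModR R" and h: "i \<in> Hom R L M" "p \<in> Hom R M N"
    and k: "is_cokernel R L i M p N"
  shows "p ` carrier M = carrier N"
proof -
  note m = ModR_module[OF M(1)] ModR_module[OF M(2)] ModR_module[OF M(3)]
  note i = Hom_lin[OF h(1)] and p = Hom_lin[OF h(2)]
  have sP: "submod R N (p ` carrier M)" by (rule submod_image[OF m(2,3) p submod_carrier[OF m(2)]])
  obtain Q :: "('r, 'm) module" and \<pi> where Q: "Q \<in> ModR R" "lin R N Q \<pi>"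
    "\<forall>x\<in>carrier N. \<pi> x = \<zero>\<^bsub>Q\<^esub> \<longleftrightarrow> x \<in> p ` carrier M"
    using quotient_exists[OF m(3) sP ModR_small[OF M(3)]] by blast
  note mQ = ModR_module[OF Q(1)]
  obtain a where a: "a \<in> Hom R N Q" "\<And>x. x \<in> carrier N \<Longrightarrow> a x = \<pi> x"
    using lin_Hom_exists[OF m(3) Q(2)] by blast
  obtain b where b: "b \<in> Hom R N Q" "\<And>x. x \<in> carrier N \<Longrightarrow> b x = \<zero>\<^bsub>Q\<^esub>"
    using lin_Hom_exists[OF m(3) lin_zero_map[OF mQ]] by blast
  obtain c where c: "c \<in> Hom R M Q" "\<And>x. x \<in> carrier M \<Longrightarrow> c x = \<zero>\<^bsub>Q\<^esub>"
    using lin_Hom_exists[OF m(2) lin_zero_map[OF mQ]] by blast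
  have "compose (carrier M) a p = c" "compose (carrier M) b p = c" "compose (carrier L) c i = zero_hom L Q"
    unfolding compose_Hom_iff[OF c(1)] compose_zero_iff
    using a b c lin_closed[OF p] lin_closed[OF i] Q(3) by auto
  then have "a = b" using is_cokernelD(2)[OF k Q(1) c(1) _ a(1) _ b(1)] by simp
  then show ?thesis using a(2) b(2) Q(3) lin_closed[OF p] by force
qed

lemma short_exact_imp_kernel_cokernel_pair:
  fixes A :: "('r, 'm) module"
  assumes "short_exact R A i B p C" shows "(A, i, B, p, C) \<in> kernel_cokernel_pairs R"
proof -
  note sx = short_exact_imp_sx[OF assms]
  note s = sxD[OF sx]
  have h: "i \<in> Hom R A B" "p \<in> Hom R B C" using assms unfolding short_exact_def by auto
  have z: "compose (carrier A) p i = zero_hom A C" unfolding compose_zero_iff using s by blast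
  have "is_kernel R A i B p C"
    unfolding is_kernel_def
  proof (intro conjI z ballI impI ex_ex1I)
    fix K :: "('r, 'm) module" and f
    assume K: "K \<in> ModR R" and f: "f \<in> Hom R K B" "compose (carrier K) p f = zero_hom K C"
    have "\<exists>w. lin R K A w \<and> (\<forall>x\<in>carrier K. i (w x) = f x)"
      using f(2) unfolding compose_zero_iff by (intro sx_factor_mono[OF sx ModR_module[OF K] Hom_lin[OF f(1)]]) auto
    then obtain w where w: "lin R K A w" "\<forall>x\<in>carrier K. i (w x) = f x" by blast
    obtain g where "g \<in> Hom R K A" "\<forall>x\<in>carrier K. g x = w x" using lin_Hom_exists[OF ModR_module[OF K] w(1)] by blast
    then show "\<exists>g. g \<in> Hom R K A \<and> compose (carrier K) i g = f"
      unfolding compose_Hom_iff[OF f(1)] using w(2) by auto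
    fix g g' assume g: "g \<in> Hom R K A \<and> compose (carrier K) i g = f" "g' \<in> Hom R K A \<and> compose (carrier K) i g' = f"
    then have "\<And>x. x \<in> carrier K \<Longrightarrow> i (g x) = i (g' x)" unfolding compose_Hom_iff[OF f(1)] by auto
    then show "g = g'" using g s(9) by (intro Hom_eqI[of g R K A g']) (auto dest!: Hom_lin simp: lin_closed inj_on_eq_iff)
  qed
  moreover have "is_cokernel R A i B p C"
    unfolding is_cokernel_def
  proof (intro conjI z ballI impI ex_ex1I)
    fix K :: "('r, 'm) module" and f
    assume K: "K \<in> ModR R" and f: "f \<in> Hom R B K" "compose (carrier A) f i = zero_hom A K"
    have "\<exists>w. lin R C K w \<and> (\<forall>x\<in>carrier B. w (p x) = f x)"
      using f(2) unfolding compose_zero_iff by (intro sx_factor_epi[OF sx ModR_module[OF K] Hom_lin[OF f(1)]]) auto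
    then obtain w where w: "lin R C K w" "\<forall>x\<in>carrier B. w (p x) = f x" by blast
    obtain g where "g \<in> Hom R C K" "\<forall>x\<in>carrier C. g x = w x" using lin_Hom_exists[OF s(6) w(1)] by blast
    then show "\<exists>g. g \<in> Hom R C K \<and> compose (carrier B) g p = f"
      unfolding compose_Hom_iff[OF f(1)] using w(2) lin_closed[OF s(8)] by auto
    fix g g' assume g: "g \<in> Hom R C K \<and> compose (carrier B) g p = f" "g' \<in> Hom R C K \<and> compose (carrier B) g' p = f"
    then have "\<And>x. x \<in> carrier B \<Longrightarrow> g (p x) = g' (p x)" unfolding compose_Hom_iff[OF f(1)] by auto
    then show "g = g'" using g s(14) by (intro Hom_eqI[of g R C K g']) auto
  qed
  ultimately show ?thesis using s h unfolding kernel_cokernel_pairs_def by simp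
qed

text \<open>From here on the categorical pairs can be treated by arguments with elements.\<close>

lemma kernel_cokernel_pairs_iff: "(A, i, B, p, C) \<in> kernel_cokernel_pairs R \<longleftrightarrow> short_exact R A i B p C"
proof
  assume "(A, i, B, p, C) \<in> kernel_cokernel_pairs R"
  then show "short_exact R A i B p C"
    unfolding short_exact_def
    using is_kernel_imp[of A R B C i p] is_cokernel_imp[of A R B C i p]
    by (auto simp: kernel_cokernel_pairs_def)
qed (rule short_exact_imp_kernel_cokernel_pair)

subsection \<open>Purity\<close>

text \<open>The functor Hom(F, -) is left exact on any short exact sequence, so only the lifting of
  maps out of finitely presented modules remains as a hypothesis.\<close>

lemma pure_exactI:
  fixes A :: "('r, 'm) module"
  assumes s: "sx R A i B p C"
    and l: "\<And>(F :: ('r, 'm) module) h. \<lbrakk>F \<in> ModR R; finitely_presented R F; lin R F C h\<rbrakk>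
      \<Longrightarrow> \<exists>g. lin R F B g \<and> (\<forall>x\<in>carrier F. p (g x) = h x)"
  shows "(A, restrict i (carrier A), B, restrict p (carrier B), C) \<in> pure_exact R"
proof -
  let ?i = "restrict i (carrier A)" and ?p = "restrict p (carrier B)"
  note d = sxD[OF s]
  have "Hom_exact R F A ?i B ?p C" if F: "F \<in> ModR R" "finitely_presented R F" for F :: "('r, 'm) module"
    unfolding Hom_exact_def
  proof (intro conjI)
    note m = ModR_module[OF F(1)]
    show "inj_on (compose (carrier F) ?i) (Hom R F A)"
    proof (rule inj_onI)
      fix g g' assume g: "g \<in> Hom R F A" "g' \<in> Hom R F A" and e: "compose (carrier F) ?i g = compose (carrier F) ?i g'"
      show "g = g'"
      proof (rule Hom_eqI[OF g])
        fix x assume x: "x \<in> carrier F"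
        have "i (g x) = i (g' x)"
          using fun_cong[OF e, of x] x lin_closed[OF Hom_lin[OF g(1)] x] lin_closed[OF Hom_lin[OF g(2)] x]
          by (simp add: compose_def)
        then show "g x = g' x"
          using d(9) lin_closed[OF Hom_lin[OF g(1)] x] lin_closed[OF Hom_lin[OF g(2)] x] by (auto dest: inj_onD)
      qed
    qed
    show "compose (carrier F) ?i ` Hom R F A = {g \<in> Hom R F B. compose (carrier F) ?p g = zero_hom F C}"
    proof (intro equalityI subsetI)
      fix k assume "k \<in> compose (carrier F) ?i ` Hom R F A"
      then obtain g where g: "g \<in> Hom R F A" "k = compose (carrier F) ?i g" by blast
      note lg = lin_closed[OF Hom_lin[OF g(1)]]
      have k: "k = restrict (\<lambda>x. i (g x)) (carrier F)"
        unfolding g(2) compose_def using lg by (auto simp: fun_eq_iff)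
      then have "k \<in> Hom R F B" using lin_restrict[OF m lin_comp[OF Hom_lin[OF g(1)] d(7)]] by simp
      moreover have "compose (carrier F) ?p k = zero_hom F C"
        unfolding compose_zero_iff k using lg d(12) lin_closed[OF d(7)] by simp
      ultimately show "k \<in> {g \<in> Hom R F B. compose (carrier F) ?p g = zero_hom F C}" by simp
    next
      fix k assume "k \<in> {g \<in> Hom R F B. compose (carrier F) ?p g = zero_hom F C}"
      then have k: "k \<in> Hom R F B" "\<forall>x\<in>carrier F. p (k x) = \<zero>\<^bsub>C\<^esub>"
        unfolding compose_zero_iff by (auto dest!: Hom_lin lin_closed)
      then obtain w where w: "lin R F A w" "\<forall>x\<in>carrier F. i (w x) = k x"
        using sx_factor_mono[OF s m Hom_lin[OF k(1)]] by blast
      obtain g where g: "g \<in> Hom R F A" "\<forall>x\<in>carrier F. g x = w x" using lin_Hom_exists[OF m w(1)] by blast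
      have "compose (carrier F) ?i g = k"
        unfolding compose_Hom_iff[OF k(1)] using g w lin_closed[OF w(1)] by simp
      then show "k \<in> compose (carrier F) ?i ` Hom R F A" using g by blast
    qed
    show "compose (carrier F) ?p ` Hom R F B = Hom R F C"
    proof (intro equalityI subsetI)
      fix k assume "k \<in> compose (carrier F) ?p ` Hom R F B"
      then obtain g where g: "g \<in> Hom R F B" "k = compose (carrier F) ?p g" by blast
      have "k = restrict (\<lambda>x. p (g x)) (carrier F)"
        unfolding g(2) compose_def using lin_closed[OF Hom_lin[OF g(1)]] by (auto simp: fun_eq_iff)
      then show "k \<in> Hom R F C" using lin_restrict[OF m lin_comp[OF Hom_lin[OF g(1)] d(8)]] by simp
    next
      fix h assume h: "h \<in> Hom R F C"
      obtain w where w: "lin R F B w" "\<forall>x\<in>carrier F. p (w x) = h x" using l[OF F Hom_lin[OF h]] by blast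
      obtain g where g: "g \<in> Hom R F B" "\<forall>x\<in>carrier F. g x = w x" using lin_Hom_exists[OF m w(1)] by blast
      have "compose (carrier F) ?p g = h"
        unfolding compose_Hom_iff[OF h] using g w lin_closed[OF w(1)] by simp
      then show "h \<in> compose (carrier F) ?p ` Hom R F B" using g by blast
    qed
  qed
  then show ?thesis unfolding pure_exact_def using sx_imp_short_exact[OF s] by simp
qed

lemma pure_exactD:
  fixes A :: "('r, 'm) module"
  assumes "(A, i, B, p, C) \<in> pure_exact R"
  shows "short_exact R A i B p C" "sx R A i B p C"
    "\<And>(F :: ('r, 'm) module) h. \<lbrakk>F \<in> ModR R; finitely_presented R F; lin R F C h\<rbrakk>
      \<Longrightarrow> \<exists>g. lin R F B g \<and> (\<forall>x\<in>carrier F. p (g x) = h x)"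
proof -
  show "short_exact R A i B p C" using assms unfolding pure_exact_def by auto
  then show "sx R A i B p C" by (rule short_exact_imp_sx)
  fix F :: "('r, 'm) module" and h assume F: "F \<in> ModR R" "finitely_presented R F" "lin R F C h"
  obtain k where k: "k \<in> Hom R F C" "\<forall>x\<in>carrier F. k x = h x" using lin_Hom_exists[OF ModR_module[OF F(1)] F(3)] by blast
  have "compose (carrier F) p ` Hom R F B = Hom R F C"
    using assms F unfolding pure_exact_def Hom_exact_def by auto
  then obtain g where g: "g \<in> Hom R F B" "compose (carrier F) p g = k" using k(1) by (metis imageE)
  have "p (g x) = h x" if "x \<in> carrier F" for x
    using g(2) k(2) that unfolding compose_Hom_iff[OF k(1)] by simp
  then show "\<exists>g. lin R F B g \<and> (\<forall>x\<in>carrier F. p (g x) = h x)" using Hom_lin[OF g(1)] by blast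
qed

lemma finitely_presented_iff:
  assumes "ring R" "right_module R F"
  shows "finitely_presented R F \<longleftrightarrow>
    (\<exists>(m::nat) (n::nat) g f. lin R (free R {..<m}) (free R {..<n}) g \<and> lin R (free R {..<n}) F f \<and>
        f ` carrier (free R {..<n}) = carrier F \<and>
        g ` carrier (free R {..<m}) = {v \<in> carrier (free R {..<n}). f v = \<zero>\<^bsub>F\<^esub>})"
    (is "?L \<longleftrightarrow> ?R")
proof
  assume ?L
  then obtain m n :: nat and g f where *: "g \<in> Hom R (free R {..<m}) (free R {..<n})" "f \<in> Hom R (free R {..<n}) F"
    "f ` carrier (free R {..<n}) = carrier F"
    "g ` carrier (free R {..<m}) = {v \<in> carrier (free R {..<n}). f v = \<zero>\<^bsub>F\<^esub>}"
    unfolding finitely_presented_def free_module_eq by (elim exE bexE conjE) (rule that)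
  show ?R
    by (intro exI conjI) (rule Hom_lin[OF *(1)] Hom_lin[OF *(2)] *(3,4))+
next
  assume ?R
  then obtain m n :: nat and g f where *: "lin R (free R {..<m}) (free R {..<n}) g" "lin R (free R {..<n}) F f"
    "f ` carrier (free R {..<n}) = carrier F"
    "g ` carrier (free R {..<m}) = {v \<in> carrier (free R {..<n}). f v = \<zero>\<^bsub>F\<^esub>}"
    by (elim exE conjE) (rule that)
  let ?g = "restrict g (carrier (free R {..<m}))" and ?f = "restrict f (carrier (free R {..<n}))"
  have "?g \<in> Hom R (free R {..<m}) (free R {..<n})" "?f \<in> Hom R (free R {..<n}) F"
    using * by (auto intro!: lin_restrict right_module_free assms)
  moreover have "?f ` carrier (free R {..<n}) = carrier F" using *(3) by simp
  moreover have "?g ` carrier (free R {..<m}) = {v \<in> carrier (free R {..<n}). ?f v = \<zero>\<^bsub>F\<^esub>}"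
    using *(4) by auto
  ultimately show ?L unfolding finitely_presented_def free_module_eq by (intro exI bexI conjI)
qed

text \<open>
  A finite system of equations is a linear map \<open>g\<close> between finitely generated free modules;
  \<open>P\<close> is pure if a system with constants in \<open>P\<close> that has a solution \<open>\<xi>\<close> has one in \<open>P\<close>.
\<close>

definition pure_submod :: "('r, 'x) ring_scheme \<Rightarrow> ('r, 'a) module \<Rightarrow> 'a set \<Rightarrow> bool" where
  "pure_submod R N P \<longleftrightarrow> submod R N P \<and>
     (\<forall>(m::nat) (n::nat) g \<xi>. lin R (free R {..<m}) (free R {..<n}) g \<longrightarrow> lin R (free R {..<n}) N \<xi> \<longrightarrow>
        (\<forall>v\<in>carrier (free R {..<m}). \<xi> (g v) \<in> P) \<longrightarrow>
        (\<exists>\<eta>. lin R (free R {..<n}) (sub N P) \<eta> \<and> (\<forall>v\<in>carrier (free R {..<m}). \<eta> (g v) = \<xi> (g v))))"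

text \<open>\<open>h\<close> lifts to a map \<xi> on the generators of \<open>F\<close>, which sends
  relations into the kernel of \<open>p\<close>. By \<open>key\<close> these values are also taken
  by some \<eta> that maps everything into that kernel; then \<xi> - \<eta> kills the relations and
  still lies over \<open>h\<close>.\<close>

lemma finitely_presented_lift:
  assumes R: "ring R" and mF: "right_module R F" and fp: "finitely_presented R F"
    and mB: "right_module R B" and mC: "right_module R C" and p: "lin R B C p" "p ` carrier B = carrier C" and h: "lin R F C h"
    and key: "\<And>(m::nat) (n::nat) g \<xi>. \<lbrakk>lin R (free R {..<m}) (free R {..<n}) g; lin R (free R {..<n}) B \<xi>;
        \<And>v. v \<in> carrier (free R {..<m}) \<Longrightarrow> p (\<xi> (g v)) = \<zero>\<^bsub>C\<^esub>\<rbrakk> \<Longrightarrow>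
        \<exists>\<eta>. lin R (free R {..<n}) B \<eta> \<and> (\<forall>v\<in>carrier (free R {..<n}). p (\<eta> v) = \<zero>\<^bsub>C\<^esub>) \<and>
          (\<forall>v\<in>carrier (free R {..<m}). \<eta> (g v) = \<xi> (g v))"
  shows "\<exists>k. lin R F B k \<and> (\<forall>x\<in>carrier F. p (k x) = h x)"
proof -
  interpret B: right_module R B by fact
  interpret C: right_module R C by fact
  obtain m n :: nat and g f where *: "lin R (free R {..<m}) (free R {..<n}) g" "lin R (free R {..<n}) F f"
    "f ` carrier (free R {..<n}) = carrier F"
    "g ` carrier (free R {..<m}) = {v \<in> carrier (free R {..<n}). f v = \<zero>\<^bsub>F\<^esub>}"
    using fp unfolding finitely_presented_iff[OF R mF] by (elim exE conjE) (rule that)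
  note fr = right_module_free[OF R]
  obtain \<xi> where \<xi>: "lin R (free R {..<n}) B \<xi>" "\<forall>x\<in>carrier (free R {..<n}). p (\<xi> x) = h (f x)"
    using free_projective[OF R mB mC p lin_comp[OF *(2) h]] by blast
  have fg: "f (g v) = \<zero>\<^bsub>F\<^esub>" if "v \<in> carrier (free R {..<m})" for v using *(4) that by blast
  have "p (\<xi> (g v)) = \<zero>\<^bsub>C\<^esub>" if "v \<in> carrier (free R {..<m})" for v
    using \<xi>(2) lin_closed[OF *(1) that] fg[OF that] lin_zero[OF mF mC h] by simp
  from key[OF *(1) \<xi>(1) this] obtain \<eta> where \<eta>: "lin R (free R {..<n}) B \<eta>"
    "\<forall>v\<in>carrier (free R {..<n}). p (\<eta> v) = \<zero>\<^bsub>C\<^esub>" "\<forall>v\<in>carrier (free R {..<m}). \<eta> (g v) = \<xi> (g v)"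
    by blast
  let ?u = "\<lambda>v. \<xi> v \<ominus>\<^bsub>B\<^esub> \<eta> v"
  have u: "lin R (free R {..<n}) B ?u" by (rule lin_difference[OF fr mB \<xi>(1) \<eta>(1)])
  have "\<exists>k. lin R F B k \<and> (\<forall>x\<in>carrier (free R {..<n}). k (f x) = ?u x)"
  proof (rule lin_factor_surj[OF fr mF mB *(2,3) u])
    fix x assume "x \<in> carrier (free R {..<n})" "f x = \<zero>\<^bsub>F\<^esub>"
    then obtain v where v: "v \<in> carrier (free R {..<m})" "x = g v" using *(4) by blast
    then show "?u x = \<zero>\<^bsub>B\<^esub>" using \<eta>(3) lin_closed[OF \<xi>(1) lin_closed[OF *(1) v(1)]] B.diff_zero_iff by simp
  qed
  then obtain k where k: "lin R F B k" "\<forall>x\<in>carrier (free R {..<n}). k (f x) = ?u x" by blast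
  have "p (k y) = h y" if y: "y \<in> carrier F" for y
  proof -
    obtain x where x: "x \<in> carrier (free R {..<n})" "y = f x" using *(3) y by blast
    have "p (?u x) = p (\<xi> x) \<ominus>\<^bsub>C\<^esub> p (\<eta> x)"
      using lin_diff[OF mB mC p(1)] lin_closed[OF \<xi>(1) x(1)] lin_closed[OF \<eta>(1) x(1)] by simp
    then show ?thesis using k(2) x \<xi>(2) \<eta>(2) lin_closed[OF h y] by (simp add: C.diff_zero)
  qed
  then show ?thesis using k(1) by blast
qed

text \<open>Links purity in terms of equations with purity in terms of Hom: since \<open>P\<close>
  is the kernel of \<open>\<pi>\<close>, its purity supplies the hypothesis \<open>key\<close> of
  \<open>finitely_presented_lift\<close>.\<close>

lemma pure_submod_pure_exact:
  fixes N :: "('r, 'm) module"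
  assumes R: "ring R" and N: "N \<in> ModR R" and Q: "Q \<in> ModR R" and \<pi>: "lin R N Q \<pi>" "\<pi> ` carrier N = carrier Q"
    and P: "pure_submod R N P" and ker: "\<And>x. x \<in> carrier N \<Longrightarrow> \<pi> x = \<zero>\<^bsub>Q\<^esub> \<longleftrightarrow> x \<in> P"
  shows "(sub N P, restrict (\<lambda>x. x) P, N, restrict \<pi> (carrier N), Q) \<in> pure_exact R"
proof -
  have sP: "submod R N P" using P unfolding pure_submod_def by blast
  note m = ModR_module[OF N] ModR_module[OF Q]
  have "(sub N P, restrict (\<lambda>x. x) (carrier (sub N P)), N, restrict \<pi> (carrier N), Q) \<in> pure_exact R"
  proof (rule pure_exactI[OF sx_sub[OF N Q \<pi> sP ker]])
    fix F :: "('r, 'm) module" and h assume F: "F \<in> ModR R" "finitely_presented R F" "lin R F Q h"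
    show "\<exists>g. lin R F N g \<and> (\<forall>x\<in>carrier F. \<pi> (g x) = h x)"
    proof (rule finitely_presented_lift[OF R ModR_module[OF F(1)] F(2) m \<pi> F(3)])
      fix n k :: nat and g \<xi>
      assume g: "lin R (free R {..<n}) (free R {..<k}) g" and \<xi>: "lin R (free R {..<k}) N \<xi>"
        and z: "\<And>v. v \<in> carrier (free R {..<n}) \<Longrightarrow> \<pi> (\<xi> (g v)) = \<zero>\<^bsub>Q\<^esub>"
      have "\<xi> (g v) \<in> P" if "v \<in> carrier (free R {..<n})" for v
        using z[OF that] ker lin_closed[OF \<xi> lin_closed[OF g that]] by blast
      then obtain \<eta> where \<eta>: "lin R (free R {..<k}) (sub N P) \<eta>"
        "\<forall>v\<in>carrier (free R {..<n}). \<eta> (g v) = \<xi> (g v)"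
        using P g \<xi> unfolding pure_submod_def by blast
      have "\<forall>v\<in>carrier (free R {..<k}). \<pi> (\<eta> v) = \<zero>\<^bsub>Q\<^esub>"
        using lin_closed[OF \<eta>(1)] ker submodD(1)[OF sP] by auto
      then show "\<exists>\<eta>. lin R (free R {..<k}) N \<eta> \<and> (\<forall>v\<in>carrier (free R {..<k}). \<pi> (\<eta> v) = \<zero>\<^bsub>Q\<^esub>) \<and>
          (\<forall>v\<in>carrier (free R {..<n}). \<eta> (g v) = \<xi> (g v))"
        using \<eta> lin_from_into_sub[OF \<eta>(1) submodD(1)[OF sP]] by blast
    qed
  qed auto
  then show ?thesis by simp
qed

section \<open>Pure submodules of bounded cardinality\<close>

text \<open>All values of the operator lie in \<open>N\<close>, so the closed set found may be cut
  down to \<open>N\<close>.\<close>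

lemma bounded_closure_within:
  fixes c :: "'n set \<Rightarrow> 'n set"
  assumes Y: "infinite (Y :: 'y set)"
    and N: "\<And>S. c S \<subseteq> N"
    and mono: "\<And>S T. S \<subseteq> T \<Longrightarrow> c S \<subseteq> c T"
    and local: "\<And>S x. x \<in> c S \<Longrightarrow> \<exists>T\<subseteq>S. |T| \<le>o |Y| \<and> x \<in> c T"
    and bound: "\<And>S. |S| \<le>o |Pow Y| \<Longrightarrow> |c S| \<le>o |Pow Y|"
  shows "\<exists>A\<subseteq>N. c A \<subseteq> A \<and> |A| \<le>o |Pow Y|"
proof -
  have "\<exists>A. c A \<subseteq> A \<and> |A| \<le>o |Pow Y|"
    by (rule bounded_closure[OF Y]) (rule mono local bound; assumption)+
  then obtain A where A: "c A \<subseteq> A" "|A| \<le>o |Pow Y|" by blast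
  have "c (A \<inter> N) \<subseteq> A \<inter> N" using A(1) N[of "A \<inter> N"] mono[of "A \<inter> N" A] by blast
  moreover have "|A \<inter> N| \<le>o |Pow Y|" by (rule ordLeq_transitive[OF card_of_mono1 A(2)]) simp
  ultimately show ?thesis by blast
qed

lemma card_of_Pow_mono: assumes "|A| \<le>o |B|" shows "|Pow A| \<le>o |Pow B|"
proof -
  obtain h where h: "inj_on h A" "h ` A \<subseteq> B" using assms card_of_ordLeq[of A B] by blast
  have "inj_on (image h) (Pow A)" using h(1) by (rule inj_on_image_Pow)
  moreover have "image h ` Pow A \<subseteq> Pow B" using h(2) by blast
  ultimately show ?thesis using card_of_ordLeq[of "Pow A" "Pow B"] by blast
qed

lemma singleton_ordLeq: "infinite Y \<Longrightarrow> |{x}| \<le>o |Y|"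
  by (intro ordLess_imp_ordLeq finite_ordLess_infinite) auto

lemma finite_ordLeq: "\<lbrakk>infinite Y; finite X\<rbrakk> \<Longrightarrow> |X| \<le>o |Y|"
  by (intro ordLess_imp_ordLeq finite_ordLess_infinite) auto

lemma image_ordLeq: "|A| \<le>o r \<Longrightarrow> |f ` A| \<le>o r"
  by (rule ordLeq_transitive[OF card_of_image])

text \<open>
  For \<open>A = {0}\<close> this produces pure submodules of \<open>N\<close>; in general \<open>B/(A \<inter> B)\<close> is pure in \<open>N/A\<close>.
\<close>

lemma relatively_pure_submod_exists:
  fixes N :: "('r, 'a) module" and R :: "('r, 'x) ring_scheme"
  assumes N: "right_module R N" and Y: "infinite (Y :: 'y set)"
    and cR: "\<And>m::nat. |carrier (free R {..<m})| \<le>o |Y|" and cR1: "|carrier R| \<le>o |Y|"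
    and S: "S \<subseteq> carrier N" "|S| \<le>o |Pow Y|"
  shows "\<exists>B. submod R N B \<and> S \<subseteq> B \<and> |B| \<le>o |Pow Y| \<and>
    (\<forall>(m::nat) (n::nat) g \<beta> \<xi>. lin R (free R {..<m}) (free R {..<n}) g \<longrightarrow>
       lin R (free R {..<m}) (sub N B) \<beta> \<longrightarrow> lin R (free R {..<n}) N \<xi> \<longrightarrow>
       (\<forall>v\<in>carrier (free R {..<m}). \<xi> (g v) \<ominus>\<^bsub>N\<^esub> \<beta> v \<in> A) \<longrightarrow>
       (\<exists>\<eta>. lin R (free R {..<n}) (sub N B) \<eta> \<and>
          (\<forall>v\<in>carrier (free R {..<m}). \<eta> (g v) \<ominus>\<^bsub>N\<^esub> \<beta> v \<in> A)))"
proof -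
  interpret N: right_module R N by fact
  let ?F = "\<lambda>m::nat. carrier (free R {..<m})"
  \<comment> \<open>\<xi> solves modulo \<open>A\<close> the system \<open>g\<close> with constants
    \<beta>; here \<open>A\<close> may be any set.\<close>
  define P where "P m n g \<beta> \<xi> \<longleftrightarrow> lin R (free R {..<n}) N \<xi> \<and> (\<forall>v\<in>?F m. \<xi> (g v) \<ominus>\<^bsub>N\<^esub> \<beta> v \<in> A)"
    for m n :: nat and g \<beta> and \<xi> :: "(nat \<Rightarrow> 'r) \<Rightarrow> 'a"
  \<comment> \<open>One solution is chosen for each system with constants, so the operator below
    adds no more than the solutions of the systems with constants in \<open>T\<close>, and the
    cardinal bound survives.\<close>
  define w where "w m n g \<beta> = (if \<exists>\<xi>. P m n g \<beta> \<xi> then (SOME \<xi>. P m n g \<beta> \<xi>) ` ?F n else {})"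
    for m n :: nat and g \<beta>
  have wP: "P m n g \<beta> (SOME \<xi>. P m n g \<beta> \<xi>)" if "\<exists>\<xi>. P m n g \<beta> \<xi>" for m n g \<beta>
    using someI_ex[OF that] .
  have wN: "w m n g \<beta> \<subseteq> carrier N" for m n g \<beta>
  proof (cases "\<exists>\<xi>. P m n g \<beta> \<xi>")
    case True
    have "lin R (free R {..<n}) N (SOME \<xi>. P m n g \<beta> \<xi>)" using wP[OF True] unfolding P_def by blast
    from lin_closed[OF this] show ?thesis using True unfolding w_def by auto
  qed (simp add: w_def)
  have wb: "|w m n g \<beta>| \<le>o |Pow Y|" for m n g \<beta>
    unfolding w_def using image_ordLeq[OF ordLeq_Pow[OF cR]] by (auto simp: card_of_empty)
  define c where "c S' = (let T = S' \<inter> carrier N in S \<union> {\<zero>\<^bsub>N\<^esub>} \<union> (\<Union>x\<in>T. \<Union>y\<in>T. {x \<oplus>\<^bsub>N\<^esub> y}) \<union>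
     (\<Union>r\<in>carrier R. \<Union>x\<in>T. {r \<odot>\<^bsub>N\<^esub> x}) \<union>
     (\<Union>m. \<Union>n. \<Union>g\<in>PiE (?F m) (\<lambda>_. ?F n). \<Union>\<beta>\<in>PiE (?F m) (\<lambda>_. T). w m n g \<beta>))" for S'
  have cI: "x \<in> c T" if "g \<in> PiE (?F m) (\<lambda>_. ?F n)" "\<beta> \<in> PiE (?F m) (\<lambda>_. T \<inter> carrier N)" "x \<in> w m n g \<beta>"
    for x T m n g \<beta>
    unfolding c_def Let_def
    by (rule UnI2, rule UN_I[OF UNIV_I], rule UN_I[OF UNIV_I], rule UN_I[OF that(1)], rule UN_I[OF that(2)], rule that(3))
  have cI0: "S \<subseteq> c T" "\<zero>\<^bsub>N\<^esub> \<in> c T" for T unfolding c_def Let_def by blast+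
  have cI1: "a \<oplus>\<^bsub>N\<^esub> b \<in> c T" if "a \<in> T \<inter> carrier N" "b \<in> T \<inter> carrier N" for a b T
    using that unfolding c_def Let_def by blast
  have cI2: "r \<odot>\<^bsub>N\<^esub> a \<in> c T" if "r \<in> carrier R" "a \<in> T \<inter> carrier N" for a r T
    using that unfolding c_def Let_def by blast
  have "\<exists>B\<subseteq>carrier N. c B \<subseteq> B \<and> |B| \<le>o |Pow Y|"
  proof (rule bounded_closure_within[OF Y])
    show "c S' \<subseteq> carrier N" for S'
      unfolding c_def Let_def using S(1) N.smult_closed by (intro Un_least UN_least wN) auto
    show "c S' \<subseteq> c T'" if "S' \<subseteq> T'" for S' T'
    proof -
      have "PiE (?F m) (\<lambda>_. S' \<inter> carrier N) \<subseteq> PiE (?F m) (\<lambda>_. T' \<inter> carrier N)" for m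
        using that by (intro PiE_mono) auto
      then show ?thesis unfolding c_def Let_def using that by (intro Un_mono UN_mono order_refl) auto
    qed
    show "\<exists>T\<subseteq>S'. |T| \<le>o |Y| \<and> x \<in> c T" if x: "x \<in> c S'" for S' x
    proof -
      consider "x \<in> S \<union> {\<zero>\<^bsub>N\<^esub>}" | a b where "a \<in> S' \<inter> carrier N" "b \<in> S' \<inter> carrier N" "x = a \<oplus>\<^bsub>N\<^esub> b"
        | r a where "r \<in> carrier R" "a \<in> S' \<inter> carrier N" "x = r \<odot>\<^bsub>N\<^esub> a"
        | m n g \<beta> where "g \<in> PiE (?F m) (\<lambda>_. ?F n)" "\<beta> \<in> PiE (?F m) (\<lambda>_. S' \<inter> carrier N)" "x \<in> w m n g \<beta>"
        using x unfolding c_def Let_def by blast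
      then show ?thesis
      proof cases
        case 1
        then have "x \<in> c {}" using cI0 by blast
        then show ?thesis by (intro exI[of _ "{}"]) (simp add: card_of_empty)
      next
        case 2
        then have "x \<in> c {a, b}" using cI1[of a "{a, b}" b] by simp
        then show ?thesis using 2 finite_ordLeq[OF Y, of "{a, b}"] by (intro exI[of _ "{a, b}"]) simp
      next
        case 3
        then have "x \<in> c {a}" using cI2[of r a "{a}"] by simp
        then show ?thesis using 3 finite_ordLeq[OF Y, of "{a}"] by (intro exI[of _ "{a}"]) simp
      next
        case 4
        \<comment> \<open>A chosen solution depends on the given set only through its constants, and
          \<beta> has at most \<open>|Y|\<close> values.\<close>
        let ?T = "\<beta> ` ?F m"
        have T: "?T \<subseteq> S' \<inter> carrier N" using 4(2) by auto
        then have "\<beta> \<in> PiE (?F m) (\<lambda>_. ?T \<inter> carrier N)" using 4(2) by (auto simp: PiE_iff)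
        then have "x \<in> c ?T" using cI 4(1,3) by blast
        moreover have "|?T| \<le>o |Y|" by (rule image_ordLeq[OF cR])
        ultimately show ?thesis using T by (intro exI[of _ ?T]) simp
      qed
    qed
    show "|c S'| \<le>o |Pow Y|" if b: "|S'| \<le>o |Pow Y|" for S'
    proof -
      have T: "|S' \<inter> carrier N| \<le>o |Pow Y|" by (rule ordLeq_transitive[OF card_of_mono1 b]) auto
      note I = infinite_Pow_ordLeq[OF Y]
      show ?thesis
        unfolding c_def Let_def
        by (intro Un_Pow_ordLeq[OF Y] UN_Pow_ordLeq[OF Y] S(2) T singleton_ordLeq[OF I] wb
            ordLeq_Pow[OF cR1] ordLeq_Pow[OF nat_ordLeq[OF Y]]
            Func_Pow_ordLeq[OF Y cR] ordLeq_Pow[OF cR])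
    qed
  qed
  then obtain B where B: "B \<subseteq> carrier N" "c B \<subseteq> B" "|B| \<le>o |Pow Y|" by blast
  then have BN: "B \<inter> carrier N = B" by blast
  have sub: "submod R N B"
  proof (rule submodI[OF B(1)])
    show "\<zero>\<^bsub>N\<^esub> \<in> B" using B(2) cI0(2) by blast
    show "x \<oplus>\<^bsub>N\<^esub> y \<in> B" if "x \<in> B" "y \<in> B" for x y using B(2) cI1[of x B y] that unfolding BN by blast
    show "r \<odot>\<^bsub>N\<^esub> x \<in> B" if "r \<in> carrier R" "x \<in> B" for r x
      using B(2) cI2[of r x B] that unfolding BN by blast
  qed
  have "\<exists>\<eta>. lin R (free R {..<n}) (sub N B) \<eta> \<and> (\<forall>v\<in>?F m. \<eta> (g v) \<ominus>\<^bsub>N\<^esub> \<beta> v \<in> A)"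
    if g: "lin R (free R {..<m}) (free R {..<n}) g" and \<beta>: "lin R (free R {..<m}) (sub N B) \<beta>"
      and \<xi>: "lin R (free R {..<n}) N \<xi>" "\<forall>v\<in>?F m. \<xi> (g v) \<ominus>\<^bsub>N\<^esub> \<beta> v \<in> A" for m n :: nat and g \<beta> \<xi>
  proof -
    \<comment> \<open>The operator ranges over extensional functions; restricting \<open>g\<close>
      and \<beta> changes none of the values that \<open>P\<close> inspects.\<close>
    let ?g = "restrict g (?F m)" and ?b = "restrict \<beta> (?F m)"
    have ex: "\<exists>\<xi>. P m n ?g ?b \<xi>" using \<xi> unfolding P_def by auto
    define \<eta> where "\<eta> = (SOME \<xi>. P m n ?g ?b \<xi>)"
    have \<eta>: "P m n ?g ?b \<eta>" unfolding \<eta>_def by (rule wP[OF ex])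
    have "?g \<in> PiE (?F m) (\<lambda>_. ?F n)" using lin_closed[OF g] by auto
    moreover have "?b \<in> PiE (?F m) (\<lambda>_. B)" using lin_closed[OF \<beta>] by auto
    ultimately have "w m n ?g ?b \<subseteq> c B" using cI[of ?g m n ?b B] unfolding BN by blast
    then have "\<eta> ` ?F n \<subseteq> B" using B(2) ex unfolding w_def \<eta>_def by auto
    then have "lin R (free R {..<n}) (sub N B) \<eta>"
      using \<eta> unfolding P_def by (intro lin_into_sub) auto
    moreover have "\<forall>v\<in>?F m. \<eta> (g v) \<ominus>\<^bsub>N\<^esub> \<beta> v \<in> A" using \<eta> unfolding P_def by simp
    ultimately show ?thesis by blast
  qed
  moreover have "S \<subseteq> B" using cI0(1) B(2) by blast
  ultimately show ?thesis using sub B(3) by (intro exI[of _ B]) simp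
qed

lemma pure_submod_exists:
  fixes N :: "('r, 'a) module" and R :: "('r, 'x) ring_scheme"
  assumes N: "right_module R N" and Y: "infinite (Y :: 'y set)"
    and cR: "\<And>m::nat. |carrier (free R {..<m})| \<le>o |Y|" "|carrier R| \<le>o |Y|"
    and S: "S \<subseteq> carrier N" "|S| \<le>o |Pow Y|"
  shows "\<exists>B. pure_submod R N B \<and> S \<subseteq> B \<and> |B| \<le>o |Pow Y|"
proof -
  interpret N: right_module R N by fact
  obtain B where B: "submod R N B" "S \<subseteq> B" "|B| \<le>o |Pow Y|" and
    p: "\<forall>(m::nat) (n::nat) g \<beta> \<xi>. lin R (free R {..<m}) (free R {..<n}) g \<longrightarrow>
       lin R (free R {..<m}) (sub N B) \<beta> \<longrightarrow> lin R (free R {..<n}) N \<xi> \<longrightarrow>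
       (\<forall>v\<in>carrier (free R {..<m}). \<xi> (g v) \<ominus>\<^bsub>N\<^esub> \<beta> v \<in> {\<zero>\<^bsub>N\<^esub>}) \<longrightarrow>
       (\<exists>\<eta>. lin R (free R {..<n}) (sub N B) \<eta> \<and>
          (\<forall>v\<in>carrier (free R {..<m}). \<eta> (g v) \<ominus>\<^bsub>N\<^esub> \<beta> v \<in> {\<zero>\<^bsub>N\<^esub>}))"
    using relatively_pure_submod_exists[OF N Y cR S, of "{\<zero>\<^bsub>N\<^esub>}"] by (elim exE conjE) (rule that)
  have BN: "B \<subseteq> carrier N" using submodD(1)[OF B(1)] .
  have "\<exists>\<eta>. lin R (free R {..<n}) (sub N B) \<eta> \<and> (\<forall>v\<in>carrier (free R {..<m}). \<eta> (g v) = \<xi> (g v))"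
    if g: "lin R (free R {..<m}) (free R {..<n}) g" and \<xi>: "lin R (free R {..<n}) N \<xi>"
      and im: "\<forall>v\<in>carrier (free R {..<m}). \<xi> (g v) \<in> B" for m n :: nat and g \<xi>
  proof -
    \<comment> \<open>The values of \<xi> on \<open>g\<close> serve as the constants, and a
      congruence modulo zero is an equality.\<close>
    let ?b = "\<lambda>v. \<xi> (g v)"
    have cl: "\<xi> (g v) \<in> carrier N" if "v \<in> carrier (free R {..<m})" for v using lin_closed[OF \<xi> lin_closed[OF g that]] .
    have b: "lin R (free R {..<m}) (sub N B) ?b" using lin_into_sub[OF lin_comp[OF g \<xi>]] im by blast
    have "\<forall>v\<in>carrier (free R {..<m}). \<xi> (g v) \<ominus>\<^bsub>N\<^esub> ?b v \<in> {\<zero>\<^bsub>N\<^esub>}" using cl by (simp add: N.diff_zero_iff)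
    then obtain \<eta> where \<eta>: "lin R (free R {..<n}) (sub N B) \<eta>"
      "\<forall>v\<in>carrier (free R {..<m}). \<eta> (g v) \<ominus>\<^bsub>N\<^esub> ?b v \<in> {\<zero>\<^bsub>N\<^esub>}" using p g b \<xi> by blast
    have "\<eta> (g v) = \<xi> (g v)" if "v \<in> carrier (free R {..<m})" for v
    proof -
      have "\<eta> (g v) \<in> carrier N" using lin_closed[OF \<eta>(1) lin_closed[OF g that]] BN by auto
      moreover have "\<eta> (g v) \<ominus>\<^bsub>N\<^esub> \<xi> (g v) = \<zero>\<^bsub>N\<^esub>" using \<eta>(2) that by blast
      ultimately show ?thesis using N.diff_zero_iff cl[OF that] by blast
    qed
    then show ?thesis using \<eta>(1) by blast
  qed
  then have "pure_submod R N B" unfolding pure_submod_def using B(1) by blast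
  then show ?thesis using B by blast
qed

text \<open>
  The theorem of Bican, El Bashir and Enochs: a large module has nonzero pure submodules in the
  kernel of every map to a small module.  The submodule found is \<open>(1 - \<sigma>)B\<close>, where \<open>\<sigma>\<close> moves a
  submodule \<open>B\<close> over \<open>M\<close> into a small \<open>A\<close> that contains a copy of every small submodule.
\<close>

lemma pure_submod_in_kernel:
  fixes N :: "('r, 'a) module" and R :: "('r, 'x) ring_scheme" and M :: "('r, 'b) module"
  assumes N: "right_module R N" and M: "right_module R M" and f: "lin R N M f"
    and Y: "infinite (Y :: 'y set)"
    and cR: "\<And>m::nat. |carrier (free R {..<m})| \<le>o |Y|" "|carrier R| \<le>o |Y|"
    and Y': "infinite (Y' :: 'z set)" "|Pow Y| \<le>o |Y'|" "|carrier (free R (Pow Y))| \<le>o |Y'|" "|carrier M| \<le>o |Y'|"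
    and big: "\<not> |carrier N| \<le>o |Pow Y'|"
  shows "\<exists>D. pure_submod R N D \<and> D \<noteq> {\<zero>\<^bsub>N\<^esub>} \<and> (\<forall>x\<in>D. f x = \<zero>\<^bsub>M\<^esub>)"
proof -
  interpret N: right_module R N by fact
  interpret M: right_module R M by fact
  have R: "ring R" by (rule N.R.ring_axioms)
  let ?Q = "Pow Y"
  let ?F = "carrier (free R ?Q)"
  \<comment> \<open>A family \<open>e\<close> indexed by \<open>Pow Y\<close> generates a submodule.
    \<open>K\<close> records its relations, \<phi> its images in \<open>M\<close>, and
    \<open>e0\<close> the members prescribed on \<open>D\<close>; two families with the same
    \<open>K\<close> and \<phi> generate submodules that are isomorphic over
    \<open>M\<close>.\<close>
  define P where "P D e0 K \<phi> e \<longleftrightarrow> (\<forall>q\<in>?Q. e q \<in> carrier N) \<and> (\<forall>q\<in>D. e q = e0 q) \<and> (\<forall>q\<in>?Q. f (e q) = \<phi> q) \<and>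
      (\<exists>w. lin R (free R ?Q) N w \<and> (\<forall>q\<in>?Q. w (basis R ?Q q) = e q) \<and> K = {v \<in> ?F. w v = \<zero>\<^bsub>N\<^esub>})"
    for D e0 K \<phi> and e :: "'y set \<Rightarrow> 'a"
  define w where "w D e0 K \<phi> = (if \<exists>e. P D e0 K \<phi> e then (SOME e. P D e0 K \<phi> e) ` ?Q else {})"
    for D e0 K \<phi>
  have wP: "P D e0 K \<phi> (SOME e. P D e0 K \<phi> e)" if "\<exists>e. P D e0 K \<phi> e" for D e0 K \<phi>
    using someI_ex[OF that] .
  have wN: "w D e0 K \<phi> \<subseteq> carrier N" for D e0 K \<phi>
  proof (cases "\<exists>e. P D e0 K \<phi> e")
    case True
    have "\<forall>q\<in>?Q. (SOME e. P D e0 K \<phi> e) q \<in> carrier N" using wP[OF True] unfolding P_def by blast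
    then show ?thesis using True unfolding w_def by auto
  qed (simp add: w_def)
  \<comment> \<open>A set closed under \<open>c\<close> realizes within itself all data with
    \<open>e0\<close> in it that can be realized in \<open>N\<close> at all.\<close>
  define c where "c S = (\<Union>D\<in>Pow ?Q. \<Union>e0\<in>PiE D (\<lambda>_. S). \<Union>K\<in>Pow ?F. \<Union>\<phi>\<in>PiE ?Q (\<lambda>_. carrier M). w D e0 K \<phi>)" for S
  have cI: "x \<in> c T" if "D \<in> Pow ?Q" "e0 \<in> PiE D (\<lambda>_. T)" "K \<in> Pow ?F" "\<phi> \<in> PiE ?Q (\<lambda>_. carrier M)"
    "x \<in> w D e0 K \<phi>" for x T D e0 K \<phi>
    unfolding c_def
    by (rule UN_I[OF that(1)], rule UN_I[OF that(2)], rule UN_I[OF that(3)], rule UN_I[OF that(4)], rule that(5))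
  have "\<exists>A\<subseteq>carrier N. c A \<subseteq> A \<and> |A| \<le>o |Pow Y'|"
  proof (rule bounded_closure_within[OF Y'(1)])
    show "c S \<subseteq> carrier N" for S unfolding c_def by (intro UN_least wN)
    show "c S \<subseteq> c T" if "S \<subseteq> T" for S T
    proof -
      have "PiE D (\<lambda>_. S) \<subseteq> PiE D (\<lambda>_. T)" for D :: "'y set set" using that by (intro PiE_mono) auto
      then show ?thesis unfolding c_def by (intro UN_mono order_refl) auto
    qed
    have sub: "|D| \<le>o |Y'|" if "D \<subseteq> ?Q" for D
      using ordLeq_transitive[OF card_of_mono1[OF that] Y'(2)] .
    show "\<exists>T\<subseteq>S. |T| \<le>o |Y'| \<and> x \<in> c T" if x: "x \<in> c S" for S x
    proof -
      obtain D e0 K \<phi> where *: "D \<in> Pow ?Q" "e0 \<in> PiE D (\<lambda>_. S)" "K \<in> Pow ?F" "\<phi> \<in> PiE ?Q (\<lambda>_. carrier M)" "x \<in> w D e0 K \<phi>"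
        using x unfolding c_def by (elim UN_E) (rule that)
      have e0: "e0 ` D \<subseteq> S" "e0 \<in> PiE D (\<lambda>_. e0 ` D)" using *(2) by (auto simp: PiE_iff)
      have "x \<in> c (e0 ` D)" by (rule cI[OF *(1) e0(2) *(3-5)])
      moreover have "|e0 ` D| \<le>o |Y'|" using sub *(1) by (intro image_ordLeq) auto
      ultimately show ?thesis using e0(1) by (intro exI[of _ "e0 ` D"]) simp
    qed
    show "|c S| \<le>o |Pow Y'|" if b: "|S| \<le>o |Pow Y'|" for S
      unfolding c_def
    proof (intro UN_Pow_ordLeq[OF Y'(1)])
      show "|Pow ?Q| \<le>o |Pow Y'|" "|Pow ?F| \<le>o |Pow Y'|" using Y'(2,3) by (auto intro: card_of_Pow_mono)
      show "|PiE D (\<lambda>_. S)| \<le>o |Pow Y'|" if "D \<in> Pow ?Q" for D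
        using that by (intro Func_Pow_ordLeq[OF Y'(1) sub b]) auto
      show "|PiE ?Q (\<lambda>_. carrier M)| \<le>o |Pow Y'|"
        by (intro Func_Pow_ordLeq[OF Y'(1,2)] ordLeq_Pow[OF Y'(4)])
      show "|w D e0 K \<phi>| \<le>o |Pow Y'|" for D e0 K \<phi>
        unfolding w_def using image_ordLeq[OF ordLeq_Pow[OF Y'(2)]] by (auto simp: card_of_empty)
    qed
  qed
  then obtain A where A: "A \<subseteq> carrier N" "c A \<subseteq> A" "|A| \<le>o |Pow Y'|" by blast
  then obtain b where b: "b \<in> carrier N" "b \<notin> A" using big by (metis subset_antisym subsetI)
  obtain B where B: "submod R N B" "{b} \<subseteq> B" "|B| \<le>o |Pow Y|" and
    p: "\<forall>(m::nat) (n::nat) g \<beta> \<xi>. lin R (free R {..<m}) (free R {..<n}) g \<longrightarrow>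
       lin R (free R {..<m}) (sub N B) \<beta> \<longrightarrow> lin R (free R {..<n}) N \<xi> \<longrightarrow>
       (\<forall>v\<in>carrier (free R {..<m}). \<xi> (g v) \<ominus>\<^bsub>N\<^esub> \<beta> v \<in> A) \<longrightarrow>
       (\<exists>\<eta>. lin R (free R {..<n}) (sub N B) \<eta> \<and>
          (\<forall>v\<in>carrier (free R {..<m}). \<eta> (g v) \<ominus>\<^bsub>N\<^esub> \<beta> v \<in> A))"
    using relatively_pure_submod_exists[OF N Y cR, of "{b}" A] b(1) singleton_ordLeq[OF infinite_Pow_ordLeq[OF Y]]
    by (elim meta_impE exE conjE) (auto intro: that)
  note BN = submodD(1)[OF B(1)]
  note mB = right_module_sub[OF N B(1)]
  obtain e where e: "e ` ?Q = B" using B(2,3) card_of_ordLeq2[of B ?Q] by auto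
  have Bq: "\<exists>q. q \<in> ?Q \<and> x = e q" if "x \<in> B" for x using that unfolding e[symmetric] by (elim imageE) (intro exI conjI)
  have eN: "e q \<in> carrier N" if "q \<in> ?Q" for q using e BN that by blast
  obtain we where we: "lin R (free R ?Q) (sub N B) we" "\<forall>q\<in>?Q. we (basis R ?Q q) = e q"
    using free_lift[OF R mB, of ?Q e] e by auto
  note weN = lin_from_into_sub[OF we(1) BN]
  have we_surj: "we ` ?F = carrier (sub N B)"
  proof
    show "we ` ?F \<subseteq> carrier (sub N B)" using lin_closed[OF we(1)] by blast
    show "carrier (sub N B) \<subseteq> we ` ?F"
    proof
      fix x assume "x \<in> carrier (sub N B)"
      then have "x \<in> e ` ?Q" unfolding e by simp
      then obtain q where q: "q \<in> ?Q" "x = e q" by (rule imageE)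
      then have "x = we (basis R ?Q q)" using we(2) by simp
      then show "x \<in> we ` ?F" using basis_closed[OF R q(1)] by (rule image_eqI)
    qed
  qed
  \<comment> \<open>The generators of \<open>B\<close> that already lie in \<open>A\<close> are
    prescribed, so that \<sigma> will fix \<open>B \<inter> A\<close>.\<close>
  define D where "D = {q \<in> ?Q. e q \<in> A}"
  define K where "K = {v \<in> ?F. we v = \<zero>\<^bsub>N\<^esub>}"
  define \<phi> where "\<phi> = (\<lambda>q\<in>?Q. f (e q))"
  have ex: "\<exists>e'. P D (restrict e D) K \<phi> e'"
    unfolding P_def using eN weN we(2) by (intro exI[of _ e]) (auto simp: D_def K_def \<phi>_def)
  define e' where "e' = (SOME e'. P D (restrict e D) K \<phi> e')"
  have e': "P D (restrict e D) K \<phi> e'" unfolding e'_def by (rule wP[OF ex])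
  have "w D (restrict e D) K \<phi> \<subseteq> c A"
  proof -
    have "D \<in> Pow ?Q" "restrict e D \<in> PiE D (\<lambda>_. A)" "K \<in> Pow ?F" "\<phi> \<in> PiE ?Q (\<lambda>_. carrier M)"
      using lin_closed[OF f eN] by (auto simp: D_def K_def \<phi>_def)
    from cI[OF this] show ?thesis by blast
  qed
  then have e'A: "e' q \<in> A" if "q \<in> ?Q" for q using A(2) ex that unfolding w_def e'_def by auto
  obtain w' where w': "lin R (free R ?Q) N w'" "\<forall>q\<in>?Q. w' (basis R ?Q q) = e' q" "K = {v \<in> ?F. w' v = \<zero>\<^bsub>N\<^esub>}"
    using e' unfolding P_def by (elim conjE exE) (rule that)
  \<comment> \<open>Both families have the relations \<open>K\<close>, so sending \<open>e q\<close>
    to \<open>e' q\<close> is well defined on \<open>B\<close>.\<close>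
  have "\<exists>\<sigma>. lin R (sub N B) N \<sigma> \<and> (\<forall>v\<in>?F. \<sigma> (we v) = w' v)"
  proof (rule lin_factor_surj[OF right_module_free[OF R] mB N we(1) we_surj w'(1)])
    fix v assume "v \<in> ?F" "we v = \<zero>\<^bsub>sub N B\<^esub>"
    then have "v \<in> K" unfolding K_def by simp
    then show "w' v = \<zero>\<^bsub>N\<^esub>" using w'(3) by simp
  qed
  then obtain \<sigma> where \<sigma>: "lin R (sub N B) N \<sigma>" "\<forall>v\<in>?F. \<sigma> (we v) = w' v" by blast
  have \<sigma>e: "\<sigma> (e q) = e' q" if "q \<in> ?Q" for q
    using \<sigma>(2) we(2) w'(2) basis_closed[OF R that] that by metis
  have \<sigma>A: "\<sigma> x \<in> A" if "x \<in> B" for x using Bq[OF that] \<sigma>e e'A by (elim exE) simp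
  have \<sigma>f: "f (\<sigma> x) = f x" if xB: "x \<in> B" for x
  proof -
    obtain q where q: "q \<in> ?Q" "x = e q" using Bq[OF xB] by (elim exE conjE) (rule that)
    then have "f (e' q) = \<phi> q" using e' unfolding P_def by (elim conjE) (erule bspec)
    then show ?thesis using q \<sigma>e by (simp add: \<phi>_def)
  qed
  have \<sigma>id: "\<sigma> x = x" if xB: "x \<in> B" and xA: "x \<in> A" for x
  proof -
    obtain q where q: "q \<in> ?Q" "x = e q" using Bq[OF xB] by (elim exE conjE) (rule that)
    then have "q \<in> D" unfolding D_def using xA by simp
    then have "e' q = restrict e D q" using e' unfolding P_def by (elim conjE) (erule bspec)
    then show ?thesis using q \<sigma>e \<open>q \<in> D\<close> by simp
  qed
  define \<tau> where "\<tau> x = x \<ominus>\<^bsub>N\<^esub> \<sigma> x" for x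
  have \<tau>: "lin R (sub N B) N \<tau>"
    unfolding \<tau>_def by (rule lin_difference[OF mB N lin_sub[OF BN lin_id] \<sigma>(1)])
  have \<sigma>N: "\<sigma> x \<in> carrier N" if "x \<in> B" for x using lin_closed[OF \<sigma>(1)] that by simp
  define D' where "D' = \<tau> ` B"
  have sD: "submod R N D'"
    using submod_image[OF mB N \<tau> submod_carrier[OF mB]] unfolding D'_def by simp
  \<comment> \<open>\<sigma> maps \<open>B\<close> into \<open>A\<close>, and \<open>b\<close> is
    outside \<open>A\<close>, so \<sigma> moves \<open>b\<close>.\<close>
  have "D' \<noteq> {\<zero>\<^bsub>N\<^esub>}"
  proof
    assume "D' = {\<zero>\<^bsub>N\<^esub>}"
    then have "\<tau> b = \<zero>\<^bsub>N\<^esub>" using B(2) unfolding D'_def by blast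
    then have "b = \<sigma> b" unfolding \<tau>_def using N.diff_zero_iff b(1) \<sigma>N B(2) by simp
    then show False using \<sigma>A B(2) b(2) by (metis insert_subset)
  qed
  moreover have "\<forall>x\<in>D'. f x = \<zero>\<^bsub>M\<^esub>"
  proof
    fix x assume "x \<in> D'"
    then obtain y where y: "y \<in> B" "x = y \<ominus>\<^bsub>N\<^esub> \<sigma> y" unfolding D'_def \<tau>_def by blast
    then have "f x = f y \<ominus>\<^bsub>M\<^esub> f (\<sigma> y)" using lin_diff[OF N M f] BN \<sigma>N by blast
    moreover have "f y \<in> carrier M" using lin_closed[OF f] y(1) BN by blast
    ultimately show "f x = \<zero>\<^bsub>M\<^esub>" using \<sigma>f[OF y(1)] M.diff_zero_iff by simp
  qed
  \<comment> \<open>Constants in \<open>D'\<close> have the form \<tau> \<beta> with \<beta> in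
    \<open>B\<close>. Since \<xi> g - \<beta> = -\<sigma> \<beta> lies in \<open>A\<close>, the
    relative purity of \<open>B\<close> gives \<eta> in \<open>B\<close> with \<eta> g congruent to
    \<beta> modulo \<open>A\<close>. As \<tau> kills \<open>B \<inter> A\<close>, the map \<tau>
    \<eta> solves the original system inside \<open>D'\<close>.\<close>
  moreover have "\<exists>\<eta>. lin R (free R {..<n}) (sub N D') \<eta> \<and> (\<forall>v\<in>carrier (free R {..<m}). \<eta> (g v) = \<xi> (g v))"
    if g: "lin R (free R {..<m}) (free R {..<n}) g" and \<xi>: "lin R (free R {..<n}) N \<xi>"
      and im: "\<forall>v\<in>carrier (free R {..<m}). \<xi> (g v) \<in> D'" for m n :: nat and g \<xi>
  proof -
    let ?m = "free R {..<m}" and ?n = "free R {..<n}"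
    have "lin R (sub N B) (sub N D') \<tau>" using \<tau> by (intro lin_into_sub) (auto simp: D'_def)
    moreover have "lin R ?m (sub N D') (\<lambda>v. \<xi> (g v))" using lin_into_sub[OF lin_comp[OF g \<xi>]] im by blast
    ultimately obtain \<beta> where \<beta>: "lin R ?m (sub N B) \<beta>" "\<forall>v\<in>carrier ?m. \<tau> (\<beta> v) = \<xi> (g v)"
      using free_projective[OF R mB right_module_sub[OF N sD], of \<tau> "{..<m}" "\<lambda>v. \<xi> (g v)"]
      by (auto simp: D'_def)
    have \<beta>B: "\<beta> v \<in> B" if "v \<in> carrier ?m" for v using lin_closed[OF \<beta>(1) that] by simp
    have "\<xi> (g v) \<ominus>\<^bsub>N\<^esub> \<beta> v \<in> A" if v: "v \<in> carrier ?m" for v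
    proof -
      have \<beta>N: "\<beta> v \<in> carrier N" using \<beta>B[OF v] BN by blast
      have "\<xi> (g v) \<ominus>\<^bsub>N\<^esub> \<beta> v = (\<beta> v \<ominus>\<^bsub>N\<^esub> \<sigma> (\<beta> v)) \<ominus>\<^bsub>N\<^esub> \<beta> v"
        using \<beta>(2) v unfolding \<tau>_def by simp
      also have "\<dots> = \<ominus>\<^bsub>N\<^esub> \<sigma> (\<beta> v)"
        using N.diff_diff_cancel[of "\<zero>\<^bsub>N\<^esub>" "\<sigma> (\<beta> v)" "\<beta> v"] \<beta>N \<sigma>N[OF \<beta>B[OF v]]
        by (simp add: N.diff_zero) (simp add: N.M.minus_eq)
      also have "\<dots> = \<sigma> (\<ominus>\<^bsub>N\<^esub> \<beta> v)"
      proof -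
        have "(\<ominus>\<^bsub>R\<^esub> \<one>\<^bsub>R\<^esub>) \<odot>\<^bsub>N\<^esub> \<beta> v = \<ominus>\<^bsub>N\<^esub> \<beta> v" by (rule N.minus_one_smult[OF \<beta>N])
        then show ?thesis
          using lin_smult[OF \<sigma>(1), of "\<ominus>\<^bsub>R\<^esub> \<one>\<^bsub>R\<^esub>" "\<beta> v"] \<beta>B[OF v] N.minus_one_smult[OF \<sigma>N[OF \<beta>B[OF v]]]
          by simp
      qed
      finally show ?thesis using \<sigma>A[OF N.submod_minus[OF B(1) \<beta>B[OF v]]] by simp
    qed
    then obtain \<eta> where \<eta>: "lin R ?n (sub N B) \<eta>" "\<forall>v\<in>carrier ?m. \<eta> (g v) \<ominus>\<^bsub>N\<^esub> \<beta> v \<in> A"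
      using p g \<beta>(1) \<xi> by blast
    have "\<tau> (\<eta> (g v)) = \<xi> (g v)" if v: "v \<in> carrier ?m" for v
    proof -
      have \<eta>B: "\<eta> (g v) \<in> B" using lin_closed[OF \<eta>(1) lin_closed[OF g v]] by simp
      let ?d = "\<eta> (g v) \<ominus>\<^bsub>N\<^esub> \<beta> v"
      have dB: "?d \<in> B" by (rule N.submod_diff[OF B(1) \<eta>B \<beta>B[OF v]])
      have "\<tau> ?d = \<zero>\<^bsub>N\<^esub>" unfolding \<tau>_def using \<sigma>id[OF dB] \<eta>(2) v dB BN N.diff_zero_iff by auto
      then have "\<tau> (?d \<oplus>\<^bsub>N\<^esub> \<beta> v) = \<tau> (\<beta> v)"
        using lin_add[OF \<tau>, of ?d "\<beta> v"] dB \<beta>B[OF v] lin_closed[OF \<tau>, of "\<beta> v"] by simp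
      moreover have "?d \<oplus>\<^bsub>N\<^esub> \<beta> v = \<eta> (g v)" using N.diff_add_cancel \<eta>B \<beta>B[OF v] BN by blast
      ultimately show ?thesis using \<beta>(2) v by simp
    qed
    moreover have "lin R ?n (sub N D') (\<lambda>v. \<tau> (\<eta> v))"
      using lin_closed[OF \<eta>(1)] by (intro lin_into_sub[OF lin_comp[OF \<eta>(1) \<tau>]]) (auto simp: D'_def)
    ultimately show ?thesis by blast
  qed
  then have "pure_submod R N D'" unfolding pure_submod_def using sD by blast
  ultimately show ?thesis by blast
qed

section \<open>A criterion for covering classes\<close>

locale module_universe = inaccessible_universe ty + R: ring R
  for ty :: "'m itself" and R :: "('r, 'x) ring_scheme" +
  assumes small_ring: "small TYPE('m) (carrier R)"
begin

lemma ring_R: "ring R" by (rule R.ring_axioms)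

lemma small_dsum:
  assumes "small TYPE('m) I" "\<And>i. i \<in> I \<Longrightarrow> small TYPE('m) (carrier (N i))"
  shows "small TYPE('m) (carrier (dsum I N))"
  by (rule small_subset[OF small_PiE[OF assms]]) (auto simp: dsum_simps)

lemma small_free: "small TYPE('m) I \<Longrightarrow> small TYPE('m) (carrier (free R I))"
  unfolding free_def by (rule small_dsum) (auto simp: regm_def small_ring)

text \<open>\<open>Y\<close> is a copy in \<open>'m\<close> of the disjoint union of all sets to be
  bounded, with the naturals added to make it infinite.\<close>

lemma bounding_set_exists:
  fixes X :: "'z set"
  assumes X: "small TYPE('m) X"
  obtains Y :: "'m set" where "small TYPE('m) Y" "infinite Y" "\<And>m::nat. |carrier (free R {..<m})| \<le>o |Y|"
    "|carrier R| \<le>o |Y|" "|X| \<le>o |Y|"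
proof -
  define F where "F = (\<Union>m::nat. carrier (free R {..<m}))"
  define W where "W = (UNIV :: nat set) <+> (F <+> (carrier R <+> X))"
  have Plus: "small TYPE('m) (A <+> B)" if "small TYPE('m) A" "small TYPE('m) B" for A :: "'u set" and B :: "'v set"
    unfolding Plus_def by (intro small_Un small_image that)
  have "small TYPE('m) F" unfolding F_def by (intro small_UN small_nat small_free)
  then have smW: "small TYPE('m) W" unfolding W_def by (intro Plus small_nat small_ring X)
  then obtain h :: "_ \<Rightarrow> 'm" where h: "inj_on h W" using small_imp_inj by blast
  have Wh: "|W| \<le>o |h ` W|" using h card_of_ordLeq[of W "h ` W"] by blast
  have 1: "|A| \<le>o |A <+> B|" and 2: "|B| \<le>o |A <+> B|" for A :: "'u set" and B :: "'v set"
    by (rule card_of_Plus1, rule card_of_Plus2)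
  show thesis
  proof (rule that)
    show "small TYPE('m) (h ` W)" by (rule small_image[OF smW])
    have "|UNIV :: nat set| \<le>o |h ` W|" by (rule ordLeq_transitive[OF _ Wh]) (simp add: W_def 1)
    then show "infinite (h ` W)" by (simp add: infinite_iff_card_of_nat)
    show "|carrier (free R {..<m})| \<le>o |h ` W|" for m :: nat
    proof -
      have "|carrier (free R {..<m})| \<le>o |F|" unfolding F_def by (rule card_of_mono1) blast
      also have "|F| \<le>o |W|" unfolding W_def by (rule ordLeq_transitive[OF 1 2])
      finally show ?thesis by (rule ordLeq_transitive[OF _ Wh])
    qed
    show "|carrier R| \<le>o |h ` W|"
      by (rule ordLeq_transitive[OF _ Wh]) (unfold W_def, rule ordLeq_transitive[OF ordLeq_transitive[OF 1 2] 2])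
    show "|X| \<le>o |h ` W|"
      by (rule ordLeq_transitive[OF _ Wh]) (unfold W_def, rule ordLeq_transitive[OF ordLeq_transitive[OF 2 2] 2])
  qed
qed

lemma small_Plus: "\<lbrakk>small TYPE('m) A; small TYPE('m) B\<rbrakk> \<Longrightarrow> small TYPE('m) (A <+> B)"
  unfolding Plus_def by (intro small_Un small_image)

end

text \<open>The condition speaks of weak coproducts, whose induced maps may fail to be unique. Index
  sets are subsets of \<open>'m\<close>; other small families are re-indexed by an injection into
  \<open>'m\<close>.\<close>

definition closed_under_coproducts :: "('r, 'x) ring_scheme \<Rightarrow> ('r, 'm) module set \<Rightarrow> bool" where
  "closed_under_coproducts R U \<longleftrightarrow>
    (\<forall>(I :: 'm set) N. small TYPE('m) I \<longrightarrow> (\<forall>i\<in>I. N i \<in> U) \<longrightarrow>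
      (\<exists>D\<in>U. \<exists>\<iota>. (\<forall>i\<in>I. lin R (N i) D (\<iota> i)) \<and>
        (\<forall>T\<in>(ModR R :: ('r, 'm) module set). \<forall>u. (\<forall>i\<in>I. lin R (N i) T (u i)) \<longrightarrow>
          (\<exists>w. lin R D T w \<and> (\<forall>i\<in>I. \<forall>x\<in>carrier (N i). w (\<iota> i x) = u i x)))))"

locale coproduct_pure_quotient_class = module_universe ty R
  for ty :: "'m itself" and R :: "('r, 'x) ring_scheme" +
  fixes U :: "('r, 'm) module set"
  assumes U_ModR: "U \<subseteq> ModR R"
    and coproducts: "closed_under_coproducts R U"
    and pure_quotients: "closed_under_pure_quotients R U"
begin

lemma U_mod: "C \<in> U \<Longrightarrow> C \<in> ModR R" "C \<in> U \<Longrightarrow> right_module R C"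
  using U_ModR ModR_module by auto

lemma coproduct_exists:
  fixes N :: "'m \<Rightarrow> ('r, 'm) module"
  assumes "small TYPE('m) I" "\<And>i. i \<in> I \<Longrightarrow> N i \<in> U"
  obtains D \<iota> where "D \<in> U" "\<And>i. i \<in> I \<Longrightarrow> lin R (N i) D (\<iota> i)"
    "\<forall>T\<in>(ModR R :: ('r, 'm) module set). \<forall>u. (\<forall>i\<in>I. lin R (N i) T (u i)) \<longrightarrow>
       (\<exists>w. lin R D T w \<and> (\<forall>i\<in>I. \<forall>x\<in>carrier (N i). w (\<iota> i x) = u i x))"
proof -
  have "\<exists>D\<in>U. \<exists>\<iota>. (\<forall>i\<in>I. lin R (N i) D (\<iota> i)) \<and>
        (\<forall>T\<in>(ModR R :: ('r, 'm) module set). \<forall>u. (\<forall>i\<in>I. lin R (N i) T (u i)) \<longrightarrow>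
          (\<exists>w. lin R D T w \<and> (\<forall>i\<in>I. \<forall>x\<in>carrier (N i). w (\<iota> i x) = u i x)))"
    using coproducts[unfolded closed_under_coproducts_def, rule_format, of I N] assms by simp
  then show thesis by (elim bexE exE conjE) (rule that, assumption, erule (1) bspec, assumption)
qed

lemma pure_quotient_in:
  fixes Q :: "('r, 'm) module"
  assumes D: "D \<in> U" and Q: "Q \<in> ModR R" and q: "lin R D Q q" "q ` carrier D = carrier Q"
    and l: "\<And>(F :: ('r, 'm) module) h. \<lbrakk>F \<in> ModR R; finitely_presented R F; lin R F Q h\<rbrakk>
      \<Longrightarrow> \<exists>g. lin R F D g \<and> (\<forall>x\<in>carrier F. q (g x) = h x)"
  shows "Q \<in> U"
proof -
  note mD = U_mod[OF D]
  have s: "sx R (sub D {x \<in> carrier D. q x = \<zero>\<^bsub>Q\<^esub>}) (\<lambda>x. x) D q Q"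
    by (rule sx_sub[OF mD(1) Q q submod_kernel[OF mD(2) ModR_module[OF Q] q(1)]]) simp
  have "(sub D {x \<in> carrier D. q x = \<zero>\<^bsub>Q\<^esub>}, restrict (\<lambda>x. x) (carrier (sub D {x \<in> carrier D. q x = \<zero>\<^bsub>Q\<^esub>})),
      D, restrict q (carrier D), Q) \<in> pure_exact R"
    by (rule pure_exactI[OF s]) (rule l)
  then show ?thesis
    using pure_quotients D unfolding closed_under_pure_quotients_def by blast
qed

lemma pure_submod_quotient_in:
  fixes Q :: "('r, 'm) module"
  assumes D: "D \<in> U" and P: "pure_submod R D P" and Q: "Q \<in> ModR R" and q: "lin R D Q q" "q ` carrier D = carrier Q"
    and ker: "\<And>x. x \<in> carrier D \<Longrightarrow> q x = \<zero>\<^bsub>Q\<^esub> \<longleftrightarrow> x \<in> P"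
  shows "Q \<in> U"
  using pure_submod_pure_exact[OF ring_R U_mod(1)[OF D] Q q P ker] pure_quotients D
  unfolding closed_under_pure_quotients_def by blast

lemma binary_coproduct_exists:
  assumes "C1 \<in> U" "C2 \<in> U"
  obtains D i1 i2 where "D \<in> U" "lin R C1 D i1" "lin R C2 D i2"
    "\<forall>T\<in>(ModR R :: ('r, 'm) module set). \<forall>u1 u2. lin R C1 T u1 \<longrightarrow> lin R C2 T u2 \<longrightarrow>
       (\<exists>w. lin R D T w \<and> (\<forall>x\<in>carrier C1. w (i1 x) = u1 x) \<and> (\<forall>x\<in>carrier C2. w (i2 x) = u2 x))"
proof -
  obtain a b :: 'm where ab: "a \<noteq> b"
  proof -
    have "\<not> finite (UNIV - {undefined :: 'm})" using infinite_universe by simp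
    then show thesis using that by (metis finite.emptyI Diff_iff insertI1 ex_in_conv)
  qed
  define N where "N i = (if i = a then C1 else C2)" for i :: 'm
  have N: "N a = C1" "N b = C2" using ab by (auto simp: N_def)
  obtain D \<iota> where D: "D \<in> U" "\<And>i. i \<in> {a, b} \<Longrightarrow> lin R (N i) D (\<iota> i)"
    and w: "\<forall>T\<in>(ModR R :: ('r, 'm) module set). \<forall>u. (\<forall>i\<in>{a, b}. lin R (N i) T (u i)) \<longrightarrow>
       (\<exists>w. lin R D T w \<and> (\<forall>i\<in>{a, b}. \<forall>x\<in>carrier (N i). w (\<iota> i x) = u i x))"
  proof (rule coproduct_exists[of "{a, b}" N])
    show "small TYPE('m) {a, b}" by (rule small_finite) simp
    show "N i \<in> U" if "i \<in> {a, b}" for i using assms by (simp add: N_def)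
  qed (rule that)
  show thesis
  proof (rule that[OF D(1), of "\<iota> a" "\<iota> b"])
    show "lin R C1 D (\<iota> a)" "lin R C2 D (\<iota> b)" using D(2)[of a] D(2)[of b] N by auto
    show "\<forall>T\<in>(ModR R :: ('r, 'm) module set). \<forall>u1 u2. lin R C1 T u1 \<longrightarrow> lin R C2 T u2 \<longrightarrow>
       (\<exists>w. lin R D T w \<and> (\<forall>x\<in>carrier C1. w (\<iota> a x) = u1 x) \<and> (\<forall>x\<in>carrier C2. w (\<iota> b x) = u2 x))"
    proof (intro ballI allI impI)
    fix T :: "('r, 'm) module" and u1 u2 assume T: "T \<in> ModR R" "lin R C1 T u1" "lin R C2 T u2"
    define u where "u i = (if i = a then u1 else u2)" for i :: 'm
    have u: "u a = u1" "u b = u2" using ab by (auto simp: u_def)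
    have "\<exists>w. lin R D T w \<and> (\<forall>i\<in>{a, b}. \<forall>x\<in>carrier (N i). w (\<iota> i x) = u i x)"
      by (rule w[rule_format, OF T(1)]) (use T N u in auto)
    then show "\<exists>w. lin R D T w \<and> (\<forall>x\<in>carrier C1. w (\<iota> a x) = u1 x) \<and> (\<forall>x\<in>carrier C2. w (\<iota> b x) = u2 x)"
      using N u by auto
    qed
  qed
qed

end

text \<open>Serves to place the finitely many generators and relations of a finitely presented
  module in one member of a directed union.\<close>

lemma finite_subset_directed:
  assumes "finite X" "X \<subseteq> (\<Union>s\<in>S. h s)" "S \<noteq> {}"
    and dir: "\<And>s t. \<lbrakk>s \<in> S; t \<in> S\<rbrakk> \<Longrightarrow> \<exists>r\<in>S. h s \<subseteq> h r \<and> h t \<subseteq> h r"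
  shows "\<exists>s\<in>S. X \<subseteq> h s"
  using assms(1,2)
proof (induction rule: finite_induct)
  case empty
  then show ?case using assms(3) by blast
next
  case (insert x X)
  then obtain s t where "s \<in> S" "X \<subseteq> h s" "t \<in> S" "x \<in> h t" by auto
  then show ?case using dir[of s t] by blast
qed

subsection \<open>Modules over a fixed module as subquotients of a free module\<close>

text \<open>
  Every map \<open>f : C \<rightarrow> M\<close> with \<open>C\<close> in the class is represented by submodules \<open>K \<subseteq> A\<close> of
  the free module \<open>G\<close> with \<open>C \<cong> A/K\<close> such that \<open>f\<close> is induced by \<open>\<Phi> : G \<rightarrow> M\<close>.  Since \<open>\<Phi>\<close>
  hits each element of \<open>M\<close> by a large set of basis elements, maps over \<open>M\<close> are represented
  by inclusions, whence direct limits become unions.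
\<close>

locale class_over = coproduct_pure_quotient_class ty R U
  for ty :: "'m itself" and R :: "('r, 'x) ring_scheme" and U :: "('r, 'm) module set" +
  fixes M :: "('r, 'm) module" and \<Phi> :: "('m \<times> 'm \<Rightarrow> 'r) \<Rightarrow> 'm"
  assumes M: "M \<in> ModR R"
    and \<Phi>: "lin R (free R UNIV) M \<Phi>"
    and \<Phi>_basis: "\<And>a b. a \<in> carrier M \<Longrightarrow> \<Phi> (basis R UNIV (a, b)) = a"
begin

abbreviation G :: "('r, 'm \<times> 'm \<Rightarrow> 'r) module" where "G \<equiv> free R UNIV"

lemma modM: "right_module R M" using M by (rule ModR_module)
lemma modG: "right_module R G" using ring_R by (rule right_module_free)

text \<open>\<open>A\<close> is enlarged by one basis element of \<open>G\<close> for each element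
  \<open>x\<close> of \<open>C\<close>, indexed by \<open>(f x, \<psi> x)\<close>: the first
  coordinate makes \<open>\<Phi>\<close> compatible with \<open>f\<close>, the second stays away
  from the supports of the elements of \<open>A\<close>.\<close>

lemma saturation:
  fixes C :: "('r, 'm) module"
  assumes A: "submod R G A" "small TYPE('m) A" and C: "C \<in> ModR R" and f: "lin R C M f"
    and v: "lin R (sub G A) C v" "\<And>x. x \<in> A \<Longrightarrow> f (v x) = \<Phi> x"
  obtains A' v' where "submod R G A'" "small TYPE('m) A'" "A \<subseteq> A'" "lin R (sub G A') C v'" "v' ` A' = carrier C"
    "\<And>x. x \<in> A \<Longrightarrow> v' x = v x" "\<And>x. x \<in> A' \<Longrightarrow> f (v' x) = \<Phi> x"
proof -
  note mC = ModR_module[OF C]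
  interpret C: right_module R C by (rule mC)
  interpret M: right_module R M by (rule modM)
  interpret G: right_module R G by (rule modG)
  note AG = submodD(1)[OF A(1)]
  define S where "S = (\<Union>x\<in>A. supp UNIV (\<lambda>_. regm R) x)"
  have "small TYPE('m) S" unfolding S_def
    by (rule small_UN[OF A(2)]) (use AG in \<open>auto intro!: small_finite simp: free_def dsum_simps\<close>)
  then obtain \<psi> :: "'m \<Rightarrow> 'm" where \<psi>: "inj_on \<psi> (carrier C)" "\<psi> ` carrier C \<inter> snd ` S = {}"
    using small_avoid[OF ModR_small[OF C], of "snd ` S"] small_image[of S snd] by blast
  define \<beta> where "\<beta> c = (f c, \<psi> c)" for c
  define B where "B = \<beta> ` carrier C"
  have BS: "B \<inter> S = {}" using \<psi>(2) unfolding B_def \<beta>_def by force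
  have \<beta>inj: "inj_on \<beta> (carrier C)" using \<psi>(1) unfolding \<beta>_def inj_on_def by auto
  define c where "c i = (if i \<in> B then inv_into (carrier C) \<beta> i else \<zero>\<^bsub>C\<^esub>)" for i
  have c: "c i \<in> carrier C" for i
    unfolding c_def B_def using inv_into_into[of i \<beta> "carrier C"] by auto
  have c\<beta>: "c (\<beta> x) = x" if "x \<in> carrier C" for x
    unfolding c_def B_def using that \<beta>inj by simp
  obtain lam where lam: "lin R G C lam" "\<And>i. lam (basis R UNIV i) = c i"
    using free_lift[OF ring_R mC, of UNIV c] c by auto
  \<comment> \<open>\<rho> erases the coordinates in \<open>B\<close> and fixes \<open>A\<close>,
    whose supports avoid \<open>B\<close>. The elements \<open>x\<close> with \<rho> x in
    \<open>A\<close> therefore split into a part in \<open>A\<close> and a part on the new basis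
    elements, and the two parts can be mapped separately.\<close>
  define \<rho> where "\<rho> x = (\<lambda>i. if i \<in> B then \<zero>\<^bsub>R\<^esub> else x i)" for x :: "'m \<times> 'm \<Rightarrow> 'r"
  have fin: "finite (supp UNIV (\<lambda>_. regm R) (\<rho> x))" if "finite (supp UNIV (\<lambda>_. regm R) x)" for x
    by (rule finite_subset[OF _ that]) (auto simp: supp_def \<rho>_def regm_def)
  have \<rho>: "lin R G G \<rho>"
    by (rule linI) (auto simp: free_def dsum_simps fin PiE_iff, auto simp: \<rho>_def regm_def fun_eq_iff)
  have \<rho>basis: "\<rho> (basis R UNIV i) = (if i \<in> B then \<zero>\<^bsub>G\<^esub> else basis R UNIV i)" for i
    by (auto simp: \<rho>_def basis_def dsum_in_def free_def dsum_simps regm_def fun_eq_iff)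
  have \<rho>A: "\<rho> x = x" if "x \<in> A" for x
  proof
    fix i
    show "\<rho> x i = x i"
    proof (cases "i \<in> B")
      case True
      then have "i \<notin> supp UNIV (\<lambda>_. regm R) x" using BS that unfolding S_def by blast
      then show ?thesis using True by (simp add: supp_def \<rho>_def regm_def)
    qed (simp add: \<rho>_def)
  qed
  have bG: "basis R UNIV i \<in> carrier G" for i by (rule basis_closed[OF ring_R]) simp
  have lam\<rho>: "lam (\<rho> x) = \<zero>\<^bsub>C\<^esub>" if "x \<in> carrier G" for x
  proof (rule free_unique[OF ring_R mC lin_comp[OF \<rho> lam(1)] lin_zero_map[OF mC] _ that])
    show "lam (\<rho> (basis R UNIV i)) = \<zero>\<^bsub>C\<^esub>" for i
      using lam(2)[of i] lin_zero[OF modG mC lam(1)] by (simp add: \<rho>basis c_def)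
  qed
  have \<Phi>lam: "f (lam x) = \<Phi> (x \<ominus>\<^bsub>G\<^esub> \<rho> x)" if "x \<in> carrier G" for x
  proof (rule free_unique[OF ring_R modM lin_comp[OF lam(1) f] lin_comp[OF lin_difference[OF modG modG lin_id \<rho>] \<Phi>] _ that])
    fix i
    show "f (lam (basis R UNIV i)) = \<Phi> (basis R UNIV i \<ominus>\<^bsub>G\<^esub> \<rho> (basis R UNIV i))"
    proof (cases "i \<in> B")
      case True
      then obtain y where y: "y \<in> carrier C" "i = \<beta> y" unfolding B_def by blast
      then have "f (lam (basis R UNIV i)) = f y" using lam(2) c\<beta> by simp
      also have "\<dots> = \<Phi> (basis R UNIV i)" using y \<Phi>_basis[OF lin_closed[OF f y(1)]] by (simp add: \<beta>_def)
      finally show ?thesis using True \<rho>basis G.diff_zero[OF bG] by simp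
    next
      case False
      then have "basis R UNIV i \<ominus>\<^bsub>G\<^esub> \<rho> (basis R UNIV i) = \<zero>\<^bsub>G\<^esub>" using \<rho>basis G.diff_zero_iff[OF bG bG] by simp
      moreover have "f (lam (basis R UNIV i)) = \<zero>\<^bsub>M\<^esub>"
        using False lam(2)[of i] lin_zero[OF mC modM f] by (simp add: c_def)
      ultimately show ?thesis using lin_zero[OF modG modM \<Phi>] by simp
    qed
  qed
  define A' where "A' = {x \<in> carrier G. \<rho> x \<in> A}"
  have sA': "submod R G A'" unfolding A'_def by (rule submod_vimage[OF modG modG \<rho> A(1)])
  have smB: "small TYPE('m) B" unfolding B_def by (rule small_image[OF ModR_small[OF C]])
  have smA': "small TYPE('m) A'"
  proof (rule small_inj_on)
    show "inj_on (\<lambda>x. (\<rho> x, restrict x B)) A'"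
    proof (rule inj_onI)
      fix x y :: "'m \<times> 'm \<Rightarrow> 'r" assume e: "(\<rho> x, restrict x B) = (\<rho> y, restrict y B)"
      show "x = y"
      proof
        fix i
        have "\<rho> x i = \<rho> y i" "restrict x B i = restrict y B i" using e by auto
        then show "x i = y i" by (cases "i \<in> B") (auto simp: \<rho>_def)
      qed
    qed
    show "(\<lambda>x. (\<rho> x, restrict x B)) ` A' \<subseteq> A \<times> PiE B (\<lambda>_. carrier R)"
      unfolding A'_def by (auto simp: free_def dsum_simps regm_def PiE_iff)
    show "small TYPE('m) (A \<times> PiE B (\<lambda>_. carrier R))"
      by (intro small_Times A(2) small_PiE smB small_ring)
  qed
  define v' where "v' x = v (\<rho> x) \<oplus>\<^bsub>C\<^esub> lam x" for x
  have A'G: "A' \<subseteq> carrier G" unfolding A'_def by blast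
  have \<rho>A': "lin R (sub G A') (sub G A) \<rho>"
    by (rule lin_into_sub[OF lin_sub[OF A'G \<rho>]]) (simp add: A'_def)
  have v': "lin R (sub G A') C v'"
    unfolding v'_def
    by (rule lin_sum[OF right_module_sub[OF modG sA'] mC lin_comp[OF \<rho>A' v(1)] lin_sub[OF A'G lam(1)]])
  have AA': "A \<subseteq> A'" unfolding A'_def using AG \<rho>A by auto
  have v'A: "v' x = v x" if "x \<in> A" for x
  proof -
    have "lam x = \<zero>\<^bsub>C\<^esub>" using lam\<rho>[of x] \<rho>A[OF that] AG that by auto
    then show ?thesis unfolding v'_def \<rho>A[OF that] using lin_closed[OF v(1), of x] that by simp
  qed
  have surj: "v' ` A' = carrier C"
  proof
    show "v' ` A' \<subseteq> carrier C" using lin_closed[OF v'] by auto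
    show "carrier C \<subseteq> v' ` A'"
    proof
      fix y assume y: "y \<in> carrier C"
      let ?x = "basis R UNIV (\<beta> y)"
      have r: "\<rho> ?x = \<zero>\<^bsub>G\<^esub>" using y \<rho>basis by (simp add: B_def)
      have "v \<zero>\<^bsub>G\<^esub> = \<zero>\<^bsub>C\<^esub>" using lin_zero[OF right_module_sub[OF modG A(1)] mC v(1)] by simp
      then have "v' ?x = y" unfolding v'_def r lam(2) c\<beta>[OF y] using y by simp
      moreover have "?x \<in> A'" unfolding A'_def using r bG submodD(2)[OF A(1)] by simp
      ultimately show "y \<in> v' ` A'" by force
    qed
  qed
  have fv': "f (v' x) = \<Phi> x" if x: "x \<in> A'" for x
  proof -
    have xG: "x \<in> carrier G" and rA: "\<rho> x \<in> A" using x unfolding A'_def by auto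
    have "f (v' x) = f (v (\<rho> x)) \<oplus>\<^bsub>M\<^esub> f (lam x)"
      unfolding v'_def using lin_add[OF f] lin_closed[OF v(1), of "\<rho> x"] rA lin_closed[OF lam(1) xG] by simp
    also have "\<dots> = \<Phi> (\<rho> x) \<oplus>\<^bsub>M\<^esub> \<Phi> (x \<ominus>\<^bsub>G\<^esub> \<rho> x)" using v(2)[OF rA] \<Phi>lam[OF xG] by simp
    also have "\<dots> = \<Phi> (\<rho> x \<oplus>\<^bsub>G\<^esub> (x \<ominus>\<^bsub>G\<^esub> \<rho> x))"
      using lin_add[OF \<Phi>, of "\<rho> x" "x \<ominus>\<^bsub>G\<^esub> \<rho> x"] lin_closed[OF \<rho> xG] xG by simp
    also have "\<dots> = \<Phi> x" using G.add_diff[OF xG lin_closed[OF \<rho> xG]] by simp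
    finally show ?thesis .
  qed
  show thesis by (rule that[OF sA' smA' AA' v' surj v'A fv'])
qed

definition presents :: "('m \<times> 'm \<Rightarrow> 'r) set \<Rightarrow> ('m \<times> 'm \<Rightarrow> 'r) set \<Rightarrow> ('r, 'm) module
    \<Rightarrow> (('m \<times> 'm \<Rightarrow> 'r) \<Rightarrow> 'm) \<Rightarrow> ('m \<Rightarrow> 'm) \<Rightarrow> bool" where
  "presents A K C \<pi> f \<longleftrightarrow> C \<in> U \<and> submod R G A \<and> small TYPE('m) A \<and> lin R (sub G A) C \<pi> \<and>
     \<pi> ` A = carrier C \<and> K = {x \<in> A. \<pi> x = \<zero>\<^bsub>C\<^esub>} \<and> lin R C M f \<and> (\<forall>x\<in>A. f (\<pi> x) = \<Phi> x)"

definition obj :: "('m \<times> 'm \<Rightarrow> 'r) set \<Rightarrow> ('m \<times> 'm \<Rightarrow> 'r) set \<Rightarrow> bool" where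
  "obj A K \<longleftrightarrow> (\<exists>C \<pi> f. presents A K C \<pi> f)"

lemma presentsD:
  assumes "presents A K C \<pi> f"
  shows "C \<in> U" "submod R G A" "small TYPE('m) A" "lin R (sub G A) C \<pi>" "\<pi> ` A = carrier C"
    "K = {x \<in> A. \<pi> x = \<zero>\<^bsub>C\<^esub>}" "lin R C M f" "\<And>x. x \<in> A \<Longrightarrow> f (\<pi> x) = \<Phi> x" "right_module R C"
    "right_module R (sub G A)" "\<And>x. x \<in> A \<Longrightarrow> \<pi> x \<in> carrier C" "A \<subseteq> carrier G" "K \<subseteq> A" "obj A K"
proof -
  show *: "C \<in> U" "submod R G A" "small TYPE('m) A" "lin R (sub G A) C \<pi>" "\<pi> ` A = carrier C"
    "K = {x \<in> A. \<pi> x = \<zero>\<^bsub>C\<^esub>}" "lin R C M f" "\<And>x. x \<in> A \<Longrightarrow> f (\<pi> x) = \<Phi> x" "K \<subseteq> A"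
    using assms unfolding presents_def by auto
  show "right_module R C" using U_mod(2)[OF *(1)] .
  show "right_module R (sub G A)" using right_module_sub[OF modG *(2)] .
  show "\<pi> x \<in> carrier C" if "x \<in> A" for x using *(5) that by blast
  show "A \<subseteq> carrier G" using submodD(1)[OF *(2)] .
  show "obj A K" unfolding obj_def using assms by blast
qed

lemma presents_exists:
  assumes C: "C \<in> U" and f: "lin R C M f"
  obtains A K \<pi> where "presents A K C \<pi> f"
proof -
  interpret G: right_module R G by (rule modG)
  have s0: "submod R G {\<zero>\<^bsub>G\<^esub>}" by (rule submod_zero[OF modG])
  obtain A' v' where *: "submod R G A'" "small TYPE('m) A'" "lin R (sub G A') C v'" "v' ` A' = carrier C"
    "\<And>x. x \<in> A' \<Longrightarrow> f (v' x) = \<Phi> x"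
  proof (rule saturation[OF s0 small_finite U_mod(1)[OF C] f lin_zero_map[OF U_mod(2)[OF C]]])
    show "f \<zero>\<^bsub>C\<^esub> = \<Phi> x" if "x \<in> {\<zero>\<^bsub>G\<^esub>}" for x
      using that lin_zero[OF U_mod(2)[OF C] modM f] lin_zero[OF modG modM \<Phi>] by simp
  qed auto
  then show thesis using that[of A' "{x \<in> A'. v' x = \<zero>\<^bsub>C\<^esub>}" v'] C f unfolding presents_def by auto
qed

text \<open>\<open>saturation\<close> is applied to \<open>u\<close> after \<open>\<pi>\<close>.
  Together with the converse \<open>presents_map\<close>, maps over \<open>M\<close> become
  inclusions of pairs.\<close>

lemma presents_extend:
  assumes p: "presents A K C \<pi> f" and C': "C' \<in> U" "lin R C' M f'" and u: "lin R C C' u" "\<And>x. x \<in> carrier C \<Longrightarrow> f' (u x) = f x"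
  obtains A' K' \<pi>' where "presents A' K' C' \<pi>' f'" "A \<subseteq> A'" "K \<subseteq> K'" "\<And>x. x \<in> A \<Longrightarrow> \<pi>' x = u (\<pi> x)"
proof -
  note d = presentsD[OF p]
  obtain A' v' where *: "submod R G A'" "small TYPE('m) A'" "A \<subseteq> A'" "lin R (sub G A') C' v'" "v' ` A' = carrier C'"
    "\<And>x. x \<in> A \<Longrightarrow> v' x = u (\<pi> x)" "\<And>x. x \<in> A' \<Longrightarrow> f' (v' x) = \<Phi> x"
  proof (rule saturation[OF d(2,3) U_mod(1)[OF C'(1)] C'(2) lin_comp[OF d(4) u(1)]])
    show "f' (u (\<pi> x)) = \<Phi> x" if "x \<in> A" for x using u(2) d(8,11) that by simp
  qed auto
  let ?K = "{x \<in> A'. v' x = \<zero>\<^bsub>C'\<^esub>}"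
  have "K \<subseteq> ?K" using *(3,6) d(6) lin_zero[OF d(9) U_mod(2)[OF C'(1)] u(1)] by auto
  moreover have "presents A' ?K C' v' f'" using * C' unfolding presents_def by auto
  ultimately show thesis using that * by blast
qed

lemma presents_map:
  assumes p: "presents A K C \<pi> f" and p': "presents A' K' C' \<pi>' f'" and le: "A \<subseteq> A'" "K \<subseteq> K'"
  obtains u where "lin R C C' u" "\<And>x. x \<in> A \<Longrightarrow> u (\<pi> x) = \<pi>' x" "\<And>y. y \<in> carrier C \<Longrightarrow> f' (u y) = f y"
proof -
  note d = presentsD[OF p] and d' = presentsD[OF p']
  have l: "lin R (sub G A) C' \<pi>'" using lin_sub[of A "sub G A'", OF _ d'(4)] le(1) by simp
  have "\<exists>u. lin R C C' u \<and> (\<forall>x\<in>carrier (sub G A). u (\<pi> x) = \<pi>' x)"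
    by (rule lin_factor_surj[OF d(10,9) d'(9) d(4) _ l]) (use d(5,6) d'(6) le in auto)
  then obtain u where u: "lin R C C' u" "\<And>x. x \<in> A \<Longrightarrow> u (\<pi> x) = \<pi>' x" by auto
  have "f' (u y) = f y" if y: "y \<in> carrier C" for y
  proof -
    obtain x where "x \<in> A" "y = \<pi> x" using y d(5) by blast
    then show ?thesis using u(2) d(8) d'(8) le(1) by auto
  qed
  then show thesis using that u by blast
qed

text \<open>The unions represent the direct limit \<open>?A/?K\<close> of the given modules. It is a
  pure quotient of their coproduct, because a map from a finitely presented module into the limit
  already factors through one stage; hence it lies in the class.\<close>

lemma obj_Union:
  assumes S: "small TYPE('m) S" "S \<noteq> {}" and o: "\<And>s. s \<in> S \<Longrightarrow> obj (fst s) (snd s)"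
    and dir: "\<And>s t. \<lbrakk>s \<in> S; t \<in> S\<rbrakk> \<Longrightarrow> \<exists>r\<in>S. fst s \<subseteq> fst r \<and> snd s \<subseteq> snd r \<and> fst t \<subseteq> fst r \<and> snd t \<subseteq> snd r"
  shows "obj (\<Union>s\<in>S. fst s) (\<Union>s\<in>S. snd s)"
proof -
  let ?A = "\<Union>s\<in>S. fst s" and ?K = "\<Union>s\<in>S. snd s"
  have "\<forall>s. \<exists>C \<pi> f. s \<in> S \<longrightarrow> presents (fst s) (snd s) C \<pi> f" using o unfolding obj_def by blast
  then obtain C \<pi> f where p: "\<And>s. s \<in> S \<Longrightarrow> presents (fst s) (snd s) (C s) (\<pi> s) (f s)" by metis
  note d = presentsD[OF p]
  have sA: "submod R G ?A"
  proof (rule submodI)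
    show "?A \<subseteq> carrier G" using d(12) by blast
    show "\<zero>\<^bsub>G\<^esub> \<in> ?A" using S(2) submodD(2)[OF d(2)] by blast
    fix x y assume "x \<in> ?A" "y \<in> ?A"
    then obtain s t where "s \<in> S" "x \<in> fst s" "t \<in> S" "y \<in> fst t" by blast
    moreover then obtain r where "r \<in> S" "fst s \<subseteq> fst r" "fst t \<subseteq> fst r" using dir[of s t] by blast
    ultimately have "x \<oplus>\<^bsub>G\<^esub> y \<in> fst r" using submodD(3)[OF d(2)] by blast
    then show "x \<oplus>\<^bsub>G\<^esub> y \<in> ?A" using \<open>r \<in> S\<close> by blast
  next
    fix r x assume "r \<in> carrier R" "x \<in> ?A"
    then show "r \<odot>\<^bsub>G\<^esub> x \<in> ?A" using submodD(4)[OF d(2)] by blast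
  qed
  have zK: "\<pi> s x = \<zero>\<^bsub>C s\<^esub> \<longleftrightarrow> x \<in> snd s" if "s \<in> S" "x \<in> fst s" for s x
    using d(6)[OF that(1)] that(2) by blast
  have sK1: "submod R (sub G (fst s)) (snd s)" if "s \<in> S" for s
    using submod_kernel[OF d(10,9,4)[OF that]] d(6)[OF that] by simp
  have KA: "?K \<subseteq> ?A" using d(13) by blast
  have sK: "submod R (sub G ?A) ?K"
  proof (rule submodI)
    show "?K \<subseteq> carrier (sub G ?A)" using KA by simp
    show "\<zero>\<^bsub>sub G ?A\<^esub> \<in> ?K" using S(2) submodD(2)[OF sK1] by auto
    fix x y assume "x \<in> ?K" "y \<in> ?K"
    then obtain s t where "s \<in> S" "x \<in> snd s" "t \<in> S" "y \<in> snd t" by blast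
    moreover then obtain r where "r \<in> S" "snd s \<subseteq> snd r" "snd t \<subseteq> snd r" using dir[of s t] by blast
    ultimately have "x \<oplus>\<^bsub>G\<^esub> y \<in> snd r" using submodD(3)[OF sK1[of r], of x y] by auto
    then show "x \<oplus>\<^bsub>sub G ?A\<^esub> y \<in> ?K" using \<open>r \<in> S\<close> by auto
  next
    fix r x assume "r \<in> carrier R" "x \<in> ?K"
    then show "r \<odot>\<^bsub>sub G ?A\<^esub> x \<in> ?K" using submodD(4)[OF sK1, of _ r x] by auto
  qed
  have smA: "small TYPE('m) ?A" by (rule small_UN[OF S(1)]) (rule d(3))
  note mA = right_module_sub[OF modG sA]
  obtain Q :: "('r, 'm) module" and \<theta> where Q: "Q \<in> ModR R" and \<theta>: "lin R (sub G ?A) Q \<theta>" "\<theta> ` ?A = carrier Q"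
    "\<And>x. x \<in> ?A \<Longrightarrow> \<theta> x = \<zero>\<^bsub>Q\<^esub> \<longleftrightarrow> x \<in> ?K"
  proof -
    have "\<exists>Q \<in> (ModR R :: ('r, 'm) module set). \<exists>\<theta>. lin R (sub G ?A) Q \<theta> \<and>
        \<theta> ` carrier (sub G ?A) = carrier Q \<and> (\<forall>x\<in>carrier (sub G ?A). \<theta> x = \<zero>\<^bsub>Q\<^esub> \<longleftrightarrow> x \<in> ?K)"
      by (rule quotient_exists[OF mA sK]) (use smA in simp)
    moreover have "carrier (sub G ?A) = ?A" by simp
    ultimately have "\<exists>Q \<in> (ModR R :: ('r, 'm) module set). \<exists>\<theta>. lin R (sub G ?A) Q \<theta> \<and>
        \<theta> ` ?A = carrier Q \<and> (\<forall>x\<in>?A. \<theta> x = \<zero>\<^bsub>Q\<^esub> \<longleftrightarrow> x \<in> ?K)" by (simp only:)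
    then show thesis by (elim bexE exE conjE) (rule that, assumption, assumption, assumption, erule (1) bspec)
  qed
  note mQ = ModR_module[OF Q]
  have \<theta>s: "lin R (sub G (fst s)) Q \<theta>" if "s \<in> S" for s
    using lin_sub[of "fst s" "sub G ?A", OF _ \<theta>(1)] that by auto
  have "\<exists>q. lin R (C s) Q q \<and> (\<forall>x\<in>fst s. q (\<pi> s x) = \<theta> x)" if s: "s \<in> S" for s
  proof -
    have "\<exists>q. lin R (C s) Q q \<and> (\<forall>x\<in>carrier (sub G (fst s)). q (\<pi> s x) = \<theta> x)"
    proof (rule lin_factor_surj[OF d(10,9)[OF s] mQ d(4)[OF s] _ \<theta>s[OF s]])
      show "\<pi> s ` carrier (sub G (fst s)) = carrier (C s)" using d(5)[OF s] by simp
      fix x assume x: "x \<in> carrier (sub G (fst s))" "\<pi> s x = \<zero>\<^bsub>C s\<^esub>"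
      then have "x \<in> ?K" "x \<in> ?A" using zK[OF s, of x] s by auto
      then show "\<theta> x = \<zero>\<^bsub>Q\<^esub>" using \<theta>(3) by simp
    qed
    then show ?thesis by simp
  qed
  then obtain q where q: "\<And>s. s \<in> S \<Longrightarrow> lin R (C s) Q (q s)" "\<And>s x. \<lbrakk>s \<in> S; x \<in> fst s\<rbrakk> \<Longrightarrow> q s (\<pi> s x) = \<theta> x"
    by metis
  \<comment> \<open>Coproducts are indexed by subsets of \<open>'m\<close>, so the family is moved
    along an injection.\<close>
  obtain j :: "_ \<Rightarrow> 'm" where j: "inj_on j S" using small_imp_inj[OF S(1)] by blast
  define k where "k = inv_into S j"
  have k: "k (j s) = s" if "s \<in> S" for s unfolding k_def using j that by simp
  have kS: "k i \<in> S" if "i \<in> j ` S" for i using that k by auto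
  obtain D \<iota> where D: "D \<in> U" and \<iota>: "\<And>i. i \<in> j ` S \<Longrightarrow> lin R (C (k i)) D (\<iota> i)"
    and lift: "\<forall>T\<in>(ModR R :: ('r, 'm) module set). \<forall>u. (\<forall>i\<in>j ` S. lin R (C (k i)) T (u i)) \<longrightarrow>
       (\<exists>w. lin R D T w \<and> (\<forall>i\<in>j ` S. \<forall>x\<in>carrier (C (k i)). w (\<iota> i x) = u i x))"
  proof (rule coproduct_exists[of "j ` S" "\<lambda>i. C (k i)"])
    show "small TYPE('m) (j ` S)" by (rule small_image[OF S(1)])
    show "C (k i) \<in> U" if "i \<in> j ` S" for i by (rule d(1)[OF kS[OF that]])
  qed (rule that)
  have "\<exists>w. lin R D Q w \<and> (\<forall>i\<in>j ` S. \<forall>x\<in>carrier (C (k i)). w (\<iota> i x) = q (k i) x)"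
    by (rule lift[rule_format, OF Q]) (intro q(1) kS)
  then obtain w where w: "lin R D Q w" "\<And>s x. \<lbrakk>s \<in> S; x \<in> carrier (C s)\<rbrakk> \<Longrightarrow> w (\<iota> (j s) x) = q s x"
    using k by auto
  have \<iota>s: "lin R (C s) D (\<iota> (j s))" if "s \<in> S" for s using \<iota>[of "j s"] k[OF that] that by simp
  have w\<theta>: "w (\<iota> (j s) (\<pi> s x)) = \<theta> x" if "s \<in> S" "x \<in> fst s" for s x
    using w(2)[OF that(1) d(11)[OF that]] q(2)[OF that] by simp
  have "Q \<in> U"
  proof (rule pure_quotient_in[OF D Q w(1)])
    show "w ` carrier D = carrier Q"
    proof
      show "w ` carrier D \<subseteq> carrier Q" using lin_closed[OF w(1)] by blast
      show "carrier Q \<subseteq> w ` carrier D"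
      proof
        fix y assume "y \<in> carrier Q"
        then obtain x s where "s \<in> S" "x \<in> fst s" "y = \<theta> x" using \<theta>(2) by blast
        then have "y = w (\<iota> (j s) (\<pi> s x))" "\<iota> (j s) (\<pi> s x) \<in> carrier D"
          using w\<theta> lin_closed[OF \<iota>s] d(11) by auto
        then show "y \<in> w ` carrier D" by blast
      qed
    qed
    fix F :: "('r, 'm) module" and h assume F: "F \<in> ModR R" "finitely_presented R F" "lin R F Q h"
    note mF = ModR_module[OF F(1)]
    obtain m n :: nat and g a where fp: "lin R (free R {..<m}) (free R {..<n}) g" "lin R (free R {..<n}) F a"
      "a ` carrier (free R {..<n}) = carrier F"
      "g ` carrier (free R {..<m}) = {v \<in> carrier (free R {..<n}). a v = \<zero>\<^bsub>F\<^esub>}"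
      using F(2) unfolding finitely_presented_iff[OF ring_R mF] by (elim exE conjE) (rule that)
    have "\<theta> ` carrier (sub G ?A) = carrier Q" using \<theta>(2) by simp
    then obtain \<xi> where \<xi>: "lin R (free R {..<n}) (sub G ?A) \<xi>" "\<forall>x\<in>carrier (free R {..<n}). \<theta> (\<xi> x) = h (a x)"
      using free_projective[OF ring_R mA mQ \<theta>(1) _ lin_comp[OF fp(2) F(3)]] by blast
    \<comment> \<open>The lifts of the finitely many generators of \<open>F\<close> lie in one
      stage, and the finitely many relations vanish in another; a stage above both receives a map
      from \<open>F\<close>.\<close>
    have "\<exists>s\<in>S. (\<lambda>i. \<xi> (basis R {..<n} i)) ` {..<n} \<subseteq> fst s"
      using lin_closed[OF \<xi>(1) basis_closed[OF ring_R]] dir S(2)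
      by (intro finite_subset_directed) (auto, metis)
    then obtain s where s: "s \<in> S" "\<And>i. i \<in> {..<n} \<Longrightarrow> \<xi> (basis R {..<n} i) \<in> fst s" by blast
    have K: "\<xi> (g v) \<in> ?K" if "v \<in> carrier (free R {..<m})" for v
    proof -
      have "a (g v) = \<zero>\<^bsub>F\<^esub>" using fp(4) that by blast
      then have "\<theta> (\<xi> (g v)) = \<zero>\<^bsub>Q\<^esub>" using \<xi>(2) lin_closed[OF fp(1) that] lin_zero[OF mF mQ F(3)] by simp
      then show ?thesis using \<theta>(3)[of "\<xi> (g v)"] lin_closed[OF \<xi>(1) lin_closed[OF fp(1) that]] by simp
    qed
    have "\<exists>t\<in>S. (\<lambda>i. \<xi> (g (basis R {..<m} i))) ` {..<m} \<subseteq> snd t"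
      using K[OF basis_closed[OF ring_R]] dir S(2)
      by (intro finite_subset_directed) (auto, metis)
    then obtain t where t: "t \<in> S" "\<And>i. i \<in> {..<m} \<Longrightarrow> \<xi> (g (basis R {..<m} i)) \<in> snd t" by blast
    obtain r where r: "r \<in> S" "fst s \<subseteq> fst r" "snd t \<subseteq> snd r" using dir[OF s(1) t(1)] by blast
    have sr: "submod R (sub G ?A) (fst r)" using submodD[OF d(2)[OF r(1)]] r(1) by (intro submodI) auto
    have skr: "submod R (sub G ?A) (snd r)" using submodD[OF sK1[OF r(1)]] d(13)[OF r(1)] r(1) by (intro submodI) auto
    have \<xi>A: "\<xi> v \<in> fst r" if "v \<in> carrier (free R {..<n})" for v
      by (rule free_image_subset[OF ring_R mA \<xi>(1) sr _ that]) (use s(2) r(2) in auto)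
    have \<xi>K: "\<xi> (g v) \<in> snd r" if "v \<in> carrier (free R {..<m})" for v
      by (rule free_image_subset[OF ring_R mA lin_comp[OF fp(1) \<xi>(1)] skr _ that]) (use t(2) r(3) in auto)
    have \<xi>r: "lin R (free R {..<n}) (sub G (fst r)) \<xi>" using \<xi>(1) \<xi>A unfolding lin_def by auto
    note mC = d(9)[OF r(1)]
    have "\<exists>e. lin R F (C r) e \<and> (\<forall>x\<in>carrier (free R {..<n}). e (a x) = \<pi> r (\<xi> x))"
    proof (rule lin_factor_surj[OF right_module_free[OF ring_R] mF mC fp(2,3) lin_comp[OF \<xi>r d(4)[OF r(1)]]])
      fix x assume "x \<in> carrier (free R {..<n})" "a x = \<zero>\<^bsub>F\<^esub>"
      then obtain v where "v \<in> carrier (free R {..<m})" "x = g v" using fp(4) by blast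
      then show "\<pi> r (\<xi> x) = \<zero>\<^bsub>C r\<^esub>" using \<xi>K zK[OF r(1)] d(13)[OF r(1)] by blast
    qed
    then obtain e where e: "lin R F (C r) e" "\<And>x. x \<in> carrier (free R {..<n}) \<Longrightarrow> e (a x) = \<pi> r (\<xi> x)" by blast
    have "w (\<iota> (j r) (e y)) = h y" if y: "y \<in> carrier F" for y
    proof -
      obtain x where x: "x \<in> carrier (free R {..<n})" "y = a x" using y fp(3) by blast
      then show ?thesis using e(2)[OF x(1)] w\<theta>[OF r(1) \<xi>A[OF x(1)]] \<xi>(2) by simp
    qed
    then show "\<exists>g. lin R F D g \<and> (\<forall>x\<in>carrier F. w (g x) = h x)"
      using lin_comp[OF e(1) \<iota>s[OF r(1)]] by blast
  qed
  moreover have "\<exists>f. lin R Q M f \<and> (\<forall>x\<in>carrier (sub G ?A). f (\<theta> x) = \<Phi> x)"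
  proof (rule lin_factor_surj[OF mA mQ modM \<theta>(1) _ lin_sub[OF submodD(1)[OF sA] \<Phi>]])
    show "\<theta> ` carrier (sub G ?A) = carrier Q" using \<theta>(2) by simp
    fix x assume x: "x \<in> carrier (sub G ?A)" "\<theta> x = \<zero>\<^bsub>Q\<^esub>"
    then obtain s where s: "s \<in> S" "x \<in> snd s" using \<theta>(3)[of x] by auto
    then have xs: "x \<in> fst s" "\<pi> s x = \<zero>\<^bsub>C s\<^esub>" using zK[OF s(1), of x] d(13)[OF s(1)] by auto
    then show "\<Phi> x = \<zero>\<^bsub>M\<^esub>" using d(8)[OF s(1) xs(1)] lin_zero[OF d(9)[OF s(1)] modM d(7)[OF s(1)]] by simp
  qed
  then obtain f' where f': "lin R Q M f'" "\<And>x. x \<in> ?A \<Longrightarrow> f' (\<theta> x) = \<Phi> x" by auto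
  moreover have "?K = {x \<in> ?A. \<theta> x = \<zero>\<^bsub>Q\<^esub>}"
  proof (intro equalityI subsetI CollectI conjI)
    fix x assume x: "x \<in> ?K"
    then show xA: "x \<in> ?A" using KA by (rule subsetD[rotated])
    show "\<theta> x = \<zero>\<^bsub>Q\<^esub>" using \<theta>(3)[OF xA] x by simp
  next
    fix x assume "x \<in> {x \<in> ?A. \<theta> x = \<zero>\<^bsub>Q\<^esub>}"
    then have x: "x \<in> ?A" "\<theta> x = \<zero>\<^bsub>Q\<^esub>" by blast+
    then show "x \<in> ?K" using \<theta>(3)[OF x(1)] by blast
  qed
  ultimately have "presents ?A ?K Q \<theta> f'"
    unfolding presents_def using sA smA \<theta>(1,2) by (intro conjI ballI)
  then show ?thesis unfolding obj_def by blast
qed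

end

text \<open>A chain with a last element bounds itself, so bounds are asked only for chains in which
  every element has a strictly larger one. That larger element is also what makes the union of such
  a chain a strict upper bound in the applications.\<close>

lemma zorn_strict:
  fixes Ob :: "'a set" and less :: "'a \<Rightarrow> 'a \<Rightarrow> bool"
  assumes ne: "Ob \<noteq> {}"
    and trans: "\<And>a b c. \<lbrakk>a \<in> Ob; b \<in> Ob; c \<in> Ob; less a b; less b c\<rbrakk> \<Longrightarrow> less a c"
    and irrefl: "\<And>a. a \<in> Ob \<Longrightarrow> \<not> less a a"
    and ub: "\<And>C. \<lbrakk>C \<subseteq> Ob; C \<noteq> {}; \<And>a b. \<lbrakk>a \<in> C; b \<in> C\<rbrakk> \<Longrightarrow> a = b \<or> less a b \<or> less b a;
        \<And>a. a \<in> C \<Longrightarrow> \<exists>b\<in>C. less a b\<rbrakk> \<Longrightarrow> \<exists>u\<in>Ob. \<forall>a\<in>C. less a u"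
  shows "\<exists>m\<in>Ob. \<forall>a\<in>Ob. \<not> less m a"
proof -
  define P where "P a b \<longleftrightarrow> a = b \<or> less a b" for a b
  have "partial_order_on Ob (relation_of P Ob)"
  proof (rule partial_order_on_relation_ofI)
    show "P a a" if "a \<in> Ob" for a by (simp add: P_def)
    show "P a c" if "a \<in> Ob" "b \<in> Ob" "c \<in> Ob" "P a b" "P b c" for a b c
      using that trans[of a b c] unfolding P_def by blast
    show "a = b" if "a \<in> Ob" "b \<in> Ob" "P a b" "P b a" for a b
      using that trans[of a b a] irrefl[of a] unfolding P_def by blast
  qed
  moreover have "\<exists>u\<in>Ob. \<forall>a\<in>C. P a u" if C: "C \<in> Chains (relation_of P Ob)" for C
  proof (cases "C = {}")
    case True
    then show ?thesis using ne by blast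
  next
    case False
    have CO: "C \<subseteq> Ob" using C Chains_relation_of by blast
    have tot: "a = b \<or> less a b \<or> less b a" if "a \<in> C" "b \<in> C" for a b
      using C that unfolding Chains_def relation_of_def P_def by blast
    show ?thesis
    proof (cases "\<forall>a\<in>C. \<exists>b\<in>C. less a b")
      case True
      then show ?thesis using ub[OF CO False tot] unfolding P_def by blast
    next
      case False
      then obtain u where u: "u \<in> C" "\<forall>b\<in>C. \<not> less u b" by blast
      then have "\<forall>a\<in>C. P a u" using tot[of _ u] unfolding P_def by blast
      then show ?thesis using u CO by blast
    qed
  qed
  ultimately obtain m where "m \<in> Ob" "\<forall>a\<in>Ob. P m a \<longrightarrow> a = m" using predicate_Zorn[of Ob P] by blast
  then show ?thesis using irrefl unfolding P_def by blast
qed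

section \<open>Objects that admit only injective maps, and the construction of the cover\<close>

context class_over
begin

definition mono_only :: "('r, 'm) module \<Rightarrow> ('m \<Rightarrow> 'm) \<Rightarrow> bool" where
  "mono_only C f \<longleftrightarrow> C \<in> U \<and> lin R C M f \<and>
     (\<forall>C'\<in>U. \<forall>f' u. lin R C' M f' \<longrightarrow> lin R C C' u \<longrightarrow> (\<forall>x\<in>carrier C. f' (u x) = f x) \<longrightarrow> inj_on u (carrier C))"

text \<open>\<open>K' \<inter> A = K\<close> says that the induced map from \<open>A/K\<close> to
  \<open>A'/K'\<close> is injective.\<close>

definition mono_obj :: "('m \<times> 'm \<Rightarrow> 'r) set \<Rightarrow> ('m \<times> 'm \<Rightarrow> 'r) set \<Rightarrow> bool" where
  "mono_obj A K \<longleftrightarrow> obj A K \<and> (\<forall>A' K'. obj A' K' \<longrightarrow> A \<subseteq> A' \<longrightarrow> K \<subseteq> K' \<longrightarrow> K' \<inter> A = K)"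

lemma mono_obj_iff:
  assumes p: "presents A K C \<pi> f"
  shows "mono_obj A K \<longleftrightarrow> mono_only C f"
proof
  note d = presentsD[OF p]
  assume m: "mono_obj A K"
  show "mono_only C f"
    unfolding mono_only_def
  proof (intro conjI ballI allI impI d(1) d(7))
    fix C' f' u assume C': "C' \<in> U" "lin R C' M f'" and u: "lin R C C' u" "\<forall>x\<in>carrier C. f' (u x) = f x"
    obtain A' K' \<pi>' where p': "presents A' K' C' \<pi>' f'" "A \<subseteq> A'" "K \<subseteq> K'" "\<And>x. x \<in> A \<Longrightarrow> \<pi>' x = u (\<pi> x)"
      using presents_extend[OF p C' u(1)] u(2) by blast
    have eq: "K' \<inter> A = K" using m p'(2,3) presentsD(14)[OF p'(1)] unfolding mono_obj_def by blast
    show "inj_on u (carrier C)"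
      unfolding lin_inj_on_iff[OF d(9) U_mod(2)[OF C'(1)] u(1)]
    proof (intro ballI impI)
      fix y assume y: "y \<in> carrier C" "u y = \<zero>\<^bsub>C'\<^esub>"
      then obtain x where x: "x \<in> A" "y = \<pi> x" using d(5) by blast
      then have "x \<in> K'" using p'(2,4) y(2) presentsD(6)[OF p'(1)] by auto
      then have "x \<in> K" using eq x(1) by blast
      then show "y = \<zero>\<^bsub>C\<^esub>" using d(6) x(2) by blast
    qed
  qed
next
  note d = presentsD[OF p]
  assume m: "mono_only C f"
  show "mono_obj A K"
    unfolding mono_obj_def
  proof (intro conjI allI impI d(14) equalityI)
    fix A' K' assume "obj A' K'" and le: "A \<subseteq> A'" "K \<subseteq> K'"
    then obtain C' \<pi>' f' where p': "presents A' K' C' \<pi>' f'" unfolding obj_def by blast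
    note d' = presentsD[OF p']
    obtain u where u: "lin R C C' u" "\<And>x. x \<in> A \<Longrightarrow> u (\<pi> x) = \<pi>' x" "\<And>y. y \<in> carrier C \<Longrightarrow> f' (u y) = f y"
      using presents_map[OF p p' le] by blast
    have inj: "inj_on u (carrier C)" using m d'(1,7) u(1,3) unfolding mono_only_def by blast
    show "K \<subseteq> K' \<inter> A" using le(2) d(13) by blast
    show "K' \<inter> A \<subseteq> K"
    proof
      fix x assume x: "x \<in> K' \<inter> A"
      then have "u (\<pi> x) = \<zero>\<^bsub>C'\<^esub>" using u(2) d'(6) by auto
      then have "\<pi> x = \<zero>\<^bsub>C\<^esub>" using inj lin_inj_on_iff[OF d(9) d'(9) u(1)] d(11) x by blast
      then show "x \<in> K" using d(6) x by blast
    qed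
  qed
qed

text \<open>Only the elements of the small set \<open>A0\<close> are watched. Zorn's lemma yields an
  extension after which no further element of \<open>A0\<close> is ever killed.\<close>

lemma stable_extension_exists:
  assumes o: "obj A0 K0"
  shows "\<exists>A K. obj A K \<and> A0 \<subseteq> A \<and> K0 \<subseteq> K \<and>
    (\<forall>A' K'. obj A' K' \<longrightarrow> A \<subseteq> A' \<longrightarrow> K \<subseteq> K' \<longrightarrow> K' \<inter> A0 = K \<inter> A0)"
proof -
  define Ob where "Ob = {s. obj (fst s) (snd s) \<and> A0 \<subseteq> fst s \<and> K0 \<subseteq> snd s}"
  define less where "less s t \<longleftrightarrow> fst s \<subseteq> fst t \<and> snd s \<subseteq> snd t \<and> snd s \<inter> A0 \<noteq> snd t \<inter> A0"
    for s t :: "('m \<times> 'm \<Rightarrow> 'r) set \<times> ('m \<times> 'm \<Rightarrow> 'r) set"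
  have sA0: "small TYPE('m) A0" using o presentsD(3) unfolding obj_def by blast
  have "\<exists>m\<in>Ob. \<forall>a\<in>Ob. \<not> less m a"
  proof (rule zorn_strict[of Ob less])
    show "Ob \<noteq> {}" using o unfolding Ob_def by force
    show "less a c" if "less a b" "less b c" for a b c using that unfolding less_def by blast
    show "\<not> less a a" for a unfolding less_def by blast
    fix C assume C: "C \<subseteq> Ob" "C \<noteq> {}" "\<And>a b. \<lbrakk>a \<in> C; b \<in> C\<rbrakk> \<Longrightarrow> a = b \<or> less a b \<or> less b a"
      "\<And>a. a \<in> C \<Longrightarrow> \<exists>b\<in>C. less a b"
    let ?A = "\<Union>s\<in>C. fst s" and ?K = "\<Union>s\<in>C. snd s"
    \<comment> \<open>Members of the chain differ in their traces on \<open>A0\<close>, so there are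
      no more of them than subsets of \<open>A0\<close>; this makes the chain small and the union
      available.\<close>
    have inj: "inj_on (\<lambda>s. snd s \<inter> A0) C"
    proof (rule inj_onI)
      fix s t assume "s \<in> C" "t \<in> C" "snd s \<inter> A0 = snd t \<inter> A0"
      then show "s = t" using C(3)[of s t] unfolding less_def by metis
    qed
    have "small TYPE('m) C"
      by (rule small_inj_on[OF inj _ small_Pow[OF sA0]]) auto
    then have "obj ?A ?K"
    proof (rule obj_Union[OF _ C(2)])
      show "obj (fst s) (snd s)" if "s \<in> C" for s using that C(1) unfolding Ob_def by blast
      show "\<exists>r\<in>C. fst s \<subseteq> fst r \<and> snd s \<subseteq> snd r \<and> fst t \<subseteq> fst r \<and> snd t \<subseteq> snd r" if "s \<in> C" "t \<in> C" for s t
        using C(3)[OF that] that unfolding less_def by blast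
    qed
    then have "(?A, ?K) \<in> Ob" using C(1,2) unfolding Ob_def by fastforce
    moreover have "less a (?A, ?K)" if aC: "a \<in> C" for a
    proof -
      obtain b where "b \<in> C" "less a b" using C(4)[OF aC] by blast
      then show ?thesis using aC unfolding less_def fst_conv snd_conv by blast
    qed
    ultimately show "\<exists>u\<in>Ob. \<forall>a\<in>C. less a u" by blast
  qed
  then obtain m where m: "m \<in> Ob" "\<And>a. a \<in> Ob \<Longrightarrow> \<not> less m a" by blast
  have "K' \<inter> A0 = snd m \<inter> A0" if "obj A' K'" "fst m \<subseteq> A'" "snd m \<subseteq> K'" for A' K'
  proof -
    have "(A', K') \<in> Ob" using that m(1) unfolding Ob_def by auto
    then show ?thesis using m(2)[of "(A', K')"] that unfolding less_def by auto
  qed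
  then show ?thesis using m(1) unfolding Ob_def by blast
qed

text \<open>Stabilizing one set of elements introduces new ones, so the step is iterated over the
  naturals. In the union every element belongs to some stage \<open>n\<close>, and its fate was
  settled at stage \<open>n + 1\<close>.\<close>

lemma mono_extension_exists:
  assumes o: "obj A0 K0"
  shows "\<exists>A K. mono_obj A K \<and> A0 \<subseteq> A \<and> K0 \<subseteq> K"
proof -
  define stab where "stab s t \<longleftrightarrow> fst s \<subseteq> fst t \<and> snd s \<subseteq> snd t \<and>
     (\<forall>A' K'. obj A' K' \<longrightarrow> fst t \<subseteq> A' \<longrightarrow> snd t \<subseteq> K' \<longrightarrow> K' \<inter> fst s = snd t \<inter> fst s)"
    for s t :: "('m \<times> 'm \<Rightarrow> 'r) set \<times> ('m \<times> 'm \<Rightarrow> 'r) set"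
  have "\<exists>F. \<forall>n. (obj (fst (F n)) (snd (F n)) \<and> (n = 0 \<longrightarrow> F n = (A0, K0))) \<and> stab (F n) (F (Suc n))"
  proof (rule dependent_nat_choice)
    show "\<exists>s. obj (fst s) (snd s) \<and> (0 = (0::nat) \<longrightarrow> s = (A0, K0))" using o by auto
    fix s and n :: nat assume s: "obj (fst s) (snd s) \<and> (n = 0 \<longrightarrow> s = (A0, K0))"
    obtain A K where AK: "obj A K" "fst s \<subseteq> A" "snd s \<subseteq> K"
      "\<forall>A' K'. obj A' K' \<longrightarrow> A \<subseteq> A' \<longrightarrow> K \<subseteq> K' \<longrightarrow> K' \<inter> fst s = K \<inter> fst s"
      using stable_extension_exists[OF conjunct1[OF s]] by (elim exE conjE) (rule that)
    have "stab s (A, K)" unfolding stab_def fst_conv snd_conv by (intro conjI AK(2-4))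
    then show "\<exists>t. (obj (fst t) (snd t) \<and> (Suc n = 0 \<longrightarrow> t = (A0, K0))) \<and> stab s t"
      using AK(1) by (intro exI[of _ "(A, K)"]) simp
  qed
  then obtain F where F': "\<forall>n. (obj (fst (F n)) (snd (F n)) \<and> (n = 0 \<longrightarrow> F n = (A0, K0))) \<and> stab (F n) (F (Suc n))"
    by (elim exE) (rule that)
  have F: "obj (fst (F n)) (snd (F n))" "F 0 = (A0, K0)" "stab (F n) (F (Suc n))" for n
    using F' by auto
  have le: "fst (F i) \<subseteq> fst (F j)" "snd (F i) \<subseteq> snd (F j)" if "i \<le> j" for i j
  proof -
    have "fst (F n) \<subseteq> fst (F (Suc n))" "snd (F n) \<subseteq> snd (F (Suc n))" for n using F(3)[of n] unfolding stab_def by auto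
    then show "fst (F i) \<subseteq> fst (F j)" "snd (F i) \<subseteq> snd (F j)"
      using lift_Suc_mono_le[of "\<lambda>n. fst (F n)" i j] lift_Suc_mono_le[of "\<lambda>n. snd (F n)" i j] that by auto
  qed
  let ?A = "\<Union>s\<in>range F. fst s" and ?K = "\<Union>s\<in>range F. snd s"
  have "obj ?A ?K"
  proof (rule obj_Union)
    show "small TYPE('m) (range F)" by (rule small_image[OF small_nat])
    show "\<exists>r\<in>range F. fst s \<subseteq> fst r \<and> snd s \<subseteq> snd r \<and> fst t \<subseteq> fst r \<and> snd t \<subseteq> snd r" if "s \<in> range F" "t \<in> range F" for s t
    proof -
      obtain i j where "s = F i" "t = F j" using \<open>s \<in> range F\<close> \<open>t \<in> range F\<close> by blast
      then show ?thesis using le[of i "max i j"] le[of j "max i j"] by (intro bexI[of _ "F (max i j)"]) auto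
    qed
  qed (use F(1) in auto)
  moreover have "K' \<inter> ?A = ?K" if K': "obj A' K'" "?A \<subseteq> A'" "?K \<subseteq> K'" for A' K'
  proof
    show "K' \<inter> ?A \<subseteq> ?K"
    proof
      fix x assume "x \<in> K' \<inter> ?A"
      then obtain n where n: "x \<in> K'" "x \<in> fst (F n)" by blast
      have "K' \<inter> fst (F n) = snd (F (Suc n)) \<inter> fst (F n)"
        using F(3)[of n] K' unfolding stab_def by blast
      then show "x \<in> ?K" using n by blast
    qed
    have "snd (F n) \<subseteq> fst (F n)" for n using F(1)[of n] presentsD(13) unfolding obj_def by blast
    then show "?K \<subseteq> K' \<inter> ?A" using K'(3) by blast
  qed
  ultimately have "mono_obj ?A ?K" unfolding mono_obj_def by blast
  moreover have "A0 \<subseteq> ?A" "K0 \<subseteq> ?K" using F(2) by (metis UN_upper fst_conv rangeI, metis UN_upper snd_conv rangeI)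
  ultimately show ?thesis by blast
qed

lemma presents_eq_iff:
  assumes p: "presents A K C \<pi> f" and x: "x \<in> A" "y \<in> A"
  shows "\<pi> x = \<pi> y \<longleftrightarrow> x \<ominus>\<^bsub>G\<^esub> y \<in> K"
proof -
  note d = presentsD[OF p]
  interpret G: right_module R G by (rule modG)
  interpret C: right_module R C by (rule d(9))
  have xy: "x \<ominus>\<^bsub>G\<^esub> y \<in> A" by (rule G.submod_diff[OF d(2) x])
  have "x = (x \<ominus>\<^bsub>G\<^esub> y) \<oplus>\<^bsub>G\<^esub> y" using G.diff_add_cancel[of x y] subsetD[OF d(12)] x by simp
  then have "\<pi> x = \<pi> (x \<ominus>\<^bsub>G\<^esub> y) \<oplus>\<^bsub>C\<^esub> \<pi> y"
    using lin_add[OF d(4), of "x \<ominus>\<^bsub>G\<^esub> y" y] xy x(2) by simp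
  then have "\<pi> x = \<pi> y \<longleftrightarrow> \<pi> (x \<ominus>\<^bsub>G\<^esub> y) = \<zero>\<^bsub>C\<^esub>"
    using d(11)[OF xy] d(11)[OF x(1)] d(11)[OF x(2)] C.M.add.r_cancel_one by auto
  then show ?thesis using d(6) xy by blast
qed

lemma obj_kernel_submod: "obj A K \<Longrightarrow> submod R G K"
proof -
  assume "obj A K"
  then obtain C \<pi> f where "presents A K C \<pi> f" unfolding obj_def by blast
  note d = presentsD[OF this]
  have "submod R (sub G A) K" using submod_kernel[OF d(10,9,4)] d(6) by simp
  from submodD[OF this] show ?thesis using d(12) by (intro submodI) auto
qed

text \<open>If \<open>C\<close> were too large, \<open>f\<close> would kill a nonzero pure submodule
  \<open>D\<close>. The quotient by \<open>D\<close> stays in the class and still maps to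
  \<open>M\<close>, so the projection would be a map over \<open>M\<close> that is not
  injective.\<close>

lemma mono_only_bounded: "\<exists>\<beta> :: 'm set. small TYPE('m) \<beta> \<and> (\<forall>C f. mono_only C f \<longrightarrow> |carrier C| \<le>o |\<beta>| )"
proof -
  obtain Y :: "'m set" where Y: "small TYPE('m) Y" "infinite Y" "\<And>m::nat. |carrier (free R {..<m})| \<le>o |Y|"
    "|carrier R| \<le>o |Y|"
    using bounding_set_exists[OF small_finite[OF finite.emptyI]] by blast
  have smP: "small TYPE('m) (Pow Y)" by (rule small_Pow[OF Y(1)])
  have "small TYPE('m) (Pow Y <+> (carrier (free R (Pow Y)) <+> carrier M))"
    by (intro small_Plus smP small_free ModR_small[OF M])
  then obtain Y' :: "'m set" where Y': "small TYPE('m) Y'" "infinite Y'"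
    "|Pow Y <+> (carrier (free R (Pow Y)) <+> carrier M)| \<le>o |Y'|"
    by (rule bounding_set_exists)
  note P = ordLeq_transitive[OF _ Y'(3)]
  have Y'1: "|Pow Y| \<le>o |Y'|" by (rule P[OF card_of_Plus1])
  have Y'2: "|carrier (free R (Pow Y))| \<le>o |Y'|" by (rule P[OF ordLeq_transitive[OF card_of_Plus1 card_of_Plus2]])
  have Y'3: "|carrier M| \<le>o |Y'|" by (rule P[OF ordLeq_transitive[OF card_of_Plus2 card_of_Plus2]])
  have b: "|carrier C| \<le>o |Pow Y'|" if m: "mono_only C f" for C f
  proof (rule ccontr)
    assume big: "\<not> |carrier C| \<le>o |Pow Y'|"
    have C: "C \<in> U" "lin R C M f" using m unfolding mono_only_def by auto
    note mC = U_mod[OF C(1)]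
    obtain D where D: "pure_submod R C D" "D \<noteq> {\<zero>\<^bsub>C\<^esub>}" "\<forall>x\<in>D. f x = \<zero>\<^bsub>M\<^esub>"
      using pure_submod_in_kernel[OF mC(2) modM C(2) Y(2-4) Y'(2) Y'1 Y'2 Y'3 big] by blast
    have sD: "submod R C D" using D(1) unfolding pure_submod_def by blast
    obtain Q :: "('r, 'm) module" and q where Q: "Q \<in> ModR R" "lin R C Q q" "q ` carrier C = carrier Q"
      "\<forall>x\<in>carrier C. q x = \<zero>\<^bsub>Q\<^esub> \<longleftrightarrow> x \<in> D"
      using quotient_exists[OF mC(2) sD ModR_small[OF mC(1)]] by blast
    have QU: "Q \<in> U" using pure_submod_quotient_in[OF C(1) D(1) Q(1-3)] Q(4) by blast
    note mQ = ModR_module[OF Q(1)]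
    have "\<exists>f'. lin R Q M f' \<and> (\<forall>x\<in>carrier C. f' (q x) = f x)"
      by (rule lin_factor_surj[OF mC(2) mQ modM Q(2,3) C(2)]) (use Q(4) D(3) in auto)
    then have "inj_on q (carrier C)" using m QU Q(2) unfolding mono_only_def by blast
    then have "\<forall>x\<in>carrier C. q x = \<zero>\<^bsub>Q\<^esub> \<longrightarrow> x = \<zero>\<^bsub>C\<^esub>" using lin_inj_on_iff[OF mC(2) mQ Q(2)] by blast
    then have "D = {\<zero>\<^bsub>C\<^esub>}" using Q(4) submodD(1,2)[OF sD] by blast
    then show False using D(2) by blast
  qed
  have "small TYPE('m) (Pow Y')" by (rule small_Pow[OF Y'(1)])
  then obtain h :: "_ \<Rightarrow> 'm" where h: "inj_on h (Pow Y')" using small_imp_inj by blast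
  have "|Pow Y'| \<le>o |h ` Pow Y'|" using h card_of_ordLeq[of "Pow Y'" "h ` Pow Y'"] by blast
  then have "|carrier C| \<le>o |h ` Pow Y'|" if "mono_only C f" for C f
    by (rule ordLeq_transitive[OF b[OF that]])
  moreover have "small TYPE('m) (h ` Pow Y')" by (rule small_image) fact
  ultimately show ?thesis by blast
qed

text \<open>
  Chains of mono-only objects are injective systems of modules of bounded cardinality, and
  therefore have small cofinal subsets.
\<close>

lemma maximal_mono_obj_exists:
  "\<exists>A K. mono_obj A K \<and> (\<forall>A' K'. mono_obj A' K' \<longrightarrow> A \<subseteq> A' \<longrightarrow> K \<subseteq> K' \<longrightarrow> (\<forall>a'\<in>A'. \<exists>a\<in>A. a' \<ominus>\<^bsub>G\<^esub> a \<in> K'))"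
proof -
  interpret G: right_module R G by (rule modG)
  define Ob where "Ob = {s. mono_obj (fst s) (snd s)}"
  define le where "le s t \<longleftrightarrow> fst s \<subseteq> fst t \<and> snd s \<subseteq> snd t"
    for s t :: "('m \<times> 'm \<Rightarrow> 'r) set \<times> ('m \<times> 'm \<Rightarrow> 'r) set"
  \<comment> \<open>For objects of \<open>Ob\<close> the induced map is injective, so growth is
    measured by its failure to be surjective.\<close>
  define less where "less s t \<longleftrightarrow> le s t \<and> (\<exists>a'\<in>fst t. \<forall>a\<in>fst s. a' \<ominus>\<^bsub>G\<^esub> a \<notin> snd t)"
    for s t :: "('m \<times> 'm \<Rightarrow> 'r) set \<times> ('m \<times> 'm \<Rightarrow> 'r) set"
  have ob: "obj (fst s) (snd s)" if "s \<in> Ob" for s using that unfolding Ob_def mono_obj_def by blast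
  have sub1: "submod R G (fst s)" "fst s \<subseteq> carrier G" "snd s \<subseteq> fst s" if "s \<in> Ob" for s
    using ob[OF that] presentsD(2,12,13) unfolding obj_def by blast+
  have sub2: "submod R G (snd s)" if "s \<in> Ob" for s using obj_kernel_submod[OF ob[OF that]] .
  have Obmono: "snd t \<inter> fst s = snd s" if "s \<in> Ob" "t \<in> Ob" "le s t" for s t
    using that ob[OF that(2)] unfolding Ob_def mono_obj_def le_def by blast
  have "\<exists>m\<in>Ob. \<forall>a\<in>Ob. \<not> less m a"
  proof (rule zorn_strict[of Ob less])
    have "submod R G {\<zero>\<^bsub>G\<^esub>}" by (rule submod_zero[OF modG])
    \<comment> \<open>The empty coproduct provides a member of the class, which the zero map turns
      into an object over \<open>M\<close>.\<close>
    obtain D where "D \<in> U"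
      using coproduct_exists[of "{}" "undefined"] small_finite[of "{}"] by (metis empty_iff finite.emptyI)
    then obtain A K \<pi> where "presents A K D \<pi> (\<lambda>x. \<zero>\<^bsub>M\<^esub>)" using presents_exists[OF _ lin_zero_map[OF modM]] by blast
    then show "Ob \<noteq> {}" using mono_extension_exists[OF presentsD(14)] unfolding Ob_def by force
    show "\<not> less a a" if "a \<in> Ob" for a
    proof
      assume "less a a"
      then obtain x where x: "x \<in> fst a" "\<forall>y\<in>fst a. x \<ominus>\<^bsub>G\<^esub> y \<notin> snd a" unfolding less_def by blast
      then have "x \<ominus>\<^bsub>G\<^esub> x \<notin> snd a" by blast
      then show False using G.diff_zero_iff[of x x] x(1) sub1(2)[OF that] submodD(2)[OF sub2[OF that]] by auto
    qed
    show "less a c" if O: "a \<in> Ob" "b \<in> Ob" "c \<in> Ob" and l: "less a b" "less b c" for a b c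
    proof -
      obtain x where x: "x \<in> fst c" "\<forall>y\<in>fst b. x \<ominus>\<^bsub>G\<^esub> y \<notin> snd c" using l(2) unfolding less_def by blast
      moreover have "fst a \<subseteq> fst b" "le a c" using l unfolding less_def le_def by auto
      ultimately show ?thesis unfolding less_def by blast
    qed
    fix C assume CO: "C \<subseteq> Ob" and C: "C \<noteq> {}" "\<And>a b. \<lbrakk>a \<in> C; b \<in> C\<rbrakk> \<Longrightarrow> a = b \<or> less a b \<or> less b a"
      "\<And>a. a \<in> C \<Longrightarrow> \<exists>b\<in>C. less a b"
    have tot: "le a b \<or> le b a" if "a \<in> C" "b \<in> C" for a b
      using C(2)[OF that] unfolding less_def le_def by blast
    let ?A = "\<Union>s\<in>C. fst s" and ?K = "\<Union>s\<in>C. snd s"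
    \<comment> \<open>\<open>obj_Union\<close> applies to small families only. If no small subset
      were cofinal, every small subset of the union would lie in a single member of the chain; this
      forces the limit to be small and then the chain to become stationary.\<close>
    have "\<exists>W\<subseteq>C. small TYPE('m) W \<and> (\<forall>s\<in>C. \<exists>w\<in>W. le s w)"
    proof (rule ccontr)
      assume no: "\<not> (\<exists>W\<subseteq>C. small TYPE('m) W \<and> (\<forall>s\<in>C. \<exists>w\<in>W. le s w))"
      have in_C: "\<exists>c\<in>C. T \<subseteq> fst c" if T: "T \<subseteq> ?A" "small TYPE('m) T" for T
      proof -
        have "\<forall>x\<in>T. \<exists>c. c \<in> C \<and> x \<in> fst c" using T(1) by blast
        then obtain h where h: "\<forall>x\<in>T. h x \<in> C \<and> x \<in> fst (h x)" by (elim bchoice[THEN exE]) (rule that)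
        have "h ` T \<subseteq> C" using h by blast
        have "\<not> (\<forall>s\<in>C. \<exists>w\<in>h ` T. le s w)"
        proof
          assume "\<forall>s\<in>C. \<exists>w\<in>h ` T. le s w"
          have "\<exists>W\<subseteq>C. small TYPE('m) W \<and> (\<forall>s\<in>C. \<exists>w\<in>W. le s w)"
            by (rule exI[of _ "h ` T"], intro conjI small_image T(2)) fact+
          then show False by (rule no[THEN notE])
        qed
        then obtain s where s: "s \<in> C" "\<forall>w\<in>h ` T. \<not> le s w" by blast
        have "T \<subseteq> fst s"
        proof
          fix x assume x: "x \<in> T"
          then have "h x \<in> C" "\<not> le s (h x)" "x \<in> fst (h x)" using h s(2) by auto
          then show "x \<in> fst s" using tot[OF s(1), of "h x"] unfolding le_def by blast
        qed
        then show ?thesis using s(1) by blast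
      qed
      have K_in: "x \<in> snd c" if c: "c \<in> C" "x \<in> fst c" "x \<in> ?K" for x c
      proof -
        obtain t where t: "t \<in> C" "x \<in> snd t" using c(3) by blast
        show ?thesis
        proof (cases "le c t")
          case True
          then show ?thesis using Obmono[of c t] c t CO by blast
        next
          case False
          then show ?thesis using tot[OF c(1) t(1)] t unfolding le_def by blast
        qed
      qed
      have diff_in: "x \<ominus>\<^bsub>G\<^esub> y \<in> snd c" if "c \<in> C" "x \<in> fst c" "y \<in> fst c" "x \<ominus>\<^bsub>G\<^esub> y \<in> ?K" for x y c
        using K_in[of c "x \<ominus>\<^bsub>G\<^esub> y"] that G.submod_diff[OF sub1(1), of c x y] CO by blast
      obtain \<beta> :: "'m set" where \<beta>: "small TYPE('m) \<beta>" "\<forall>D f. mono_only D f \<longrightarrow> |carrier D| \<le>o |\<beta>|"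
        using mono_only_bounded by blast
      \<comment> \<open>The classes are the elements of the direct limit \<open>?A/?K\<close>, and
        \<open>r\<close> picks representatives.\<close>
      define cls where "cls a = {b \<in> ?A. b \<ominus>\<^bsub>G\<^esub> a \<in> ?K}" for a
      define r where "r = inv_into ?A cls"
      have r: "r x \<in> ?A" "cls (r x) = x" if "x \<in> cls ` ?A" for x
        unfolding r_def using that by (rule inv_into_into, rule f_inv_into_f)
      have cls_eq: "cls a = cls b" if ab: "a \<in> ?A" "b \<in> ?A" "a \<ominus>\<^bsub>G\<^esub> b \<in> ?K" for a b
      proof -
        have "x \<ominus>\<^bsub>G\<^esub> a \<in> ?K \<longleftrightarrow> x \<ominus>\<^bsub>G\<^esub> b \<in> ?K" if x: "x \<in> ?A" for x
        proof -
          obtain c where c: "c \<in> C" "{a, b, x} \<subseteq> fst c"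
            using in_C[of "{a, b, x}"] ab x small_finite[of "{a, b, x}"] by blast
          have cO: "c \<in> Ob" using c(1) CO by blast
          obtain D \<pi> f where p: "presents (fst c) (snd c) D \<pi> f" using ob[OF cO] unfolding obj_def by blast
          have e: "y \<ominus>\<^bsub>G\<^esub> z \<in> ?K \<longleftrightarrow> \<pi> y = \<pi> z" if "y \<in> fst c" "z \<in> fst c" for y z
            using presents_eq_iff[OF p that] diff_in[OF c(1) that] c(1) by blast
          show ?thesis using e[of a b] e[of x a] e[of x b] c(2) ab(3) by auto
        qed
        then show ?thesis unfolding cls_def by blast
      qed
      \<comment> \<open>The representatives of a small set of classes lie in one member
        \<open>c\<close>, and they remain distinct in the module presented there, whose cardinality
        is at most that of \<beta>.\<close>
      have inj: "|r ` T| \<le>o |\<beta>|" if T: "T \<subseteq> cls ` ?A" "small TYPE('m) T" for T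
      proof -
        have rT: "r ` T \<subseteq> ?A" by (rule image_subsetI) (rule r(1)[OF subsetD[OF T(1)]])
        obtain c where c: "c \<in> C" "r ` T \<subseteq> fst c"
          using in_C[OF rT small_image[OF T(2)]] by (elim bexE) (rule that)
        have cO: "c \<in> Ob" using c(1) CO by blast
        obtain D \<pi> f where p: "presents (fst c) (snd c) D \<pi> f" using ob[OF cO] unfolding obj_def by blast
        have "mono_only D f" using cO mono_obj_iff[OF p] unfolding Ob_def by blast
        then have b: "|carrier D| \<le>o |\<beta>|" using \<beta>(2) by blast
        have "inj_on \<pi> (r ` T)"
        proof (rule inj_onI)
          fix x y assume xy: "x \<in> r ` T" "y \<in> r ` T" "\<pi> x = \<pi> y"
          then have "x \<ominus>\<^bsub>G\<^esub> y \<in> snd c" using presents_eq_iff[OF p, of x y] c(2) by blast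
          then have "x \<ominus>\<^bsub>G\<^esub> y \<in> ?K" using c(1) by blast
          then have "cls x = cls y" by (intro cls_eq subsetD[OF rT] xy(1,2))
          moreover obtain u v where uv: "u \<in> T" "x = r u" "v \<in> T" "y = r v" using xy by blast
          ultimately have "u = v" using r(2)[OF subsetD[OF T(1) uv(1)]] r(2)[OF subsetD[OF T(1) uv(3)]] by simp
          then show "x = y" using uv by simp
        qed
        moreover have "\<pi> ` (r ` T) \<subseteq> carrier D" using presentsD(11)[OF p] c(2) by blast
        ultimately have "|r ` T| \<le>o |carrier D|" using card_of_ordLeq[of "r ` T" "carrier D"] by blast
        then show ?thesis by (rule ordLeq_transitive[OF _ b])
      qed
      have rinj: "inj_on r (cls ` ?A)" using r(2) by (metis inj_onI)
      \<comment> \<open>Otherwise some set of 2^\<beta> classes, which is small, would contradict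
        the bound just found.\<close>
      have "small TYPE('m) (cls ` ?A)"
      proof (rule ccontr)
        assume "\<not> small TYPE('m) (cls ` ?A)"
        then have "|Pow \<beta>| \<le>o |cls ` ?A|" using not_small_ordLeq small_Pow[OF \<beta>(1)] by blast
        then obtain k where k: "inj_on k (Pow \<beta>)" "k ` Pow \<beta> \<subseteq> cls ` ?A"
          using card_of_ordLeq[of "Pow \<beta>" "cls ` ?A"] by blast
        have "|r ` (k ` Pow \<beta>)| \<le>o |\<beta>|" by (rule inj[OF k(2) small_image[OF small_Pow[OF \<beta>(1)]]])
        moreover have "|Pow \<beta>| \<le>o |r ` (k ` Pow \<beta>)|"
        proof -
          have "inj_on (\<lambda>x. r (k x)) (Pow \<beta>)"
            using comp_inj_on[OF k(1) inj_on_subset[OF rinj k(2)]] by (simp add: comp_def)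
          moreover have "(\<lambda>x. r (k x)) ` Pow \<beta> \<subseteq> r ` (k ` Pow \<beta>)" by blast
          ultimately show ?thesis using card_of_ordLeq[of "Pow \<beta>" "r ` (k ` Pow \<beta>)"] by blast
        qed
        ultimately have "|Pow \<beta>| \<le>o |\<beta>|" by (rule ordLeq_transitive[rotated])
        then show False using card_of_Pow[of \<beta>] not_ordLess_ordLeq by blast
      qed
      then have "small TYPE('m) (r ` cls ` ?A)" by (rule small_image)
      moreover have "r ` cls ` ?A \<subseteq> ?A" by (rule image_subsetI) (rule r(1))
      ultimately obtain c where c: "c \<in> C" "r ` cls ` ?A \<subseteq> fst c"
        using in_C[of "r ` cls ` ?A"] by (elim meta_impE bexE) (assumption, assumption, rule that)
      \<comment> \<open>All representatives lie in \<open>c\<close>, so \<open>c\<close> maps onto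
        the limit and therefore onto the later member \<open>t\<close>; this contradicts the strict
        growth from \<open>c\<close> to \<open>t\<close>.\<close>
      obtain t where t: "t \<in> C" "less c t" using C(3)[OF c(1)] by blast
      then obtain a' where a': "a' \<in> fst t" "\<forall>a\<in>fst c. a' \<ominus>\<^bsub>G\<^esub> a \<notin> snd t" unfolding less_def by blast
      have a'A: "a' \<in> ?A" using a'(1) t(1) by blast
      let ?a = "r (cls a')"
      have "a' \<in> carrier G" using sub1(2) t(1) CO a'(1) by blast
      then have "a' \<ominus>\<^bsub>G\<^esub> a' = \<zero>\<^bsub>G\<^esub>" using G.diff_zero_iff by simp
      then have "a' \<in> cls a'" using a'A submodD(2)[OF sub2, of t] t(1) CO unfolding cls_def by auto
      then have "a' \<in> cls ?a" using r(2)[of "cls a'"] a'A by auto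
      then have d: "a' \<ominus>\<^bsub>G\<^esub> ?a \<in> ?K" unfolding cls_def by blast
      have ac: "?a \<in> fst c" using c(2) a'A by blast
      have "fst c \<subseteq> fst t" using t(2) unfolding less_def le_def by blast
      then have "a' \<ominus>\<^bsub>G\<^esub> ?a \<in> snd t" using diff_in[OF t(1) a'(1) _ d] ac by blast
      then show False using a'(2) ac by blast
    qed
    then obtain W where W: "W \<subseteq> C" "small TYPE('m) W" "\<forall>s\<in>C. \<exists>w\<in>W. le s w" by blast
    let ?A' = "\<Union>s\<in>W. fst s" and ?K' = "\<Union>s\<in>W. snd s"
    have "obj ?A' ?K'"
    proof (rule obj_Union[OF W(2)])
      show "W \<noteq> {}" using C(1) W(3) by blast
      show "obj (fst s) (snd s)" if "s \<in> W" for s using that W(1) CO ob by blast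
      show "\<exists>r\<in>W. fst s \<subseteq> fst r \<and> snd s \<subseteq> snd r \<and> fst t \<subseteq> fst r \<and> snd t \<subseteq> snd r" if "s \<in> W" "t \<in> W" for s t
        using tot[of s t] that W(1) unfolding le_def by blast
    qed
    \<comment> \<open>Each member of \<open>W\<close> already resists all extensions, so none of
      them kills anything new in the union.\<close>
    moreover have "K'' \<inter> ?A' = ?K'" if "obj A'' K''" "?A' \<subseteq> A''" "?K' \<subseteq> K''" for A'' K''
    proof -
      have "K'' \<inter> fst s = snd s" if s: "s \<in> W" for s
      proof -
        have "mono_obj (fst s) (snd s)" using s W(1) CO unfolding Ob_def by blast
        then show ?thesis using \<open>obj A'' K''\<close> \<open>?A' \<subseteq> A''\<close> \<open>?K' \<subseteq> K''\<close> s unfolding mono_obj_def by blast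
      qed
      then show ?thesis by blast
    qed
    ultimately have uO: "(?A', ?K') \<in> Ob" unfolding Ob_def mono_obj_def by simp
    moreover have "less a (?A', ?K')" if aC: "a \<in> C" for a
    proof -
      have bound: "le s (?A', ?K')" if sC: "s \<in> C" for s
      proof -
        obtain w where "w \<in> W" "le s w" using bspec[OF W(3) sC] by (elim bexE) (rule that)
        then show ?thesis unfolding le_def fst_conv snd_conv by blast
      qed
      obtain b where b: "b \<in> C" "less a b" using C(3)[OF aC] by blast
      then obtain a' where a': "a' \<in> fst b" "\<forall>x\<in>fst a. a' \<ominus>\<^bsub>G\<^esub> x \<notin> snd b" unfolding less_def by blast
      have bO: "b \<in> Ob" and lab: "fst a \<subseteq> fst b" using b CO unfolding less_def le_def by auto
      have "a' \<ominus>\<^bsub>G\<^esub> x \<notin> ?K'" if x: "x \<in> fst a" for x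
      proof -
        have "a' \<ominus>\<^bsub>G\<^esub> x \<in> fst b" using G.submod_diff[OF sub1(1)[OF bO] a'(1)] lab x by blast
        moreover have "?K' \<inter> fst b = snd b" using Obmono[OF bO uO bound[OF b(1)]] by simp
        ultimately show ?thesis using a'(2) x by blast
      qed
      then show ?thesis
        using bound[OF aC] bound[OF b(1)] a'(1) unfolding less_def le_def fst_conv snd_conv by blast
    qed
    ultimately show "\<exists>u\<in>Ob. \<forall>a\<in>C. less a u" by blast
  qed
  then obtain m where m: "m \<in> Ob" "\<forall>a\<in>Ob. \<not> less m a" by blast
  have "\<exists>a\<in>fst m. a' \<ominus>\<^bsub>G\<^esub> a \<in> K'" if "mono_obj A' K'" "fst m \<subseteq> A'" "snd m \<subseteq> K'" "a' \<in> A'" for A' K' a'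
  proof -
    have "(A', K') \<in> Ob" using that(1) unfolding Ob_def by simp
    then have "\<not> less m (A', K')" using m(2) by blast
    then show ?thesis using that unfolding less_def le_def fst_conv snd_conv by blast
  qed
  then show ?thesis using m(1) unfolding Ob_def by blast
qed

lemma cover_exists: "\<exists>C f. is_cover R U C f M"
proof -
  obtain A K where AK: "mono_obj A K" and
    max: "\<forall>A' K'. mono_obj A' K' \<longrightarrow> A \<subseteq> A' \<longrightarrow> K \<subseteq> K' \<longrightarrow> (\<forall>a'\<in>A'. \<exists>a\<in>A. a' \<ominus>\<^bsub>G\<^esub> a \<in> K')"
    using maximal_mono_obj_exists by (elim exE conjE) (rule that)
  obtain C \<pi> f where p: "presents A K C \<pi> f" using AK unfolding mono_obj_def obj_def by blast
  note d = presentsD[OF p]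
  have mono: "mono_only C f" using mono_obj_iff[OF p] AK by blast
  \<comment> \<open>Injectivity is the mono-only property of \<open>C\<close>, surjectivity the
    maximality of the pair \<open>A\<close>, \<open>K\<close>.\<close>
  have bij: "bij_betw u (carrier C) (carrier C')"
    if C': "mono_only C' f'" and u: "lin R C C' u" "\<And>x. x \<in> carrier C \<Longrightarrow> f' (u x) = f x" for C' f' u
  proof -
    have CU: "C' \<in> U" "lin R C' M f'" using C' unfolding mono_only_def by auto
    obtain A' K' \<pi>' where p': "presents A' K' C' \<pi>' f'" "A \<subseteq> A'" "K \<subseteq> K'" "\<And>x. x \<in> A \<Longrightarrow> \<pi>' x = u (\<pi> x)"
      using presents_extend[OF p CU u] by blast
    note d' = presentsD[OF p'(1)]
    have mo: "mono_obj A' K'" using mono_obj_iff[OF p'(1)] C' by blast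
    have "carrier C' \<subseteq> u ` carrier C"
    proof
      fix y assume "y \<in> carrier C'"
      then obtain a' where a': "a' \<in> A'" "y = \<pi>' a'" using d'(5) by blast
      then obtain a where a: "a \<in> A" "a' \<ominus>\<^bsub>G\<^esub> a \<in> K'" using max[rule_format, OF mo p'(2,3) a'(1)] by blast
      then have "\<pi>' a' = \<pi>' a" using presents_eq_iff[OF p'(1), of a' a] a'(1) p'(2) by blast
      then have "y = u (\<pi> a)" using p'(4)[OF a(1)] a'(2) by simp
      then show "y \<in> u ` carrier C" using d(11)[OF a(1)] by blast
    qed
    moreover have "u ` carrier C \<subseteq> carrier C'" using lin_closed[OF u(1)] by blast
    moreover have "inj_on u (carrier C)" using mono CU u unfolding mono_only_def by blast
    ultimately show ?thesis unfolding bij_betw_def by blast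
  qed
  have "is_cover R U C (restrict f (carrier C)) M"
    unfolding is_cover_def
  proof (intro conjI ballI impI)
    show "C \<in> U" by (rule d(1))
    show "restrict f (carrier C) \<in> Hom R C M" by (rule lin_restrict[OF d(9,7)])
  next
    fix C' g assume C': "C' \<in> U" and g: "g \<in> Hom R C' M"
    note mC' = U_mod[OF C']
    \<comment> \<open>The map to \<open>M\<close> given by \<open>f\<close> and \<open>g\<close> on
      the coproduct is followed by a map over \<open>M\<close> to a mono-only \<open>E\<close>. As
      \<open>C\<close> maps bijectively onto \<open>E\<close>, the inverse carries \<open>C'\<close>
      into \<open>C\<close> over \<open>M\<close>.\<close>
    obtain D i1 i2 where D: "D \<in> U" "lin R C D i1" "lin R C' D i2"
      and lift: "\<forall>T\<in>(ModR R :: ('r, 'm) module set). \<forall>u1 u2. lin R C T u1 \<longrightarrow> lin R C' T u2 \<longrightarrow>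
       (\<exists>w. lin R D T w \<and> (\<forall>x\<in>carrier C. w (i1 x) = u1 x) \<and> (\<forall>x\<in>carrier C'. w (i2 x) = u2 x))"
      by (rule binary_coproduct_exists[OF d(1) C']) (rule that)
    obtain w where w: "lin R D M w" "\<And>x. x \<in> carrier C \<Longrightarrow> w (i1 x) = f x" "\<And>x. x \<in> carrier C' \<Longrightarrow> w (i2 x) = g x"
      using lift[rule_format, OF M d(7) Hom_lin[OF g]] by blast
    obtain A' K' \<pi>' where p': "presents A' K' D \<pi>' w" using presents_exists[OF D(1) w(1)] by blast
    obtain A2 K2 where AK2: "mono_obj A2 K2" "A' \<subseteq> A2" "K' \<subseteq> K2" using mono_extension_exists[OF presentsD(14)[OF p']] by blast
    obtain E \<pi>2 f2 where p2: "presents A2 K2 E \<pi>2 f2" using AK2(1) unfolding mono_obj_def obj_def by blast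
    obtain v where v: "lin R D E v" "\<And>y. y \<in> carrier D \<Longrightarrow> f2 (v y) = w y"
      using presents_map[OF p' p2 AK2(2,3)] by blast
    have mE: "mono_only E f2" using mono_obj_iff[OF p2] AK2(1) by blast
    have u: "lin R C E (\<lambda>x. v (i1 x))" by (rule lin_comp[OF D(2) v(1)])
    have b: "bij_betw (\<lambda>x. v (i1 x)) (carrier C) (carrier E)"
      by (rule bij[OF mE u]) (use v(2) w(2) lin_closed[OF D(2)] in simp)
    let ?k = "inv_into (carrier C) (\<lambda>x. v (i1 x))"
    note mE' = presentsD(9)[OF p2]
    have k: "lin R E C ?k" by (rule lin_inv[OF d(9) mE' u b])
    have fk: "f (?k y) = f2 y" if "y \<in> carrier E" for y
    proof -
      have y: "v (i1 (?k y)) = y" using b that unfolding bij_betw_def by (metis f_inv_into_f)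
      have "?k y \<in> carrier C" using lin_closed[OF k that] .
      then have "f (?k y) = f2 (v (i1 (?k y)))" using v(2) w(2) lin_closed[OF D(2)] by simp
      then show ?thesis using y by simp
    qed
    let ?h = "restrict (\<lambda>x. ?k (v (i2 x))) (carrier C')"
    have h: "?h \<in> Hom R C' C" by (rule lin_restrict[OF mC'(2) lin_comp[OF lin_comp[OF D(3) v(1)] k]])
    have "restrict f (carrier C) (?h x) = g x" if x: "x \<in> carrier C'" for x
    proof -
      have iD: "i2 x \<in> carrier D" by (rule lin_closed[OF D(3) x])
      have vE: "v (i2 x) \<in> carrier E" by (rule lin_closed[OF v(1) iD])
      have "f (?k (v (i2 x))) = g x" using fk[OF vE] v(2)[OF iD] w(3)[OF x] by simp
      then show ?thesis using lin_closed[OF k vE] x by simp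
    qed
    then have "compose (carrier C') (restrict f (carrier C)) ?h = g" unfolding compose_Hom_iff[OF g] by blast
    then show "\<exists>h\<in>Hom R C' C. compose (carrier C') (restrict f (carrier C)) h = g" using h by blast
  next
    fix h assume h: "h \<in> Hom R C C" and e: "compose (carrier C) (restrict f (carrier C)) h = restrict f (carrier C)"
    have fh: "f (h x) = f x" if "x \<in> carrier C" for x
      using fun_cong[OF e, of x] that lin_closed[OF Hom_lin[OF h] that] by (simp add: compose_def)
    show "h \<in> Iso R C C" unfolding Iso_def using h bij[OF mono Hom_lin[OF h] fh] by blast
  qed
  then show ?thesis by blast
qed

end

theorem (in coproduct_pure_quotient_class) covering: "covering R U"
  unfolding covering_def
proof
  fix M :: "('r, 'm) module" assume M: "M \<in> ModR R"
  note mM = ModR_module[OF M]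
  interpret M: right_module R M by (rule mM)
  \<comment> \<open>The second index is ignored, so that every element of \<open>M\<close> has a
    basis element above it for each element of \<open>'m\<close>.\<close>
  define c where "c = (\<lambda>(a, b :: 'm). if a \<in> carrier M then a else \<zero>\<^bsub>M\<^esub>)"
  have "c i \<in> carrier M" for i unfolding c_def by (auto split: prod.split)
  then obtain \<Phi> where \<Phi>: "lin R (free R UNIV) M \<Phi>" "\<forall>i\<in>UNIV. \<Phi> (basis R UNIV i) = c i"
    using free_lift[OF ring_R mM, of UNIV c] by blast
  interpret class_over ty R U M \<Phi>
    by unfold_locales (use M \<Phi> in \<open>auto simp: c_def\<close>)
  show "\<exists>C f. is_cover R U C f M" by (rule cover_exists)
qed

section \<open>A criterion for preenveloping classes\<close>

definition closed_under_products :: "('r, 'x) ring_scheme \<Rightarrow> ('r, 'm) module set \<Rightarrow> bool" where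
  "closed_under_products R U \<longleftrightarrow>
    (\<forall>(I :: 'm set) N. small TYPE('m) I \<longrightarrow> (\<forall>i\<in>I. N i \<in> U) \<longrightarrow>
      (\<exists>P\<in>U. \<exists>pr. (\<forall>i\<in>I. lin R P (N i) (pr i)) \<and>
        (\<forall>T\<in>(ModR R :: ('r, 'm) module set). \<forall>u. (\<forall>i\<in>I. lin R T (N i) (u i)) \<longrightarrow>
          (\<exists>w. lin R T P w \<and> (\<forall>i\<in>I. \<forall>x\<in>carrier T. pr i (w x) = u i x)))))"

context module_universe
begin

text \<open>A solution set argument: each map from \<open>M\<close> into the class factors through a
  member with at most 2^Y elements, such members are quotients of one free module \<open>?F\<close>,
  and the product over the small set of kernels receives \<open>M\<close>.\<close>

lemma preenvelope_exists:
  fixes U :: "('r, 'm) module set"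
  assumes UM: "U \<subseteq> ModR R" and prod: "closed_under_products R U"
    and pure: "\<And>N B. \<lbrakk>N \<in> U; pure_submod R N B\<rbrakk> \<Longrightarrow> sub N B \<in> U"
    and M: "M \<in> ModR R"
  shows "\<exists>C f. is_preenvelope R U M f C"
proof -
  note mM = ModR_module[OF M]
  have mU: "right_module R N" if "N \<in> U" for N using UM that ModR_module by blast
  obtain Y :: "'m set" where Y: "small TYPE('m) Y" "infinite Y" "\<And>m::nat. |carrier (free R {..<m})| \<le>o |Y|"
    "|carrier R| \<le>o |Y|" "|carrier M| \<le>o |Y|"
    using bounding_set_exists[OF ModR_small[OF M]] by blast
  \<comment> \<open>Left indices carry the images of the elements of \<open>M\<close>, right indices
    enumerate the target; a kernel in \<open>?F\<close> then determines the target together with the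
    map from \<open>M\<close>, up to isomorphism.\<close>
  define J where "J = carrier M <+> Pow Y"
  let ?F = "free R J"
  note mF = right_module_free[OF ring_R, of J]
  have smF: "small TYPE('m) (carrier ?F)"
    unfolding J_def by (intro small_free small_Plus ModR_small[OF M] small_Pow[OF Y(1)])
  define ok where "ok K N \<pi> f \<longleftrightarrow> N \<in> U \<and> lin R ?F N \<pi> \<and> \<pi> ` carrier ?F = carrier N \<and>
     K = {v \<in> carrier ?F. \<pi> v = \<zero>\<^bsub>N\<^esub>} \<and> lin R M N f \<and> (\<forall>x\<in>carrier M. f x = \<pi> (basis R J (Inl x)))"
    for K and N :: "('r, 'm) module" and \<pi> f
  define V where "V = {K. \<exists>N \<pi> f. ok K N \<pi> f}"
  have "V \<subseteq> Pow (carrier ?F)" unfolding V_def ok_def by blast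
  then have smV: "small TYPE('m) V" using small_subset[OF small_Pow[OF smF]] by blast
  have "\<forall>K. \<exists>N \<pi> f. K \<in> V \<longrightarrow> ok K N \<pi> f" unfolding V_def by blast
  then obtain N \<pi> f where ok: "\<And>K. K \<in> V \<Longrightarrow> ok K (N K) (\<pi> K) (f K)" by metis
  obtain j :: "_ \<Rightarrow> 'm" where j: "inj_on j V" using small_imp_inj[OF smV] by blast
  define k where "k = inv_into V j"
  have k: "k (j K) = K" if "K \<in> V" for K unfolding k_def using j that by simp
  have kV: "k i \<in> V" if "i \<in> j ` V" for i using that k by auto
  have okD: "N K \<in> U" "lin R M (N K) (f K)" if "K \<in> V" for K using ok[OF that] unfolding ok_def by auto
  have "\<exists>P\<in>U. \<exists>pr. (\<forall>i\<in>j ` V. lin R P (N (k i)) (pr i)) \<and>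
        (\<forall>T\<in>(ModR R :: ('r, 'm) module set). \<forall>u. (\<forall>i\<in>j ` V. lin R T (N (k i)) (u i)) \<longrightarrow>
          (\<exists>w. lin R T P w \<and> (\<forall>i\<in>j ` V. \<forall>x\<in>carrier T. pr i (w x) = u i x)))"
    by (rule prod[unfolded closed_under_products_def, rule_format, of "j ` V" "\<lambda>i. N (k i)"])
      (rule small_image[OF smV], rule okD(1)[OF kV])
  then obtain P pr where P: "P \<in> U" "\<forall>i\<in>j ` V. lin R P (N (k i)) (pr i)" and
    w: "\<forall>T\<in>(ModR R :: ('r, 'm) module set). \<forall>u. (\<forall>i\<in>j ` V. lin R T (N (k i)) (u i)) \<longrightarrow>
          (\<exists>w. lin R T P w \<and> (\<forall>i\<in>j ` V. \<forall>x\<in>carrier T. pr i (w x) = u i x))"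
    by (elim bexE exE conjE) (rule that)
  have "\<exists>w. lin R M P w \<and> (\<forall>i\<in>j ` V. \<forall>x\<in>carrier M. pr i (w x) = f (k i) x)"
    by (rule w[rule_format, OF M]) (rule okD(2)[OF kV])
  then obtain \<phi> where \<phi>: "lin R M P \<phi>" "\<forall>i\<in>j ` V. \<forall>x\<in>carrier M. pr i (\<phi> x) = f (k i) x" by blast
  have "is_preenvelope R U M (restrict \<phi> (carrier M)) P"
    unfolding is_preenvelope_def
  proof (intro conjI ballI P(1))
    show "restrict \<phi> (carrier M) \<in> Hom R M P" by (rule lin_restrict[OF mM \<phi>(1)])
    fix C g assume C: "C \<in> U" and g: "g \<in> Hom R M C"
    note lg = Hom_lin[OF g]
    have gC: "g ` carrier M \<subseteq> carrier C" using lin_closed[OF lg] by blast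
    have "|g ` carrier M| \<le>o |Pow Y|" by (rule image_ordLeq[OF ordLeq_Pow[OF Y(5)]])
    then obtain B where B: "pure_submod R C B" "g ` carrier M \<subseteq> B" "|B| \<le>o |Pow Y|"
      using pure_submod_exists[OF mU[OF C] Y(2-4) gC] by blast
    have sB: "submod R C B" using B(1) unfolding pure_submod_def by blast
    note mB = right_module_sub[OF mU[OF C] sB]
    have "B \<noteq> {}" using submodD(2)[OF sB] by blast
    then obtain e where e: "e ` Pow Y = B" using card_of_ordLeq2[of B "Pow Y"] B(3) by blast
    define c where "c = case_sum g e"
    have "c i \<in> carrier (sub C B)" if "i \<in> J" for i
      using that B(2) e unfolding J_def c_def by auto
    then obtain \<theta> where \<theta>: "lin R ?F (sub C B) \<theta>" "\<forall>i\<in>J. \<theta> (basis R J i) = c i"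
      using free_lift[OF ring_R mB, of J c] by blast
    have surj: "\<theta> ` carrier ?F = carrier (sub C B)"
    proof
      show "\<theta> ` carrier ?F \<subseteq> carrier (sub C B)" using lin_closed[OF \<theta>(1)] by blast
      show "carrier (sub C B) \<subseteq> \<theta> ` carrier ?F"
      proof
        fix y assume "y \<in> carrier (sub C B)"
        then have "y \<in> e ` Pow Y" unfolding e by simp
        then obtain z where z: "z \<in> Pow Y" "y = e z" by (rule imageE)
        then have J: "Inr z \<in> J" unfolding J_def by blast
        then have "y = \<theta> (basis R J (Inr z))" using \<theta>(2) z(2) by (simp add: c_def)
        then show "y \<in> \<theta> ` carrier ?F" using basis_closed[OF ring_R J] by (rule image_eqI)
      qed
    qed
    define K where "K = {v \<in> carrier ?F. \<theta> v = \<zero>\<^bsub>C\<^esub>}"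
    have gB: "lin R M (sub C B) g" using B(2) by (intro lin_into_sub[OF lg]) blast
    have Inl_J: "Inl x \<in> J" if "x \<in> carrier M" for x unfolding J_def using that by blast
    have g\<theta>: "g x = \<theta> (basis R J (Inl x))" if "x \<in> carrier M" for x
      using bspec[OF \<theta>(2) Inl_J[OF that]] by (simp add: c_def)
    have "ok K (sub C B) \<theta> g"
      unfolding ok_def using pure[OF C B(1)] \<theta>(1) surj gB g\<theta> by (auto simp: K_def)
    then have KV: "K \<in> V" unfolding V_def by blast
    note okK = ok[OF KV, unfolded ok_def]
    \<comment> \<open>\<open>N K\<close> and \<open>sub C B\<close> are quotients of
      \<open>?F\<close> by the same kernel, so the chosen representative maps to the submodule at
      hand.\<close>
    have "\<exists>h. lin R (N K) (sub C B) h \<and> (\<forall>v\<in>carrier ?F. h (\<pi> K v) = \<theta> v)"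
    proof (rule lin_factor_surj[OF mF mU[OF okD(1)[OF KV]] mB _ _ \<theta>(1)])
      show "lin R ?F (N K) (\<pi> K)" "\<pi> K ` carrier ?F = carrier (N K)" using okK by auto
      fix v assume "v \<in> carrier ?F" "\<pi> K v = \<zero>\<^bsub>N K\<^esub>"
      then have "v \<in> K" using okK by blast
      then show "\<theta> v = \<zero>\<^bsub>sub C B\<^esub>" unfolding K_def by simp
    qed
    then obtain h where h: "lin R (N K) (sub C B) h" "\<forall>v\<in>carrier ?F. h (\<pi> K v) = \<theta> v" by blast
    have jK: "j K \<in> j ` V" using KV by blast
    have pr: "lin R P (N K) (pr (j K))" using P(2) jK k[OF KV] by metis
    have hC: "lin R P C (\<lambda>x. h (pr (j K) x))"
      by (rule lin_comp[OF pr lin_from_into_sub[OF h(1) submodD(1)[OF sB]]])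
    have "h (pr (j K) (\<phi> x)) = g x" if x: "x \<in> carrier M" for x
    proof -
      have "pr (j K) (\<phi> x) = f K x" using \<phi>(2) jK k[OF KV] x by metis
      also have "\<dots> = \<pi> K (basis R J (Inl x))" using okK x by blast
      finally show ?thesis
        using bspec[OF h(2) basis_closed[OF ring_R Inl_J[OF x]]] g\<theta>[OF x] by simp
    qed
    then have "compose (carrier M) (restrict (\<lambda>x. h (pr (j K) x)) (carrier P)) (restrict \<phi> (carrier M)) = g"
      unfolding compose_Hom_iff[OF g] using lin_closed[OF \<phi>(1)] by simp
    then show "\<exists>h\<in>Hom R P C. compose (carrier M) h (restrict \<phi> (carrier M)) = g"
      using lin_restrict[OF mU[OF P(1)] hC] by blast
  qed
  then show ?thesis by blast
qed

end

section \<open>Push-outs and pull-backs of short exact sequences\<close>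

text \<open>A product over \<open>bool\<close>, so that the module axioms and smallness come from
  \<open>prodm\<close>; the index \<open>True\<close> is the first factor.\<close>

definition pairm :: "('r, 'm) module \<Rightarrow> ('r, 'm) module \<Rightarrow> ('r, bool \<Rightarrow> 'm) module" where
  "pairm A B = prodm UNIV (\<lambda>b. if b then A else B)"

definition pair :: "'m \<Rightarrow> 'm \<Rightarrow> bool \<Rightarrow> 'm" where
  "pair a b = (\<lambda>t. if t then a else b)"

lemma pairm_simps:
  "x \<in> carrier (pairm A B) \<longleftrightarrow> x True \<in> carrier A \<and> x False \<in> carrier B"
  "\<zero>\<^bsub>pairm A B\<^esub> = pair \<zero>\<^bsub>A\<^esub> \<zero>\<^bsub>B\<^esub>"
  "v \<oplus>\<^bsub>pairm A B\<^esub> w = pair (v True \<oplus>\<^bsub>A\<^esub> w True) (v False \<oplus>\<^bsub>B\<^esub> w False)"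
  "r \<odot>\<^bsub>pairm A B\<^esub> v = pair (r \<odot>\<^bsub>A\<^esub> v True) (r \<odot>\<^bsub>B\<^esub> v False)"
proof -
  show "x \<in> carrier (pairm A B) \<longleftrightarrow> x True \<in> carrier A \<and> x False \<in> carrier B"
  proof
    assume "x True \<in> carrier A \<and> x False \<in> carrier B"
    then have "x i \<in> carrier (if i then A else B)" for i by (cases i) auto
    then show "x \<in> carrier (pairm A B)" unfolding pairm_def prodm_simps by auto
  next
    assume "x \<in> carrier (pairm A B)"
    then have "x i \<in> carrier (if i then A else B)" for i unfolding pairm_def prodm_simps by (rule PiE_mem) simp
    from this[of True] this[of False] show "x True \<in> carrier A \<and> x False \<in> carrier B" by simp
  qed
  show "\<zero>\<^bsub>pairm A B\<^esub> = pair \<zero>\<^bsub>A\<^esub> \<zero>\<^bsub>B\<^esub>"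
    "v \<oplus>\<^bsub>pairm A B\<^esub> w = pair (v True \<oplus>\<^bsub>A\<^esub> w True) (v False \<oplus>\<^bsub>B\<^esub> w False)"
    "r \<odot>\<^bsub>pairm A B\<^esub> v = pair (r \<odot>\<^bsub>A\<^esub> v True) (r \<odot>\<^bsub>B\<^esub> v False)"
    by (auto simp: pairm_def prodm_simps pair_def fun_eq_iff)
qed

lemma pair_simps [simp]: "pair a b True = a" "pair a b False = b" "pair (x True) (x False) = x"
  "pair a b = pair c d \<longleftrightarrow> a = c \<and> b = d"
  by (auto simp: pair_def fun_eq_iff split: if_splits)

lemma pair_exhaust: obtains a b where "x = pair a b"
  using pair_simps(3)[of x] by metis

lemma right_module_pairm: "\<lbrakk>ring R; right_module R A; right_module R B\<rbrakk> \<Longrightarrow> right_module R (pairm A B)"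
  unfolding pairm_def by (rule right_module_prodm) auto

lemma lin_fst: "lin R (pairm A B) A (\<lambda>x. x True)"
  by (rule linI) (auto simp: pairm_simps)

lemma lin_snd: "lin R (pairm A B) B (\<lambda>x. x False)"
  by (rule linI) (auto simp: pairm_simps)

lemma lin_pair: "\<lbrakk>lin R T A u; lin R T B v\<rbrakk> \<Longrightarrow> lin R T (pairm A B) (\<lambda>x. pair (u x) (v x))"
  by (rule linI) (auto simp: pairm_simps lin_closed lin_add lin_smult)

lemma lin_copair:
  assumes "right_module R T" "ring R" "right_module R A" "right_module R B" "lin R A T u" "lin R B T v"
  shows "lin R (pairm A B) T (\<lambda>x. u (x True) \<oplus>\<^bsub>T\<^esub> v (x False))"
  by (rule lin_sum[OF right_module_pairm[OF assms(2-4)] assms(1) lin_comp[OF lin_fst assms(5)] lin_comp[OF lin_snd assms(6)]])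

context module_universe
begin

lemma small_pairm:
  assumes "A \<in> ModR R" "B \<in> (ModR R :: ('r, 'm) module set)"
  shows "small TYPE('m) (carrier (pairm A B))"
  unfolding pairm_def prodm_simps
  by (rule small_PiE[OF small_finite[OF finite]]) (use ModR_small[OF assms(1)] ModR_small[OF assms(2)] in auto)

text \<open>For linear maps this is the elementwise form of a pull-back square: \<open>M'\<close> is
  identified with the pairs \<open>(a, b)\<close> such that \<open>p a = f b\<close>, the last
  clause being the injectivity of the identification.\<close>

definition cartesian :: "('r, 'm) module \<Rightarrow> ('m \<Rightarrow> 'm) \<Rightarrow> ('m \<Rightarrow> 'm) \<Rightarrow> ('r, 'm) module \<Rightarrow> ('m \<Rightarrow> 'm)
    \<Rightarrow> ('r, 'm) module \<Rightarrow> ('m \<Rightarrow> 'm) \<Rightarrow> bool" where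
  "cartesian M' f' p' M p N' f \<longleftrightarrow>
     (\<forall>x\<in>carrier M'. p (f' x) = f (p' x)) \<and>
     (\<forall>a\<in>carrier M. \<forall>b\<in>carrier N'. p a = f b \<longrightarrow> (\<exists>x\<in>carrier M'. f' x = a \<and> p' x = b)) \<and>
     (\<forall>x\<in>carrier M'. f' x = \<zero>\<^bsub>M\<^esub> \<longrightarrow> p' x = \<zero>\<^bsub>N'\<^esub> \<longrightarrow> x = \<zero>\<^bsub>M'\<^esub>)"

text \<open>The push-out of \<open>i : L \<rightarrow> M\<close> along \<open>f\<close> is \<open>(M \<oplus> L')/{(i x, -f x)}\<close>.\<close>

lemma sx_pushout_exists:
  fixes L L' :: "('r, 'm) module"
  assumes s: "sx R L i M p N" and L': "L' \<in> ModR R" and f: "lin R L L' f"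
  obtains M' i' p' f' where "sx R L' i' M' p' N" "lin R M M' f'"
    "\<And>x. x \<in> carrier L \<Longrightarrow> f' (i x) = i' (f x)" "\<And>x. x \<in> carrier M \<Longrightarrow> p' (f' x) = p x"
proof -
  note d = sxD[OF s]
  note mL' = ModR_module[OF L']
  interpret L: right_module R L by (rule d(4))
  interpret M: right_module R M by (rule d(5))
  interpret N: right_module R N by (rule d(6))
  interpret L': right_module R L' by (rule mL')
  let ?D = "pairm M L'"
  note mD = right_module_pairm[OF ring_R d(5) mL']
  interpret D: right_module R ?D by (rule mD)
  let ?r = "\<lambda>x. pair (i x) (\<zero>\<^bsub>L'\<^esub> \<ominus>\<^bsub>L'\<^esub> f x)"
  have r: "lin R L ?D ?r"
    by (rule lin_pair[OF d(7) lin_difference[OF d(4) mL' lin_zero_map[OF mL'] f]])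
  have sP: "submod R ?D (?r ` carrier L)" by (rule submod_image[OF d(4) mD r submod_carrier[OF d(4)]])
  obtain Q :: "('r, 'm) module" and \<pi> where Q: "Q \<in> ModR R" "lin R ?D Q \<pi>" "\<pi> ` carrier ?D = carrier Q"
    "\<forall>x\<in>carrier ?D. \<pi> x = \<zero>\<^bsub>Q\<^esub> \<longleftrightarrow> x \<in> ?r ` carrier L"
    using quotient_exists[OF mD sP small_pairm[OF d(2) L']] by blast
  note mQ = ModR_module[OF Q(1)]
  interpret Q: right_module R Q by (rule mQ)
  let ?f = "\<lambda>x. \<pi> (pair x \<zero>\<^bsub>L'\<^esub>)" and ?i = "\<lambda>y. \<pi> (pair \<zero>\<^bsub>M\<^esub> y)"
  have f': "lin R M Q ?f" by (rule lin_comp[OF lin_pair[OF lin_id lin_zero_map[OF mL']] Q(2)])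
  have i': "lin R L' Q ?i" by (rule lin_comp[OF lin_pair[OF lin_zero_map[OF d(5)] lin_id] Q(2)])
  have fL: "f x \<in> carrier L'" if "x \<in> carrier L" for x using lin_closed[OF f that] .
  have iL: "i x \<in> carrier M" if "x \<in> carrier L" for x using lin_closed[OF d(7) that] .
  have decomp: "\<pi> (pair a b) = ?f a \<oplus>\<^bsub>Q\<^esub> ?i b" if "a \<in> carrier M" "b \<in> carrier L'" for a b
    using lin_add[OF Q(2), of "pair a \<zero>\<^bsub>L'\<^esub>" "pair \<zero>\<^bsub>M\<^esub> b"] that by (simp add: pairm_simps)
  have rel: "?f (i x) = ?i (f x)" if x: "x \<in> carrier L" for x
  proof -
    have "\<pi> (?r x) = \<zero>\<^bsub>Q\<^esub>" using Q(4) lin_closed[OF r x] x by blast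
    then have "?f (i x) \<oplus>\<^bsub>Q\<^esub> ?i (\<zero>\<^bsub>L'\<^esub> \<ominus>\<^bsub>L'\<^esub> f x) = \<zero>\<^bsub>Q\<^esub>" using decomp[OF iL[OF x], of "\<zero>\<^bsub>L'\<^esub> \<ominus>\<^bsub>L'\<^esub> f x"] fL[OF x] by simp
    moreover have "?i (\<zero>\<^bsub>L'\<^esub> \<ominus>\<^bsub>L'\<^esub> f x) = \<zero>\<^bsub>Q\<^esub> \<ominus>\<^bsub>Q\<^esub> ?i (f x)"
      using lin_diff[OF mL' mQ i' _ fL[OF x], of "\<zero>\<^bsub>L'\<^esub>"] lin_zero[OF mL' mQ i'] by simp
    ultimately have "?f (i x) \<ominus>\<^bsub>Q\<^esub> ?i (f x) = \<zero>\<^bsub>Q\<^esub>"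
      using lin_closed[OF i' fL[OF x]] by (simp add: Q.M.minus_eq)
    then show ?thesis using Q.diff_zero_iff lin_closed[OF i' fL[OF x]] lin_closed[OF f' iL[OF x]] by simp
  qed
  have "\<exists>w. lin R Q N w \<and> (\<forall>x\<in>carrier ?D. w (\<pi> x) = p (x True))"
  proof (rule lin_factor_surj[OF mD mQ d(6) Q(2,3) lin_comp[OF lin_fst d(8)]])
    fix x assume "x \<in> carrier ?D" "\<pi> x = \<zero>\<^bsub>Q\<^esub>"
    then obtain y where "y \<in> carrier L" "x = ?r y" using Q(4) by blast
    then show "p (x True) = \<zero>\<^bsub>N\<^esub>" using d(12) by simp
  qed
  then obtain p' where p': "lin R Q N p'" "\<forall>x\<in>carrier ?D. p' (\<pi> x) = p (x True)" by blast
  have p'f: "p' (?f x) = p x" if "x \<in> carrier M" for x using p'(2) that by (simp add: pairm_simps)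
  have "sx R L' ?i Q p' N"
  proof (rule sxI[OF L' Q(1) d(3) i' p'(1)])
    show "inj_on ?i (carrier L')"
      unfolding lin_inj_on_iff[OF mL' mQ i']
    proof (intro ballI impI)
      fix y assume y: "y \<in> carrier L'" "?i y = \<zero>\<^bsub>Q\<^esub>"
      then have "pair \<zero>\<^bsub>M\<^esub> y \<in> ?r ` carrier L" using Q(4) by (simp add: pairm_simps)
      then obtain x where x: "x \<in> carrier L" "\<zero>\<^bsub>M\<^esub> = i x" "y = \<zero>\<^bsub>L'\<^esub> \<ominus>\<^bsub>L'\<^esub> f x" by auto
      have "x = \<zero>\<^bsub>L\<^esub>" using x(1,2) d(9) lin_inj_on_iff[OF d(4,5,7)] by metis
      then show "y = \<zero>\<^bsub>L'\<^esub>" using x(3) lin_zero[OF d(4) mL' f] L'.diff_zero_iff by simp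
    qed
    show "p' (?i y) = \<zero>\<^bsub>N\<^esub>" if "y \<in> carrier L'" for y
      using p'(2) that lin_zero[OF d(5,6,8)] by (simp add: pairm_simps)
    show "\<exists>x\<in>carrier L'. ?i x = y" if y: "y \<in> carrier Q" "p' y = \<zero>\<^bsub>N\<^esub>" for y
    proof -
      obtain z where "z \<in> carrier ?D" "y = \<pi> z" using y(1) Q(3) by blast
      moreover obtain a b where "z = pair a b" by (rule pair_exhaust)
      ultimately have ab: "a \<in> carrier M" "b \<in> carrier L'" "y = \<pi> (pair a b)" by (auto simp: pairm_simps)
      have "p a = \<zero>\<^bsub>N\<^esub>" using p'(2) ab y(2) by (simp add: pairm_simps)
      then obtain x where x: "x \<in> carrier L" "i x = a" using d(13) ab(1) by blast
      have "y = ?i (f x) \<oplus>\<^bsub>Q\<^esub> ?i b" using decomp[OF ab(1,2)] rel[OF x(1)] x(2) ab(3) by simp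
      then have "?i (f x \<oplus>\<^bsub>L'\<^esub> b) = y" using lin_add[OF i' fL[OF x(1)] ab(2)] by simp
      then show ?thesis using fL[OF x(1)] ab(2) by blast
    qed
    show "\<exists>x\<in>carrier Q. p' x = z" if z: "z \<in> carrier N" for z
    proof -
      obtain x where "x \<in> carrier M" "p x = z" using d(14)[OF z] by blast
      then show ?thesis using p'f lin_closed[OF f'] by blast
    qed
  qed
  then show thesis using that f' rel p'f by blast
qed

text \<open>The submodule of \<open>pairm M N'\<close> on which the two maps to \<open>N\<close>
  agree is copied into \<open>'m\<close>; the kernel of its projection to \<open>N'\<close> is again
  \<open>L\<close>.\<close>

lemma sx_pullback_exists:
  fixes N N' :: "('r, 'm) module"
  assumes s: "sx R L i M p N" and N': "N' \<in> ModR R" and f: "lin R N' N f"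
  obtains M' i' p' f' where "sx R L i' M' p' N'" "lin R M' M f'"
    "cartesian M' f' p' M p N' f" "\<And>x. x \<in> carrier L \<Longrightarrow> f' (i' x) = i x"
proof -
  note d = sxD[OF s]
  note mN' = ModR_module[OF N']
  interpret L: right_module R L by (rule d(4))
  interpret M: right_module R M by (rule d(5))
  interpret N: right_module R N by (rule d(6))
  interpret N': right_module R N' by (rule mN')
  let ?D = "pairm M N'"
  note mD = right_module_pairm[OF ring_R d(5) mN']
  let ?e = "\<lambda>x. p (x True) \<ominus>\<^bsub>N\<^esub> f (x False)"
  have e: "lin R ?D N ?e" by (rule lin_difference[OF mD d(6) lin_comp[OF lin_fst d(8)] lin_comp[OF lin_snd f]])
  define P where "P = {x \<in> carrier ?D. ?e x = \<zero>\<^bsub>N\<^esub>}"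
  have sP: "submod R ?D P" unfolding P_def by (rule submod_kernel[OF mD d(6) e])
  have P: "x \<in> P \<longleftrightarrow> x True \<in> carrier M \<and> x False \<in> carrier N' \<and> p (x True) = f (x False)" for x
    unfolding P_def pairm_simps using N.diff_zero_iff lin_closed[OF d(8)] lin_closed[OF f] by auto
  note mP = right_module_sub[OF mD sP]
  have smP: "small TYPE('m) (carrier (sub ?D P))"
    using small_subset[OF small_pairm[OF d(2) N'] submodD(1)[OF sP]] by simp
  obtain Q :: "('r, 'm) module" and \<phi> where Q: "Q \<in> ModR R" "lin R (sub ?D P) Q \<phi>" "bij_betw \<phi> (carrier (sub ?D P)) (carrier Q)"
    using realize[OF mP smP] by blast
  note mQ = ModR_module[OF Q(1)]
  have inj: "inj_on \<phi> P" and im: "\<phi> ` P = carrier Q" using Q(3) by (auto simp: bij_betw_def)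
  define \<psi> where "\<psi> = inv_into P \<phi>"
  have \<psi>: "lin R Q (sub ?D P) \<psi>" using lin_inv[OF mP mQ Q(2,3)] unfolding \<psi>_def by simp
  have \<psi>\<phi>: "\<psi> (\<phi> x) = x" if "x \<in> P" for x unfolding \<psi>_def using inj that by simp
  have \<psi>P: "\<psi> y \<in> P" "\<phi> (\<psi> y) = y" if "y \<in> carrier Q" for y
    unfolding \<psi>_def using that f_inv_into_f[of y \<phi> P] inv_into_into[of y \<phi> P] unfolding im by auto
  have \<psi>D: "lin R Q ?D \<psi>" by (rule lin_from_into_sub[OF \<psi> submodD(1)[OF sP]])
  let ?f = "\<lambda>y. \<psi> y True" and ?p = "\<lambda>y. \<psi> y False" and ?i = "\<lambda>x. \<phi> (pair (i x) \<zero>\<^bsub>N'\<^esub>)"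
  have f': "lin R Q M ?f" by (rule lin_comp[OF \<psi>D lin_fst])
  have p': "lin R Q N' ?p" by (rule lin_comp[OF \<psi>D lin_snd])
  have iP: "pair (i x) \<zero>\<^bsub>N'\<^esub> \<in> P" if "x \<in> carrier L" for x
    unfolding P using that d(12) lin_closed[OF d(7)] lin_zero[OF mN' d(6) f] by simp
  have "lin R L (sub ?D P) (\<lambda>x. pair (i x) \<zero>\<^bsub>N'\<^esub>)"
    by (rule lin_into_sub[OF lin_pair[OF d(7) lin_zero_map[OF mN']] iP])
  then have i': "lin R L Q ?i" by (rule lin_comp[OF _ Q(2)])
  have pf: "p (?f x) = f (?p x)" if "x \<in> carrier Q" for x using \<psi>P(1)[OF that] unfolding P by simp
  have ex: "\<exists>x\<in>carrier Q. ?f x = a \<and> ?p x = b" if "a \<in> carrier M" "b \<in> carrier N'" "p a = f b" for a b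
  proof -
    have "pair a b \<in> P" unfolding P using that by simp
    then show ?thesis using \<psi>\<phi> im by (intro bexI[of _ "\<phi> (pair a b)"]) auto
  qed
  have zero: "x = \<zero>\<^bsub>Q\<^esub>" if x: "x \<in> carrier Q" "?f x = \<zero>\<^bsub>M\<^esub>" "?p x = \<zero>\<^bsub>N'\<^esub>" for x
  proof -
    have "\<psi> x = pair (\<psi> x True) (\<psi> x False)" by simp
    then have "\<psi> x = pair \<zero>\<^bsub>M\<^esub> \<zero>\<^bsub>N'\<^esub>" unfolding x(2,3) .
    then have "\<psi> x = \<zero>\<^bsub>sub ?D P\<^esub>" by (simp add: pairm_simps)
    then show ?thesis using \<psi>P(2)[OF x(1)] lin_zero[OF mP mQ Q(2)] by metis
  qed
  have fi: "?f (?i x) = i x" "?p (?i x) = \<zero>\<^bsub>N'\<^esub>" if "x \<in> carrier L" for x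
    using \<psi>\<phi>[OF iP[OF that]] by auto
  have "sx R L ?i Q ?p N'"
  proof (rule sxI[OF d(1) Q(1) N' i' p'])
    show "inj_on ?i (carrier L)"
    proof (rule inj_onI)
      fix x y assume xy: "x \<in> carrier L" "y \<in> carrier L" and e: "?i x = ?i y"
      have "i x = i y" using fi(1)[OF xy(1)] fi(1)[OF xy(2)] unfolding e by simp
      then show "x = y" using d(9) xy by (auto dest: inj_onD)
    qed
    show "?p (?i x) = \<zero>\<^bsub>N'\<^esub>" if "x \<in> carrier L" for x by (rule fi(2)[OF that])
    show "\<exists>x\<in>carrier L. ?i x = y" if y: "y \<in> carrier Q" "?p y = \<zero>\<^bsub>N'\<^esub>" for y
    proof -
      have "p (?f y) = \<zero>\<^bsub>N\<^esub>" using pf[OF y(1)] y(2) lin_zero[OF mN' d(6) f] by simp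
      then obtain x where x: "x \<in> carrier L" "i x = ?f y" using d(13)[OF lin_closed[OF f' y(1)]] by blast
      have "\<psi> y = pair (?f y) (?p y)" by simp
      then have "\<psi> y = pair (i x) \<zero>\<^bsub>N'\<^esub>" using x y(2) by simp
      then show ?thesis using \<psi>P(2)[OF y(1)] x(1) by metis
    qed
    show "\<exists>x\<in>carrier Q. ?p x = z" if z: "z \<in> carrier N'" for z
    proof -
      obtain a where "a \<in> carrier M" "p a = f z" using d(14)[OF lin_closed[OF f z]] by blast
      then show ?thesis using ex[OF _ z] by blast
    qed
  qed
  moreover have "cartesian Q ?f ?p M p N' f" unfolding cartesian_def using pf ex zero by blast
  ultimately show thesis using that f' fi(1) by blast
qed

text \<open>A morphism of short exact sequences that is the identity on \<open>N\<close> has a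
  push-out as its left square: \<open>M \<oplus> L'\<close> maps onto \<open>M'\<close>, and a pair
  in the kernel has the form \<open>(i l, -f l)\<close>. The second conclusion yields the uniqueness
  of induced maps.\<close>

lemma sx_is_pushout:
  fixes L L' :: "('r, 'm) module"
  assumes s: "sx R L i M p N" and s': "sx R L' i' M' p' N" and f: "lin R L L' f" and f': "lin R M M' f'"
    and c: "\<And>x. x \<in> carrier L \<Longrightarrow> f' (i x) = i' (f x)" "\<And>x. x \<in> carrier M \<Longrightarrow> p' (f' x) = p x"
    and T: "right_module R T" and u: "lin R M T u" and v: "lin R L' T v"
    and e: "\<And>x. x \<in> carrier L \<Longrightarrow> u (i x) = v (f x)"
  shows "\<exists>w. lin R M' T w \<and> (\<forall>x\<in>carrier M. w (f' x) = u x) \<and> (\<forall>y\<in>carrier L'. w (i' y) = v y)"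
    "\<And>y. y \<in> carrier M' \<Longrightarrow> \<exists>a\<in>carrier M. \<exists>b\<in>carrier L'. y = f' a \<oplus>\<^bsub>M'\<^esub> i' b"
proof -
  note d = sxD[OF s] and d' = sxD[OF s']
  interpret M: right_module R M by (rule d(5))
  interpret L': right_module R L' by (rule d'(4))
  interpret M': right_module R M' by (rule d'(5))
  interpret N: right_module R N by (rule d(6))
  interpret T: right_module R T by (rule T)
  show dec: "\<exists>a\<in>carrier M. \<exists>b\<in>carrier L'. y = f' a \<oplus>\<^bsub>M'\<^esub> i' b" if y: "y \<in> carrier M'" for y
  proof -
    obtain a where a: "a \<in> carrier M" "p a = p' y" using d(14)[OF lin_closed[OF d'(8) y]] by blast
    have fa: "f' a \<in> carrier M'" by (rule lin_closed[OF f' a(1)])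
    have "p' (y \<ominus>\<^bsub>M'\<^esub> f' a) = \<zero>\<^bsub>N\<^esub>"
      using lin_diff[OF d'(5,6,8) y fa] c(2)[OF a(1)] a(2) lin_closed[OF d'(8) y] N.diff_zero_iff by simp
    then obtain b where b: "b \<in> carrier L'" "i' b = y \<ominus>\<^bsub>M'\<^esub> f' a" using d'(13) y fa M'.M.minus_closed by metis
    then have "y = f' a \<oplus>\<^bsub>M'\<^esub> i' b" using M'.add_diff[OF y fa] by simp
    then show ?thesis using a(1) b(1) by blast
  qed
  note mD = right_module_pairm[OF ring_R d(5) d'(4)]
  let ?h = "\<lambda>x. f' (x True) \<oplus>\<^bsub>M'\<^esub> i' (x False)" and ?g = "\<lambda>x. u (x True) \<oplus>\<^bsub>T\<^esub> v (x False)"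
  have h: "lin R (pairm M L') M' ?h" by (rule lin_copair[OF d'(5) ring_R d(5) d'(4) f' d'(7)])
  have g: "lin R (pairm M L') T ?g" by (rule lin_copair[OF T ring_R d(5) d'(4) u v])
  have "\<exists>w. lin R M' T w \<and> (\<forall>x\<in>carrier (pairm M L'). w (?h x) = ?g x)"
  proof (rule lin_factor_surj[OF mD d'(5) T h _ g])
    show "?h ` carrier (pairm M L') = carrier M'"
    proof
      show "?h ` carrier (pairm M L') \<subseteq> carrier M'" using lin_closed[OF h] by blast
      show "carrier M' \<subseteq> ?h ` carrier (pairm M L')"
      proof
        fix y assume "y \<in> carrier M'"
        then obtain a b where "a \<in> carrier M" "b \<in> carrier L'" "y = f' a \<oplus>\<^bsub>M'\<^esub> i' b" using dec by blast
        then show "y \<in> ?h ` carrier (pairm M L')" by (intro image_eqI[of _ _ "pair a b"]) (auto simp: pairm_simps)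
      qed
    qed
    fix x assume x: "x \<in> carrier (pairm M L')" "?h x = \<zero>\<^bsub>M'\<^esub>"
    obtain a b where ab: "x = pair a b" by (rule pair_exhaust)
    then have ac: "a \<in> carrier M" and bc: "b \<in> carrier L'" and z: "f' a \<oplus>\<^bsub>M'\<^esub> i' b = \<zero>\<^bsub>M'\<^esub>"
      using x by (auto simp: pairm_simps)
    have fa: "f' a \<in> carrier M'" and ib: "i' b \<in> carrier M'" using lin_closed[OF f' ac] lin_closed[OF d'(7) bc] .
    have "p' (f' a) \<oplus>\<^bsub>N\<^esub> p' (i' b) = \<zero>\<^bsub>N\<^esub>" using lin_add[OF d'(8) fa ib] z lin_zero[OF d'(5,6,8)] by simp
    then have "p a = \<zero>\<^bsub>N\<^esub>" using c(2)[OF ac] d'(12)[OF bc] lin_closed[OF d(8) ac] by simp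
    then obtain l where l: "l \<in> carrier L" "i l = a" using d(13)[OF ac] by blast
    have fl: "f l \<in> carrier L'" by (rule lin_closed[OF f l(1)])
    have "i' (f l \<oplus>\<^bsub>L'\<^esub> b) = \<zero>\<^bsub>M'\<^esub>" using lin_add[OF d'(7) fl bc] c(1)[OF l(1)] l(2) z by simp
    then have lb: "f l \<oplus>\<^bsub>L'\<^esub> b = \<zero>\<^bsub>L'\<^esub>" using d'(9) lin_inj_on_iff[OF d'(4,5,7)] fl bc by simp
    have "?g x = v (f l) \<oplus>\<^bsub>T\<^esub> v b" using ab e[OF l(1)] l(2) by simp
    also have "\<dots> = v (f l \<oplus>\<^bsub>L'\<^esub> b)" using lin_add[OF v fl bc] by simp
    also have "\<dots> = \<zero>\<^bsub>T\<^esub>" using lb lin_zero[OF d'(4) T v] by simp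
    finally show "?g x = \<zero>\<^bsub>T\<^esub>" .
  qed
  then obtain w where w: "lin R M' T w" "\<forall>x\<in>carrier (pairm M L'). w (?h x) = ?g x" by blast
  have "w (f' x) = u x" if x: "x \<in> carrier M" for x
    using w(2)[rule_format, of "pair x \<zero>\<^bsub>L'\<^esub>"] x lin_zero[OF d'(4,5,7)] lin_zero[OF d'(4) T v]
      lin_closed[OF f' x] lin_closed[OF u x] by (simp add: pairm_simps)
  moreover have "w (i' y) = v y" if y: "y \<in> carrier L'" for y
    using w(2)[rule_format, of "pair \<zero>\<^bsub>M\<^esub> y"] y lin_zero[OF d(5) d'(5) f'] lin_zero[OF d(5) T u]
      lin_closed[OF d'(7) y] lin_closed[OF v y] by (simp add: pairm_simps)
  ultimately show "\<exists>w. lin R M' T w \<and> (\<forall>x\<in>carrier M. w (f' x) = u x) \<and> (\<forall>y\<in>carrier L'. w (i' y) = v y)"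
    using w(1) by blast
qed

lemma pullback_factor:
  fixes M M' N' :: "('r, 'm) module"
  assumes m: "right_module R M" "right_module R M'" "right_module R N'" and f': "lin R M' M f'" and p': "lin R M' N' p'"
    and cart: "cartesian M' f' p' M p N' f"
  shows "\<lbrakk>right_module R T; lin R T M u; lin R T N' v; \<And>x. x \<in> carrier T \<Longrightarrow> p (u x) = f (v x)\<rbrakk>
    \<Longrightarrow> \<exists>w. lin R T M' w \<and> (\<forall>x\<in>carrier T. f' (w x) = u x \<and> p' (w x) = v x)"
    "\<lbrakk>x \<in> carrier M'; y \<in> carrier M'; f' x = f' y; p' x = p' y\<rbrakk> \<Longrightarrow> x = y"
proof -
  note mD = right_module_pairm[OF ring_R m(1,3)]
  have h: "lin R M' (pairm M N') (\<lambda>y. pair (f' y) (p' y))" by (rule lin_pair[OF f' p'])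
  have inj: "inj_on (\<lambda>y. pair (f' y) (p' y)) (carrier M')"
    unfolding lin_inj_on_iff[OF m(2) mD h] using cart by (simp add: pairm_simps cartesian_def)
  then show "\<lbrakk>x \<in> carrier M'; y \<in> carrier M'; f' x = f' y; p' x = p' y\<rbrakk> \<Longrightarrow> x = y" by (simp add: inj_on_def)
  assume T: "right_module R T" and u: "lin R T M u" and v: "lin R T N' v"
    and e: "\<And>x. x \<in> carrier T \<Longrightarrow> p (u x) = f (v x)"
  have "\<exists>w. lin R T M' w \<and> (\<forall>x\<in>carrier T. pair (f' (w x)) (p' (w x)) = pair (u x) (v x))"
  proof (rule lin_factor_inj[OF m(2) mD T h inj lin_pair[OF u v]])
    fix x assume x: "x \<in> carrier T"
    then obtain y where "y \<in> carrier M'" "f' y = u x" "p' y = v x" 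
      using cart lin_closed[OF u x] lin_closed[OF v x] e[OF x] unfolding cartesian_def by blast
    then show "pair (u x) (v x) \<in> (\<lambda>y. pair (f' y) (p' y)) ` carrier M'" by (intro image_eqI[of _ _ y]) auto
  qed
  then show "\<exists>w. lin R T M' w \<and> (\<forall>x\<in>carrier T. f' (w x) = u x \<and> p' (w x) = v x)" by simp
qed

end

section \<open>Vanishing of relative Ext groups\<close>

text \<open>On \<open>K\<close> the map \<open>t\<close> takes values in \<open>N\<close>. Extending
  these to \<open>P\<close> and subtracting leaves a map that kills \<open>K\<close> and so descends
  to a section on \<open>M\<close>.\<close>

lemma sx_section_of_extension:
  assumes s: "sx R K i P p M" and s': "sx R N j B q M"
    and t: "lin R P B t" "\<And>x. x \<in> carrier P \<Longrightarrow> q (t x) = p x"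
    and ext: "\<And>w. lin R K N w \<Longrightarrow> \<exists>g. lin R P N g \<and> (\<forall>x\<in>carrier K. g (i x) = w x)"
  shows "\<exists>s. lin R M B s \<and> (\<forall>x\<in>carrier M. q (s x) = x)"
proof -
  note d = sxD[OF s]
  note d' = sxD[OF s']
  interpret B: right_module R B by (rule d'(5))
  interpret M: right_module R M by (rule d(6))
  have "q (t (i x)) = \<zero>\<^bsub>M\<^esub>" if "x \<in> carrier K" for x
    using t(2) lin_closed[OF d(7) that] d(12)[OF that] by simp
  then obtain w where w: "lin R K N w" "\<forall>x\<in>carrier K. j (w x) = t (i x)"
    using sx_factor_mono[OF s' d(4) lin_comp[OF d(7) t(1)]] by blast
  obtain g where g: "lin R P N g" "\<forall>x\<in>carrier K. g (i x) = w x" using ext[OF w(1)] by blast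
  let ?u = "\<lambda>x. t x \<ominus>\<^bsub>B\<^esub> j (g x)"
  have jg: "lin R P B (\<lambda>x. j (g x))" by (rule lin_comp[OF g(1) d'(7)])
  have u: "lin R P B ?u" by (rule lin_difference[OF d(5) d'(5) t(1) jg])
  have "?u (i x) = \<zero>\<^bsub>B\<^esub>" if "x \<in> carrier K" for x
    using g(2) w(2) that lin_closed[OF t(1) lin_closed[OF d(7) that]] B.diff_zero_iff by simp
  then obtain a where a: "lin R M B a" "\<forall>x\<in>carrier P. a (p x) = ?u x" using sx_factor_epi[OF s d'(5) u] by blast
  have "q (a y) = y" if y: "y \<in> carrier M" for y
  proof -
    obtain x where x: "x \<in> carrier P" "p x = y" using d(14)[OF y] by blast
    have "q (?u x) = q (t x) \<ominus>\<^bsub>M\<^esub> q (j (g x))"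
      by (rule lin_diff[OF d'(5,6,8) lin_closed[OF t(1) x(1)] lin_closed[OF jg x(1)]])
    also have "\<dots> = y" using t(2)[OF x(1)] x d'(12)[OF lin_closed[OF g(1) x(1)]] M.diff_zero y by simp
    finally show ?thesis using a(2) x by auto
  qed
  then show ?thesis using a(1) by blast
qed

text \<open>The preceding lemma for the sequence over itself, where \<open>t\<close> is the identity
  and a retraction extends every map out of \<open>N\<close>.\<close>

lemma sx_section_of_retraction:
  assumes s: "sx R N j B q M" and r: "lin R B N r" "\<And>x. x \<in> carrier N \<Longrightarrow> r (j x) = x"
  shows "\<exists>s. lin R M B s \<and> (\<forall>x\<in>carrier M. q (s x) = x)"
proof (rule sx_section_of_extension[OF s s lin_id])
  show "\<exists>g. lin R B N g \<and> (\<forall>x\<in>carrier N. g (j x) = w x)" if "lin R N N w" for w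
    using lin_comp[OF r(1) that] r(2) by (intro exI[of _ "\<lambda>x. w (r x)"]) simp
qed simp

text \<open>Pairs in \<open>E\<close> consist of extensional functions; restricting here lets
  arbitrary linear maps take part.\<close>

definition conf :: "('r, 'm) mod_pair set \<Rightarrow> ('r, 'm) module \<Rightarrow> ('m \<Rightarrow> 'm) \<Rightarrow> ('r, 'm) module
    \<Rightarrow> ('m \<Rightarrow> 'm) \<Rightarrow> ('r, 'm) module \<Rightarrow> bool" where
  "conf E A i B p C \<longleftrightarrow> (A, restrict i (carrier A), B, restrict p (carrier B), C) \<in> E"

lemma sx_cong:
  assumes s: "sx R A i B p C" and i: "\<And>x. x \<in> carrier A \<Longrightarrow> i x = i' x" and p: "\<And>x. x \<in> carrier B \<Longrightarrow> p x = p' x"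
  shows "sx R A i' B p' C"
proof -
  note d = sxD[OF s]
  show ?thesis
  proof (rule sxI[OF d(1-3)])
    show "lin R A B i'" by (rule lin_cong[OF i d(4,7)])
    show "lin R B C p'" by (rule lin_cong[OF p d(5,8)])
    show "inj_on i' (carrier A)" using d(9) i by (simp add: inj_on_def)
    show "p' (i' x) = \<zero>\<^bsub>C\<^esub>" if "x \<in> carrier A" for x
      using d(12)[OF that] i[OF that] p[OF lin_closed[OF d(7) that]] by simp
    show "\<exists>x\<in>carrier A. i' x = y" if "y \<in> carrier B" "p' y = \<zero>\<^bsub>C\<^esub>" for y
      using d(13)[of y] that p i by auto
    show "\<exists>y\<in>carrier B. p' y = z" if "z \<in> carrier C" for z using d(14)[OF that] p by auto
  qed
qed

lemma conf_sx:
  assumes "E \<subseteq> kernel_cokernel_pairs R" "conf E A i B p C" shows "sx R A i B p C"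
proof -
  have "(A, restrict i (carrier A), B, restrict p (carrier B), C) \<in> kernel_cokernel_pairs R"
    using assms unfolding conf_def by blast
  then have "sx R A (restrict i (carrier A)) B (restrict p (carrier B)) C"
    unfolding kernel_cokernel_pairs_iff by (rule short_exact_imp_sx)
  then show ?thesis by (rule sx_cong) auto
qed

lemma conf_iff_mem:
  assumes "E \<subseteq> kernel_cokernel_pairs R" "(A, i, B, p, C) \<in> E" shows "conf E A i B p C"
proof -
  have "i \<in> Hom R A B" "p \<in> Hom R B C" using assms unfolding kernel_cokernel_pairs_def by auto
  then show ?thesis using assms(2) unfolding conf_def by (simp add: Hom_restrict)
qed

lemma conf_kernel_cokernel_pairs: "sx R A i B p C \<Longrightarrow> conf (kernel_cokernel_pairs R) A i B p C"
  unfolding conf_def kernel_cokernel_pairs_iff by (rule sx_imp_short_exact)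

lemma E_projective_lift:
  assumes E: "E \<subseteq> kernel_cokernel_pairs R" and P: "E_projective R E P" and c: "conf E A i B p C" and f: "lin R P C f"
  shows "\<exists>g. lin R P B g \<and> (\<forall>x\<in>carrier P. p (g x) = f x)"
proof -
  have mP: "right_module R P" using P ModR_module unfolding E_projective_def by blast
  have "admissible_epic E B (restrict p (carrier B)) C" using c unfolding conf_def admissible_epic_def by blast
  then obtain g where g: "g \<in> Hom R P B" "compose (carrier P) (restrict p (carrier B)) g = restrict f (carrier P)"
    using P lin_restrict[OF mP f] unfolding E_projective_def by metis
  have "p (g x) = f x" if "x \<in> carrier P" for x
    using fun_cong[OF g(2), of x] that lin_closed[OF Hom_lin[OF g(1)] that] by (simp add: compose_def)
  then show ?thesis using Hom_lin[OF g(1)] by blast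
qed

lemma E_injective_extend:
  assumes E: "E \<subseteq> kernel_cokernel_pairs R" and I: "E_injective R E I" and c: "conf E A i B p C" and f: "lin R A I f"
  shows "\<exists>g. lin R B I g \<and> (\<forall>x\<in>carrier A. g (i x) = f x)"
proof -
  note s = sxD[OF conf_sx[OF E c]]
  have "admissible_monic E A (restrict i (carrier A)) B" using c unfolding conf_def admissible_monic_def by blast
  then obtain g where g: "g \<in> Hom R B I" "compose (carrier A) g (restrict i (carrier A)) = restrict f (carrier A)"
    using I lin_restrict[OF s(4) f] unfolding E_injective_def by metis
  have "g (i x) = f x" if "x \<in> carrier A" for x
    using fun_cong[OF g(2), of x] that by (simp add: compose_def)
  then show ?thesis using Hom_lin[OF g(1)] by blast
qed

text \<open>Collects what the description of the first Ext group uses, so that it applies both to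
  \<open>E\<close> and to the structure of all kernel-cokernel pairs.\<close>

locale conflations = module_universe ty R
  for ty :: "'m itself" and R :: "('r, 'x) ring_scheme" +
  fixes E :: "('r, 'm) mod_pair set"
  assumes E_kcp: "E \<subseteq> kernel_cokernel_pairs R"
    and enough_proj: "enough_projectives R E"
    and pushouts: "\<lbrakk>conf E L i M p N; L' \<in> ModR R; lin R L L' f\<rbrakk> \<Longrightarrow>
      \<exists>M' i' p' f'. conf E L' i' M' p' N \<and> lin R M M' f' \<and>
        (\<forall>x\<in>carrier L. f' (i x) = i' (f x)) \<and> (\<forall>x\<in>carrier M. p' (f' x) = p x)"
begin

lemma conf_D: "conf E A i B p C \<Longrightarrow> sx R A i B p C"
  by (rule conf_sx[OF E_kcp])

lemma projective_conf_exists: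
  assumes "M \<in> ModR R" obtains K i P p where "E_projective R E P" "(K, i, P, p, M) \<in> E"
  using enough_proj assms unfolding enough_projectives_def admissible_epic_def by blast

lemma resolution_exists:
  assumes M: "M \<in> ModR R" shows "\<exists>P d e. E_projective_resolution R E M e P d"
proof -
  have "\<forall>M. \<exists>K i P p. M \<in> ModR R \<longrightarrow> E_projective R E P \<and> (K, i, P, p, M) \<in> E"
    using projective_conf_exists by metis
  then obtain K i P p where *: "\<And>M. M \<in> ModR R \<Longrightarrow> E_projective R E (P M)" "\<And>M. M \<in> ModR R \<Longrightarrow> (K M, i M, P M, p M, M) \<in> E"
    by metis
  define Ks where "Ks n = (K ^^ n) M" for n
  have KM: "K N \<in> ModR R" if "N \<in> ModR R" for N
    using *(2)[OF that] E_kcp unfolding kernel_cokernel_pairs_def by auto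
  have Ks: "Ks n \<in> ModR R" for n unfolding Ks_def by (induction n) (auto intro: M KM)
  have "E_projective_resolution R E M (p M) (\<lambda>n. P (Ks n)) (\<lambda>n. compose (carrier (P (Ks (Suc n)))) (i (Ks n)) (p (Ks (Suc n))))"
    unfolding E_projective_resolution_def
    by (rule exI[of _ Ks], rule exI[of _ "\<lambda>n. i (Ks n)"], rule exI[of _ "\<lambda>n. p (Ks n)"])
      (use *[OF Ks] in \<open>auto simp: Ks_def\<close>)
  then show ?thesis by blast
qed

text \<open>The vanishing of the first Ext group in Yoneda's form, free of any resolution.\<close>

definition splits :: "('r, 'm) module \<Rightarrow> ('r, 'm) module \<Rightarrow> bool" where
  "splits M N \<longleftrightarrow> (\<forall>B j q. conf E N j B q M \<longrightarrow> (\<exists>s. lin R M B s \<and> (\<forall>x\<in>carrier M. q (s x) = x)))"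

text \<open>If extensions split, push out along \<open>f\<close>: a section of the push-out yields
  the extension of \<open>f\<close> to \<open>P\<close>. Conversely the projectivity of
  \<open>P\<close> gives a map into the middle term, and \<open>sx_section_of_extension\<close>
  applies.\<close>

lemma splits_iff_extend:
  assumes c: "conf E K i P p M" and P: "E_projective R E P" and N: "N \<in> ModR R"
  shows "splits M N \<longleftrightarrow> (\<forall>f. lin R K N f \<longrightarrow> (\<exists>g. lin R P N g \<and> (\<forall>x\<in>carrier K. g (i x) = f x)))"
proof
  note s = conf_D[OF c]
  note d = sxD[OF s]
  note mN = ModR_module[OF N]
  assume sp: "splits M N"
  show "\<forall>f. lin R K N f \<longrightarrow> (\<exists>g. lin R P N g \<and> (\<forall>x\<in>carrier K. g (i x) = f x))"
  proof (intro allI impI)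
    fix f assume f: "lin R K N f"
    obtain B j q f' where c': "conf E N j B q M" and f': "lin R P B f'" "\<forall>x\<in>carrier K. f' (i x) = j (f x)" "\<forall>x\<in>carrier P. q (f' x) = p x"
      using pushouts[OF c N f] by (elim exE conjE) (rule that)
    note s' = conf_D[OF c']
    note d' = sxD[OF s']
    interpret B: right_module R B by (rule d'(5))
    interpret M: right_module R M by (rule d(6))
    obtain t where t: "lin R M B t" "\<forall>x\<in>carrier M. q (t x) = x" using sp c' unfolding splits_def by blast
    let ?u = "\<lambda>x. f' x \<ominus>\<^bsub>B\<^esub> t (p x)"
    have tp: "lin R P B (\<lambda>x. t (p x))" by (rule lin_comp[OF d(8) t(1)])
    have u: "lin R P B ?u" by (rule lin_difference[OF d(5) d'(5) f'(1) tp])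
    have "q (?u x) = \<zero>\<^bsub>M\<^esub>" if x: "x \<in> carrier P" for x
      using lin_diff[OF d'(5,6,8) lin_closed[OF f'(1) x] lin_closed[OF tp x]] f'(3) t(2) x lin_closed[OF d(8) x]
        M.diff_zero_iff by simp
    then obtain g where g: "lin R P N g" "\<forall>x\<in>carrier P. j (g x) = ?u x"
      using sx_factor_mono[OF s' d(5) u] by blast
    have "g (i x) = f x" if x: "x \<in> carrier K" for x
    proof -
      have ix: "i x \<in> carrier P" by (rule lin_closed[OF d(7) x])
      have fx: "f x \<in> carrier N" by (rule lin_closed[OF f x])
      have "j (g (i x)) = j (f x) \<ominus>\<^bsub>B\<^esub> t \<zero>\<^bsub>M\<^esub>" using g(2) ix f'(2) x d(12)[OF x] by simp
      also have "\<dots> = j (f x)" using lin_zero[OF d(6) d'(5) t(1)] B.diff_zero lin_closed[OF d'(7) fx] by simp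
      finally show ?thesis using d'(9) lin_closed[OF g(1) ix] fx by (simp add: inj_on_eq_iff)
    qed
    then show "\<exists>g. lin R P N g \<and> (\<forall>x\<in>carrier K. g (i x) = f x)" using g(1) by blast
  qed
next
  note s = conf_D[OF c]
  note d = sxD[OF s]
  note mN = ModR_module[OF N]
  assume ext: "\<forall>f. lin R K N f \<longrightarrow> (\<exists>g. lin R P N g \<and> (\<forall>x\<in>carrier K. g (i x) = f x))"
  show "splits M N"
    unfolding splits_def
  proof (intro allI impI)
    fix B j q assume c': "conf E N j B q M"
    note s' = conf_D[OF c']
    obtain t where t: "lin R P B t" "\<And>x. x \<in> carrier P \<Longrightarrow> q (t x) = p x"
      using E_projective_lift[OF E_kcp P c' d(8)] by blast
    show "\<exists>s. lin R M B s \<and> (\<forall>x\<in>carrier M. q (s x) = x)"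
      by (rule sx_section_of_extension[OF s s' t], assumption) (rule ext[rule_format])
  qed
qed

section \<open>The first cohomology group of a resolution\<close>

lemma Hom_group_comm_group:
  assumes M: "right_module R M" and N: "right_module R N"
  shows "comm_group (Hom_group R M N)"
proof -
  interpret N: right_module R N by fact
  have cl: "f x \<in> carrier N" if "f \<in> Hom R M N" "x \<in> carrier M" for f x using lin_closed[OF Hom_lin[OF that(1)] that(2)] .
  have ext: "f x = undefined" if "f \<in> Hom R M N" "x \<notin> carrier M" for f x
    using Hom_extensional[OF that(1)] that(2) by (simp add: extensional_def)
  show ?thesis
  proof (rule comm_groupI)
    fix f g assume f: "f \<in> carrier (Hom_group R M N)" and g: "g \<in> carrier (Hom_group R M N)"
    then show "f \<otimes>\<^bsub>Hom_group R M N\<^esub> g \<in> carrier (Hom_group R M N)"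
      using lin_restrict[OF M lin_sum[OF M N Hom_lin[of f] Hom_lin[of g]]] by (simp add: Hom_group_def)
    show "f \<otimes>\<^bsub>Hom_group R M N\<^esub> g = g \<otimes>\<^bsub>Hom_group R M N\<^esub> f"
      using f g cl N.M.a_comm by (auto simp: Hom_group_def fun_eq_iff)
    fix h assume h: "h \<in> carrier (Hom_group R M N)"
    show "f \<otimes>\<^bsub>Hom_group R M N\<^esub> g \<otimes>\<^bsub>Hom_group R M N\<^esub> h = f \<otimes>\<^bsub>Hom_group R M N\<^esub> (g \<otimes>\<^bsub>Hom_group R M N\<^esub> h)"
      using f g h cl N.M.a_assoc by (auto simp: Hom_group_def fun_eq_iff)
  next
    show "\<one>\<^bsub>Hom_group R M N\<^esub> \<in> carrier (Hom_group R M N)"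
      using lin_restrict[OF M lin_zero_map[OF N]] by (simp add: Hom_group_def zero_hom_def)
    fix f assume f: "f \<in> carrier (Hom_group R M N)"
    then have f': "f \<in> Hom R M N" by (simp add: Hom_group_def)
    show "\<one>\<^bsub>Hom_group R M N\<^esub> \<otimes>\<^bsub>Hom_group R M N\<^esub> f = f"
      using cl[OF f'] ext[OF f'] by (auto simp: Hom_group_def zero_hom_def fun_eq_iff)
    let ?g = "restrict (\<lambda>x. \<zero>\<^bsub>N\<^esub> \<ominus>\<^bsub>N\<^esub> f x) (carrier M)"
    have "?g \<in> Hom R M N" by (rule lin_restrict[OF M lin_difference[OF M N lin_zero_map[OF N] Hom_lin[OF f']]])
    moreover have "?g \<otimes>\<^bsub>Hom_group R M N\<^esub> f = \<one>\<^bsub>Hom_group R M N\<^esub>"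
      using cl[OF f'] N.diff_add_cancel by (auto simp: Hom_group_def zero_hom_def fun_eq_iff)
    ultimately show "\<exists>g\<in>carrier (Hom_group R M N). g \<otimes>\<^bsub>Hom_group R M N\<^esub> f = \<one>\<^bsub>Hom_group R M N\<^esub>"
      by (intro bexI[of _ ?g]) (auto simp: Hom_group_def)
  qed
qed

lemma trivial_FactGroup_iff:
  assumes G: "comm_group G" and H: "subgroup H G"
  shows "trivial_group (G Mod H) \<longleftrightarrow> H = carrier G"
proof -
  interpret G: comm_group G by fact
  have nH: "H \<lhd> G" using G.subgroup_imp_normal[OF H] .
  have grp: "group (G Mod H)" using nH by (rule normal.factorgroup_is_group)
  show ?thesis
  proof
    assume "trivial_group (G Mod H)"
    then have c: "carrier (G Mod H) = {H}" unfolding trivial_group_def by (simp add: FactGroup_def)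
    have "x \<in> H" if x: "x \<in> carrier G" for x
    proof -
      have "H #>\<^bsub>G\<^esub> x \<in> carrier (G Mod H)" unfolding FactGroup_def RCOSETS_def using x by auto
      then have "H #>\<^bsub>G\<^esub> x = H" using c by simp
      then show ?thesis using G.rcos_self[OF x H] by simp
    qed
    then show "H = carrier G" using subgroup.subset[OF H] by blast
  next
    assume e: "H = carrier G"
    have "X = H" if X: "X \<in> carrier (G Mod H)" for X
    proof -
      obtain x where "x \<in> carrier G" "X = H #>\<^bsub>G\<^esub> x" using X unfolding FactGroup_def RCOSETS_def by auto
      then show ?thesis using e G.coset_join2[OF _ H] by simp
    qed
    moreover have "\<one>\<^bsub>G Mod H\<^esub> = H" by (simp add: FactGroup_def)
    moreover have "\<one>\<^bsub>G Mod H\<^esub> \<in> carrier (G Mod H)" by (rule monoid.one_closed[OF group.is_monoid[OF grp]])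
    ultimately have "carrier (G Mod H) = {\<one>\<^bsub>G Mod H\<^esub>}" by auto
    then show "trivial_group (G Mod H)" unfolding trivial_group_def using grp by blast
  qed
qed

text \<open>A cocycle of degree 1 vanishes on the second syzygy, so it is a map on the first syzygy
  \<open>K 1\<close>; it is a coboundary if and only if that map extends to \<open>P 0\<close>. This
  is the criterion of \<open>splits_iff_extend\<close>.\<close>

lemma cohomology_trivial_iff:
  assumes r: "E_projective_resolution R E M e P d" and N: "N \<in> ModR R"
  shows "trivial_group (cohomology R P d N 1) \<longleftrightarrow> splits M N"
proof -
  note mN = ModR_module[OF N]
  interpret N: right_module R N by (rule mN)
  obtain K i p where K: "K 0 = M" "p 0 = e" and
    P: "\<And>n. E_projective R E (P n)" and c: "\<And>n. (K (Suc n), i n, P n, p n, K n) \<in> E"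
    and dd: "\<And>n. d n = compose (carrier (P (Suc n))) (i n) (p (Suc n))"
    using r unfolding E_projective_resolution_def by blast
  have cf: "conf E (K (Suc n)) (i n) (P n) (p n) (K n)" for n by (rule conf_iff_mem[OF E_kcp c])
  note s = conf_D[OF cf]
  note S = sxD[OF s]
  have dval: "d n x = i n (p (Suc n) x)" if "x \<in> carrier (P (Suc n))" for n x using that unfolding dd compose_def by simp
  let ?H = "Hom_group R (P 1) N" and ?Z = "cocycles R P d N 1" and ?B = "coboundaries R P d N 1"
  interpret H: comm_group ?H by (rule Hom_group_comm_group[OF S(5) mN])
  have Z_iff: "f \<in> ?Z \<longleftrightarrow> f \<in> Hom R (P 1) N \<and> (\<forall>y\<in>carrier (K 2). f (i 1 y) = \<zero>\<^bsub>N\<^esub>)" for f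
  proof -
    have "compose (carrier (P 2)) f (d 1) = zero_hom (P 2) N \<longleftrightarrow> (\<forall>y\<in>carrier (K 2). f (i 1 y) = \<zero>\<^bsub>N\<^esub>)"
      unfolding compose_zero_iff
    proof
      assume a: "\<forall>x\<in>carrier (P 2). f (d 1 x) = \<zero>\<^bsub>N\<^esub>"
      show "\<forall>y\<in>carrier (K 2). f (i 1 y) = \<zero>\<^bsub>N\<^esub>"
      proof
        fix y assume "y \<in> carrier (K 2)"
        then obtain x where x: "x \<in> carrier (P 2)" "p 2 x = y" using S(14)[of y 2] by blast
        then have "d 1 x = i 1 y" using dval[of x 1] by (simp add: numeral_2_eq_2)
        then show "f (i 1 y) = \<zero>\<^bsub>N\<^esub>" using bspec[OF a x(1)] by simp
      qed
    next
      assume "\<forall>y\<in>carrier (K 2). f (i 1 y) = \<zero>\<^bsub>N\<^esub>"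
      then show "\<forall>x\<in>carrier (P 2). f (d 1 x) = \<zero>\<^bsub>N\<^esub>"
        using dval[of _ 1] lin_closed[OF S(8)[of 2]] by (simp add: numeral_2_eq_2)
    qed
    then show ?thesis unfolding cocycles_def by (simp add: numeral_2_eq_2)
  qed
  have B_eq: "?B = (\<lambda>g. compose (carrier (P 1)) g (d 0)) ` Hom R (P 0) N" by (simp add: One_nat_def)
  have BI: "compose (carrier (P 1)) g (d 0) \<in> Hom R (P 1) N" if g: "g \<in> Hom R (P 0) N" for g
  proof -
    have "compose (carrier (P 1)) g (d 0) = restrict (\<lambda>x. g (i 0 (p 1 x))) (carrier (P 1))"
      using dval[of _ 0] by (auto simp: compose_def fun_eq_iff)
    moreover have "lin R (P 1) N (\<lambda>x. g (i 0 (p 1 x)))"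
      using lin_comp[OF lin_comp[OF S(8)[of 1] S(7)[of 0, folded One_nat_def]] Hom_lin[OF g]] by simp
    ultimately show ?thesis using lin_restrict[OF S(5)] by simp
  qed
  have Bval: "compose (carrier (P 1)) g (d 0) x = g (i 0 (p 1 x))" if "x \<in> carrier (P 1)" for g x
    using dval[of x 0] that by (simp add: compose_def)
  have cl: "f x \<in> carrier N" if "f \<in> Hom R A N" "x \<in> carrier A" for f x and A :: "('r, 'm) module"
    using lin_closed[OF Hom_lin[OF that(1)] that(2)] .
  have invH: "restrict (\<lambda>x. \<zero>\<^bsub>N\<^esub> \<ominus>\<^bsub>N\<^esub> f x) (carrier (P 1)) = inv\<^bsub>?H\<^esub> f" if f: "f \<in> Hom R (P 1) N" for f
  proof (rule H.inv_equality[symmetric])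
    show "restrict (\<lambda>x. \<zero>\<^bsub>N\<^esub> \<ominus>\<^bsub>N\<^esub> f x) (carrier (P 1)) \<otimes>\<^bsub>?H\<^esub> f = \<one>\<^bsub>?H\<^esub>"
      using cl[OF f] N.diff_add_cancel by (auto simp: Hom_group_def zero_hom_def fun_eq_iff)
    show "f \<in> carrier ?H" using f by (simp add: Hom_group_def)
    show "restrict (\<lambda>x. \<zero>\<^bsub>N\<^esub> \<ominus>\<^bsub>N\<^esub> f x) (carrier (P 1)) \<in> carrier ?H"
      using lin_restrict[OF S(5) lin_difference[OF S(5) mN lin_zero_map[OF mN] Hom_lin[OF f]]] by (simp add: Hom_group_def)
  qed
  have i1P: "i 1 y \<in> carrier (P 1)" if "y \<in> carrier (K 2)" for y
    using lin_closed[OF S(7)[of 1]] that by (simp add: numeral_2_eq_2)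
  have ZH: "subgroup ?Z ?H"
  proof (rule H.subgroupI)
    show "?Z \<subseteq> carrier ?H" using Z_iff by (auto simp: Hom_group_def)
    show "?Z \<noteq> {}"
    proof -
      have "zero_hom (P 1) N \<in> ?Z"
        unfolding Z_iff using H.one_closed i1P by (auto simp: Hom_group_def zero_hom_def)
      then show ?thesis by blast
    qed
    fix f assume f: "f \<in> ?Z"
    then have fH: "f \<in> Hom R (P 1) N" using Z_iff by blast
    have "inv\<^bsub>?H\<^esub> f \<in> Hom R (P 1) N" using H.inv_closed[of f] fH by (simp add: Hom_group_def)
    then show "inv\<^bsub>?H\<^esub> f \<in> ?Z"
      unfolding Z_iff using f[unfolded Z_iff] i1P invH[OF fH, symmetric] N.diff_zero_iff by simp
    fix g assume g: "g \<in> ?Z"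
    have "f \<otimes>\<^bsub>?H\<^esub> g \<in> Hom R (P 1) N" using H.m_closed[of f g] f g Z_iff by (simp add: Hom_group_def)
    then show "f \<otimes>\<^bsub>?H\<^esub> g \<in> ?Z" unfolding Z_iff using f[unfolded Z_iff] g[unfolded Z_iff] i1P by (simp add: Hom_group_def)
  qed
  have BZ: "?B \<subseteq> ?Z"
  proof
    fix f assume "f \<in> ?B"
    then obtain g where g: "g \<in> Hom R (P 0) N" "f = compose (carrier (P 1)) g (d 0)" unfolding B_eq by blast
    have "f (i 1 y) = \<zero>\<^bsub>N\<^esub>" if y: "y \<in> carrier (K 2)" for y
    proof -
      have "p 1 (i 1 y) = \<zero>\<^bsub>K 1\<^esub>" using S(12)[of y 1] y by (simp add: numeral_2_eq_2)
      then have "f (i 1 y) = g (i 0 \<zero>\<^bsub>K 1\<^esub>)" using g(2) Bval[OF i1P[OF y]] by simp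
      then show ?thesis
        using lin_zero[OF S(4)[of 0] S(5)[of 0] S(7)[of 0]] lin_zero[OF S(5)[of 0] mN Hom_lin[OF g(1)]] by simp
    qed
    then show "f \<in> ?Z" unfolding Z_iff using BI[OF g(1)] g(2) by blast
  qed
  let ?G = "?H\<lparr>carrier := ?Z\<rparr>"
  have G: "comm_group ?G"
    by (rule group.group_comm_groupI[OF H.subgroup_imp_group[OF ZH]])
      (use subgroup.subset[OF ZH] H.m_comm in auto)
  have BG: "subgroup ?B ?H"
  proof (rule H.subgroupI)
    show "?B \<subseteq> carrier ?H" using BZ subgroup.subset[OF ZH] by blast
    show "?B \<noteq> {}"
    proof -
      have "zero_hom (P 0) N \<in> Hom R (P 0) N"
        using lin_restrict[OF S(5)[of 0] lin_zero_map[OF mN]] by (simp add: zero_hom_def)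
      then show ?thesis unfolding B_eq by blast
    qed
    fix f assume "f \<in> ?B"
    then obtain g where g: "g \<in> Hom R (P 0) N" "f = compose (carrier (P 1)) g (d 0)" unfolding B_eq by blast
    have ip: "i 0 (p 1 x) \<in> carrier (P 0)" if "x \<in> carrier (P 1)" for x
      using lin_closed[OF S(7)[of 0], of "p 1 x"] lin_closed[OF S(8)[of 1] that] by simp
    let ?g = "restrict (\<lambda>x. \<zero>\<^bsub>N\<^esub> \<ominus>\<^bsub>N\<^esub> g x) (carrier (P 0))"
    have gm: "?g \<in> Hom R (P 0) N" by (rule lin_restrict[OF S(5) lin_difference[OF S(5) mN lin_zero_map[OF mN] Hom_lin[OF g(1)]]])
    have ge: "compose (carrier (P 1)) ?g (d 0) = inv\<^bsub>?H\<^esub> f"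
      unfolding invH[OF BI[OF g(1)], folded g(2), symmetric]
      using Bval[of _ ?g] Bval[of _ g] g(2) ip by (auto simp: fun_eq_iff compose_def)
    show "inv\<^bsub>?H\<^esub> f \<in> ?B" unfolding B_eq by (rule image_eqI[OF _ gm]) (rule ge[symmetric])
    fix f' assume "f' \<in> ?B"
    then obtain g' where g': "g' \<in> Hom R (P 0) N" "f' = compose (carrier (P 1)) g' (d 0)" unfolding B_eq by blast
    let ?s = "restrict (\<lambda>x. g x \<oplus>\<^bsub>N\<^esub> g' x) (carrier (P 0))"
    have sm: "?s \<in> Hom R (P 0) N" by (rule lin_restrict[OF S(5) lin_sum[OF S(5) mN Hom_lin[OF g(1)] Hom_lin[OF g'(1)]]])
    have se: "compose (carrier (P 1)) ?s (d 0) = f \<otimes>\<^bsub>?H\<^esub> f'"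
      using Bval[of _ ?s] Bval[of _ g] Bval[of _ g'] g(2) g'(2) ip by (auto simp: fun_eq_iff compose_def Hom_group_def)
    show "f \<otimes>\<^bsub>?H\<^esub> f' \<in> ?B" unfolding B_eq by (rule image_eqI[OF _ sm]) (rule se[symmetric])
  qed
  have "subgroup ?B ?G" by (rule H.subgroup_incl[OF BG ZH BZ])
  then have "trivial_group (cohomology R P d N 1) \<longleftrightarrow> ?B = ?Z"
    unfolding cohomology_def using trivial_FactGroup_iff[OF G] by simp
  also have "\<dots> \<longleftrightarrow> (\<forall>f. lin R (K 1) N f \<longrightarrow> (\<exists>g. lin R (P 0) N g \<and> (\<forall>x\<in>carrier (K 1). g (i 0 x) = f x)))"
  proof
    assume BZ': "?B = ?Z"
    show "\<forall>f. lin R (K 1) N f \<longrightarrow> (\<exists>g. lin R (P 0) N g \<and> (\<forall>x\<in>carrier (K 1). g (i 0 x) = f x))"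
    proof (intro allI impI)
      fix f assume f: "lin R (K 1) N f"
      let ?f = "restrict (\<lambda>x. f (p 1 x)) (carrier (P 1))"
      have "?f \<in> Hom R (P 1) N" by (rule lin_restrict[OF S(5) lin_comp[OF S(8)[of 1] f]])
      moreover have "?f (i 1 y) = \<zero>\<^bsub>N\<^esub>" if y: "y \<in> carrier (K 2)" for y
        using S(12)[of y 1] y i1P[OF y] lin_zero[OF S(6)[of 1] mN f] by (simp add: numeral_2_eq_2)
      ultimately have "?f \<in> ?B" unfolding BZ' Z_iff by blast
      then obtain g where g: "g \<in> Hom R (P 0) N" "?f = compose (carrier (P 1)) g (d 0)" unfolding B_eq by blast
      have "g (i 0 y) = f y" if y: "y \<in> carrier (K 1)" for y
      proof -
        obtain x where x: "x \<in> carrier (P 1)" "p 1 x = y" using S(14)[OF y] by blast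
        have "?f x = g (i 0 (p 1 x))" unfolding g(2) by (rule Bval[OF x(1)])
        then show ?thesis using x by simp
      qed
      then show "\<exists>g. lin R (P 0) N g \<and> (\<forall>x\<in>carrier (K 1). g (i 0 x) = f x)" using Hom_lin[OF g(1)] by blast
    qed
  next
    assume ext: "\<forall>f. lin R (K 1) N f \<longrightarrow> (\<exists>g. lin R (P 0) N g \<and> (\<forall>x\<in>carrier (K 1). g (i 0 x) = f x))"
    show "?B = ?Z"
    proof
      show "?Z \<subseteq> ?B"
      proof
        fix f assume "f \<in> ?Z"
        then have f: "f \<in> Hom R (P 1) N" "\<forall>y\<in>carrier (K 2). f (i 1 y) = \<zero>\<^bsub>N\<^esub>" unfolding Z_iff by auto
        have "\<exists>w. lin R (K 1) N w \<and> (\<forall>x\<in>carrier (P 1). w (p 1 x) = f x)"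
          by (rule sx_factor_epi[OF s[of 1] mN Hom_lin[OF f(1)]]) (use f(2) in \<open>simp add: numeral_2_eq_2\<close>)
        then obtain w where w: "lin R (K 1) N w" "\<forall>x\<in>carrier (P 1). w (p 1 x) = f x" by blast
        obtain g where g: "lin R (P 0) N g" "\<forall>x\<in>carrier (K 1). g (i 0 x) = w x" using ext w(1) by blast
        obtain g' where g': "g' \<in> Hom R (P 0) N" "\<forall>x\<in>carrier (P 0). g' x = g x" using lin_Hom_exists[OF S(5) g(1)] by blast
        have "compose (carrier (P 1)) g' (d 0) = f"
          unfolding compose_Hom_iff[OF f(1)]
        proof
          fix x assume x: "x \<in> carrier (P 1)"
          have px: "p 1 x \<in> carrier (K 1)" by (rule lin_closed[OF S(8)[of 1] x])
          have "i 0 (p 1 x) \<in> carrier (P 0)" using lin_closed[OF S(7)[of 0]] px by simp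
          then show "g' (d 0 x) = f x" using dval[of x 0] x g'(2) g(2) w(2) px by simp
        qed
        then show "f \<in> ?B" unfolding B_eq using g'(1) by blast
      qed
    qed (rule BZ)
  qed
  also have "\<dots> \<longleftrightarrow> splits M N" using splits_iff_extend[OF cf[of 0] P N] K(1) by simp
  finally show ?thesis .
qed

text \<open>The criterion holds for every resolution, in particular for the one selected in
  \<open>E_Ext\<close>.\<close>

lemma Ext_trivial_iff_splits:
  assumes M: "M \<in> ModR R" and N: "N \<in> ModR R"
  shows "trivial_group (E_Ext R E 1 M N) \<longleftrightarrow> splits M N"
proof -
  define Pd where "Pd = (SOME (P, d). \<exists>e. E_projective_resolution R E M e P d)"
  obtain P d e where r: "E_projective_resolution R E M e P d" using resolution_exists[OF M] by blast
  have "\<exists>x. case x of (P, d) \<Rightarrow> \<exists>e. E_projective_resolution R E M e P d"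
    by (rule exI[of _ "(P, d)"]) (use r in auto)
  then have "case Pd of (P, d) \<Rightarrow> \<exists>e. E_projective_resolution R E M e P d" unfolding Pd_def by (rule someI_ex)
  then obtain e' where r': "E_projective_resolution R E M e' (fst Pd) (snd Pd)" by (auto split: prod.splits)
  have "E_Ext R E 1 M N = cohomology R (fst Pd) (snd Pd) N 1"
    unfolding E_Ext_def Pd_def[symmetric] by (simp add: case_prod_beta)
  then show ?thesis using cohomology_trivial_iff[OF r' N] by simp
qed

end

section \<open>Exact structures\<close>

lemma Iso_of_lin:
  assumes "right_module R A" "lin R A B f" "bij_betw f (carrier A) (carrier B)"
  shows "restrict f (carrier A) \<in> Iso R A B"
  using assms lin_restrict[OF assms(1,2)] bij_betw_cong[of "carrier A" "restrict f (carrier A)" f] unfolding Iso_def by auto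

context module_universe
begin

lemma sx_kernel:
  fixes D :: "('r, 'm) module"
  assumes "D \<in> ModR R" "Q \<in> ModR R" "lin R D Q q" "q ` carrier D = carrier Q"
  shows "sx R (sub D {x \<in> carrier D. q x = \<zero>\<^bsub>Q\<^esub>}) (\<lambda>x. x) D q Q"
  by (rule sx_sub[OF assms submod_kernel[OF ModR_module[OF assms(1)] ModR_module[OF assms(2)] assms(3)]]) simp

lemma free_cover_exists:
  fixes M :: "('r, 'm) module"
  assumes M: "M \<in> ModR R"
  obtains P :: "('r, 'm) module" and p where "P \<in> ModR R" "lin R P M p" "p ` carrier P = carrier M"
    "\<forall>(A :: ('r, 'm) module) (B :: ('r, 'm) module) q f. right_module R A \<longrightarrow> right_module R B \<longrightarrow> lin R A B q \<longrightarrow>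
       q ` carrier A = carrier B \<longrightarrow> lin R P B f \<longrightarrow> (\<exists>g. lin R P A g \<and> (\<forall>x\<in>carrier P. q (g x) = f x))"
proof -
  note mM = ModR_module[OF M]
  let ?F = "free R (carrier M)"
  note mF = right_module_free[OF ring_R, of "carrier M"]
  obtain P :: "('r, 'm) module" and \<phi> where P: "P \<in> ModR R" "lin R ?F P \<phi>" "bij_betw \<phi> (carrier ?F) (carrier P)"
    using realize[OF mF small_free[OF ModR_small[OF M]]] by blast
  note mP = ModR_module[OF P(1)]
  let ?\<psi> = "inv_into (carrier ?F) \<phi>"
  have \<psi>: "lin R P ?F ?\<psi>" by (rule lin_inv[OF mF mP P(2,3)])
  have \<phi>\<psi>: "\<phi> (?\<psi> x) = x" if "x \<in> carrier P" for x
    using P(3) that by (simp add: bij_betw_def f_inv_into_f)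
  have \<psi>\<phi>: "?\<psi> (\<phi> x) = x" if "x \<in> carrier ?F" for x using P(3) that by (simp add: bij_betw_def)
  obtain p where p: "lin R ?F M p" "\<forall>x\<in>carrier M. p (basis R (carrier M) x) = x"
    using free_lift[OF ring_R mM, of "carrier M" "\<lambda>x. x"] by blast
  show thesis
  proof (rule that[OF P(1) lin_comp[OF \<psi> p(1)]])
    show "(\<lambda>x. p (?\<psi> x)) ` carrier P = carrier M"
    proof
      show "(\<lambda>x. p (?\<psi> x)) ` carrier P \<subseteq> carrier M" using lin_closed[OF lin_comp[OF \<psi> p(1)]] by blast
      show "carrier M \<subseteq> (\<lambda>x. p (?\<psi> x)) ` carrier P"
      proof
        fix x assume x: "x \<in> carrier M"
        let ?b = "basis R (carrier M) x"
        have b: "?b \<in> carrier ?F" by (rule basis_closed[OF ring_R x])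
        have "x = p (?\<psi> (\<phi> ?b))" using \<psi>\<phi>[OF b] p(2) x by simp
        then show "x \<in> (\<lambda>x. p (?\<psi> x)) ` carrier P" using lin_closed[OF P(2) b] by (rule image_eqI)
      qed
    qed
    show "\<forall>(A :: ('r, 'm) module) (B :: ('r, 'm) module) q f. right_module R A \<longrightarrow> right_module R B \<longrightarrow> lin R A B q \<longrightarrow>
       q ` carrier A = carrier B \<longrightarrow> lin R P B f \<longrightarrow> (\<exists>g. lin R P A g \<and> (\<forall>x\<in>carrier P. q (g x) = f x))"
    proof (intro allI impI)
      fix A B :: "('r, 'm) module" and q f
      assume q: "right_module R A" "right_module R B" "lin R A B q" "q ` carrier A = carrier B" "lin R P B f"
      obtain g where g: "lin R ?F A g" "\<forall>x\<in>carrier ?F. q (g x) = f (\<phi> x)"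
        using free_projective[OF ring_R q(1-4) lin_comp[OF P(2) q(5)]] by blast
      then show "\<exists>g. lin R P A g \<and> (\<forall>x\<in>carrier P. q (g x) = f x)"
        using lin_comp[OF \<psi> g(1)] \<phi>\<psi> lin_closed[OF \<psi>] by (intro exI[of _ "\<lambda>x. g (?\<psi> x)"]) auto
    qed
  qed
qed

text \<open>Makes the splitting criterion available for the ordinary Ext groups. Enough projectives
  come from free modules, the push-outs from \<open>sx_pushout_exists\<close>.\<close>

lemma kernel_cokernel_pairs_conflations: "conflations R (kernel_cokernel_pairs R :: ('r, 'm) mod_pair set)"
proof unfold_locales
  show "enough_projectives R (kernel_cokernel_pairs R :: ('r, 'm) mod_pair set)"
    unfolding enough_projectives_def
  proof
    fix M :: "('r, 'm) module" assume M: "M \<in> ModR R"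
    obtain P :: "('r, 'm) module" and p where P: "P \<in> ModR R" "lin R P M p" "p ` carrier P = carrier M"
      and lift: "\<forall>(A :: ('r, 'm) module) (B :: ('r, 'm) module) q f. right_module R A \<longrightarrow> right_module R B \<longrightarrow> lin R A B q \<longrightarrow>
       q ` carrier A = carrier B \<longrightarrow> lin R P B f \<longrightarrow> (\<exists>g. lin R P A g \<and> (\<forall>x\<in>carrier P. q (g x) = f x))"
      by (rule free_cover_exists[OF M]) (rule that; assumption)
    note mP = ModR_module[OF P(1)]
    have "E_projective R (kernel_cokernel_pairs R :: ('r, 'm) mod_pair set) P"
      unfolding E_projective_def
    proof (intro conjI P(1) allI impI ballI)
      fix A q B f assume "admissible_epic (kernel_cokernel_pairs R :: ('r, 'm) mod_pair set) A q B" and f: "f \<in> Hom R P B"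
      then obtain L i where "short_exact R L i A q B" unfolding admissible_epic_def kernel_cokernel_pairs_iff by blast
      note d = sxD[OF short_exact_imp_sx[OF this]]
      obtain g where g: "lin R P A g" "\<forall>x\<in>carrier P. q (g x) = f x" using lift[rule_format, OF d(5,6,8,11) Hom_lin[OF f]] by blast
      obtain g' where "g' \<in> Hom R P A" "\<forall>x\<in>carrier P. g' x = g x" using lin_Hom_exists[OF mP g(1)] by blast
      then show "\<exists>g\<in>Hom R P A. compose (carrier P) q g = f" unfolding compose_Hom_iff[OF f] using g(2) by (intro bexI[of _ g']) simp_all
    qed
    moreover have "conf (kernel_cokernel_pairs R) (sub P {x \<in> carrier P. p x = \<zero>\<^bsub>M\<^esub>}) (\<lambda>x. x) P p M"
      by (rule conf_kernel_cokernel_pairs[OF sx_kernel[OF P(1) M P(2,3)]])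
    ultimately show "\<exists>P p. E_projective R (kernel_cokernel_pairs R) P \<and> admissible_epic (kernel_cokernel_pairs R) P p M"
      unfolding conf_def admissible_epic_def by blast
  qed
  fix L :: "('r, 'm) module" and i M p N and L' :: "('r, 'm) module" and f assume c: "conf (kernel_cokernel_pairs R :: ('r, 'm) mod_pair set) L i M p N" and L': "L' \<in> ModR R" "lin R L L' f"
  obtain M' :: "('r, 'm) module" and i' p' f' where *: "sx R L' i' M' p' N" "lin R M M' f'"
    "\<And>x. x \<in> carrier L \<Longrightarrow> f' (i x) = i' (f x)" "\<And>x. x \<in> carrier M \<Longrightarrow> p' (f' x) = p x"
    by (rule sx_pushout_exists[OF conf_sx[OF subset_refl c] L']) (rule that; assumption)
  then show "\<exists>M' i' p' f'. conf (kernel_cokernel_pairs R :: ('r, 'm) mod_pair set) L' i' M' p' N \<and> lin R M M' f' \<and>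
        (\<forall>x\<in>carrier L. f' (i x) = i' (f x)) \<and> (\<forall>x\<in>carrier M. p' (f' x) = p x)"
    using conf_kernel_cokernel_pairs[OF *(1)] by blast
qed simp

end

locale exact_category = module_universe ty R
  for ty :: "'m itself" and R :: "('r, 'x) ring_scheme" +
  fixes E :: "('r, 'm) mod_pair set"
  assumes exact: "exact_structure R E"
    and projectives: "enough_projectives R E"
    and injectives: "enough_injectives R E"
    and pure: "pure_exact R \<subseteq> E"
begin

lemma E_pairs: "E \<subseteq> kernel_cokernel_pairs R"
  using exact unfolding exact_structure_def by (elim conjE)

lemma conf_transport:
  assumes c: "conf E A i B p C" and s': "sx R A' i' B' p' C'"
    and a: "lin R A A' a" "bij_betw a (carrier A) (carrier A')"
    and b: "lin R B B' b" "bij_betw b (carrier B) (carrier B')"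
    and cc: "lin R C C' c" "bij_betw c (carrier C) (carrier C')"
    and com: "\<And>x. x \<in> carrier A \<Longrightarrow> b (i x) = i' (a x)" "\<And>x. x \<in> carrier B \<Longrightarrow> c (p x) = p' (b x)"
  shows "conf E A' i' B' p' C'"
proof -
  note d = sxD[OF conf_sx[OF E_pairs c]]
  have iso: "iso_closed R E" using exact unfolding exact_structure_def by (elim conjE)
  let ?i = "restrict i (carrier A)" and ?p = "restrict p (carrier B)"
  let ?i' = "restrict i' (carrier A')" and ?p' = "restrict p' (carrier B')"
  let ?a = "restrict a (carrier A)" and ?b = "restrict b (carrier B)" and ?c = "restrict c (carrier C)"
  have "compose (carrier A) ?b ?i = compose (carrier A) ?i' ?a"
    using com(1) lin_closed[OF d(7)] lin_closed[OF a(1)] by (auto simp: compose_def fun_eq_iff)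
  moreover have "compose (carrier B) ?c ?p = compose (carrier B) ?p' ?b"
    using com(2) lin_closed[OF d(8)] lin_closed[OF b(1)] by (auto simp: compose_def fun_eq_iff)
  moreover have "?a \<in> Iso R A A'" "?b \<in> Iso R B B'" "?c \<in> Iso R C C'"
    by (rule Iso_of_lin[OF d(4) a], rule Iso_of_lin[OF d(5) b], rule Iso_of_lin[OF d(6) cc])
  moreover have "(A', ?i', B', ?p', C') \<in> kernel_cokernel_pairs R"
    unfolding kernel_cokernel_pairs_iff by (rule sx_imp_short_exact[OF s'])
  moreover have "(A, ?i, B, ?p, C) \<in> E" using c unfolding conf_def .
  ultimately have "(A', ?i', B', ?p', C') \<in> E"
    by (intro iso[unfolded iso_closed_def, rule_format, of A ?i B ?p C A' ?i' B' ?p' C'] conjI bexI[of _ ?a] bexI[of _ ?b] bexI[of _ ?c])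
  then show ?thesis unfolding conf_def .
qed

text \<open>The monic occurs in some conflation, whose cokernel is isomorphic to \<open>C\<close>;
  closure of \<open>E\<close> under isomorphisms does the rest.\<close>

lemma conf_of_admissible_monic:
  assumes s: "sx R A i B p C" and m: "admissible_monic E A (restrict i (carrier A)) B"
  shows "conf E A i B p C"
proof -
  note d = sxD[OF s]
  obtain q C' where q: "(A, restrict i (carrier A), B, q, C') \<in> E" using m unfolding admissible_monic_def by blast
  have c: "conf E A (restrict i (carrier A)) B q C'" by (rule conf_iff_mem[OF E_pairs q])
  note s' = conf_sx[OF E_pairs c]
  note d' = sxD[OF s']
  have z: "q y = \<zero>\<^bsub>C'\<^esub> \<longleftrightarrow> p y = \<zero>\<^bsub>C\<^esub>" if y: "y \<in> carrier B" for y
  proof -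
    have "i ` carrier A = {x \<in> carrier B. q x = \<zero>\<^bsub>C'\<^esub>}" using d'(10) by simp
    then show ?thesis using d(10) y by blast
  qed
  have "\<exists>w. lin R C' C w \<and> (\<forall>x\<in>carrier B. w (q x) = p x)"
    by (rule lin_factor_surj[OF d'(5,6) d(6) d'(8,11) d(8)]) (use z in blast)
  then obtain w where w: "lin R C' C w" "\<forall>x\<in>carrier B. w (q x) = p x" by blast
  have "inj_on w (carrier C')"
    unfolding lin_inj_on_iff[OF d'(6) d(6) w(1)]
  proof (intro ballI impI)
    fix y assume y: "y \<in> carrier C'" "w y = \<zero>\<^bsub>C\<^esub>"
    obtain x where x: "x \<in> carrier B" "q x = y" using d'(14)[OF y(1)] by blast
    then show "y = \<zero>\<^bsub>C'\<^esub>" using w(2) z[OF x(1)] y(2) by auto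
  qed
  moreover have "w ` carrier C' = carrier C"
  proof
    show "w ` carrier C' \<subseteq> carrier C" using lin_closed[OF w(1)] by blast
    show "carrier C \<subseteq> w ` carrier C'"
    proof
      fix y assume "y \<in> carrier C"
      then obtain x where x: "x \<in> carrier B" "p x = y" using d(14) by blast
      then have "y = w (q x)" using w(2) by simp
      then show "y \<in> w ` carrier C'" using lin_closed[OF d'(8) x(1)] by (rule image_eqI)
    qed
  qed
  ultimately have b: "bij_betw w (carrier C') (carrier C)" unfolding bij_betw_def by blast
  have id: "bij_betw (\<lambda>x. x) X X" for X :: "'m set" by (simp add: bij_betw_def)
  show ?thesis
    by (rule conf_transport[OF c s lin_id id lin_id id w(1) b]) (use w(2) in auto)
qed

text \<open>Dual to the previous lemma, by the uniqueness of kernels up to isomorphism.\<close>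

lemma conf_of_admissible_epic:
  assumes s: "sx R A i B p C" and m: "admissible_epic E B (restrict p (carrier B)) C"
  shows "conf E A i B p C"
proof -
  note d = sxD[OF s]
  obtain j A' where j: "(A', j, B, restrict p (carrier B), C) \<in> E" using m unfolding admissible_epic_def by blast
  have c: "conf E A' j B (restrict p (carrier B)) C" by (rule conf_iff_mem[OF E_pairs j])
  note s' = conf_sx[OF E_pairs c]
  note d' = sxD[OF s']
  have im: "j ` carrier A' = i ` carrier A" using d(10) d'(10) by auto
  have "\<exists>w. lin R A' A w \<and> (\<forall>x\<in>carrier A'. i (w x) = j x)"
    by (rule lin_factor_inj[OF d(4,5) d'(4) d(7,9) d'(7)]) (use im in blast)
  then obtain w where w: "lin R A' A w" "\<forall>x\<in>carrier A'. i (w x) = j x" by blast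
  have "inj_on w (carrier A')"
  proof (rule inj_onI)
    fix x y assume xy: "x \<in> carrier A'" "y \<in> carrier A'" "w x = w y"
    then have "j x = j y" using w(2) by metis
    then show "x = y" using d'(9) xy by (auto dest: inj_onD)
  qed
  moreover have "w ` carrier A' = carrier A"
  proof
    show "w ` carrier A' \<subseteq> carrier A" using lin_closed[OF w(1)] by blast
    show "carrier A \<subseteq> w ` carrier A'"
    proof
      fix y assume y: "y \<in> carrier A"
      then obtain x where x: "x \<in> carrier A'" "i y = j x" using im by blast
      then have "i y = i (w x)" using w(2) by simp
      then have "y = w x" using d(9) y lin_closed[OF w(1) x(1)] by (auto dest: inj_onD)
      then show "y \<in> w ` carrier A'" using x(1) by (rule image_eqI)
    qed
  qed
  ultimately have b: "bij_betw w (carrier A') (carrier A)" unfolding bij_betw_def by blast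
  have id: "bij_betw (\<lambda>x. x) X X" for X :: "'m set" by (simp add: bij_betw_def)
  show ?thesis
    by (rule conf_transport[OF c s w(1) b lin_id id lin_id id]) (use w(2) in auto)
qed

text \<open>The axioms speak of push-outs in the categorical sense. \<open>sx_is_pushout\<close>
  supplies the universal property, so a morphism of short exact sequences that is the identity on
  the right carries conflations forward.\<close>

lemma conf_pushout:
  assumes c: "conf E L i M p N" and s': "sx R L' i' M' p' N" and f: "lin R L L' f" and f': "lin R M M' f'"
    and com: "\<And>x. x \<in> carrier L \<Longrightarrow> f' (i x) = i' (f x)" "\<And>x. x \<in> carrier M \<Longrightarrow> p' (f' x) = p x"
  shows "conf E L' i' M' p' N"
proof (rule conf_of_admissible_monic[OF s'])
  note s = conf_sx[OF E_pairs c]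
  note d = sxD[OF s] and d' = sxD[OF s']
  let ?i = "restrict i (carrier L)" and ?f = "restrict f (carrier L)" and ?i' = "restrict i' (carrier L')" and ?f' = "restrict f' (carrier M)"
  have m: "admissible_monic E L ?i M" using c unfolding conf_def admissible_monic_def by blast
  have H: "?f \<in> Hom R L L'" "?i' \<in> Hom R L' M'" "?f' \<in> Hom R M M'"
    by (rule lin_restrict[OF d(4) f], rule lin_restrict[OF d'(4,7)], rule lin_restrict[OF d(5) f'])
  have "is_pushout R L ?i M ?f L' ?i' M' ?f'"
    unfolding is_pushout_def
  proof (intro conjI d'(2) H(2,3) ballI impI ex_ex1I)
    show "compose (carrier L) ?f' ?i = compose (carrier L) ?i' ?f"
      using com(1) lin_closed[OF d(7)] lin_closed[OF f] by (auto simp: compose_def fun_eq_iff)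
    fix T u v assume T: "T \<in> (ModR R :: ('r, 'm) module set)" and u: "u \<in> Hom R M T" and v: "v \<in> Hom R L' T"
      and e: "compose (carrier L) u ?i = compose (carrier L) v ?f"
    note mT = ModR_module[OF T]
    have e': "u (i x) = v (f x)" if "x \<in> carrier L" for x using fun_cong[OF e, of x] that by (simp add: compose_def)
    have "\<exists>w. lin R M' T w \<and> (\<forall>x\<in>carrier M. w (f' x) = u x) \<and> (\<forall>y\<in>carrier L'. w (i' y) = v y)"
      by (rule sx_is_pushout(1)[OF s s' f f' com mT Hom_lin[OF u] Hom_lin[OF v] e'])
    then obtain w where w: "lin R M' T w" "\<forall>x\<in>carrier M. w (f' x) = u x" "\<forall>y\<in>carrier L'. w (i' y) = v y" by blast
    obtain w' where w': "w' \<in> Hom R M' T" "\<forall>x\<in>carrier M'. w' x = w x" using lin_Hom_exists[OF d'(5) w(1)] by blast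
    show "\<exists>w. w \<in> Hom R M' T \<and> compose (carrier M) w ?f' = u \<and> compose (carrier L') w ?i' = v"
      unfolding compose_Hom_iff[OF u] compose_Hom_iff[OF v]
      using w' w(2,3) lin_closed[OF f'] lin_closed[OF d'(7)] by (intro exI[of _ w']) auto
    fix w1 w2 assume *: "w1 \<in> Hom R M' T \<and> compose (carrier M) w1 ?f' = u \<and> compose (carrier L') w1 ?i' = v"
      "w2 \<in> Hom R M' T \<and> compose (carrier M) w2 ?f' = u \<and> compose (carrier L') w2 ?i' = v"
    show "w1 = w2"
    proof (rule Hom_eqI[of w1 R M' T w2])
      show "w1 \<in> Hom R M' T" "w2 \<in> Hom R M' T" using * by auto
      fix y assume "y \<in> carrier M'"
      then obtain a b where ab: "a \<in> carrier M" "b \<in> carrier L'" "y = f' a \<oplus>\<^bsub>M'\<^esub> i' b"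
        using sx_is_pushout(2)[OF s s' f f' com mT Hom_lin[OF u] Hom_lin[OF v] e'] by blast
      have "w (f' a \<oplus>\<^bsub>M'\<^esub> i' b) = u a \<oplus>\<^bsub>T\<^esub> v b"
        if w: "w \<in> Hom R M' T \<and> compose (carrier M) w ?f' = u \<and> compose (carrier L') w ?i' = v" for w
      proof -
        have "w (f' a) = u a" "w (i' b) = v b"
          using w ab(1,2) unfolding compose_Hom_iff[OF u] compose_Hom_iff[OF v] by auto
        moreover have "lin R M' T w" using w by (auto intro: Hom_lin)
        ultimately show ?thesis using lin_add lin_closed[OF f' ab(1)] lin_closed[OF d'(7) ab(2)] by metis
      qed
      then show "w1 y = w2 y" using * unfolding ab(3) by metis
    qed
  qed
  then show "admissible_monic E L' ?i' M'"
    using exact m d'(1) H(1) unfolding exact_structure_def by meson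
qed

text \<open>The dual transfer, with the universal property taken from
  \<open>pullback_factor\<close>.\<close>

lemma conf_pullback:
  assumes c: "conf E L i M p N" and s': "sx R L i' M' p' N'" and f: "lin R N' N f" and f': "lin R M' M f'"
    and cart: "cartesian M' f' p' M p N' f"
  shows "conf E L i' M' p' N'"
proof (rule conf_of_admissible_epic[OF s'])
  note s = conf_sx[OF E_pairs c]
  note d = sxD[OF s] and d' = sxD[OF s']
  let ?p = "restrict p (carrier M)" and ?f = "restrict f (carrier N')" and ?p' = "restrict p' (carrier M')" and ?f' = "restrict f' (carrier M')"
  have m: "admissible_epic E M ?p N" using c unfolding conf_def admissible_epic_def by blast
  have H: "?f \<in> Hom R N' N" "?p' \<in> Hom R M' N'" "?f' \<in> Hom R M' M"
    by (rule lin_restrict[OF d'(6) f], rule lin_restrict[OF d'(5,8)], rule lin_restrict[OF d'(5) f'])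
  note pf = pullback_factor[OF d(5) d'(5,6) f' d'(8) cart]
  have com: "p (f' x) = f (p' x)" if "x \<in> carrier M'" for x using cart that unfolding cartesian_def by blast
  have "is_pullback R M ?p N ?f N' ?p' M' ?f'"
    unfolding is_pullback_def
  proof (intro conjI d'(2) H(2,3) ballI impI ex_ex1I)
    show "compose (carrier M') ?p ?f' = compose (carrier M') ?f ?p'"
      using com lin_closed[OF d'(8)] lin_closed[OF f'] by (auto simp: compose_def fun_eq_iff)
    fix T u v assume T: "T \<in> (ModR R :: ('r, 'm) module set)" and u: "u \<in> Hom R T M" and v: "v \<in> Hom R T N'"
      and e: "compose (carrier T) ?p u = compose (carrier T) ?f v"
    note mT = ModR_module[OF T]
    have e': "p (u x) = f (v x)" if "x \<in> carrier T" for x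
      using fun_cong[OF e, of x] that lin_closed[OF Hom_lin[OF u] that] lin_closed[OF Hom_lin[OF v] that]
      by (simp add: compose_def)
    obtain w where w: "lin R T M' w" "\<forall>x\<in>carrier T. f' (w x) = u x \<and> p' (w x) = v x"
      using pf(1)[OF mT Hom_lin[OF u] Hom_lin[OF v] e'] by blast
    obtain w' where w': "w' \<in> Hom R T M'" "\<forall>x\<in>carrier T. w' x = w x" using lin_Hom_exists[OF mT w(1)] by blast
    show "\<exists>w. w \<in> Hom R T M' \<and> compose (carrier T) ?f' w = u \<and> compose (carrier T) ?p' w = v"
      unfolding compose_Hom_iff[OF u] compose_Hom_iff[OF v]
      using w' w(2) lin_closed[OF w(1)] by (intro exI[of _ w']) auto
    fix w1 w2 assume *: "w1 \<in> Hom R T M' \<and> compose (carrier T) ?f' w1 = u \<and> compose (carrier T) ?p' w1 = v"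
      "w2 \<in> Hom R T M' \<and> compose (carrier T) ?f' w2 = u \<and> compose (carrier T) ?p' w2 = v"
    show "w1 = w2"
    proof (rule Hom_eqI[of w1 R T M' w2])
      show H12: "w1 \<in> Hom R T M'" "w2 \<in> Hom R T M'" using * by auto
      fix y assume y: "y \<in> carrier T"
      have wM: "w1 y \<in> carrier M'" "w2 y \<in> carrier M'" using lin_closed[OF Hom_lin[OF H12(1)] y] lin_closed[OF Hom_lin[OF H12(2)] y] .
      have "f' (w1 y) = u y" "p' (w1 y) = v y"
        using conjunct1[OF conjunct2[OF *(1)], unfolded compose_Hom_iff[OF u], rule_format, OF y]
          conjunct2[OF conjunct2[OF *(1)], unfolded compose_Hom_iff[OF v], rule_format, OF y] wM(1) by simp_all
      moreover have "f' (w2 y) = u y" "p' (w2 y) = v y"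
        using conjunct1[OF conjunct2[OF *(2)], unfolded compose_Hom_iff[OF u], rule_format, OF y]
          conjunct2[OF conjunct2[OF *(2)], unfolded compose_Hom_iff[OF v], rule_format, OF y] wM(2) by simp_all
      ultimately have "f' (w1 y) = f' (w2 y)" "p' (w1 y) = p' (w2 y)" by simp_all
      then show "w1 y = w2 y" using pf(2)[OF wM] by blast
    qed
  qed
  then show "admissible_epic E M' ?p' N'"
    using exact m d'(3) H(1) unfolding exact_structure_def by meson
qed

lemma pullbacks:
  fixes N' :: "('r, 'm) module"
  assumes c: "conf E L i M p N" and N': "N' \<in> ModR R" and f: "lin R N' N f"
  obtains M' :: "('r, 'm) module" and i' p' f' where "conf E L i' M' p' N'" "lin R M' M f'" "cartesian M' f' p' M p N' f"
    "\<And>x. x \<in> carrier L \<Longrightarrow> f' (i' x) = i x"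
proof (rule sx_pullback_exists[OF conf_sx[OF E_pairs c] N' f])
  fix M' i' p' f' assume *: "sx R L i' M' p' N'" "lin R M' M f'" "cartesian M' f' p' M p N' f"
    "\<And>x. x \<in> carrier L \<Longrightarrow> f' (i' x) = i x"
  have "conf E L i' M' p' N'" by (rule conf_pullback[OF c *(1) f *(2,3)])
  then show thesis by (rule that[OF _ *(2-4)])
qed

lemma is_conflations: "conflations R E"
proof unfold_locales
  fix L :: "('r, 'm) module" and i M p N and L' :: "('r, 'm) module" and f assume c: "conf E L i M p N" and L': "L' \<in> ModR R" "lin R L L' f"
  obtain M' :: "('r, 'm) module" and i' p' f' where *: "sx R L' i' M' p' N" "lin R M M' f'"
    "\<And>x. x \<in> carrier L \<Longrightarrow> f' (i x) = i' (f x)" "\<And>x. x \<in> carrier M \<Longrightarrow> p' (f' x) = p x"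
    by (rule sx_pushout_exists[OF conf_sx[OF E_pairs c] L']) (rule that; assumption)
  have "conf E L' i' M' p' N" by (rule conf_pushout[OF c *(1) L'(2) *(2-4)])
  then show "\<exists>M' i' p' f'. conf E L' i' M' p' N \<and> lin R M M' f' \<and>
        (\<forall>x\<in>carrier L. f' (i x) = i' (f x)) \<and> (\<forall>x\<in>carrier M. p' (f' x) = p x)"
    using * by blast
qed (rule E_pairs projectives)+

sublocale conflations ty R E by (rule is_conflations)

text \<open>A split sequence is pure exact, since maps lift through the section, and
  \<open>E\<close> contains all pure exact sequences.\<close>

lemma conf_split:
  assumes s: "sx R A i B p C" and t: "lin R C B t" "\<And>x. x \<in> carrier C \<Longrightarrow> p (t x) = x"
  shows "conf E A i B p C"
proof -
  have "(A, restrict i (carrier A), B, restrict p (carrier B), C) \<in> pure_exact R"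
  proof (rule pure_exactI[OF s])
    fix F :: "('r, 'm) module" and h assume h: "lin R F C h"
    show "\<exists>g. lin R F B g \<and> (\<forall>x\<in>carrier F. p (g x) = h x)"
    proof (intro exI[of _ "\<lambda>x. t (h x)"] conjI ballI)
      show "lin R F B (\<lambda>x. t (h x))" by (rule lin_comp[OF h t(1)])
    qed (rule t(2)[OF lin_closed[OF h]])
  qed
  then show ?thesis unfolding conf_def using pure by blast
qed

text \<open>
  The pull-back \<open>D\<close> of \<open>p = g h\<close> along \<open>g\<close> maps onto \<open>P\<close> by a split epic, hence onto \<open>M\<close> by
  an admissible epic, and \<open>g\<close> is the push-out of the latter along the kernel of \<open>D \<rightarrow> C\<close>.
\<close>

lemma conf_of_factor:
  assumes c: "conf E K i P p M" and C: "C \<in> ModR R" and g: "lin R C M g" and h: "lin R P C h"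
    and gh: "\<And>x. x \<in> carrier P \<Longrightarrow> g (h x) = p x"
  shows "conf E (sub C {x \<in> carrier C. g x = \<zero>\<^bsub>M\<^esub>}) (\<lambda>x. x) C g M"
proof -
  note d = sxD[OF conf_D[OF c]]
  have gsurj: "g ` carrier C = carrier M"
  proof
    show "g ` carrier C \<subseteq> carrier M" using lin_closed[OF g] by blast
    show "carrier M \<subseteq> g ` carrier C"
    proof
      fix y assume "y \<in> carrier M"
      then obtain x where x: "x \<in> carrier P" "p x = y" using d(14) by blast
      then have "y = g (h x)" using gh by simp
      then show "y \<in> g ` carrier C" using lin_closed[OF h x(1)] by (rule image_eqI)
    qed
  qed
  have sC: "sx R (sub C {x \<in> carrier C. g x = \<zero>\<^bsub>M\<^esub>}) (\<lambda>x. x) C g M" by (rule sx_kernel[OF C d(3) g gsurj])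
  obtain D i' q f where D: "conf E K i' D q C" "lin R D P f"
    and cart: "cartesian D f q P p C g"
    by (rule pullbacks[OF c C g]) (rule that; assumption)
  have com: "p (f x) = g (q x)" if "x \<in> carrier D" for x using cart that unfolding cartesian_def by blast
  note e = sxD[OF conf_D[OF D(1)]]
  \<comment> \<open>The identity of \<open>P\<close> and \<open>h\<close> agree over
    \<open>M\<close>, so together they define a section of the projection from \<open>D\<close> to
    \<open>P\<close>.\<close>
  obtain t where t: "lin R P D t" "\<forall>x\<in>carrier P. f (t x) = x \<and> q (t x) = h x"
    using pullback_factor(1)[OF d(5) e(5,6) D(2) e(8) cart d(5) lin_id h] gh by auto
  have fsurj: "f ` carrier D = carrier P"
  proof
    show "f ` carrier D \<subseteq> carrier P" using lin_closed[OF D(2)] by blast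
    show "carrier P \<subseteq> f ` carrier D"
    proof
      fix x assume x: "x \<in> carrier P"
      then have "x = f (t x)" using t(2) by simp
      then show "x \<in> f ` carrier D" using lin_closed[OF t(1) x] by (rule image_eqI)
    qed
  qed
  have "conf E (sub D {x \<in> carrier D. f x = \<zero>\<^bsub>P\<^esub>}) (\<lambda>x. x) D f P"
    by (rule conf_split[OF sx_kernel[OF e(2) d(2) D(2) fsurj] t(1)]) (use t(2) in blast)
  then have "admissible_epic E D (restrict f (carrier D)) P" unfolding conf_def admissible_epic_def by blast
  moreover have "admissible_epic E P (restrict p (carrier P)) M" using c unfolding conf_def admissible_epic_def by blast
  ultimately have "admissible_epic E D (compose (carrier D) (restrict p (carrier P)) (restrict f (carrier D))) M"
    using exact unfolding exact_structure_def by meson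
  moreover have "compose (carrier D) (restrict p (carrier P)) (restrict f (carrier D)) = restrict (\<lambda>x. p (f x)) (carrier D)"
    using lin_closed[OF D(2)] by (auto simp: compose_def fun_eq_iff)
  ultimately have ad: "admissible_epic E D (restrict (\<lambda>x. p (f x)) (carrier D)) M" by simp
  have l: "lin R D M (\<lambda>x. p (f x))" by (rule lin_comp[OF D(2) d(8)])
  have "(\<lambda>x. p (f x)) ` carrier D = p ` (f ` carrier D)" by (rule image_image[symmetric])
  then have lsurj: "(\<lambda>x. p (f x)) ` carrier D = carrier M" unfolding fsurj d(11) .
  let ?W = "{x \<in> carrier D. p (f x) = \<zero>\<^bsub>M\<^esub>}"
  have cW: "conf E (sub D ?W) (\<lambda>x. x) D (\<lambda>x. p (f x)) M"
    by (rule conf_of_admissible_epic[OF sx_kernel[OF e(2) d(3) l lsurj] ad])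
  \<comment> \<open>\<open>q\<close> carries the kernel of the composite from \<open>D\<close> to
    \<open>M\<close> into the kernel of \<open>g\<close>, giving a morphism of short exact sequences
    that is the identity on \<open>M\<close>.\<close>
  have l': "lin R (sub D ?W) (sub C {x \<in> carrier C. g x = \<zero>\<^bsub>M\<^esub>}) q"
  proof (rule lin_into_sub[OF lin_sub[OF _ e(8)]])
    fix x assume "x \<in> carrier (sub D ?W)"
    then show "q x \<in> {x \<in> carrier C. g x = \<zero>\<^bsub>M\<^esub>}" using com[of x] lin_closed[OF e(8), of x] by simp
  qed blast
  show ?thesis by (rule conf_pushout[OF cW sC l' e(8)]) (simp_all add: com)
qed

end

section \<open>Orthogonal classes\<close>

context module_universe
begin

lemma closed_under_coproductsI:
  fixes U :: "('r, 'm) module set"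
  assumes UM: "U \<subseteq> ModR R"
    and U: "\<And>(J :: 'm set) N D \<phi> \<psi>. \<lbrakk>\<And>i. i \<in> J \<Longrightarrow> N i \<in> U; D \<in> ModR R; mutually_inverse R (dsum J N) D \<phi> \<psi>\<rbrakk> \<Longrightarrow> D \<in> U"
  shows "closed_under_coproducts R U"
  unfolding closed_under_coproducts_def
proof (intro allI impI)
  fix J :: "'m set" and N :: "'m \<Rightarrow> ('r, 'm) module" assume J: "small TYPE('m) J" and "\<forall>i\<in>J. N i \<in> U"
  then have N: "\<And>i. i \<in> J \<Longrightarrow> N i \<in> U" by blast
  then have NM: "\<And>i. i \<in> J \<Longrightarrow> N i \<in> ModR R" using UM by blast
  then have mN: "\<And>i. i \<in> J \<Longrightarrow> right_module R (N i)" by (rule ModR_module)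
  have sm: "small TYPE('m) (carrier (dsum J N))" by (intro small_dsum J ModR_small[OF NM])
  have mP: "right_module R (dsum J N)" by (rule right_module_dsum[OF ring_R]) (erule ModR_module[OF NM])
  obtain D :: "('r, 'm) module" and \<phi> \<psi> where D0: "D \<in> ModR R" "mutually_inverse R (dsum J N) D \<phi> \<psi>"
    using realize_inverse[OF mP sm] by blast
  note D = D0(1) mutually_inverseD[OF D0(2)]
  have di: "lin R (N i) (dsum J N) (dsum_in J N i)" if "i \<in> J" for i
    by (rule dsum_in_lin[where N=N, OF _ that]) (erule mN)
  have DU: "D \<in> U" by (rule U[OF N D0])
  show "\<exists>D\<in>U. \<exists>\<iota>. (\<forall>i\<in>J. lin R (N i) D (\<iota> i)) \<and>
        (\<forall>T\<in>(ModR R :: ('r, 'm) module set). \<forall>u. (\<forall>i\<in>J. lin R (N i) T (u i)) \<longrightarrow>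
          (\<exists>w. lin R D T w \<and> (\<forall>i\<in>J. \<forall>x\<in>carrier (N i). w (\<iota> i x) = u i x)))"
  proof (intro bexI[OF _ DU] exI[of _ "\<lambda>i x. \<phi> (dsum_in J N i x)"] conjI ballI allI impI)
    fix i assume i: "i \<in> J"
    show "lin R (N i) D (\<lambda>x. \<phi> (dsum_in J N i x))" by (rule lin_comp[OF di[OF i] D(2)])
  next
    fix T :: "('r, 'm) module" and u assume T: "T \<in> ModR R" and "\<forall>i\<in>J. lin R (N i) T (u i)"
    then have u: "\<And>i. i \<in> J \<Longrightarrow> lin R (N i) T (u i)" by blast
    note mT = ModR_module[OF T]
    have l: "lin R D T (\<lambda>y. dsum_lift J N T u (\<psi> y))" by (rule lin_comp[OF D(3) dsum_lift_lin[OF ring_R mT]]) (erule mN u)+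
    have e: "dsum_lift J N T u (\<psi> (\<phi> (dsum_in J N i x))) = u i x" if i: "i \<in> J" and x: "x \<in> carrier (N i)" for i x
    proof -
      have "dsum_lift J N T u (dsum_in J N i x) = u i x"
        by (rule dsum_lift_in[where N=N and u=u, OF mT _ _ i x]) (erule mN u)+
      then show ?thesis using D(4)[OF lin_closed[OF di[OF i] x]] by simp
    qed
    show "\<exists>w. lin R D T w \<and> (\<forall>i\<in>J. \<forall>x\<in>carrier (N i). w (\<phi> (dsum_in J N i x)) = u i x)"
      by (intro exI[of _ "\<lambda>y. dsum_lift J N T u (\<psi> y)"] conjI ballI l e)
  qed
qed

text \<open>The generators of \<open>B\<close> also generate \<open>C\<close>. The relations for
  \<open>C\<close> are those for \<open>B\<close> together with lifts of the \<open>k\<close>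
  generators of \<open>A\<close>: an element \<open>v\<close> that maps to zero in \<open>C\<close>
  differs from a combination of these lifts by a relation of \<open>B\<close>.\<close>

lemma finitely_presented_quotient:
  fixes A :: "('r, 'm) module"
  assumes s: "sx R A i B p C" and fp: "finitely_presented R B"
    and \<alpha>: "lin R (free R {..<k::nat}) A \<alpha>" "\<alpha> ` carrier (free R {..<k}) = carrier A"
  shows "finitely_presented R C"
proof -
  note d = sxD[OF s]
  obtain m n :: nat and g f where g: "lin R (free R {..<m}) (free R {..<n}) g" and f: "lin R (free R {..<n}) B f"
    and fs: "f ` carrier (free R {..<n}) = carrier B"
    and ker: "g ` carrier (free R {..<m}) = {v \<in> carrier (free R {..<n}). f v = \<zero>\<^bsub>B\<^esub>}"
    using fp unfolding finitely_presented_iff[OF ring_R d(5)] by (elim exE conjE) (rule that)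
  let ?F = "\<lambda>n::nat. free R {..<n}"
  note mF = right_module_free[OF ring_R]
  interpret Fn: right_module R "?F n" by (rule mF)
  have pf: "lin R (?F n) C (\<lambda>x. p (f x))" by (rule lin_comp[OF f d(8)])
  obtain l where l: "lin R (?F k) (?F n) l" "\<forall>x\<in>carrier (?F k). f (l x) = i (\<alpha> x)"
    using free_projective[OF ring_R mF d(5) f fs lin_comp[OF \<alpha>(1) d(7)]] by blast
  \<comment> \<open>The first \<open>m\<close> basis elements carry the relations of
    \<open>B\<close>, the following \<open>k\<close> the lifted generators of \<open>A\<close>,
    hence the shift by \<open>m\<close>.\<close>
  let ?c = "\<lambda>j. if j < m then g (basis R {..<m} j) else l (basis R {..<k} (j - m))"
  have gb: "g (basis R {..<m} j) \<in> carrier (?F n)" if "j < m" for j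
    using lin_closed[OF g basis_closed[OF ring_R]] that by simp
  have lb: "l (basis R {..<k} j) \<in> carrier (?F n)" if "j < k" for j
    using lin_closed[OF l(1) basis_closed[OF ring_R]] that by simp
  have "\<exists>w. lin R (?F (m + k)) (?F n) w \<and> (\<forall>j\<in>{..<m + k}. w (basis R {..<m + k} j) = ?c j)"
    by (rule free_lift[OF ring_R mF]) (use gb lb in auto)
  then obtain G where G: "lin R (?F (m + k)) (?F n) G" "\<forall>j\<in>{..<m + k}. G (basis R {..<m + k} j) = ?c j" by blast
  let ?I = "G ` carrier (?F (m + k))"
  have sI: "submod R (?F n) ?I" by (rule submod_image[OF mF mF G(1) submod_carrier[OF mF]])
  have gI: "g x \<in> ?I" if "x \<in> carrier (?F m)" for x
  proof (rule free_image_subset[OF ring_R mF g sI _ that])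
    fix j assume j: "j \<in> {..<m}"
    have "G (basis R {..<m + k} j) = g (basis R {..<m} j)" using G(2) j by simp
    then show "g (basis R {..<m} j) \<in> ?I" using basis_closed[OF ring_R, of j "{..<m + k}"] j by (intro image_eqI[OF sym]) auto
  qed
  have lI: "l x \<in> ?I" if "x \<in> carrier (?F k)" for x
  proof (rule free_image_subset[OF ring_R mF l(1) sI _ that])
    fix j assume j: "j \<in> {..<k}"
    have "G (basis R {..<m + k} (m + j)) = l (basis R {..<k} j)" using G(2) j by simp
    then show "l (basis R {..<k} j) \<in> ?I" using basis_closed[OF ring_R, of "m + j" "{..<m + k}"] j by (intro image_eqI[OF sym]) auto
  qed
  have "(\<lambda>x. p (f x)) ` carrier (?F n) = carrier C" unfolding d(11)[symmetric] fs[symmetric] by (rule image_image[symmetric])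
  moreover have "?I = {v \<in> carrier (?F n). p (f v) = \<zero>\<^bsub>C\<^esub>}"
  proof
    let ?P = "{v \<in> carrier (?F n). p (f v) = \<zero>\<^bsub>C\<^esub>}"
    have P: "submod R (?F n) ?P" by (rule submod_kernel[OF mF d(6) pf])
    have "G x \<in> ?P" if "x \<in> carrier (?F (m + k))" for x
    proof (rule free_image_subset[OF ring_R mF G(1) P _ that])
      fix j assume j: "j \<in> {..<m + k}"
      show "G (basis R {..<m + k} j) \<in> ?P"
      proof (cases "j < m")
        case True
        then have b: "basis R {..<m} j \<in> carrier (?F m)" by (intro basis_closed[OF ring_R]) simp
        then have "g (basis R {..<m} j) \<in> {v \<in> carrier (?F n). f v = \<zero>\<^bsub>B\<^esub>}" unfolding ker[symmetric] by (rule imageI)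
        then show ?thesis using G(2) j True lin_zero[OF d(5,6,8)] by simp
      next
        case False
        then have b: "basis R {..<k} (j - m) \<in> carrier (?F k)" using j by (intro basis_closed[OF ring_R]) auto
        show ?thesis using G(2) j False lb[of "j - m"] l(2) b d(12)[OF lin_closed[OF \<alpha>(1) b]] by auto
      qed
    qed
    then show "?I \<subseteq> ?P" by blast
    show "?P \<subseteq> ?I"
    proof
      fix v assume v: "v \<in> ?P"
      then have fv: "f v \<in> carrier B" "p (f v) = \<zero>\<^bsub>C\<^esub>" using lin_closed[OF f] by auto
      then obtain a where a: "a \<in> carrier A" "i a = f v" using d(13) by blast
      then obtain w where w: "w \<in> carrier (?F k)" "\<alpha> w = a" unfolding \<alpha>(2)[symmetric] by auto
      note lw = lin_closed[OF l(1) w(1)]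
      have vc: "v \<in> carrier (?F n)" using v by simp
      interpret B: right_module R B by (rule d(5))
      have "f (v \<ominus>\<^bsub>?F n\<^esub> l w) = f v \<ominus>\<^bsub>B\<^esub> f (l w)" by (rule lin_diff[OF mF d(5) f vc lw])
      also have "\<dots> = \<zero>\<^bsub>B\<^esub>" using l(2) w a fv(1) B.diff_zero_iff by simp
      finally have "v \<ominus>\<^bsub>?F n\<^esub> l w \<in> g ` carrier (?F m)" unfolding ker using vc lw by simp
      then have "v \<ominus>\<^bsub>?F n\<^esub> l w \<in> ?I" using gI by auto
      then show "v \<in> ?I" by (rule Fn.submod_diff_add[OF sI vc lI[OF w(1)]])
    qed
  qed
  ultimately show ?thesis unfolding finitely_presented_iff[OF ring_R d(6)] using G(1) pf
    by (intro exI[of _ "m + k"] exI[of _ n] exI[of _ G] exI[of _ "\<lambda>x. p (f x)"]) simp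
qed

lemma finitely_presented_generators:
  fixes A :: "('r, 'm) module"
  assumes "right_module R A" "finitely_presented R A"
  obtains n :: nat and f where "lin R (free R {..<n}) A f" "f ` carrier (free R {..<n}) = carrier A"
  using assms(2) unfolding finitely_presented_iff[OF ring_R assms(1)] by (elim exE conjE) (rule that)

end

context exact_category
begin

section \<open>Orthogonality expressed by lifting and extension of maps\<close>

lemma projective_conf:
  assumes "M \<in> ModR R" obtains K i P p where "E_projective R E P" "conf E K i P p M"
  using projective_conf_exists[OF assms] conf_iff_mem[OF E_pairs] by metis

lemma injective_conf:
  assumes "N \<in> ModR R" obtains j I q L where "E_injective R E I" "conf E N j I q L"
  using injectives assms conf_iff_mem[OF E_pairs] unfolding enough_injectives_def admissible_monic_def by metis

lemma left_perp_iff: "Z \<subseteq> ModR R \<Longrightarrow> M \<in> left_perp R E Z \<longleftrightarrow> M \<in> ModR R \<and> (\<forall>N\<in>Z. splits M N)"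
  unfolding left_perp_def using Ext_trivial_iff_splits by blast

lemma right_perp_iff: "Z \<subseteq> ModR R \<Longrightarrow> N \<in> right_perp R E Z \<longleftrightarrow> N \<in> ModR R \<and> (\<forall>M\<in>Z. splits M N)"
  unfolding right_perp_def using Ext_trivial_iff_splits by blast

text \<open>The dual of \<open>splits_iff_extend\<close>. If extensions split, pull back along
  \<open>f\<close>. Conversely \<open>j\<close> extends to a map \<open>b\<close> on the middle term
  by injectivity; subtracting a lift of the map that \<open>b\<close> induces from \<open>M\<close>
  to \<open>L\<close> makes it land in \<open>N\<close>, as a retraction.\<close>

lemma splits_iff_lift:
  assumes c: "conf E N j I q L" and I: "E_injective R E I" and M: "M \<in> ModR R"
  shows "splits M N \<longleftrightarrow> (\<forall>f. lin R M L f \<longrightarrow> (\<exists>g. lin R M I g \<and> (\<forall>x\<in>carrier M. q (g x) = f x)))"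
proof
  note d = sxD[OF conf_D[OF c]]
  assume s: "splits M N"
  show "\<forall>f. lin R M L f \<longrightarrow> (\<exists>g. lin R M I g \<and> (\<forall>x\<in>carrier M. q (g x) = f x))"
  proof (intro allI impI)
    fix f assume f: "lin R M L f"
    obtain M' i' p' f' where p: "conf E N i' M' p' M" "lin R M' I f'" and cart: "cartesian M' f' p' I q M f"
      by (rule pullbacks[OF c M f]) (rule that; assumption)
    obtain t where t: "lin R M M' t" "\<forall>x\<in>carrier M. p' (t x) = x" using s p(1) unfolding splits_def by blast
    have "q (f' (t x)) = f x" if "x \<in> carrier M" for x
      using cart lin_closed[OF t(1) that] t(2) that unfolding cartesian_def by auto
    then show "\<exists>g. lin R M I g \<and> (\<forall>x\<in>carrier M. q (g x) = f x)"
      by (intro exI[of _ "\<lambda>x. f' (t x)"] conjI lin_comp[OF t(1) p(2)] ballI)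
  qed
next
  note d = sxD[OF conf_D[OF c]]
  assume h: "\<forall>f. lin R M L f \<longrightarrow> (\<exists>g. lin R M I g \<and> (\<forall>x\<in>carrier M. q (g x) = f x))"
  show "splits M N"
    unfolding splits_def
  proof (intro allI impI)
    fix B j' q' assume c': "conf E N j' B q' M"
    note s' = conf_D[OF c']
    note d' = sxD[OF s']
    interpret I: right_module R I by (rule d(5))
    obtain b where b: "lin R B I b" "\<forall>x\<in>carrier N. b (j' x) = j x" using E_injective_extend[OF E_pairs I c' d(7)] by blast
    have "q (b (j' x)) = \<zero>\<^bsub>L\<^esub>" if "x \<in> carrier N" for x using b(2) d(12)[OF that] that by simp
    then obtain a where a: "lin R M L a" "\<forall>x\<in>carrier B. a (q' x) = q (b x)"
      using sx_factor_epi[OF s' d(6) lin_comp[OF b(1) d(8)]] by blast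
    obtain g where g: "lin R M I g" "\<forall>x\<in>carrier M. q (g x) = a x" using h[rule_format, OF a(1)] by blast
    let ?r = "\<lambda>x. b x \<ominus>\<^bsub>I\<^esub> g (q' x)"
    have gq: "lin R B I (\<lambda>x. g (q' x))" by (rule lin_comp[OF d'(8) g(1)])
    have r: "lin R B I ?r" by (rule lin_difference[OF d'(5) d(5) b(1) gq])
    interpret L: right_module R L by (rule d(6))
    have "q (?r x) = \<zero>\<^bsub>L\<^esub>" if x: "x \<in> carrier B" for x
    proof -
      note bx = lin_closed[OF b(1) x] and gx = lin_closed[OF gq x]
      have "q (?r x) = q (b x) \<ominus>\<^bsub>L\<^esub> q (g (q' x))" by (rule lin_diff[OF d(5,6,8) bx gx])
      then show ?thesis using a(2) g(2) lin_closed[OF d'(8) x] x lin_closed[OF d(8) bx] L.diff_zero_iff by simp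
    qed
    then obtain w where w: "lin R B N w" "\<forall>x\<in>carrier B. j (w x) = ?r x"
      using sx_factor_mono[OF conf_D[OF c] d'(5) r] by blast
    have "w (j' x) = x" if x: "x \<in> carrier N" for x
    proof (rule inj_onD[OF d(9)])
      show "j (w (j' x)) = j x"
        using w(2) lin_closed[OF d'(7) x] b(2) x d'(12)[OF x] lin_zero[OF d'(6) d(5) g(1)] I.diff_zero[OF lin_closed[OF d(7) x]]
        by simp
    qed (use x lin_closed[OF w(1) lin_closed[OF d'(7) x]] in auto)
    then show "\<exists>s. lin R M B s \<and> (\<forall>x\<in>carrier M. q' (s x) = x)" by (rule sx_section_of_retraction[OF s' w(1)])
  qed
qed

text \<open>By \<open>splits_iff_lift\<close> a map out of the sum has to be lifted, which can be
  done on each summand separately.\<close>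

lemma left_perp_coproducts:
  assumes Z: "Z \<subseteq> ModR R"
  shows "closed_under_coproducts R (left_perp R E Z)"
proof (rule closed_under_coproductsI)
  show "left_perp R E Z \<subseteq> ModR R" unfolding left_perp_def by blast
  fix J :: "'m set" and N D \<phi> \<psi>
  assume N: "\<And>i. i \<in> J \<Longrightarrow> N i \<in> left_perp R E Z" and D0: "D \<in> (ModR R :: ('r, 'm) module set)" "mutually_inverse R (dsum J N) D \<phi> \<psi>"
  note D = D0(1) mutually_inverseD[OF D0(2)]
  have NM: "N i \<in> ModR R" if "i \<in> J" for i using N[OF that] unfolding left_perp_def by blast
  note mN = ModR_module[OF NM]
  have di: "lin R (N i) (dsum J N) (dsum_in J N i)" if "i \<in> J" for i
    by (rule dsum_in_lin[where N=N, OF _ that]) (erule mN)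
  have "splits D Y" if Y: "Y \<in> Z" for Y
  proof -
    have YM: "Y \<in> ModR R" using Y Z by blast
    obtain j I q L where I: "E_injective R E I" and c: "conf E Y j I q L" by (rule injective_conf[OF YM])
    note d = sxD[OF conf_D[OF c]]
    show "splits D Y"
      unfolding splits_iff_lift[OF c I D(1)]
    proof (intro allI impI)
      fix f assume f: "lin R D L f"
      have "\<exists>g. lin R (N i) I g \<and> (\<forall>x\<in>carrier (N i). q (g x) = f (\<phi> (dsum_in J N i x)))" if i: "i \<in> J" for i
      proof -
        have "splits (N i) Y" using N[OF i] Y unfolding left_perp_iff[OF Z] by blast
        then show ?thesis
          unfolding splits_iff_lift[OF c I NM[OF i]] using lin_comp[OF lin_comp[OF di[OF i] D(2)] f] by blast
      qed
      then obtain g where g: "\<And>i. i \<in> J \<Longrightarrow> lin R (N i) I (g i)"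
        "\<And>i x. \<lbrakk>i \<in> J; x \<in> carrier (N i)\<rbrakk> \<Longrightarrow> q (g i x) = f (\<phi> (dsum_in J N i x))" by metis
      have lg: "lin R (dsum J N) I (dsum_lift J N I g)" by (rule dsum_lift_lin[OF ring_R d(5)]) (erule mN g(1))+
      have "q (dsum_lift J N I g x) = f (\<phi> x)" if x: "x \<in> carrier (dsum J N)" for x
      proof (rule dsum_unique[where N=N, OF ring_R d(6) _ lin_comp[OF lg d(8)] lin_comp[OF D(2) f] _ x])
        fix i a assume i: "i \<in> J" and a: "a \<in> carrier (N i)"
        have "dsum_lift J N I g (dsum_in J N i a) = g i a"
          by (rule dsum_lift_in[where N=N and u=g, OF d(5) _ _ i a]) (erule mN g(1))+
        then show "q (dsum_lift J N I g (dsum_in J N i a)) = f (\<phi> (dsum_in J N i a))" using g(2)[OF i a] by simp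
      qed (rule mN)
      then have "q (dsum_lift J N I g (\<psi> x)) = f x" if "x \<in> carrier D" for x
        using lin_closed[OF D(3) that] D(5)[OF that] by simp
      then show "\<exists>g. lin R D I g \<and> (\<forall>x\<in>carrier D. q (g x) = f x)"
        by (intro exI[of _ "\<lambda>x. dsum_lift J N I g (\<psi> x)"] conjI ballI lin_comp[OF D(3) lg])
    qed
  qed
  then show "D \<in> left_perp R E Z" unfolding left_perp_iff[OF Z] using D(1) by blast
qed

lemma pure_exact_pairs: "pure_exact R \<subseteq> (kernel_cokernel_pairs R :: ('r, 'm) mod_pair set)"
  using pure E_pairs by blast

text \<open>A map from \<open>C\<close> to the cosyzygy lifts over \<open>B\<close> to some
  \<open>h\<close>, whose restriction to \<open>A\<close> lands in \<open>Y\<close>. Pure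
  injectivity of \<open>Y\<close> extends this restriction to \<open>B\<close>; after subtracting
  it, \<open>h\<close> kills \<open>A\<close> and descends to \<open>C\<close>.\<close>

lemma left_perp_pure_quotients:
  assumes Z: "Z \<subseteq> ModR R" "Z \<subseteq> pure_injectives R"
  shows "closed_under_pure_quotients R (left_perp R E Z)"
  unfolding closed_under_pure_quotients_def
proof (intro allI impI, elim conjE)
  fix A i B p C assume pe: "(A, i, B, p, C) \<in> pure_exact R" and B: "B \<in> left_perp R E Z"
  note s = pure_exactD(2)[OF pe]
  note e = sxD[OF s]
  have "splits C Y" if Y: "Y \<in> Z" for Y
  proof -
    have YM: "Y \<in> ModR R" using Y Z by blast
    obtain j I q L where I: "E_injective R E I" and c: "conf E Y j I q L" by (rule injective_conf[OF YM])
    note d = sxD[OF conf_D[OF c]]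
    interpret I: right_module R I by (rule d(5))
    interpret L: right_module R L by (rule d(6))
    have sB: "splits B Y" using B Y unfolding left_perp_iff[OF Z(1)] by blast
    show "splits C Y"
      unfolding splits_iff_lift[OF c I e(3)]
    proof (intro allI impI)
      fix f assume f: "lin R C L f"
      obtain h where h: "lin R B I h" "\<forall>x\<in>carrier B. q (h x) = f (p x)"
        using sB[unfolded splits_iff_lift[OF c I e(2)], rule_format, OF lin_comp[OF e(8) f]] by blast
      have "q (h (i x)) = \<zero>\<^bsub>L\<^esub>" if "x \<in> carrier A" for x
        using h(2) lin_closed[OF e(7) that] e(12)[OF that] lin_zero[OF e(6) d(6) f] by simp
      then obtain w where w: "lin R A Y w" "\<forall>x\<in>carrier A. j (w x) = h (i x)"
        using sx_factor_mono[OF conf_D[OF c] e(4) lin_comp[OF e(7) h(1)]] by blast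
      have "E_injective R (pure_exact R) Y" using Y Z(2) unfolding pure_injectives_def by blast
      then obtain t where t: "lin R B Y t" "\<forall>x\<in>carrier A. t (i x) = w x"
        using E_injective_extend[OF pure_exact_pairs _ conf_iff_mem[OF pure_exact_pairs pe] w(1)] by blast
      let ?u = "\<lambda>x. h x \<ominus>\<^bsub>I\<^esub> j (t x)"
      have jt: "lin R B I (\<lambda>x. j (t x))" by (rule lin_comp[OF t(1) d(7)])
      have u: "lin R B I ?u" by (rule lin_difference[OF e(5) d(5) h(1) jt])
      have "?u (i x) = \<zero>\<^bsub>I\<^esub>" if "x \<in> carrier A" for x
        using t(2) w(2) that lin_closed[OF h(1) lin_closed[OF e(7) that]] I.diff_zero_iff by simp
      then obtain g where g: "lin R C I g" "\<forall>x\<in>carrier B. g (p x) = ?u x" using sx_factor_epi[OF s d(5) u] by blast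
      have "q (g y) = f y" if y: "y \<in> carrier C" for y
      proof -
        obtain x where x: "x \<in> carrier B" "p x = y" using e(14)[OF y] by blast
        have "q (?u x) = q (h x) \<ominus>\<^bsub>L\<^esub> q (j (t x))"
          by (rule lin_diff[OF d(5,6,8) lin_closed[OF h(1) x(1)] lin_closed[OF jt x(1)]])
        also have "\<dots> = f y"
          using h(2) x d(12)[OF lin_closed[OF t(1) x(1)]] L.diff_zero lin_closed[OF f y] by simp
        finally show ?thesis using g(2) x by auto
      qed
      then show "\<exists>g. lin R C I g \<and> (\<forall>x\<in>carrier C. q (g x) = f x)" using g(1) by blast
    qed
  qed
  then show "C \<in> left_perp R E Z" unfolding left_perp_iff[OF Z(1)] using e(3) by blast
qed

lemma left_perp_covering:
  assumes Z: "Z \<subseteq> ModR R" "Z \<subseteq> pure_injectives R"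
  shows "covering R (left_perp R E Z)"
proof -
  interpret coproduct_pure_quotient_class ty R "left_perp R E Z"
  proof unfold_locales
    show "left_perp R E Z \<subseteq> ModR R" unfolding left_perp_def by blast
  qed (rule left_perp_coproducts[OF Z(1)] left_perp_pure_quotients[OF Z])+
  show ?thesis by (rule covering)
qed

section \<open>Right orthogonal classes of pure projective and of finitely presented type\<close>

lemma right_perp_products:
  assumes Z: "Z \<subseteq> ModR R"
  shows "closed_under_products R (right_perp R E Z)"
  unfolding closed_under_products_def
proof (intro allI impI)
  fix J :: "'m set" and N :: "'m \<Rightarrow> ('r, 'm) module"
  assume J: "small TYPE('m) J" and N: "\<forall>i\<in>J. N i \<in> right_perp R E Z"
  have NM: "N i \<in> ModR R" if "i \<in> J" for i using N that unfolding right_perp_def by blast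
  have sm: "small TYPE('m) (carrier (prodm J N))" unfolding prodm_simps by (intro small_PiE J ModR_small[OF NM])
  have mP: "right_module R (prodm J N)" by (rule right_module_prodm[OF ring_R]) (erule ModR_module[OF NM])
  obtain D :: "('r, 'm) module" and \<phi> \<psi> where D0: "D \<in> ModR R" "mutually_inverse R (prodm J N) D \<phi> \<psi>"
    using realize_inverse[OF mP sm] by blast
  note D = D0(1) mutually_inverseD[OF D0(2)]
  have "splits M D" if M: "M \<in> Z" for M
  proof -
    have MM: "M \<in> ModR R" using M Z by blast
    obtain K i P p where P: "E_projective R E P" and c: "conf E K i P p M" by (rule projective_conf[OF MM])
    note d = sxD[OF conf_D[OF c]]
    show ?thesis
      unfolding splits_iff_extend[OF c P D(1)]
    proof (intro allI impI)
      fix f assume f: "lin R K D f"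
      have "\<exists>g. lin R P (N l) g \<and> (\<forall>x\<in>carrier K. g (i x) = \<psi> (f x) l)" if l: "l \<in> J" for l
      proof -
        have "splits M (N l)" using N l M unfolding right_perp_iff[OF Z] by blast
        then show ?thesis unfolding splits_iff_extend[OF c P NM[OF l]]
          using lin_comp[OF lin_comp[OF f D(3)] prodm_proj[OF l]] by blast
      qed
      then obtain g where g: "\<And>l. l \<in> J \<Longrightarrow> lin R P (N l) (g l)" "\<And>l x. \<lbrakk>l \<in> J; x \<in> carrier K\<rbrakk> \<Longrightarrow> g l (i x) = \<psi> (f x) l" by metis
      have lg: "lin R P (prodm J N) (\<lambda>x. \<lambda>l\<in>J. g l x)" by (rule prodm_lift[OF _ d(5)]) (erule g(1))
      have "\<phi> (\<lambda>l\<in>J. g l (i x)) = f x" if x: "x \<in> carrier K" for x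
      proof -
        have "\<psi> (f x) \<in> extensional J"
          using lin_closed[OF D(3) lin_closed[OF f x]] unfolding prodm_simps by (simp add: PiE_def)
        then have "(\<lambda>l\<in>J. g l (i x)) = \<psi> (f x)" using g(2) x by (auto simp: fun_eq_iff extensional_def)
        then show ?thesis using D(5)[OF lin_closed[OF f x]] by simp
      qed
      then show "\<exists>g. lin R P D g \<and> (\<forall>x\<in>carrier K. g (i x) = f x)"
        by (intro exI[of _ "\<lambda>x. \<phi> (\<lambda>l\<in>J. g l x)"] conjI ballI lin_comp[OF lg D(2)])
    qed
  qed
  then have DU: "D \<in> right_perp R E Z" unfolding right_perp_iff[OF Z] using D(1) by blast
  show "\<exists>P\<in>right_perp R E Z. \<exists>pr. (\<forall>i\<in>J. lin R P (N i) (pr i)) \<and>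
        (\<forall>T\<in>(ModR R :: ('r, 'm) module set). \<forall>u. (\<forall>i\<in>J. lin R T (N i) (u i)) \<longrightarrow>
          (\<exists>w. lin R T P w \<and> (\<forall>i\<in>J. \<forall>x\<in>carrier T. pr i (w x) = u i x)))"
  proof (intro bexI[OF _ DU] exI[of _ "\<lambda>i y. \<psi> y i"] conjI ballI allI impI)
    fix i assume i: "i \<in> J"
    show "lin R D (N i) (\<lambda>y. \<psi> y i)" by (rule lin_comp[OF D(3) prodm_proj[OF i]])
  next
    fix T :: "('r, 'm) module" and u assume T: "T \<in> ModR R" and "\<forall>i\<in>J. lin R T (N i) (u i)"
    then have "lin R T (prodm J N) (\<lambda>x. \<lambda>i\<in>J. u i x)" by (intro prodm_lift ModR_module) blast+
    then show "\<exists>w. lin R T D w \<and> (\<forall>i\<in>J. \<forall>x\<in>carrier T. \<psi> (w x) i = u i x)"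
      using lin_comp[OF _ D(2)] D(4) lin_closed by (intro exI[of _ "\<lambda>x. \<phi> (\<lambda>i\<in>J. u i x)"] conjI ballI) (blast, fastforce)
  qed
qed

text \<open>A map from the syzygy to the submodule extends to \<open>g\<close> from \<open>P\<close>
  to \<open>N\<close>, which induces a map from \<open>M\<close> to the quotient of
  \<open>N\<close>. Pure projectivity of \<open>M\<close> lifts that map to \<open>N\<close>;
  subtracting the lift moves \<open>g\<close> into the submodule and leaves it unchanged on the
  syzygy.\<close>

lemma right_perp_pure_submod:
  assumes Z: "Z \<subseteq> ModR R" "Z \<subseteq> pure_projectives R" and N: "N \<in> right_perp R E Z" and B: "pure_submod R N B"
  shows "sub N B \<in> right_perp R E Z"
proof -
  have NM: "N \<in> ModR R" using N unfolding right_perp_def by blast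
  note mN = ModR_module[OF NM]
  interpret N: right_module R N by (rule mN)
  have sB: "submod R N B" using B unfolding pure_submod_def by blast
  have BM: "sub N B \<in> ModR R" by (rule ModR_sub[OF NM sB])
  have Bc: "B \<subseteq> carrier N" by (rule submodD(1)[OF sB])
  obtain Q :: "('r, 'm) module" and \<pi> where Q: "Q \<in> ModR R" "lin R N Q \<pi>" "\<pi> ` carrier N = carrier Q"
    "\<forall>x\<in>carrier N. \<pi> x = \<zero>\<^bsub>Q\<^esub> \<longleftrightarrow> x \<in> B"
    using quotient_exists[OF mN sB ModR_small[OF NM]] by blast
  note mQ = ModR_module[OF Q(1)]
  interpret Q: right_module R Q by (rule mQ)
  have "(sub N B, restrict (\<lambda>x. x) B, N, restrict \<pi> (carrier N), Q) \<in> pure_exact R"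
    by (rule pure_submod_pure_exact[OF ring_R NM Q(1-3) B]) (use Q(4) in blast)
  then have cQ: "conf (pure_exact R) (sub N B) (\<lambda>x. x) N \<pi> Q" unfolding conf_def by simp
  have "splits M (sub N B)" if M: "M \<in> Z" for M
  proof -
    have MM: "M \<in> ModR R" using M Z by blast
    have Mp: "E_projective R (pure_exact R) M" using M Z(2) unfolding pure_projectives_def by blast
    obtain K i P p where P: "E_projective R E P" and c: "conf E K i P p M" by (rule projective_conf[OF MM])
    note d = sxD[OF conf_D[OF c]]
    have sN: "splits M N" using N M unfolding right_perp_iff[OF Z(1)] by blast
    show ?thesis
      unfolding splits_iff_extend[OF c P BM]
    proof (intro allI impI)
      fix f assume f: "lin R K (sub N B) f"
      note f' = lin_from_into_sub[OF f Bc]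
      obtain g where g: "lin R P N g" "\<forall>x\<in>carrier K. g (i x) = f x"
        using sN[unfolded splits_iff_extend[OF c P NM], rule_format, OF f'] by blast
      have "\<pi> (g (i x)) = \<zero>\<^bsub>Q\<^esub>" if "x \<in> carrier K" for x
        using g(2) that Q(4) lin_closed[OF f that] lin_closed[OF f' that] by simp
      then obtain a where a: "lin R M Q a" "\<forall>x\<in>carrier P. a (p x) = \<pi> (g x)"
        using sx_factor_epi[OF conf_D[OF c] mQ lin_comp[OF g(1) Q(2)]] by blast
      obtain t where t: "lin R M N t" "\<forall>x\<in>carrier M. \<pi> (t x) = a x"
        using E_projective_lift[OF pure_exact_pairs Mp cQ a(1)] by blast
      let ?h = "\<lambda>x. g x \<ominus>\<^bsub>N\<^esub> t (p x)"
      have tp: "lin R P N (\<lambda>x. t (p x))" by (rule lin_comp[OF d(8) t(1)])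
      have h: "lin R P N ?h" by (rule lin_difference[OF d(5) mN g(1) tp])
      have hB: "?h x \<in> B" if x: "x \<in> carrier P" for x
      proof -
        have "\<pi> (?h x) = \<pi> (g x) \<ominus>\<^bsub>Q\<^esub> \<pi> (t (p x))" by (rule lin_diff[OF mN mQ Q(2) lin_closed[OF g(1) x] lin_closed[OF tp x]])
        also have "\<dots> = \<zero>\<^bsub>Q\<^esub>"
          using a(2) t(2) x lin_closed[OF d(8) x] lin_closed[OF Q(2) lin_closed[OF g(1) x]] Q.diff_zero_iff by simp
        finally show ?thesis using Q(4) lin_closed[OF h x] by blast
      qed
      have "?h (i x) = f x" if x: "x \<in> carrier K" for x
        using g(2) x d(12)[OF x] lin_zero[OF d(6) mN t(1)] N.diff_zero[OF lin_closed[OF f' x]] by simp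
      then show "\<exists>g. lin R P (sub N B) g \<and> (\<forall>x\<in>carrier K. g (i x) = f x)"
        by (intro exI[of _ ?h] conjI ballI lin_into_sub[OF h hB])
    qed
  qed
  then show ?thesis unfolding right_perp_iff[OF Z(1)] using BM by blast
qed

lemma right_perp_preenveloping:
  assumes Z: "Z \<subseteq> ModR R" "Z \<subseteq> pure_projectives R"
  shows "preenveloping R (right_perp R E Z)"
  unfolding preenveloping_def
proof
  fix M :: "('r, 'm) module" assume M: "M \<in> ModR R"
  show "\<exists>C f. is_preenvelope R (right_perp R E Z) M f C"
    by (rule preenvelope_exists[OF _ right_perp_products[OF Z(1)] right_perp_pure_submod[OF Z] M])
      (auto simp: right_perp_def)
qed

text \<open>The second syzygy is finitely generated, as an image of \<open>P 2\<close>, and the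
  first syzygy is the quotient of \<open>P 1\<close> by it; so
  \<open>finitely_presented_quotient\<close> applies.\<close>

lemma fp_syzygy_exists:
  assumes h: "has_fp_E_presentation R E M"
  obtains K i P p where "E_projective R E P" "conf E K i P p M" "finitely_presented R K"
proof -
  obtain e P d where r: "E_projective_resolution R E M e P d" and fp: "finitely_presented R (P 1)" "finitely_presented R (P 2)"
    using h unfolding has_fp_E_presentation_def by blast
  obtain K i p where K: "K 0 = M" and *: "\<And>n. E_projective R E (P n)" "\<And>n. (K (Suc n), i n, P n, p n, K n) \<in> E"
    using r unfolding E_projective_resolution_def by blast
  have c: "conf E (K (Suc n)) (i n) (P n) (p n) (K n)" for n by (rule conf_iff_mem[OF E_pairs *(2)])
  note s1 = conf_D[OF c[of 1]] and s2 = conf_D[OF c[of 2]]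
  have K2: "K (Suc 1) = K 2" by (simp add: numeral_2_eq_2)
  obtain n :: nat and f where f: "lin R (free R {..<n}) (P 2) f" "f ` carrier (free R {..<n}) = carrier (P 2)"
    by (rule finitely_presented_generators[OF sxD(5)[OF s2] fp(2)])
  have "(\<lambda>x. p 2 (f x)) ` carrier (free R {..<n}) = p 2 ` (f ` carrier (free R {..<n}))" by (rule image_image[symmetric])
  also have "\<dots> = carrier (K (Suc 1))" unfolding f(2) K2 by (rule sxD(11)[OF s2])
  finally have sur: "(\<lambda>x. p 2 (f x)) ` carrier (free R {..<n}) = carrier (K (Suc 1))" .
  have l: "lin R (free R {..<n}) (K (Suc 1)) (\<lambda>x. p 2 (f x))" unfolding K2 by (rule lin_comp[OF f(1) sxD(8)[OF s2]])
  have "finitely_presented R (K 1)" by (rule finitely_presented_quotient[OF s1 fp(1) l sur])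
  then show thesis using that[OF *(1)[of 0], of "K 1" "i 0" "p 0"] c[of 0] K by simp
qed

text \<open>The syzygy is finitely generated, so the image of a map into the direct sum is supported
  on a finite set \<open>?S\<close> of indices, and the components can be extended one by
  one.\<close>

lemma right_perp_fp_coproducts:
  assumes Z: "Z \<subseteq> ModR R" "\<And>M. M \<in> Z \<Longrightarrow> has_fp_E_presentation R E M"
  shows "closed_under_coproducts R (right_perp R E Z)"
proof (rule closed_under_coproductsI)
  show "right_perp R E Z \<subseteq> ModR R" unfolding right_perp_def by blast
  fix J :: "'m set" and N D \<phi> \<psi>
  assume N: "\<And>i. i \<in> J \<Longrightarrow> N i \<in> right_perp R E Z" and D0: "D \<in> (ModR R :: ('r, 'm) module set)" "mutually_inverse R (dsum J N) D \<phi> \<psi>"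
  note D = D0(1) mutually_inverseD[OF D0(2)]
  have NM: "N i \<in> ModR R" if "i \<in> J" for i using N[OF that] unfolding right_perp_def by blast
  note mN = ModR_module[OF NM]
  have mD: "right_module R (dsum J N)" by (rule right_module_dsum[OF ring_R]) (erule mN)
  interpret D: right_module R "dsum J N" by (rule mD)
  have "splits M D" if M: "M \<in> Z" for M
  proof -
    obtain K i P p where P: "E_projective R E P" and c: "conf E K i P p M" and fp: "finitely_presented R K"
      by (rule fp_syzygy_exists[OF Z(2)[OF M]])
    note d = sxD[OF conf_D[OF c]]
    obtain n :: nat and \<alpha> where \<alpha>: "lin R (free R {..<n}) K \<alpha>" "\<alpha> ` carrier (free R {..<n}) = carrier K"
      by (rule finitely_presented_generators[OF d(4) fp])
    show ?thesis
      unfolding splits_iff_extend[OF c P D(1)]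
    proof (intro allI impI)
      fix f assume f: "lin R K D f"
      note \<psi>f = lin_comp[OF f D(3)]
      let ?S = "\<Union>l\<in>{..<n}. supp J N (\<psi> (f (\<alpha> (basis R {..<n} l))))"
      have b: "\<psi> (f (\<alpha> (basis R {..<n} l))) \<in> carrier (dsum J N)" if "l \<in> {..<n}" for l
        by (rule lin_closed[OF \<psi>f lin_closed[OF \<alpha>(1) basis_closed[OF ring_R that]]])
      have S: "finite ?S" using b unfolding dsum_simps by auto
      let ?P = "{x \<in> carrier (dsum J N). supp J N x \<subseteq> ?S}"
      have sP: "submod R (dsum J N) ?P"
      proof (rule submodI)
        show "\<zero>\<^bsub>dsum J N\<^esub> \<in> ?P" using D.M.zero_closed by (auto simp: supp_def dsum_simps(2))
        fix x y assume xy: "x \<in> ?P" "y \<in> ?P"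
        have "x \<oplus>\<^bsub>dsum J N\<^esub> y \<in> carrier (dsum J N)" using xy by simp
        moreover have "(x \<oplus>\<^bsub>dsum J N\<^esub> y) l = \<zero>\<^bsub>N l\<^esub>" if l: "l \<in> J" "l \<notin> ?S" for l
        proof -
          interpret Nl: right_module R "N l" by (rule mN[OF l(1)])
          have "x l = \<zero>\<^bsub>N l\<^esub>" "y l = \<zero>\<^bsub>N l\<^esub>" using xy l unfolding supp_def by blast+
          then show ?thesis using l(1) by (simp add: dsum_simps)
        qed
        ultimately show "x \<oplus>\<^bsub>dsum J N\<^esub> y \<in> ?P" unfolding supp_def by blast
      next
        fix r x assume r: "r \<in> carrier R" and x: "x \<in> ?P"
        have "r \<odot>\<^bsub>dsum J N\<^esub> x \<in> carrier (dsum J N)" using x r D.smult_closed by simp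
        moreover have "(r \<odot>\<^bsub>dsum J N\<^esub> x) l = \<zero>\<^bsub>N l\<^esub>" if l: "l \<in> J" "l \<notin> ?S" for l
        proof -
          interpret Nl: right_module R "N l" by (rule mN[OF l(1)])
          have "x l = \<zero>\<^bsub>N l\<^esub>" using x l unfolding supp_def by blast
          then show ?thesis using l(1) Nl.smult_zero[OF r] by (simp add: dsum_simps)
        qed
        ultimately show "r \<odot>\<^bsub>dsum J N\<^esub> x \<in> ?P" unfolding supp_def by blast
      qed blast
      have fP: "\<psi> (f x) \<in> ?P" if x: "x \<in> carrier K" for x
      proof -
        obtain v where v: "v \<in> carrier (free R {..<n})" "\<alpha> v = x" using x unfolding \<alpha>(2)[symmetric] by auto
        have "\<psi> (f (\<alpha> v)) \<in> ?P"
          by (rule free_image_subset[OF ring_R mD lin_comp[OF \<alpha>(1) \<psi>f] sP _ v(1)]) (use b in blast)+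
        then show ?thesis using v(2) by simp
      qed
      \<comment> \<open>Outside \<open>?S\<close> the component is extended by the zero map on all
        of \<open>P\<close>; an arbitrary extension could destroy finiteness of supports.\<close>
      have "\<exists>g. lin R P (N l) g \<and> (\<forall>x\<in>carrier K. g (i x) = \<psi> (f x) l) \<and> (l \<notin> ?S \<longrightarrow> (\<forall>x. g x = \<zero>\<^bsub>N l\<^esub>))" if l: "l \<in> J" for l
      proof (cases "l \<in> ?S")
        case True
        have "splits M (N l)" using N[OF l] M unfolding right_perp_iff[OF Z(1)] by blast
        then obtain g where "lin R P (N l) g" "\<forall>x\<in>carrier K. g (i x) = \<psi> (f x) l" unfolding splits_iff_extend[OF c P NM[OF l]]
          using lin_comp[OF \<psi>f dsum_proj[OF l]] by blast
        then show ?thesis using True by (intro exI[of _ g]) simp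
      next
        case False
        have "\<psi> (f x) l = \<zero>\<^bsub>N l\<^esub>" if "x \<in> carrier K" for x using fP[OF that] False l unfolding supp_def by blast
        then show ?thesis by (intro exI[of _ "\<lambda>x. \<zero>\<^bsub>N l\<^esub>"] conjI lin_zero_map[OF mN[OF l]]) auto
      qed
      then obtain g where g: "\<And>l. l \<in> J \<Longrightarrow> lin R P (N l) (g l)" "\<And>l x. \<lbrakk>l \<in> J; x \<in> carrier K\<rbrakk> \<Longrightarrow> g l (i x) = \<psi> (f x) l"
        "\<And>l x. \<lbrakk>l \<in> J; l \<notin> ?S\<rbrakk> \<Longrightarrow> g l x = \<zero>\<^bsub>N l\<^esub>" by metis
      have lg: "lin R P (prodm J N) (\<lambda>x. \<lambda>l\<in>J. g l x)" by (rule prodm_lift[OF _ d(5)]) (erule g(1))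
      have "lin R P (dsum J N) (\<lambda>x. \<lambda>l\<in>J. g l x)"
        unfolding dsum_def
      proof (rule lin_into_sub[OF lg])
        fix x assume x: "x \<in> carrier P"
        have "supp J N (\<lambda>l\<in>J. g l x) \<subseteq> ?S"
        proof
          fix l assume "l \<in> supp J N (\<lambda>l\<in>J. g l x)"
          then have l: "l \<in> J" "g l x \<noteq> \<zero>\<^bsub>N l\<^esub>" by (auto simp: supp_def)
          show "l \<in> ?S" by (rule ccontr) (use g(3)[OF l(1)] l(2) in metis)
        qed
        then have "finite (supp J N (\<lambda>l\<in>J. g l x))" using S by (rule finite_subset)
        then show "(\<lambda>l\<in>J. g l x) \<in> {x \<in> carrier (prodm J N). finite (supp J N x)}" using lin_closed[OF lg x] by blast
      qed
      note lD = lin_comp[OF this D(2)]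
      have "\<phi> (\<lambda>l\<in>J. g l (i x)) = f x" if x: "x \<in> carrier K" for x
      proof -
        have "\<psi> (f x) \<in> extensional J"
          using lin_closed[OF \<psi>f x] unfolding dsum_simps by (simp add: PiE_def)
        then have "(\<lambda>l\<in>J. g l (i x)) = \<psi> (f x)" using g(2) x by (auto simp: fun_eq_iff extensional_def)
        then show ?thesis using D(5)[OF lin_closed[OF f x]] by simp
      qed
      then show "\<exists>g. lin R P D g \<and> (\<forall>x\<in>carrier K. g (i x) = f x)"
        by (intro exI[of _ "\<lambda>x. \<phi> (\<lambda>l\<in>J. g l x)"] conjI ballI lD)
    qed
  qed
  then show "D \<in> right_perp R E Z" unfolding right_perp_iff[OF Z(1)] using D(1) by blast
qed

text \<open>The syzygy is finitely presented, so a map from it to \<open>C\<close> lifts to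
  \<open>B\<close>; the lift is extended to \<open>P\<close> there and projected back to
  \<open>C\<close>.\<close>

lemma right_perp_fp_pure_quotients:
  assumes Z: "Z \<subseteq> ModR R" "\<And>M. M \<in> Z \<Longrightarrow> has_fp_E_presentation R E M"
  shows "closed_under_pure_quotients R (right_perp R E Z)"
  unfolding closed_under_pure_quotients_def
proof (intro allI impI, elim conjE)
  fix A j B q C assume pe: "(A, j, B, q, C) \<in> pure_exact R" and B: "B \<in> right_perp R E Z"
  note e = sxD[OF pure_exactD(2)[OF pe]]
  have "splits M C" if M: "M \<in> Z" for M
  proof -
    obtain K i P p where P: "E_projective R E P" and c: "conf E K i P p M" and fp: "finitely_presented R K"
      by (rule fp_syzygy_exists[OF Z(2)[OF M]])
    note d = sxD[OF conf_D[OF c]]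
    have sB: "splits M B" using B M unfolding right_perp_iff[OF Z(1)] by blast
    show ?thesis
      unfolding splits_iff_extend[OF c P e(3)]
    proof (intro allI impI)
      fix f assume f: "lin R K C f"
      obtain h where h: "lin R K B h" "\<forall>x\<in>carrier K. q (h x) = f x" using pure_exactD(3)[OF pe d(1) fp f] by blast
      obtain g where g: "lin R P B g" "\<forall>x\<in>carrier K. g (i x) = h x"
        using sB[unfolded splits_iff_extend[OF c P e(2)], rule_format, OF h(1)] by blast
      show "\<exists>g. lin R P C g \<and> (\<forall>x\<in>carrier K. g (i x) = f x)"
        by (intro exI[of _ "\<lambda>x. q (g x)"] conjI ballI lin_comp[OF g(1) e(8)]) (simp add: g(2) h(2))
    qed
  qed
  then show "C \<in> right_perp R E Z" unfolding right_perp_iff[OF Z(1)] using e(3) by blast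
qed

lemma right_perp_fp_covering:
  assumes Z: "Z \<subseteq> ModR R" "\<And>M. M \<in> Z \<Longrightarrow> has_fp_E_presentation R E M"
  shows "covering R (right_perp R E Z)"
proof -
  interpret coproduct_pure_quotient_class ty R "right_perp R E Z"
  proof unfold_locales
    show "right_perp R E Z \<subseteq> ModR R" unfolding right_perp_def by blast
  qed (rule right_perp_fp_coproducts[OF Z] right_perp_fp_pure_quotients[OF Z]; assumption)+
  show ?thesis by (rule covering)
qed

end

section \<open>Cotorsion pairs\<close>

context exact_category
begin

lemma left_perp_ModR: "left_perp R E Z \<subseteq> ModR R"
  unfolding left_perp_def by blast

lemma right_perp_ModR: "right_perp R E Z \<subseteq> ModR R"
  unfolding right_perp_def by blast

lemma splits_projective: "E_projective R E P \<Longrightarrow> splits P N"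
  unfolding splits_def using E_projective_lift[OF E_pairs _ _ lin_id] by blast

text \<open>Part of the long exact sequence for an arbitrary conflation: push out along
  \<open>f\<close>, and subtract the section so that the map from \<open>B\<close> lands in
  \<open>N\<close>.\<close>

lemma splits_extend:
  assumes s: "splits C N" and c: "conf E A i B p C" and N: "N \<in> ModR R" and f: "lin R A N f"
  shows "\<exists>g. lin R B N g \<and> (\<forall>x\<in>carrier A. g (i x) = f x)"
proof -
  note d = sxD[OF conf_D[OF c]]
  obtain M' i' p' f' where c': "conf E N i' M' p' C" and f': "lin R B M' f'"
    and com: "\<forall>x\<in>carrier A. f' (i x) = i' (f x)" "\<forall>x\<in>carrier B. p' (f' x) = p x"
    using pushouts[OF c N f] by (elim exE conjE) (rule that)
  note d' = sxD[OF conf_D[OF c']]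
  interpret M': right_module R M' by (rule d'(5))
  interpret C: right_module R C by (rule d(6))
  obtain t where t: "lin R C M' t" "\<forall>x\<in>carrier C. p' (t x) = x" using s c' unfolding splits_def by blast
  let ?u = "\<lambda>x. f' x \<ominus>\<^bsub>M'\<^esub> t (p x)"
  have tp: "lin R B M' (\<lambda>x. t (p x))" by (rule lin_comp[OF d(8) t(1)])
  have u: "lin R B M' ?u" by (rule lin_difference[OF d(5) d'(5) f' tp])
  have "p' (?u x) = \<zero>\<^bsub>C\<^esub>" if x: "x \<in> carrier B" for x
  proof -
    have "p' (?u x) = p' (f' x) \<ominus>\<^bsub>C\<^esub> p' (t (p x))" by (rule lin_diff[OF d'(5,6,8) lin_closed[OF f' x] lin_closed[OF tp x]])
    then show ?thesis using com(2) t(2) x lin_closed[OF d(8) x] C.diff_zero_iff by simp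
  qed
  then obtain w where w: "lin R B N w" "\<forall>x\<in>carrier B. i' (w x) = ?u x"
    using sx_factor_mono[OF conf_D[OF c'] d(5) u] by blast
  have "w (i x) = f x" if x: "x \<in> carrier A" for x
  proof (rule inj_onD[OF d'(9)])
    show "i' (w (i x)) = i' (f x)"
      using w(2) com(1) x lin_closed[OF d(7) x] d(12)[OF x] lin_zero[OF d(6) d'(5) t(1)]
        M'.diff_zero[OF lin_closed[OF d'(7) lin_closed[OF f x]]] by simp
  qed (use lin_closed[OF w(1) lin_closed[OF d(7) x]] lin_closed[OF f x] in auto)
  then show ?thesis using w(1) by blast
qed

text \<open>The lift on \<open>A\<close> extends to \<open>B\<close> by injectivity of
  \<open>I\<close>. The remaining error vanishes on \<open>A\<close>, descends to \<open>C\<close>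
  and is lifted there.\<close>

lemma left_perp_extension:
  assumes Z: "Z \<subseteq> ModR R" and c: "conf E A i B p C" and A: "A \<in> left_perp R E Z" and C: "C \<in> left_perp R E Z"
  shows "B \<in> left_perp R E Z"
proof -
  note e = sxD[OF conf_D[OF c]]
  have "splits B N" if N: "N \<in> Z" for N
  proof -
    have NM: "N \<in> ModR R" using N Z by blast
    obtain j I q L where I: "E_injective R E I" and cI: "conf E N j I q L" by (rule injective_conf[OF NM])
    note d = sxD[OF conf_D[OF cI]]
    interpret L: right_module R L by (rule d(6))
    have sA: "splits A N" and sC: "splits C N" using A C N unfolding left_perp_iff[OF Z] by blast+
    show ?thesis
      unfolding splits_iff_lift[OF cI I e(2)]
    proof (intro allI impI)
      fix f assume f: "lin R B L f"
      obtain a where a: "lin R A I a" "\<forall>x\<in>carrier A. q (a x) = f (i x)"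
        using sA[unfolded splits_iff_lift[OF cI I e(1)], rule_format, OF lin_comp[OF e(7) f]] by blast
      obtain b where b: "lin R B I b" "\<forall>x\<in>carrier A. b (i x) = a x" using E_injective_extend[OF E_pairs I c a(1)] by blast
      let ?u = "\<lambda>x. f x \<ominus>\<^bsub>L\<^esub> q (b x)"
      have qb: "lin R B L (\<lambda>x. q (b x))" by (rule lin_comp[OF b(1) d(8)])
      have u: "lin R B L ?u" by (rule lin_difference[OF e(5) d(6) f qb])
      have "?u (i x) = \<zero>\<^bsub>L\<^esub>" if "x \<in> carrier A" for x
        using a(2) b(2) that lin_closed[OF f lin_closed[OF e(7) that]] L.diff_zero_iff by simp
      then obtain h where h: "lin R C L h" "\<forall>x\<in>carrier B. h (p x) = ?u x" using sx_factor_epi[OF conf_D[OF c] d(6) u] by blast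
      obtain g where g: "lin R C I g" "\<forall>x\<in>carrier C. q (g x) = h x"
        using sC[unfolded splits_iff_lift[OF cI I e(3)], rule_format, OF h(1)] by blast
      have gp: "lin R B I (\<lambda>x. g (p x))" by (rule lin_comp[OF e(8) g(1)])
      have "q (b x \<oplus>\<^bsub>I\<^esub> g (p x)) = f x" if x: "x \<in> carrier B" for x
        using lin_add[OF d(8) lin_closed[OF b(1) x] lin_closed[OF gp x]] g(2) h(2) x lin_closed[OF e(8) x]
          L.add_diff[OF lin_closed[OF f x] lin_closed[OF qb x]] by simp
      then show "\<exists>g. lin R B I g \<and> (\<forall>x\<in>carrier B. q (g x) = f x)"
        by (intro exI[of _ "\<lambda>x. b x \<oplus>\<^bsub>I\<^esub> g (p x)"] conjI ballI lin_sum[OF e(5) d(5) b(1) gp])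
    qed
  qed
  then show ?thesis unfolding left_perp_iff[OF Z] using e(2) by blast
qed

text \<open>Dimension shifting: the cosyzygy \<open>L\<close> is again in \<open>Z\<close>, so
  \<open>C\<close> is orthogonal to it and a map from \<open>A\<close> to \<open>L\<close> extends
  to \<open>B\<close>; there it lifts to \<open>I\<close>, and the lift restricts to
  \<open>A\<close>.\<close>

lemma left_perp_kernel:
  assumes Z: "Z \<subseteq> ModR R" "closed_under_E_cosyzygies R E Z"
    and c: "conf E A i B p C" and B: "B \<in> left_perp R E Z" and C: "C \<in> left_perp R E Z"
  shows "A \<in> left_perp R E Z"
proof -
  note e = sxD[OF conf_D[OF c]]
  have "splits A N" if N: "N \<in> Z" for N
  proof -
    have NM: "N \<in> ModR R" using N Z(1) by blast
    obtain j I q L where I: "E_injective R E I" and cI: "conf E N j I q L" by (rule injective_conf[OF NM])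
    note d = sxD[OF conf_D[OF cI]]
    have LZ: "L \<in> Z" using Z(2) cI I N unfolding closed_under_E_cosyzygies_def conf_def by blast
    have sB: "splits B N" and sC: "splits C L" using B C N LZ unfolding left_perp_iff[OF Z(1)] by blast+
    show ?thesis
      unfolding splits_iff_lift[OF cI I e(1)]
    proof (intro allI impI)
      fix f assume f: "lin R A L f"
      obtain g where g: "lin R B L g" "\<forall>x\<in>carrier A. g (i x) = f x" using splits_extend[OF sC c d(3) f] by blast
      obtain h where h: "lin R B I h" "\<forall>x\<in>carrier B. q (h x) = g x"
        using sB[unfolded splits_iff_lift[OF cI I e(2)], rule_format, OF g(1)] by blast
      show "\<exists>g. lin R A I g \<and> (\<forall>x\<in>carrier A. q (g x) = f x)"
        by (intro exI[of _ "\<lambda>x. h (i x)"] conjI ballI lin_comp[OF e(7) h(1)]) (simp add: h(2) g(2) lin_closed[OF e(7)])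
    qed
  qed
  then show ?thesis unfolding left_perp_iff[OF Z(1)] using e(1) by blast
qed

lemma left_perp_projective: "Z \<subseteq> ModR R \<Longrightarrow> E_projective R E P \<Longrightarrow> P \<in> left_perp R E Z"
  unfolding left_perp_iff using splits_projective unfolding E_projective_def by blast

lemma left_perp_resolving:
  assumes Z: "Z \<subseteq> ModR R" "closed_under_E_cosyzygies R E Z"
  shows "E_resolving R E (left_perp R E Z)"
  unfolding E_resolving_def
proof (intro conjI allI impI; (elim conjE)?)
  show "P \<in> left_perp R E Z" if "E_projective R E P" for P by (rule left_perp_projective[OF Z(1) that])
  fix A i B p C assume "(A, i, B, p, C) \<in> E"
  then have c: "conf E A i B p C" by (rule conf_iff_mem[OF E_pairs])
  show "B \<in> left_perp R E Z" if "A \<in> left_perp R E Z" "C \<in> left_perp R E Z" by (rule left_perp_extension[OF Z(1) c that])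
  show "A \<in> left_perp R E Z" if "B \<in> left_perp R E Z" "C \<in> left_perp R E Z" by (rule left_perp_kernel[OF Z c that])
qed

text \<open>The formal Galois connection of the two orthogonals: \<open>Z\<close> lies in the right
  orthogonal of its left orthogonal, so a third passage gives nothing new.\<close>

lemma perp_cotorsion_pair:
  assumes Z: "Z \<subseteq> ModR R"
  shows "E_cotorsion_pair R E (left_perp R E Z) (right_perp R E (left_perp R E Z))"
proof -
  let ?U = "left_perp R E Z" let ?V = "right_perp R E ?U"
  have "?U \<subseteq> left_perp R E ?V"
    unfolding left_perp_iff[OF right_perp_ModR] using right_perp_iff[OF left_perp_ModR] left_perp_ModR
    by (auto simp: subset_iff left_perp_iff[OF right_perp_ModR])
  moreover have "Z \<subseteq> ?V"
    using Z by (auto simp: subset_iff right_perp_iff[OF left_perp_ModR] left_perp_iff[OF Z])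
  then have "left_perp R E ?V \<subseteq> ?U" by (auto simp: subset_iff left_perp_iff[OF Z] left_perp_iff[OF right_perp_ModR])
  ultimately show ?thesis unfolding E_cotorsion_pair_def by blast
qed

text \<open>Wakamatsu's lemma.\<close>

lemma cover_kernel_right_perp:
  assumes Z: "Z \<subseteq> ModR R" and cov: "is_cover R (left_perp R E Z) C f M"
    and c: "conf E V0 k C f M"
  shows "V0 \<in> right_perp R E (left_perp R E Z)"
proof -
  let ?U = "left_perp R E Z"
  note d = sxD[OF conf_D[OF c]]
  have C: "C \<in> ?U" and fH: "f \<in> Hom R C M" using cov unfolding is_cover_def by auto
  have "splits X V0" if X: "X \<in> ?U" for X
    unfolding splits_def
  proof (intro allI impI)
    fix B j q assume cB: "conf E V0 j B q X"
    note s = conf_D[OF cB]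
    note e = sxD[OF s]
    \<comment> \<open>The push-out along \<open>k\<close> is an extension of \<open>X\<close> by
      \<open>C\<close>, so it stays in the left orthogonal and the cover property can be applied to
      it.\<close>
    obtain D j' q' b where cD: "conf E C j' D q' X" and b: "lin R B D b"
      and com: "\<forall>x\<in>carrier V0. b (j x) = j' (k x)" "\<forall>x\<in>carrier B. q' (b x) = q x"
      using pushouts[OF cB d(2,7)] by (elim exE conjE) (rule that)
    note s' = conf_D[OF cD]
    note e' = sxD[OF s']
    have D: "D \<in> ?U" by (rule left_perp_extension[OF Z cD C X])
    \<comment> \<open>\<open>f\<close> on \<open>C\<close> and zero on \<open>B\<close> agree on
      \<open>V0\<close>, because \<open>V0\<close> is the kernel of \<open>f\<close>.\<close>
    have "\<exists>w. lin R D M w \<and> (\<forall>x\<in>carrier B. w (b x) = \<zero>\<^bsub>M\<^esub>) \<and> (\<forall>y\<in>carrier C. w (j' y) = f y)"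
      by (rule sx_is_pushout(1)[OF s s' d(7) b _ _ d(6) lin_zero_map[OF d(6)] d(8)]) (use com d(12) in auto)
    then obtain w where w: "lin R D M w" "\<forall>x\<in>carrier B. w (b x) = \<zero>\<^bsub>M\<^esub>" "\<forall>y\<in>carrier C. w (j' y) = f y" by blast
    obtain h where h: "h \<in> Hom R D C" "compose (carrier D) f h = restrict w (carrier D)"
      using cov D lin_restrict[OF e'(5) w(1)] unfolding is_cover_def by metis
    have fh: "f (h x) = w x" if "x \<in> carrier D" for x using fun_cong[OF h(2), of x] that by (simp add: compose_def)
    \<comment> \<open>The composite from \<open>C\<close> through \<open>D\<close> back to
      \<open>C\<close> lies over \<open>M\<close>, so it is an automorphism by the minimality of the
      cover.\<close>
    let ?a = "restrict (\<lambda>x. h (j' x)) (carrier C)"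
    have a: "?a \<in> Hom R C C" by (rule lin_restrict[OF d(5) lin_comp[OF e'(7) Hom_lin[OF h(1)]]])
    have fa: "f (h (j' x)) = f x" if "x \<in> carrier C" for x using fh[OF lin_closed[OF e'(7) that]] w(3) that by simp
    then have "compose (carrier C) f ?a = f" unfolding compose_Hom_iff[OF fH] by simp
    then have "?a \<in> Iso R C C" using cov a unfolding is_cover_def by blast
    then have bij: "bij_betw ?a (carrier C) (carrier C)" unfolding Iso_def by blast
    let ?s = "inv_into (carrier C) ?a"
    have ls: "lin R C C ?s" by (rule lin_inv[OF d(5,5) Hom_lin[OF a] bij])
    have sa: "?s (h (j' x)) = x" if "x \<in> carrier C" for x
      using bij_betw_inv_into_left[OF bij that] that by simp
    have fs: "f (?s y) = f y" if y: "y \<in> carrier C" for y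
    proof -
      have "h (j' (?s y)) = y" using bij_betw_inv_into_right[OF bij y] lin_closed[OF ls y] by simp
      then show ?thesis using fa[OF lin_closed[OF ls y]] by simp
    qed
    \<comment> \<open>Corrected by the inverse automorphism, the map from \<open>B\<close> through
      \<open>D\<close> to \<open>C\<close> vanishes in \<open>M\<close> and restricts to
      \<open>k\<close> on \<open>V0\<close>; factoring it through \<open>V0\<close> gives a
      retraction of \<open>j\<close>.\<close>
    let ?r = "\<lambda>x. ?s (h (b x))"
    have r: "lin R B C ?r" by (rule lin_comp[OF lin_comp[OF b Hom_lin[OF h(1)]] ls])
    have "f (?r x) = \<zero>\<^bsub>M\<^esub>" if x: "x \<in> carrier B" for x
      using fs[OF lin_closed[OF Hom_lin[OF h(1)] lin_closed[OF b x]]] fh[OF lin_closed[OF b x]] w(2) x by simp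
    then obtain t where t: "lin R B V0 t" "\<forall>x\<in>carrier B. k (t x) = ?r x"
      using sx_factor_mono[OF conf_D[OF c] e(5) r] by blast
    have "t (j x) = x" if x: "x \<in> carrier V0" for x
    proof (rule inj_onD[OF d(9)])
      show "k (t (j x)) = k x" using t(2) lin_closed[OF e(7) x] com(1) x sa[OF lin_closed[OF d(7) x]] by simp
    qed (use lin_closed[OF t(1) lin_closed[OF e(7) x]] x in auto)
    then show "\<exists>s. lin R X B s \<and> (\<forall>x\<in>carrier X. q (s x) = x)" by (rule sx_section_of_retraction[OF s t(1)])
  qed
  then show ?thesis unfolding right_perp_iff[OF left_perp_ModR] using d(1) by blast
qed

text \<open>The cover is an admissible epic by \<open>conf_of_factor\<close>: an
  \<open>E\<close>-projective lies in the left orthogonal, so its admissible epic onto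
  \<open>M\<close> factors through the cover. Wakamatsu's lemma handles the kernel.\<close>

lemma special_precover_exists:
  assumes Z: "Z \<subseteq> ModR R" "Z \<subseteq> pure_injectives R" and M: "M \<in> ModR R"
  obtains V0 k C f where "conf E V0 k C f M" "V0 \<in> right_perp R E (left_perp R E Z)" "C \<in> left_perp R E Z"
proof -
  obtain C f where cov: "is_cover R (left_perp R E Z) C f M"
    using left_perp_covering[OF Z] M unfolding covering_def by blast
  then have C: "C \<in> left_perp R E Z" and fH: "f \<in> Hom R C M" unfolding is_cover_def by auto
  then have CM: "C \<in> ModR R" using left_perp_ModR by blast
  obtain K i P p where P: "E_projective R E P" and c: "conf E K i P p M" by (rule projective_conf[OF M])
  note d = sxD[OF conf_D[OF c]]
  obtain h where h: "h \<in> Hom R P C" "compose (carrier P) f h = restrict p (carrier P)"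
    using cov left_perp_projective[OF Z(1) P] lin_restrict[OF d(5,8)] unfolding is_cover_def by metis
  have "f (h x) = p x" if "x \<in> carrier P" for x using fun_cong[OF h(2), of x] that by (simp add: compose_def)
  then have cC: "conf E (sub C {x \<in> carrier C. f x = \<zero>\<^bsub>M\<^esub>}) (\<lambda>x. x) C f M"
    by (rule conf_of_factor[OF c CM Hom_lin[OF fH] Hom_lin[OF h(1)]])
  show thesis by (rule that[OF cC cover_kernel_right_perp[OF Z(1) cov cC] C])
qed

text \<open>The pull-back of a special precover of a cosyzygy is a special preenvelope.\<close>

lemma special_preenvelope_exists:
  assumes Z: "Z \<subseteq> ModR R" "Z \<subseteq> pure_injectives R" and M: "M \<in> ModR R"
  obtains m D c C where "conf E M m D c C" "D \<in> right_perp R E (left_perp R E Z)" "C \<in> left_perp R E Z"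
proof -
  let ?U = "left_perp R E Z" let ?V = "right_perp R E ?U"
  obtain j J \<pi> L where J: "E_injective R E J" and cJ: "conf E M j J \<pi> L" by (rule injective_conf[OF M])
  note dJ = sxD[OF conf_D[OF cJ]]
  obtain V0 k0 C g where cC: "conf E V0 k0 C g L" and V0: "V0 \<in> ?V" and C: "C \<in> ?U"
    by (rule special_precover_exists[OF Z dJ(3)])
  note dC = sxD[OF conf_D[OF cC]]
  obtain D m c f' where cD: "conf E M m D c C" and f': "lin R D J f'" and cart: "cartesian D f' c J \<pi> C g"
    by (rule pullbacks[OF cJ dC(2,8)]) (rule that; assumption)
  note dD = sxD[OF conf_D[OF cD]]
  note pf = pullback_factor[OF dJ(5) dD(5,6) f' dD(8) cart]
  have com: "\<pi> (f' x) = g (c x)" if "x \<in> carrier D" for x using cart that unfolding cartesian_def by blast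
  interpret L: right_module R L by (rule dJ(6))
  interpret C: right_module R C by (rule dC(5))
  have "splits X D" if X: "X \<in> ?U" for X
  proof -
    have XM: "X \<in> ModR R" using X left_perp_ModR by blast
    obtain K k P p where P: "E_projective R E P" and cP: "conf E K k P p X" by (rule projective_conf[OF XM])
    note dP = sxD[OF conf_D[OF cP]]
    have sV: "splits X V0" using V0 X unfolding right_perp_iff[OF left_perp_ModR] by blast
    show ?thesis
      unfolding splits_iff_extend[OF cP P dD(2)]
    proof (intro allI impI)
      fix f assume f: "lin R K D f"
      obtain a where a: "lin R P J a" "\<forall>x\<in>carrier K. a (k x) = f' (f x)"
        using E_injective_extend[OF E_pairs J cP lin_comp[OF f f']] by blast
      obtain b where b: "lin R P C b" "\<forall>x\<in>carrier P. g (b x) = \<pi> (a x)"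
        using E_projective_lift[OF E_pairs P cC lin_comp[OF a(1) dJ(8)]] by blast
      \<comment> \<open>\<open>a\<close> and \<open>b\<close> induce a map from \<open>P\<close> to
        the pull-back \<open>D\<close> that agrees with \<open>f\<close> on \<open>K\<close> in the
        component \<open>J\<close> only. The error in the component \<open>C\<close> has values in
        \<open>V0\<close>; it extends to \<open>P\<close>, since \<open>X\<close> is orthogonal to
        \<open>V0\<close>, and is added to \<open>b\<close>.\<close>
      let ?u = "\<lambda>x. c (f x) \<ominus>\<^bsub>C\<^esub> b (k x)"
      have cf: "lin R K C (\<lambda>x. c (f x))" and bk: "lin R K C (\<lambda>x. b (k x))"
        by (rule lin_comp[OF f dD(8)], rule lin_comp[OF dP(7) b(1)])
      have u: "lin R K C ?u" by (rule lin_difference[OF dP(4) dC(5) cf bk])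
      have "g (?u x) = \<zero>\<^bsub>L\<^esub>" if x: "x \<in> carrier K" for x
      proof -
        have "g (?u x) = g (c (f x)) \<ominus>\<^bsub>L\<^esub> g (b (k x))"
          by (rule lin_diff[OF dC(5,6,8) lin_closed[OF cf x] lin_closed[OF bk x]])
        then show ?thesis
          using b(2) a(2) x lin_closed[OF dP(7) x] com[OF lin_closed[OF f x]] lin_closed[OF dC(8) lin_closed[OF cf x]] L.diff_zero_iff
          by simp
      qed
      then obtain e where e: "lin R K V0 e" "\<forall>x\<in>carrier K. k0 (e x) = ?u x"
        using sx_factor_mono[OF conf_D[OF cC] dP(4) u] by blast
      obtain e' where e': "lin R P V0 e'" "\<forall>x\<in>carrier K. e' (k x) = e x"
        using sV[unfolded splits_iff_extend[OF cP P dC(1)], rule_format, OF e(1)] by blast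
      have ke: "lin R P C (\<lambda>x. k0 (e' x))" by (rule lin_comp[OF e'(1) dC(7)])
      have b': "lin R P C (\<lambda>x. b x \<oplus>\<^bsub>C\<^esub> k0 (e' x))" by (rule lin_sum[OF dP(5) dC(5) b(1) ke])
      have "\<pi> (a x) = g (b x \<oplus>\<^bsub>C\<^esub> k0 (e' x))" if x: "x \<in> carrier P" for x
        using lin_add[OF dC(8) lin_closed[OF b(1) x] lin_closed[OF ke x]] dC(12)[OF lin_closed[OF e'(1) x]] b(2) x
          lin_closed[OF dC(8) lin_closed[OF b(1) x]] by simp
      then obtain t where t: "lin R P D t" "\<forall>x\<in>carrier P. f' (t x) = a x \<and> c (t x) = b x \<oplus>\<^bsub>C\<^esub> k0 (e' x)"
        using pf(1)[OF dP(5) a(1) b'] by blast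
      have "t (k x) = f x" if x: "x \<in> carrier K" for x
      proof (rule pf(2)[OF lin_closed[OF t(1) lin_closed[OF dP(7) x]] lin_closed[OF f x]])
        show "f' (t (k x)) = f' (f x)" using t(2) a(2) x lin_closed[OF dP(7) x] by simp
        show "c (t (k x)) = c (f x)"
          using t(2) e'(2) e(2) x lin_closed[OF dP(7) x] C.add_diff[OF lin_closed[OF cf x] lin_closed[OF bk x]] by simp
      qed
      then show "\<exists>g. lin R P D g \<and> (\<forall>x\<in>carrier K. g (k x) = f x)" using t(1) by blast
    qed
  qed
  then have "D \<in> ?V" unfolding right_perp_iff[OF left_perp_ModR] using dD(2) by blast
  then show thesis by (rule that[OF cD _ C])
qed

lemma perp_complete_hereditary:
  assumes Z: "Z \<subseteq> ModR R" "Z \<subseteq> pure_injectives R" "closed_under_E_cosyzygies R E Z"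
  shows "complete_hereditary_cotorsion_pair R E (left_perp R E Z) (right_perp R E (left_perp R E Z))"
  unfolding complete_hereditary_cotorsion_pair_def complete_pair_def
proof (intro conjI ballI perp_cotorsion_pair[OF Z(1)] left_perp_resolving[OF Z(1,3)])
  fix M :: "('r, 'm) module" assume M: "M \<in> ModR R"
  show "\<exists>A\<in>right_perp R E (left_perp R E Z). \<exists>B\<in>left_perp R E Z. \<exists>i p. (A, i, B, p, M) \<in> E"
    by (rule special_precover_exists[OF Z(1,2) M]) (unfold conf_def, blast)
  show "\<exists>A\<in>right_perp R E (left_perp R E Z). \<exists>B\<in>left_perp R E Z. \<exists>i p. (M, i, A, p, B) \<in> E"
    by (rule special_preenvelope_exists[OF Z(1,2) M]) (unfold conf_def, blast)
qed

text \<open>Every conflation is exact, which gives one inclusion. For the other, an arbitrary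
  extension of \<open>M\<close> by \<open>N\<close> is pulled back to an \<open>E\<close>-projective
  \<open>P\<close>, where it splits by hypothesis; the resulting map from \<open>P\<close> into the
  middle term and the extension property on the \<open>E\<close>-syzygy give a section by
  \<open>sx_section_of_extension\<close>.\<close>

lemma left_perp_1_eq:
  assumes Z: "Z \<subseteq> ModR R"
    and h: "\<forall>N\<in>Z. \<forall>P. E_projective R E P \<longrightarrow> trivial_group (Ext_R R 1 P N)"
  shows "left_perp_1 R Z = left_perp R E Z"
proof -
  interpret S: conflations ty R "kernel_cokernel_pairs R :: ('r, 'm) mod_pair set"
    by (rule kernel_cokernel_pairs_conflations)
  have iff: "trivial_group (Ext_R R 1 M N) \<longleftrightarrow> S.splits M N" if "M \<in> ModR R" "N \<in> ModR R" for M N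
    unfolding Ext_R_def by (rule S.Ext_trivial_iff_splits[OF that])
  have "S.splits M N \<longleftrightarrow> splits M N" if M: "M \<in> ModR R" and N: "N \<in> Z" for M N
  proof
    assume "S.splits M N"
    then show "splits M N" unfolding S.splits_def splits_def conf_def using E_pairs by blast
  next
    assume s: "splits M N"
    have NM: "N \<in> ModR R" using N Z by blast
    obtain K i P p where P: "E_projective R E P" and c: "conf E K i P p M" by (rule projective_conf[OF M])
    note d = sxD[OF conf_D[OF c]]
    have sP: "S.splits P N" using h N P iff[OF d(2) NM] by blast
    show "S.splits M N"
      unfolding S.splits_def
    proof (intro allI impI)
      fix B j q assume "conf (kernel_cokernel_pairs R) N j B q M"
      note s' = S.conf_D[OF this]
      obtain B' :: "('r, 'm) module" and j' q' f' where B': "sx R N j' B' q' P" "lin R B' B f'" and cart: "cartesian B' f' q' B q P p"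
        by (rule sx_pullback_exists[OF s' d(2,8)]) (rule that; assumption)
      obtain t where t: "lin R P B' t" "\<forall>x\<in>carrier P. q' (t x) = x"
        using sP conf_kernel_cokernel_pairs[OF B'(1)] unfolding S.splits_def by blast
      have qt: "q (f' (t x)) = p x" if "x \<in> carrier P" for x
        using cart lin_closed[OF t(1) that] t(2) that unfolding cartesian_def by auto
      show "\<exists>s. lin R M B s \<and> (\<forall>x\<in>carrier M. q (s x) = x)"
        by (rule sx_section_of_extension[OF conf_D[OF c] s' lin_comp[OF t(1) B'(2)] qt s[unfolded splits_iff_extend[OF c P NM], rule_format]])
    qed
  qed
  then show ?thesis
    unfolding left_perp_1_def using iff Z by (auto simp: left_perp_iff[OF Z] subset_iff)
qed

end

theorem theorem4p4:
  fixes R :: "('r, 'x) ring_scheme"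
    and E :: "('r, 'm) mod_pair set"
    and XX YY :: "('r, 'm) module set"
  assumes universe: "set_universe TYPE('m)"
    and small_ring: "small TYPE('m) (carrier R)"
    and ring: "ring R"
    and exact: "exact_structure R E"
    and projectives: "enough_projectives R E"
    and injectives: "enough_injectives R E"
    and pure: "pure_exact R \<subseteq> E"
    and XX: "subcategory R XX" "XX \<subseteq> pure_projectives R"
    and YY: "subcategory R YY" "YY \<subseteq> pure_injectives R"
  shows "(preenveloping R (right_perp R E XX) \<and>
          ((\<forall>M\<in>XX. has_fp_E_presentation R E M) \<longrightarrow> covering R (right_perp R E XX))) \<and>
         (covering R (left_perp R E YY) \<and> closed_under_pure_quotients R (left_perp R E YY)) \<and>
         (closed_under_E_cosyzygies R E YY \<longrightarrow>
          complete_hereditary_cotorsion_pair R E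
            (left_perp R E YY) (right_perp R E (left_perp R E YY)) \<and>
          ((\<forall>N\<in>YY. \<forall>P. E_projective R E P \<longrightarrow> trivial_group (Ext_R R 1 P N)) \<longrightarrow>
           complete_hereditary_cotorsion_pair R E
             (left_perp_1 R YY) (right_perp R E (left_perp_1 R YY))))"
proof -
  interpret exact_category "TYPE('m)" R E
    by (intro exact_category.intro module_universe.intro inaccessible_universe.intro exact_category_axioms.intro
        module_universe_axioms.intro ring universe small_ring exact projectives injectives pure)
  have X: "XX \<subseteq> ModR R" and Y: "YY \<subseteq> ModR R" using XX(1) YY(1) unfolding subcategory_def by auto
  show ?thesis
  proof (intro conjI impI)
    show "preenveloping R (right_perp R E XX)" by (rule right_perp_preenveloping[OF X XX(2)])
    show "covering R (right_perp R E XX)" if "\<forall>M\<in>XX. has_fp_E_presentation R E M"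
      by (rule right_perp_fp_covering[OF X]) (use that in blast)
    show "covering R (left_perp R E YY)" by (rule left_perp_covering[OF Y YY(2)])
    show "closed_under_pure_quotients R (left_perp R E YY)" by (rule left_perp_pure_quotients[OF Y YY(2)])
    assume cosyz: "closed_under_E_cosyzygies R E YY"
    show *: "complete_hereditary_cotorsion_pair R E (left_perp R E YY) (right_perp R E (left_perp R E YY))"
      by (rule perp_complete_hereditary[OF Y YY(2) cosyz])
    show "complete_hereditary_cotorsion_pair R E (left_perp_1 R YY) (right_perp R E (left_perp_1 R YY))"
      if "\<forall>N\<in>YY. \<forall>P. E_projective R E P \<longrightarrow> trivial_group (Ext_R R 1 P N)"
      unfolding left_perp_1_eq[OF Y that] by (rule *)
  qed
qed

end
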